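(* Let $\Omega\subset\mathbb{R}^N$ be a smooth bounded domain with $0\in\Omega$, let $p\in(1,N)$, $q\in(p-1,p)$, $\vartheta>0$, and let $A,B$ satisfy the structural assumptions listed in the context. Let $f\in W^{1,\infty}(\bar\Omega)$ be nonnegative and let $u\in C^1(\bar\Omega\setminus\{0\})$ be a weak solution of $$-\operatorname{div}(A(|\nabla u|)\nabla u)+B(|\nabla u|)=\vartheta\frac{u^q}{|x|^p}+f(x)\ \text{ in }\Omega,\quad u>0\ \text{ in }\Omega,\quad u=0\ \text{ on }\partial\Omega.$$ If $1<p<3$, then $u_i\in W^{1,2}_{loc}(\Omega\setminus\{0\})$ for every $i=1,\dots,N$; if $p\ge3$, then $u_i\in W^{1,s}_{loc}(\Omega\setminus\{0\})$ for every $i=1,\dots,N$ and every $1\le s<\frac{p-1}{p-2}$. Moreover, the generalized derivatives of $u_i$ coincide with the classical ones (both denoted $u_{ij}$) almost everywhere in $\Omega$.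
   Context: Notation: $\mathbb{R}^+=(0,+\infty)$, $\overline{\mathbb{R}}^+=[0,+\infty)$; $u_i=\partial u/\partial x_i$; $Z_u=\{x\in\Omega\setminus\{0\}:\nabla u(x)=0\}$. Such a $u$ is of class $C^2$ in $\Omega\setminus(Z_u\cup\{0\})$ by standard elliptic regularity; the classical second derivatives $u_{ij}$ are defined there, and are set equal to $0$ on $Z_u$. Weak solution means: $u\in W_0^{1,p}(\Omega)$, $u>0$, and $\int_\Omega A(|\nabla u|)(\nabla u,\nabla\varphi)\,dx+\int_\Omega B(|\nabla u|)\varphi\,dx=\vartheta\int_\Omega\frac{u^q}{|x|^p}\varphi\,dx+\int_\Omega f\varphi\,dx$ for all $\varphi\in W_0^{1,p}(\Omega)\cap L^\infty(\Omega)$. Assumptions on $A$: $A:\mathbb{R}^+\to\mathbb{R}^+$ is of class $C^1(\mathbb{R}^+)$ (with the convention that $A(|\eta|)\eta=0$ when $\eta=0$), and there are constants $K\ge 1$, $c_1,c_2>0$ such that: (i) $t\mapsto tA(t)$ is increasing; (ii) $|A(|\eta|)\eta|\le c_1|\eta|^{p-1}$ for all $\eta\in\mathbb{R}^N$ with $|\eta|\ge K$; (iii) $[A(|\eta|)\eta-A(|\eta'|)\eta']\cdot[\eta-\eta']\ge c_2(|\eta|+|\eta'|)^{p-2}|\eta-\eta'|^2$ for all $\eta,\eta'\in\mathbb{R}^N$ (not both zero); (iv) $-1<m_A:=\inf_{t>0}\frac{tA'(t)}{A(t)}\le M_A:=\sup_{t>0}\frac{tA'(t)}{A(t)}<+\infty$.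 Assumptions on $B$: $B:\overline{\mathbb{R}}^+\to\overline{\mathbb{R}}^+$ is of class $C^1(\overline{\mathbb{R}}^+)$, $B(0)=0$, $B(t)\ge\sigma t^p$ for all $t\geq 0$ for some $\sigma>0$, and $B'(t)\le\hat C\,tA(t)$ for all $t>0$ for some $\hat C>0$. *)

theory Defs
  imports "HOL-Analysis.Analysis"
begin

subsection \<open>Classical derivatives and smooth domains\<close>

definition pderiv_at :: "'n::finite \<Rightarrow> (real^'n \<Rightarrow> real) \<Rightarrow> real^'n \<Rightarrow> real" where
  "pderiv_at i g x = deriv (\<lambda>t. g (x + t *\<^sub>R axis i 1)) 0"

definition grad :: "(real^'n \<Rightarrow> real) \<Rightarrow> real^'n \<Rightarrow> real^'n" where
  "grad g x = (\<chi> i. pderiv_at i g x)"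

primrec Ck_on :: "nat \<Rightarrow> (real^'n) set \<Rightarrow> (real^'n \<Rightarrow> real) \<Rightarrow> bool" where
  "Ck_on 0 U g \<longleftrightarrow> continuous_on U g"
| "Ck_on (Suc k) U g \<longleftrightarrow>
     (\<forall>x\<in>U. g differentiable (at x)) \<and> (\<forall>i. Ck_on k U (pderiv_at i g))"

text \<open>\<^term>\<open>C1_upto U K u\<close> is meant for \<^term>\<open>U\<close> open and \<^term>\<open>U \<subseteq> K \<and> K \<subseteq> closure U\<close>:
  \<^term>\<open>u\<close> is continuously differentiable in \<^term>\<open>U\<close>, and \<^term>\<open>u\<close> and its gradient extend
  continuously to \<^term>\<open>K\<close> (\<^term>\<open>u\<close> by its own values).\<close>

definition C1_upto :: "(real^'n) set \<Rightarrow> (real^'n) set \<Rightarrow> (real^'n \<Rightarrow> real) \<Rightarrow> bool" where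
  "C1_upto U K u \<longleftrightarrow> Ck_on 1 U u \<and> continuous_on K u \<and>
     (\<exists>G. continuous_on K G \<and> (\<forall>x\<in>U. G x = grad u x))"

text \<open>A smooth bounded domain: near each boundary point, after relabelling and reorienting the
  coordinate axes (the choice of \<open>k\<close> and \<open>\<epsilon>\<close>), the domain is the region above the graph of a smooth
  function \<open>\<gamma>\<close> of the remaining coordinates.\<close>

definition smooth_bounded_domain :: "(real^'n) set \<Rightarrow> bool" where
  "smooth_bounded_domain \<Omega> \<longleftrightarrow>
     open \<Omega> \<and> connected \<Omega> \<and> \<Omega> \<noteq> {} \<and> bounded \<Omega> \<and>
     (\<forall>z\<in>frontier \<Omega>. \<exists>r>0. \<exists>k. \<exists>\<epsilon>\<in>{-1, 1::real}. \<exists>\<gamma>.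
        (\<forall>m. Ck_on m UNIV \<gamma>) \<and>
        (\<forall>x y. (\<forall>j. j \<noteq> k \<longrightarrow> x $ j = y $ j) \<longrightarrow> \<gamma> x = \<gamma> y) \<and>
        \<Omega> \<inter> ball z r = {x \<in> ball z r. \<epsilon> * x $ k > \<gamma> x})"

subsection \<open>Lebesgue and Sobolev spaces\<close>

text \<open>Elements are represented by functions on the whole space; only the values on the given
  set matter, and only up to null sets.\<close>

definition Lp_on :: "real \<Rightarrow> (real^'n) set \<Rightarrow> (real^'n \<Rightarrow> real) set" where
  "Lp_on p U = {g. set_borel_measurable lebesgue U g \<and>
                   (\<lambda>x. \<bar>g x\<bar> powr p) absolutely_integrable_on U}"

definition Linf_on :: "(real^'n) set \<Rightarrow> (real^'n \<Rightarrow> real) set" where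
  "Linf_on U = {g. set_borel_measurable lebesgue U g \<and>
                   (\<exists>C. AE x in lebesgue. x \<in> U \<longrightarrow> \<bar>g x\<bar> \<le> C)}"

definition Lp_loc :: "real \<Rightarrow> (real^'n) set \<Rightarrow> (real^'n \<Rightarrow> real) set" where
  "Lp_loc p U = {g. \<forall>K. compact K \<and> K \<subseteq> U \<longrightarrow> g \<in> Lp_on p K}"

definition test_fun :: "(real^'n) set \<Rightarrow> (real^'n \<Rightarrow> real) set" where
  "test_fun U = {\<phi>. (\<forall>m. Ck_on m UNIV \<phi>) \<and>
                    compact (closure {x. \<phi> x \<noteq> 0}) \<and> closure {x. \<phi> x \<noteq> 0} \<subseteq> U}"

definition weak_pderiv :: "(real^'n) set \<Rightarrow> 'n \<Rightarrow> (real^'n \<Rightarrow> real) \<Rightarrow> (real^'n \<Rightarrow> real) \<Rightarrow> bool" where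
  "weak_pderiv U i g h \<longleftrightarrow> g \<in> Lp_loc 1 U \<and> h \<in> Lp_loc 1 U \<and>
     (\<forall>\<phi>\<in>test_fun U. (LINT x:U|lebesgue. g x * pderiv_at i \<phi> x) =
                      - (LINT x:U|lebesgue. h x * \<phi> x))"

definition weak_grad :: "(real^'n) set \<Rightarrow> (real^'n \<Rightarrow> real) \<Rightarrow> real^'n \<Rightarrow> real^'n" where
  "weak_grad U g = (SOME G. \<forall>i. weak_pderiv U i g (\<lambda>x. G x $ i))"

definition W1p :: "real \<Rightarrow> (real^'n) set \<Rightarrow> (real^'n \<Rightarrow> real) set" where
  "W1p p U = {g \<in> Lp_on p U. \<forall>i. \<exists>h\<in>Lp_on p U. weak_pderiv U i g h}"

definition W1inf :: "(real^'n) set \<Rightarrow> (real^'n \<Rightarrow> real) set" where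
  "W1inf U = {g \<in> Linf_on U. \<forall>i. \<exists>h\<in>Linf_on U. weak_pderiv U i g h}"

definition W1p_loc :: "real \<Rightarrow> (real^'n) set \<Rightarrow> (real^'n \<Rightarrow> real) set" where
  "W1p_loc p U = {g \<in> Lp_loc p U. \<forall>i. \<exists>h\<in>Lp_loc p U. weak_pderiv U i g h}"

text \<open>The closure of the test functions in \<^term>\<open>W1p p U\<close>.\<close>

definition W1p_0 :: "real \<Rightarrow> (real^'n) set \<Rightarrow> (real^'n \<Rightarrow> real) set" where
  "W1p_0 p U = {g \<in> W1p p U. \<exists>\<phi>. (\<forall>n::nat. \<phi> n \<in> test_fun U) \<and>
      (\<lambda>n. LINT x:U|lebesgue. \<bar>\<phi> n x - g x\<bar> powr p) \<longlonglongrightarrow> 0 \<and>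
      (\<forall>i. (\<lambda>n. LINT x:U|lebesgue. \<bar>pderiv_at i (\<phi> n) x - weak_grad U g x $ i\<bar> powr p)
             \<longlonglongrightarrow> 0)}"

subsection \<open>Structural assumptions\<close>

definition m_low :: "(real \<Rightarrow> real) \<Rightarrow> ereal" where
  "m_low A = (INF t\<in>{0<..}. ereal (t * deriv A t / A t))"

definition M_upp :: "(real \<Rightarrow> real) \<Rightarrow> ereal" where
  "M_upp A = (SUP t\<in>{0<..}. ereal (t * deriv A t / A t))"

text \<open>The first argument carries the type of the space in which the vectors range. The convention
  that \<open>A(|\<eta>|)\<eta>\<close> vanishes at \<open>\<eta> = 0\<close> holds by itself, whatever the value \<^term>\<open>A 0\<close>.\<close>

definition structural_A :: "'n::finite itself \<Rightarrow> real \<Rightarrow> (real \<Rightarrow> real) \<Rightarrow> bool" where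
  "structural_A N p A \<longleftrightarrow>
     (\<forall>t>0. A t > 0) \<and>
     (\<forall>t>0. A differentiable (at t)) \<and> continuous_on {0<..} (deriv A) \<and>
     mono_on {0<..} (\<lambda>t. t * A t) \<and>
     (\<exists>K\<ge>1. \<exists>c\<^sub>1>0. \<forall>\<eta>::real^'n. norm \<eta> \<ge> K \<longrightarrow>
        norm (A (norm \<eta>) *\<^sub>R \<eta>) \<le> c\<^sub>1 * norm \<eta> powr (p - 1)) \<and>
     (\<exists>c\<^sub>2>0. \<forall>\<eta> \<eta>'::real^'n. \<eta> \<noteq> 0 \<or> \<eta>' \<noteq> 0 \<longrightarrow>
        (A (norm \<eta>) *\<^sub>R \<eta> - A (norm \<eta>') *\<^sub>R \<eta>') \<bullet> (\<eta> - \<eta>')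
          \<ge> c\<^sub>2 * (norm \<eta> + norm \<eta>') powr (p - 2) * (norm (\<eta> - \<eta>'))\<^sup>2) \<and>
     - 1 < m_low A \<and> m_low A \<le> M_upp A \<and> M_upp A < \<infinity>"

definition structural_B :: "real \<Rightarrow> (real \<Rightarrow> real) \<Rightarrow> (real \<Rightarrow> real) \<Rightarrow> bool" where
  "structural_B p A B \<longleftrightarrow>
     (\<forall>t\<ge>0. B t \<ge> 0) \<and> B 0 = 0 \<and>
     (\<exists>\<sigma>>0. \<forall>t\<ge>0. B t \<ge> \<sigma> * t powr p) \<and>
     (\<exists>B'. (\<forall>t\<ge>0. (B has_real_derivative B' t) (at t within {0..})) \<and>
           continuous_on {0..} B' \<and>
           (\<exists>C>0. \<forall>t>0. B' t \<le> C * (t * A t)))"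

subsection \<open>The equation\<close>

text \<open>Positivity is not imposed at the origin, where a solution need not have a meaningful value.
  Since \<open>LINT\<close> is 0 for non-integrable functions, integrability is stated explicitly.\<close>

definition weak_solution ::
  "(real^'n) set \<Rightarrow> real \<Rightarrow> real \<Rightarrow> real \<Rightarrow> (real \<Rightarrow> real) \<Rightarrow> (real \<Rightarrow> real) \<Rightarrow>
   (real^'n \<Rightarrow> real) \<Rightarrow> (real^'n \<Rightarrow> real) \<Rightarrow> bool" where
  "weak_solution \<Omega> p q \<theta> A B f u \<longleftrightarrow>
     u \<in> W1p_0 p \<Omega> \<and> (\<forall>x\<in>\<Omega> - {0}. u x > 0) \<and>
     (\<forall>\<phi>\<in>W1p_0 p \<Omega> \<inter> Linf_on \<Omega>.
        let Du = weak_grad \<Omega> u;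
            a = (\<lambda>x. A (norm (Du x)) * (Du x \<bullet> weak_grad \<Omega> \<phi> x));
            b = (\<lambda>x. B (norm (Du x)) * \<phi> x);
            h = (\<lambda>x. u x powr q / norm x powr p * \<phi> x);
            k = (\<lambda>x. f x * \<phi> x)
        in a absolutely_integrable_on \<Omega> \<and> b absolutely_integrable_on \<Omega> \<and>
           h absolutely_integrable_on \<Omega> \<and> k absolutely_integrable_on \<Omega> \<and>
           (LINT x:\<Omega>|lebesgue. a x) + (LINT x:\<Omega>|lebesgue. b x) =
           \<theta> * (LINT x:\<Omega>|lebesgue. h x) + (LINT x:\<Omega>|lebesgue. k x))"

definition crit_set :: "(real^'n) set \<Rightarrow> (real^'n \<Rightarrow> real) \<Rightarrow> (real^'n) set" where
  "crit_set \<Omega> u = {x \<in> \<Omega> - {0}. grad u x = 0}"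

text \<open>\<^term>\<open>d\<close> is the classical derivative \<open>u\<^sub>i\<^sub>j(x)\<close>, which by convention is 0 on the critical set.
  As a relation it also asserts that the derivative exists.\<close>

definition has_classical_pderiv2 ::
  "(real^'n) set \<Rightarrow> (real^'n \<Rightarrow> real) \<Rightarrow> 'n \<Rightarrow> 'n \<Rightarrow> real^'n \<Rightarrow> real \<Rightarrow> bool" where
  "has_classical_pderiv2 \<Omega> u i j x d \<longleftrightarrow>
     (if x \<in> crit_set \<Omega> u then d = 0
      else ((\<lambda>t. pderiv_at i u (x + t *\<^sub>R axis j 1)) has_real_derivative d) (at 0))"

end

theory Submission imports Defs
begin

notation scaleR (infixr "*R" 75)
notation LIMSEQ (infix "~~>" 60)

text \<open>
  Off the critical set the equation is uniformly elliptic, so bounds for difference quotients give second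
  derivatives in \<open>L\<^sup>2\<close> there. The linearised equation is tested with \<open>\<psi>\<^sup>2 |\<nabla>u|\<^sup>-\<^sup>b u\<^sub>i\<close>, where \<open>b < 1\<close>, the weight
  being cut off near the critical set. As \<open>B'\<close> is bounded on one side only, its term is integrated by parts,
  and then \<open>B(t) \<le> C t\<^sup>2 A(t)\<close> suffices. The outcome is that \<open>|\<nabla>u|\<^sup>-\<^sup>b A(|\<nabla>u|) |D\<^sup>2u|\<^sup>2\<close> is locally integrable.
  For \<open>p < 3\<close> and \<open>b = max 0 (p - 2)\<close> the weight is bounded below. For \<open>p \<ge> 3\<close> the equation itself, whose right
  hand side is positive, is tested with \<open>\<psi>\<^sup>2 |\<nabla>u|\<^sup>-\<^sup>b / A(|\<nabla>u|)\<close>; so \<open>|\<nabla>u|\<^sup>-\<^sup>b / A(|\<nabla>u|)\<close> is locally integrable, and with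
  \<open>b = (p - 2)(s - 1)\<close> Young's inequality gives \<open>D\<^sup>2u\<close> in \<open>L\<^sup>s\<close>. That \<open>D\<^sup>2u\<close>, extended by zero, is the weak
  derivative across the critical set follows by truncating \<open>u\<^sub>i\<close> near its zeros. Finally, a weakly differentiable
  continuous function is absolutely continuous on almost every line.\<close>


section \<open>Smooth functions and mollification\<close>

text \<open>The obstacle is that second derivatives are at first known only in L2 on compact parts
  of the regular set \<open>V\<close>, so a function of the gradient is not an admissible test
  function. Test functions are built from difference quotients of \<open>u\<close> instead, which
  are C1 because \<open>u\<close> is, and every identity with second derivatives is the limit of a
  discrete one. The terms of that identity are quadratic in the difference quotients of the
  gradient, so weak convergence would not do: their squares have to converge in L1. Truncations that
  vanish, or are constant, near gradient zero confine these terms to a fixed compact part of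
  \<open>V\<close>. Differentiating the weight produces a term with factor -b whose quadratic form
  is bounded only by the main term itself; the fraction 1 - b survives, whence b < 1. For p >= 3 the
  condition s < (p - 1) / (p - 2) says precisely that (p - 2)(s - 1) < 1, so the range of s is the
  range of b. Everything takes place on compact subsets of \<open>\<Omega> - {0}\<close>, where the
  gradient is bounded and the singular potential is C1 and bounded below by a positive
  constant.\<close>

text \<open>Links the coordinatewise gradient of the definitions with the Frechet derivative: the
  chain rule along an axis gives each partial derivative, and a linear functional is determined by
  its values on the axes.\<close>

lemma GDERIV_iff_grad:
 fixes g :: "real^'n => real"
 shows "GDERIV g x :> w \<longleftrightarrow> g differentiable (at x) & grad g x = w"
proof -
 have G: "grad g x = w" if "GDERIV g x :> w" for w
 proof -
  have "((%t. g (x + t *R axis i 1)) has_real_derivative w $ i) (at 0)" for i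
  proof -
   have f: "(g has_derivative (%h. inner h w)) (at (x + 0 *R axis i 1))"
    using that by (simp add: gderiv_def)
   have "((%t. x + t *R axis i (1::real)) has_derivative (%t. t *R axis i 1)) (at 0)" by (auto intro!: derivative_eq_intros)
   from has_derivative_compose[OF this f]
   show ?thesis by (simp add: has_field_derivative_def inner_axis' mult_commute_abs)
  qed
  then show ?thesis by (simp add: grad_def pderiv_at_def vec_eq_iff DERIV_imp_deriv)
 qed
 moreover have "GDERIV g x :> grad g x" if dg: "g differentiable (at x)"
 proof -
  obtain g' where g': "(g has_derivative g') (at x)" using dg by (auto simp: differentiable_def)
  then have "linear g'" by (simp add: has_derivative_linear)
  then have "g' v = inner v (\<chi> i. g' (axis i 1))" for v by (subst basis_expansion[of v, symmetric])
    (simp add: linear_sum linear_cmul inner_vec_def scalar_mult_eq_scaleR o_def)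
  then have "GDERIV g x :> (\<chi> i. g' (axis i 1))"
   unfolding gderiv_def by (intro has_derivative_subst[OF g'] ext)
  with G show ?thesis by metis
 qed
 ultimately show ?thesis by (metis differentiableI gderiv_def)
qed

lemma grad_nth [simp]: "grad g x $ i = pderiv_at i g x" by (simp add: grad_def)

lemma GDERIV_imp_pderiv_at: "GDERIV g x :> w ==> pderiv_at i g x = w $ i" by (metis GDERIV_iff_grad grad_nth)

lemma GDERIV_grad: "g differentiable (at x) ==> GDERIV g x :> grad g x"
 for g :: "real^'n => real" by (simp add: GDERIV_iff_grad)

lemma GDERIV_line:
 fixes g :: "real^'n => real"
 assumes "GDERIV g (x + s *R v) :> w"
 shows "((%t. g (x + t *R v)) has_real_derivative inner v w) (at s)"
proof -
 have f: "(g has_derivative (%h. inner h w)) (at (x + s *R v))"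
  using assms by (simp add: gderiv_def)
 have "((%t. x + t *R v) has_derivative (%t. t *R v)) (at s)" by (auto intro!: derivative_eq_intros)
 from has_derivative_compose[OF this f] show ?thesis by (simp add: has_field_derivative_def mult_commute_abs)
qed

lemma GDERIV_translate:
 fixes g :: "real^'n => real"
 assumes "GDERIV g (x + c) :> w"
 shows "GDERIV (%x. g (x + c)) x :> w"
proof -
 have "((%x. x + c) has_derivative (%h. h)) (at x)" by (auto intro!: derivative_eq_intros)
 from has_derivative_compose[OF this assms[unfolded gderiv_def]] show ?thesis by (simp add: gderiv_def)
qed

lemma GDERIV_outside_support:
 fixes g :: "real^'n => real"
 assumes "closed S" "!!x. x ~: S ==> g x = 0" "x ~: S"
 shows "GDERIV g x :> 0"
proof -
 have "open (- S)" "x : - S" using assms by auto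
 moreover have "((%x. 0::real) has_derivative (%h. inner h 0)) (at x)" by simp
 ultimately have "(g has_derivative (%h. inner h 0)) (at x)"
  using has_derivative_transform_within_open[of "%x. 0::real" "%h. inner h 0" x UNIV "- S" g] assms(2) by auto
 then show ?thesis by (simp add: gderiv_def)
qed

section \<open>Calculus of the classes \<open>Ck_on\<close>\<close>

lemma Ck_on_Suc_D: "Ck_on (Suc m) U g ==> Ck_on m U g"
proof (induction m arbitrary: g)
 case 0
 then show ?case by (auto intro!: continuous_at_imp_continuous_on differentiable_imp_continuous_within)
next
 case (Suc m)
 then show ?case by (metis Ck_on.simps(2))
qed


lemma Ck_on_const: "Ck_on m UNIV (%x::real^'n. c)"
proof (induction m arbitrary: c)
 case (Suc m)
 have "pderiv_at i (%x::real^'n. c) = (%x. 0)" for i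
  using GDERIV_imp_pderiv_at[OF GDERIV_const] by fastforce
 then show ?case using Suc by simp
qed (simp)

lemma Ck_on_add:
 fixes f g :: "real^'n => real"
 assumes "Ck_on m UNIV f" "Ck_on m UNIV g"
 shows "Ck_on m UNIV (%x. f x + g x)"
 using assms
proof (induction m arbitrary: f g)
 case 0
 then show ?case by (simp add: continuous_on_add)
next
 case (Suc m)
 have "pderiv_at i (%x. f x + g x) = (%x. pderiv_at i f x + pderiv_at i g x)" for i
  using Suc.prems GDERIV_imp_pderiv_at[OF GDERIV_add[OF GDERIV_grad[of f] GDERIV_grad[of g]]] by (intro ext) simp
 then show ?case using Suc by auto
qed

lemma Ck_on_mult:
 fixes f g :: "real^'n => real"
 assumes "Ck_on m UNIV f" "Ck_on m UNIV g"
 shows "Ck_on m UNIV (%x. f x * g x)"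
 using assms
proof (induction m arbitrary: f g)
 case 0
 then show ?case by (simp add: continuous_on_mult)
next
 case (Suc m)
 have "pderiv_at i (%x. f x * g x) = (%x. f x * pderiv_at i g x + g x * pderiv_at i f x)" for i
  using Suc.prems GDERIV_imp_pderiv_at[OF GDERIV_mult[OF GDERIV_grad[of f] GDERIV_grad[of g]]] by (intro ext) simp
 moreover have "Ck_on m UNIV f" "Ck_on m UNIV g" using Suc.prems Ck_on_Suc_D by blast+
 ultimately show ?case using Suc by (auto intro!: Ck_on_add)
qed

text \<open>The sequence \<open>\<sigma>\<close> lists a function of one variable together with all
  its derivatives. One differentiation moves from \<open>k\<close> to \<open>Suc k\<close>, so the
  induction generalises over \<open>k\<close> and no formula for higher derivatives of a composition
  is required.\<close>

lemma Ck_on_compose_real: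
 fixes g :: "real^'n => real" and \<sigma> :: "nat => real => real"
 assumes \<sigma>: "!!k t. (\<sigma> k has_real_derivative \<sigma> (Suc k) t) (at t)" and g: "!!m. Ck_on m UNIV g"
 shows "Ck_on m UNIV (%x. \<sigma> k (g x))"
proof (induction m arbitrary: k)
 case 0
 have "continuous_on UNIV (\<sigma> k)"
  using \<sigma> by (meson DERIV_isCont continuous_at_imp_continuous_on)
 then show ?case using g[of 0] by (auto intro: continuous_on_compose2)
next
 case (Suc m)
 have d: "g differentiable at x" for x using g[of 1] by simp
 have G: "GDERIV (%x. \<sigma> k (g x)) x :> \<sigma> (Suc k) (g x) *R grad g x" for x by (rule GDERIV_DERIV_compose[OF GDERIV_grad[OF d] \<sigma>])
 then have "pderiv_at i (%x. \<sigma> k (g x)) = (%x. \<sigma> (Suc k) (g x) * pderiv_at i g x)" for i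
  using GDERIV_imp_pderiv_at[OF G] by (intro ext) simp
 moreover have "Ck_on m UNIV (pderiv_at i g)" for i using g[of "Suc m"] by simp
 ultimately show ?case using G Suc by (auto intro!: Ck_on_mult simp: GDERIV_iff_grad)
qed

lemma GDERIV_inner_self: "GDERIV (%x::real^'n. inner x x) x :> 2 *R x"
 unfolding gderiv_def by (auto intro!: derivative_eq_intros simp: inner_commute)

lemma Ck_on_nth: "Ck_on m UNIV (%x::real^'n. x $ i)"
proof (cases m)
 case 0 then show ?thesis by (simp add: continuous_on_component)
next
 case (Suc n)
 have G: "GDERIV (%x::real^'n. x $ i) x :> axis i 1" for x
  unfolding gderiv_def by (simp add: inner_axis bounded_linear_imp_has_derivative bounded_linear_vec_nth)
 then have "pderiv_at j (%x::real^'n. x $ i) = (%x. axis i 1 $ j)" for j by (intro ext) (rule GDERIV_imp_pderiv_at)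
 then show ?thesis using G by (auto simp: Suc GDERIV_iff_grad intro: Ck_on_const)
qed

lemma Ck_on_norm_sq: "Ck_on m UNIV (%x::real^'n. c - (norm x)^2)"
proof (cases m)
 case 0 then show ?thesis by (auto intro!: continuous_intros)
next
 case (Suc n)
 have G: "GDERIV (%x::real^'n. c - (norm x)^2) x :> 0 - 2 *R x" for x
  unfolding power2_norm_eq_inner by (intro GDERIV_diff GDERIV_const GDERIV_inner_self)
 then have "pderiv_at j (%x::real^'n. c - (norm x)^2) = (%x. (-2) * x $ j)" for j
  using GDERIV_imp_pderiv_at[OF G] by (intro ext) simp
 then show ?thesis using G
  using Ck_on_mult[OF Ck_on_const[of n "-2"] Ck_on_nth] by (auto simp: Suc GDERIV_iff_grad)
qed

text \<open>With these polynomials \<open>bump_fun k\<close> is the k-th derivative of exp(-1/t),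
  extended by zero: differentiating P(1/t) exp(-1/t) gives the factor 1/t^2 and replaces P by P -
  P'.\<close>

primrec bump_poly :: "nat => real poly" where
 "bump_poly 0 = 1"
| "bump_poly (Suc k) = [:0, 0, 1:] * (bump_poly k - pderiv (bump_poly k))"

definition bump_fun :: "nat => real => real" where
 "bump_fun k t = (if t > 0 then poly (bump_poly k) (1/t) * exp (- (1/t)) else 0)"

lemma tendsto_poly_exp_0: "((%x. poly p x * exp (- x)) \<longlongrightarrow> (0::real)) at_top"
proof -
 have "((%x. \<Sum>i\<le>degree p. coeff p i * (x ^ i / exp x)) \<longlongrightarrow> (\<Sum>i\<le>degree p. coeff p i * 0)) at_top"
  by (intro tendsto_intros tendsto_power_div_exp_0)
 then show ?thesis by (simp add: poly_altdef exp_minus sum_distrib_right divide_inverse mult.assoc)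
qed

text \<open>Only t = 0 needs an argument. From the right the difference quotient is again a
  polynomial in 1/t times exp(-1/t), of degree one higher, and the exponential wins.\<close>

lemma DERIV_bump_fun: "(bump_fun k has_real_derivative bump_fun (Suc k) t) (at t)"
proof -
 consider "t > 0" | "t < 0" | "t = 0" by linarith
 then show ?thesis
 proof cases
  case 1
  let ?p = "bump_poly k"
  have "((%t. poly ?p (1/t) * exp (- (1/t))) has_real_derivative
    (poly (pderiv ?p) (1/t) * (- (1/t^2)) * exp (- (1/t)) + poly ?p (1/t) * (exp (-(1/t)) * (1/t^2)))) (at t)"
   using 1 by (auto intro!: derivative_eq_intros DERIV_chain2[OF poly_DERIV] simp: power2_eq_square)
  then have "((%t. poly ?p (1/t) * exp (- (1/t))) has_real_derivative bump_fun (Suc k) t) (at t)"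
   by (rule DERIV_cong) (use 1 in \<open>simp add: bump_fun_def power2_eq_square algebra_simps\<close>)
  moreover have "\<forall>\<^sub>F s in nhds t. poly ?p (1/s) * exp (- (1/s)) = bump_fun k s"
   using eventually_nhds_in_open[of "{0<..}" t] 1 by (auto elim!: eventually_mono simp: bump_fun_def)
  ultimately show ?thesis by (subst (asm) DERIV_cong_ev) auto
 next
  case 2
  have "\<forall>\<^sub>F s in nhds t. 0 = bump_fun k s"
   using eventually_nhds_in_open[of "{..<0}" t] 2 by (auto elim!: eventually_mono simp: bump_fun_def)
  moreover have "((%s. 0) has_real_derivative bump_fun (Suc k) t) (at t)"
   using 2 by (simp add: bump_fun_def)
  ultimately show ?thesis by (subst (asm) DERIV_cong_ev) auto
 next
  case 3
  have "((%x. poly ([:0,1:] * bump_poly k) x * exp (- x)) \<longlongrightarrow> (0::real)) at_top" by (rule tendsto_poly_exp_0)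
  then have "((%t. poly ([:0,1:] * bump_poly k) (1/t) * exp (- (1/t))) \<longlongrightarrow> (0::real)) (at_right 0)"
   by (rule filterlim_compose) (rule filterlim_inverse_at_top_right[unfolded inverse_eq_divide])
  then have r: "((%t. bump_fun k t / t) \<longlongrightarrow> (0::real)) (at_right 0)" by (rule Lim_transform_eventually)
    (auto simp: eventually_at_filter bump_fun_def)
  have l: "((%t. bump_fun k t / t) \<longlongrightarrow> (0::real)) (at_left 0)" by (rule tendsto_eventually) (auto simp: eventually_at_filter bump_fun_def)
  have "((%t. bump_fun k t / t) \<longlongrightarrow> (0::real)) (at 0)"
   using l r by (simp add: filterlim_split_at)
  then show ?thesis using 3 by (simp add: DERIV_def bump_fun_def)
 qed
qed

text \<open>Uniform continuity on the compact 1-neighbourhood of \<open>S\<close> suffices: two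
  points at distance at most 1 lie both in it or both outside \<open>S\<close>.\<close>

lemma uniformly_continuous_compact_support:
 fixes f :: "'a::euclidean_space => 'b::real_normed_vector"
 assumes "compact S" "continuous_on UNIV f" "!!x. x ~: S ==> f x = 0"
 shows "uniformly_continuous_on UNIV f"
proof -
 define S' where "S' = (\<Union>x\<in>S. \<Union>y\<in>cball 0 1. {x + y})"
 have "compact S'" unfolding S'_def by (rule compact_sums'[OF assms(1) compact_cball])
 then have u: "uniformly_continuous_on S' f"
  using assms(2) compact_uniformly_continuous continuous_on_subset by blast
 have inS': "y : S'" if "x : S" "dist x y <= 1" for x y
  unfolding S'_def using that by (intro UN_I[of x] UN_I[of "y - x"]) (auto simp: dist_norm norm_minus_commute)
 show ?thesis
  unfolding uniformly_continuous_on_def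
 proof (intro allI impI)
  fix e :: real assume "e > 0"
  with u obtain d where d: "d > 0" "!!x y. x : S' ==> y : S' ==> dist y x < d ==> dist (f y) (f x) < e"
   unfolding uniformly_continuous_on_def by metis
  have "dist (f y) (f x) < e" if "dist y x < min d 1" for x y
  proof (cases "x : S \<or> y : S")
   case True
   then have "x : S'" "y : S'" using that inS'[of x x] inS'[of y y] inS'[of x y] inS'[of y x] by (auto simp: dist_commute)
   then show ?thesis using d that by simp
  next
   case False then show ?thesis using assms(3) \<open>e > 0\<close> by simp
  qed
  then show "\<exists>d>0. \<forall>x\<in>UNIV. \<forall>x'\<in>UNIV. dist x' x < d --> dist (f x') (f x) < e"
   using d(1) by (intro exI[of _ "min d 1"]) auto
 qed
qed

text \<open>The working class of test functions. It asks only for C1 because test functions built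
  from \<open>u\<close> are no smoother, and it carries a compact set \<open>S\<close> containing
  the support so that translates and products can be kept inside the domain.\<close>

definition C1c :: "(real^'n) set => (real^'n => real) => bool" where
 "C1c S ph \<longleftrightarrow> compact S & (\<forall>x. ph differentiable (at x)) & continuous_on UNIV (grad ph) \<and>
   (\<forall>x. x ~: S --> ph x = 0)"

lemma C1c_grad_0: "C1c S ph ==> x ~: S ==> grad ph x = 0"
 using GDERIV_outside_support[of S ph x] by (auto simp: C1c_def compact_imp_closed GDERIV_iff_grad)

lemma C1c_continuous: "C1c S ph ==> continuous_on A ph"
 by (auto simp: C1c_def intro!: continuous_at_imp_continuous_on differentiable_imp_continuous_within)

lemma C1c_continuous_grad: "C1c S ph ==> continuous_on A (grad ph)" by (auto simp: C1c_def intro: continuous_on_subset)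

lemma continuous_on_grad_iff:
 "continuous_on S (grad g) \<longleftrightarrow> (\<forall>i. continuous_on S (pderiv_at i g))"
proof
 assume "continuous_on S (grad g)"
 then show "\<forall>i. continuous_on S (pderiv_at i g)" by (auto dest: continuous_on_component[of S "grad g"])
next
 assume "\<forall>i. continuous_on S (pderiv_at i g)"
 then show "continuous_on S (grad g)"
  unfolding grad_def by (intro continuous_on_vec_lambda) auto
qed

lemma bounded_compact_support:
 fixes f :: "'a::euclidean_space => 'b::real_normed_vector"
 assumes "compact S" "continuous_on UNIV f" "!!x. x ~: S ==> f x = 0"
 obtains C where "C > 0" "!!x. norm (f x) <= C"
proof -
 have "bounded (f ` S)" by (intro compact_imp_bounded compact_continuous_image continuous_on_subset[OF assms(2)] assms(1)) auto
 then obtain C where "C > 0" "\<forall>x\<in>S. norm (f x) <= C" by (auto simp: bounded_pos)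
 then show ?thesis by (intro that[of C]) (metis assms(3) norm_zero less_imp_le)+
qed

lemma integrable_compact_support:
 fixes f :: "'a::euclidean_space => real"
 assumes "compact S" "continuous_on UNIV f" "!!x. x ~: S ==> f x = 0"
 shows "integrable lborel f"
proof -
 have "set_integrable lborel S f"
  unfolding set_integrable_def
  using borel_integrable_compact[OF assms(1) continuous_on_subset[OF assms(2)]] by (simp add: indicator_def if_distrib cong: if_cong)
 moreover have "(%x. indicator S x *R f x) = f"
  using assms(3) by (intro ext) (auto simp: indicator_def)
 ultimately show ?thesis by (simp add: set_integrable_def)
qed

lemma GDERIV_linearization_bound:
 fixes f :: "real^'n => real"
 assumes "!!x. f differentiable (at x)" and "!!y. norm (y - z) <= norm v ==> norm (grad f y - grad f z) <= e"
 shows "\<bar>f (z + v) - f z - inner v (grad f z)\<bar> <= e * norm v"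
proof -
 let ?S = "cball z (norm v)"
 have "norm (f (z + v) - f z - inner (z + v - z) (grad f z)) <= norm (z + v - z) * e"
 proof (rule differentiable_bound_linearization[where S = ?S and f' = "%x h. inner h (grad f x)"])
  show "z + t *R (z + v - z) : ?S" if "t : {0..1}" for t
   using that by (simp add: dist_norm mult_left_le_one_le)
  show "(f has_derivative (%h. inner h (grad f x))) (at x within ?S)" for x
   using GDERIV_grad[OF assms(1)] by (auto simp: gderiv_def intro: has_derivative_at_withinI)
  show "onorm ((%h. inner h (grad f x)) - (%h. inner h (grad f z))) <= e" if "x : ?S" for x
  proof (rule onorm_le)
   fix h
   have "\<bar>inner h (grad f x - grad f z)\<bar> <= norm h * norm (grad f x - grad f z)" by (rule Cauchy_Schwarz_ineq2)
   also have "... <= e * norm h" using assms(2)[of x] that by (subst mult.commute) (auto simp: dist_norm norm_minus_commute intro!: mult_right_mono)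
   finally show "norm (((%h. inner h (grad f x)) - (%h. inner h (grad f z))) h) <= e * norm h" by (simp add: inner_diff_right)
  qed
 qed auto
 then show ?thesis by (simp add: mult.commute)
qed

text \<open>One construction for two uses: with \<open>k\<close> the identity it is convolution with
  \<open>g\<close>; with \<open>k t = t *R e\<close> and \<open>g\<close> the indicator of an
  interval it is the integral of \<open>ph\<close> along a segment.\<close>

definition conv_along :: "'a measure => ('a => real) => ('a => real^'n) => (real^'n => real) => real^'n => real"
 where "conv_along M g k ph x = (\<integral>t. g t * ph (x - k t) \<partial>M)"

lemma conv_along_integrable:
 fixes k :: "'a => real^'n" and ph :: "real^'n => real"
 assumes g: "integrable M g" and k: "k : borel_measurable M"
  and ph: "compact S" "continuous_on UNIV ph" "!!x. x ~: S ==> ph x = 0"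
 shows "integrable M (%t. g t * ph (x - k t))"
proof -
 obtain C where C: "!!x. norm (ph x) <= C" by (rule bounded_compact_support[OF ph]) auto
 have [measurable]: "ph : borel_measurable borel" by (rule borel_measurable_continuous_onI[OF ph(2)])
 note k[measurable]
 show ?thesis by (rule Bochner_Integration.integrable_bound[where f = "%t. C * g t"])
   (use g C in \<open>auto simp: abs_mult mult.commute[of C] intro!: AE_I2 mult_left_mono
    intro: order_trans[OF C[unfolded real_norm_def] abs_ge_self]\<close>)
qed

text \<open>The gradient of \<open>ph\<close> is uniformly continuous, so the error of linearisation
  is small uniformly in the shift and may be integrated against the absolute value of
  \<open>g\<close>.\<close>

lemma conv_along_GDERIV:
 fixes k :: "'a => real^'n" and ph :: "real^'n => real"
 assumes g: "integrable M g" and k: "k : borel_measurable M" and ph: "C1c S ph"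
 shows "GDERIV (conv_along M g k ph) x :> (\<chi> i. conv_along M g k (pderiv_at i ph) x)"
proof -
 have S: "compact S" and 0: "!!x. x ~: S ==> ph x = 0" using ph by (auto simp: C1c_def)
 have c: "continuous_on UNIV ph" using ph by (rule C1c_continuous)
 have cp: "continuous_on UNIV (pderiv_at i ph)" for i
  using C1c_continuous_grad[OF ph] continuous_on_grad_iff by blast
 have p0: "pderiv_at i ph x = 0" if "x ~: S" for i x
  using C1c_grad_0[OF ph that] by (metis grad_nth zero_index)
 note I = conv_along_integrable[OF g k S c 0] and Ip = conv_along_integrable[OF g k S cp p0]
 have Ig: "integrable M (%t. g t * inner v (grad ph (x - k t)))" for v x
 proof -
  have "(%t. g t * inner v (grad ph (x - k t))) = (%t. \<Sum>i\<in>UNIV. v $ i * (g t * pderiv_at i ph (x - k t)))"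
   by (intro ext) (simp add: inner_vec_def sum_distrib_left mult_ac)
  then show ?thesis using Ip by (simp)
 qed
 have eq: "inner v (\<chi> i. conv_along M g k (pderiv_at i ph) x) = (\<integral>t. g t * inner v (grad ph (x - k t)) \<partial>M)" for v
 proof -
  have "(\<Sum>i\<in>UNIV. v $ i * (\<integral>t. g t * pderiv_at i ph (x - k t) \<partial>M)) =
    (\<integral>t. (\<Sum>i\<in>UNIV. v $ i * (g t * pderiv_at i ph (x - k t))) \<partial>M)"
   using Ip by (subst Bochner_Integration.integral_sum) auto
  then show ?thesis by (simp add: conv_along_def inner_vec_def sum_distrib_left mult.left_commute)
 qed
 have u: "uniformly_continuous_on UNIV (grad ph)"
  using uniformly_continuous_compact_support[OF S C1c_continuous_grad[OF ph]] C1c_grad_0[OF ph] by blast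
 define N where "N = (\<integral>t. \<bar>g t\<bar> \<partial>M)"
 have N: "N >= 0" by (simp add: N_def)
 show ?thesis
  unfolding gderiv_def has_derivative_at_alt
 proof (intro conjI allI impI)
  show "bounded_linear (%h. inner h (\<chi> i. conv_along M g k (pderiv_at i ph) x))" by (rule bounded_linear_inner_left)
  fix e :: real assume "e > 0"
  \<comment> \<open>\<open>N\<close> is the total mass of the absolute value of \<open>g\<close>;
    adding 1 keeps the quotient defined when that mass is zero.\<close>
  define e' where "e' = e / (N + 1)"
  have e': "e' > 0" using \<open>e > 0\<close> N by (simp add: e'_def)
  then obtain d where d: "d > 0" "!!y z. dist y z < d ==> dist (grad ph y) (grad ph z) < e'"
   using u unfolding uniformly_continuous_on_def by (metis UNIV_I)
  have "norm (conv_along M g k ph y - conv_along M g k ph x - inner (y - x) (\<chi> i. conv_along M g k (pderiv_at i ph) x))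
    <= e * norm (y - x)" if y: "norm (y - x) < d" for y
  proof -
   let ?D = "%t. ph (y - k t) - ph (x - k t) - inner (y - x) (grad ph (x - k t))"
   have D: "\<bar>?D t\<bar> <= e' * norm (y - x)" for t
   proof -
    have "\<bar>ph (x - k t + (y - x)) - ph (x - k t) - inner (y - x) (grad ph (x - k t))\<bar> <= e' * norm (y - x)"
    proof (rule GDERIV_linearization_bound)
     fix z assume "norm (z - (x - k t)) <= norm (y - x)"
     then have "dist z (x - k t) < d" using y by (simp add: dist_norm)
     from d(2)[OF this] show "norm (grad ph z - grad ph (x - k t)) <= e'" by (simp add: dist_norm)
    qed (use ph in \<open>auto simp: C1c_def\<close>)
    then show ?thesis by simp
   qed
   have E: "conv_along M g k ph y - conv_along M g k ph x - inner (y - x) (\<chi> i. conv_along M g k (pderiv_at i ph) x)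
     = (\<integral>t. g t * ?D t \<partial>M)"
    unfolding eq unfolding conv_along_def using I Ig by (simp add: right_diff_distrib)
   have "\<bar>\<integral>t. g t * ?D t \<partial>M\<bar> <= (\<integral>t. \<bar>g t * ?D t\<bar> \<partial>M)" by (rule integral_abs_bound)
   also have "... <= (\<integral>t. \<bar>g t\<bar> * (e' * norm (y - x)) \<partial>M)"
   proof (rule integral_mono)
    show "integrable M (%t. \<bar>g t * ?D t\<bar>)"
     unfolding right_diff_distrib by (intro integrable_abs Bochner_Integration.integrable_diff I Ig)
    show "integrable M (%t. \<bar>g t\<bar> * (e' * norm (y - x)))" using g by simp
    show "\<bar>g t * ?D t\<bar> <= \<bar>g t\<bar> * (e' * norm (y - x))" for t
     unfolding abs_mult by (rule mult_left_mono[OF D]) simp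
   qed
   also have "... = N * e' * norm (y - x)" by (simp add: N_def)
   also have "... <= e * norm (y - x)"
    using N \<open>e > 0\<close> by (intro mult_right_mono) (auto simp: e'_def field_simps)
   finally show ?thesis unfolding E by simp
  qed
  then show "\<exists>d>0. \<forall>y. norm (y - x) < d --> norm (conv_along M g k ph y - conv_along M g k ph x - inner (y - x) (\<chi> i. conv_along M g k (pderiv_at i ph) x))
    <= e * norm (y - x)" using d(1) by blast
 qed
qed

lemma smooth_imp_C1c:
 assumes "!!m. Ck_on m UNIV ph" "compact S" "!!x. x ~: S ==> ph x = 0"
 shows "C1c S ph"
 using assms(1)[of 1] assms(2,3) by (auto simp: C1c_def continuous_on_grad_iff)

text \<open>Each derivative falls on \<open>ph\<close> and stays supported in \<open>S\<close>, so
  the induction runs over \<open>m\<close> with \<open>ph\<close> arbitrary.\<close>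

lemma conv_along_smooth:
 fixes k :: "'a => real^'n" and ph :: "real^'n => real"
 assumes g: "integrable M g" and k: "k : borel_measurable M"
  and ph: "!!m. Ck_on m UNIV ph" "compact S" "!!x. x ~: S ==> ph x = 0"
 shows "Ck_on m UNIV (conv_along M g k ph)"
 using ph(1,3)
proof (induction m arbitrary: ph)
 case (0 ph)
 then have "C1c S ph" using smooth_imp_C1c ph(2) by blast
 from conv_along_GDERIV[OF g k this] show ?case by (auto intro!: continuous_at_imp_continuous_on differentiable_imp_continuous_within simp: GDERIV_iff_grad)
next
 case (Suc m ph)
 then have C: "C1c S ph" using smooth_imp_C1c ph(2) by blast
 note G = conv_along_GDERIV[OF g k C]
 have "pderiv_at i (conv_along M g k ph) = conv_along M g k (pderiv_at i ph)" for i
  using GDERIV_imp_pderiv_at[OF G] by (intro ext) simp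
 moreover have "Ck_on m UNIV (conv_along M g k (pderiv_at i ph))" for i
 proof (rule Suc.IH)
  show "Ck_on n UNIV (pderiv_at i ph)" for n using Suc.prems(1)[of "Suc n"] by simp
  show "pderiv_at i ph x = 0" if "x ~: S" for x
   using C1c_grad_0[OF C that] by (metis grad_nth zero_index)
 qed
 ultimately show ?case using G by (auto simp: GDERIV_iff_grad)
qed

section \<open>Test functions and mollifiers\<close>

lemma test_funI:
 assumes "!!m. Ck_on m UNIV ph" "compact S" "!!x. x ~: S ==> ph x = 0" "S <= U"
 shows "ph : test_fun U"
proof -
 have "closure {x. ph x ~= 0} <= S"
  using assms by (intro closure_minimal) (auto simp: compact_imp_closed)
 moreover have "compact (closure {x. ph x ~= 0})"
  using calculation assms(2) by (meson closed_closure compact_Int_closed compact_eq_bounded_closed bounded_subset)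
 ultimately show ?thesis using assms by (auto simp: test_fun_def)
qed

lemma test_funE:
 assumes "ph : test_fun U"
 obtains S where "C1c S ph" "S <= U" "compact S" "!!x. x ~: S ==> ph x = 0" "!!m. Ck_on m UNIV ph"
proof
 let ?S = "closure {x. ph x ~= 0}"
 show c: "compact ?S" and "?S <= U" and s: "!!m. Ck_on m UNIV ph" using assms by (auto simp: test_fun_def)
 show 0: "ph x = 0" if "x ~: ?S" for x using that closure_subset[of "{x. ph x ~= 0}"] by blast
 show "C1c ?S ph" by (rule smooth_imp_C1c[OF s c 0])
qed

text \<open>The profile is evaluated at \<open>d^2 - (norm x)^2\<close>, a polynomial in the
  coordinates, so smoothness at the origin is automatic.\<close>

definition mollifier :: "real => real^'n => real" where
 "mollifier d x = bump_fun 0 (d^2 - (norm x)^2) / (LBINT x. bump_fun 0 (d^2 - (norm (x::real^'n))^2))"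

lemma mollifier_smooth: "Ck_on m UNIV (mollifier d :: real^'n => real)"
proof -
 have "mollifier d = (%x::real^'n. bump_fun 0 (d^2 - (norm x)^2) * (1 / (LBINT x. bump_fun 0 (d^2 - (norm (x::real^'n))^2))))"
  by (intro ext) (simp add: mollifier_def)
 then show ?thesis
  using Ck_on_compose_real[of bump_fun "%x::real^'n. d^2 - (norm x)^2" m 0, OF DERIV_bump_fun Ck_on_norm_sq]
  by (simp only: Ck_on_mult[OF _ Ck_on_const])
qed

lemma mollifier_0: "0 <= d ==> x ~: cball 0 d ==> mollifier d x = 0"
proof -
 assume "0 <= d" "x ~: cball 0 d"
 then have "d^2 <= (norm x)^2" by (intro power_mono) auto
 then show ?thesis by (simp add: mollifier_def bump_fun_def[of 0 "d^2 - (norm x)^2"])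
qed

lemma mollifier_C1c: "0 <= d ==> C1c (cball 0 d) (mollifier d)" by (rule smooth_imp_C1c) (auto simp: mollifier_smooth mollifier_0 simp del: mem_cball)

lemma bump_fun_nonneg: "bump_fun 0 t >= 0" by (simp add: bump_fun_def)

lemma mollifier_nonneg: "mollifier d x >= 0"
 unfolding mollifier_def by (intro divide_nonneg_nonneg bump_fun_nonneg Bochner_Integration.integral_nonneg)

lemma mollifier_integrable: "0 <= d ==> integrable lborel (mollifier d)" by (rule integrable_compact_support[of "cball 0 d"])
  (auto intro: C1c_continuous[OF mollifier_C1c] simp: mollifier_0 simp del: mem_cball)

lemma mollifier_integral:
 assumes "d > 0" shows "(LBINT x. mollifier d (x::real^'n)) = 1"
proof -
 let ?b = "%x::real^'n. bump_fun 0 (d^2 - (norm x)^2)"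
 have c: "continuous_on UNIV ?b"
  using Ck_on_compose_real[of bump_fun "%x::real^'n. d^2 - (norm x)^2" 0 0, OF DERIV_bump_fun Ck_on_norm_sq] by simp
 have i: "integrable lborel ?b" by (rule integrable_compact_support[of "cball 0 d", OF _ c])
   (use assms power_mono[of d "norm _" 2] in \<open>auto simp: bump_fun_def not_less not_le\<close>)
 have "(LBINT x. ?b x) ~= 0"
 proof
  assume "(LBINT x. ?b x) = 0"
  then have "AE x in lborel. ?b x = 0"
   using integral_nonneg_eq_0_iff_AE[OF i] bump_fun_nonneg by auto
  then have "AE x in lborel. x ~: ball (0::real^'n) d" by eventually_elim (use assms in \<open>auto simp: bump_fun_def power_strict_mono split: if_splits\<close>)
  then have "ball (0::real^'n) d : null_sets lborel" by (subst AE_iff_null_sets) auto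
  then have "emeasure lborel (ball (0::real^'n) d) = 0" by (simp add: null_sets_def)
  moreover have "measure lebesgue (ball (0::real^'n) d) > 0"
   using content_ball_pos[OF assms] by simp
  ultimately show False by (simp add: measure_def)
 qed
 then show ?thesis by (simp add: mollifier_def[abs_def])
qed

section \<open>Translation and reflection invariance of Lebesgue measure\<close>

lemma lborel_integral_shift:
 fixes f :: "'a::euclidean_space => 'b::{banach, second_countable_topology}"
 assumes "f : borel_measurable borel"
 shows "(LBINT x. f (x + c)) = (LBINT x. f x)"
proof -
 have "(LBINT x. f x) = (\<integral>x. f x \<partial>distr lborel borel ((+) c))" by (simp add: lborel_distr_plus)
 also have "... = (LBINT x. f (c + x))" by (subst integral_distr) (use assms in auto)
 finally show ?thesis by (simp add: add.commute)
qed

lemma lborel_integrable_shift: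
 fixes f :: "'a::euclidean_space => 'b::{banach, second_countable_topology}"
 assumes "integrable lborel f"
 shows "integrable lborel (%x. f (x + c))"
proof -
 have [measurable]: "f : borel_measurable borel" using borel_measurable_integrable[OF assms] by simp
 have "integrable (distr lborel borel ((+) c)) f" by (simp add: lborel_distr_plus assms)
 then show ?thesis by (subst (asm) integrable_distr_eq) (auto simp: add.commute)
qed

lemma nn_integral_lborel_shift:
 fixes f :: "'a::euclidean_space => ennreal"
 assumes "f : borel_measurable borel"
 shows "(\<integral>\<^sup>+x. f (x + c) \<partial>lborel) = (\<integral>\<^sup>+x. f x \<partial>lborel)"
proof -
 have "(\<integral>\<^sup>+x. f x \<partial>lborel) = (\<integral>\<^sup>+x. f x \<partial>distr lborel borel ((+) c))" by (simp add: lborel_distr_plus)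
 also have "... = (\<integral>\<^sup>+x. f (c + x) \<partial>lborel)" by (subst nn_integral_distr) (use assms in auto)
 finally show ?thesis by (simp add: add.commute)
qed

lemma lborel_integral_reflect:
 fixes f :: "'a::euclidean_space => real"
 assumes "f : borel_measurable borel"
 shows "(LBINT x. f (c - x)) = (LBINT x. f x)"
proof -
 have "lborel = distr lborel borel (%x::'a. c + (-1) *R x)"
  using lborel_affine[of "-1" c] by (simp add: density_1)
 then have "(LBINT x. f x) = (\<integral>x. f x \<partial>distr lborel borel (%x. c + (-1) *R x))" by simp
 also have "... = (LBINT x. f (c + (-1) *R x))" by (subst integral_distr) (use assms in auto)
 finally show ?thesis by simp
qed

text \<open>The neighbourhood is written as a Minkowski sum with a closed ball, so that compactness
  of sums of compact sets applies directly.\<close>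

definition thicken :: "real => (real^'n) set => (real^'n) set" where
 "thicken d K = (\<Union>x\<in>K. \<Union>y\<in>cball 0 d. {x + y})"

lemma compact_thicken: "compact K ==> compact (thicken d K)"
 unfolding thicken_def by (rule compact_sums'[OF _ compact_cball])

lemma thickenI: "x : K ==> norm (y - x) <= d ==> y : thicken d K"
 unfolding thicken_def by (rule UN_I[of x], assumption, rule UN_I[of "y - x"]) auto

lemma thickenE: "y : thicken d K ==> (!!x. x : K ==> norm (y - x) <= d ==> P) ==> P"
 unfolding thicken_def by auto

lemma thicken_mono: "d <= e ==> thicken d K <= thicken e K" by (auto elim!: thickenE intro: thickenI)

lemma thicken_superset: "0 <= d ==> K <= thicken d K" by (auto intro!: thickenI)

lemma thicken_subset_open:
 assumes "compact K" "open U" "K <= U"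
 obtains d where "d > 0" "thicken d K <= U"
proof -
 obtain e where "e > 0" "(\<Union>x\<in>K. cball x e) <= U"
  using compact_subset_open_imp_cball_epsilon_subset[OF assms] by blast
 then show ?thesis by (intro that[of e]) (auto elim!: thickenE simp: dist_norm norm_minus_commute subset_eq)
qed

text \<open>The indicator of \<open>thicken d K\<close> is mollified at radius \<open>d\<close>,
  with \<open>d\<close> half of the available distance \<open>e\<close>: near a point of
  \<open>K\<close> only the value 1 is averaged, and outside \<open>thicken e K\<close> only the
  value 0.\<close>

lemma smooth_cutoff:
 fixes K :: "(real^'n) set"
 assumes "compact K" "open U" "K <= U"
 obtains ps where "ps : test_fun U" "!!x. 0 <= ps x" "!!x. ps x <= 1" "!!x. x : K ==> ps x = 1"
proof -
 obtain e where e: "e > 0" "thicken e K <= U" using thicken_subset_open[OF assms] .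
 define d where "d = e / 2"
 have d: "d > 0" "d + d <= e" using e by (auto simp: d_def)
 let ?K = "thicken d K"
 define ps where "ps = conv_along lborel (indicator ?K) (%y. y) (mollifier d)"
 have cK: "compact ?K" by (rule compact_thicken[OF assms(1)])
 have Kb: "?K : sets borel" using cK by (simp add: borel_compact)
 have gi: "integrable lborel (indicator ?K :: _ => real)"
  using Kb emeasure_compact_finite[OF cK] by (simp add: integrable_indicator_iff)
 have mb[measurable]: "mollifier d : borel_measurable (borel :: (real^'n) measure)"
  using borel_measurable_integrable[OF mollifier_integrable[of d]] d by simp
 have int: "(LBINT y. mollifier d (x - y)) = 1" for x :: "real^'n"
  using lborel_integral_reflect[of "mollifier d" x] mollifier_integral[OF d(1)] by simp
 have inti: "integrable lborel (%y. mollifier d (x - y))" for x :: "real^'n"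
  using int[of x] not_integrable_integral_eq by fastforce
 note inti' = conv_along_integrable[OF gi, of "%y. y" "cball 0 d" "mollifier d", OF _ compact_cball
   C1c_continuous[OF mollifier_C1c] mollifier_0]
 show ?thesis
 proof
  show "ps : test_fun U"
  proof (rule test_funI)
   show "Ck_on m UNIV ps" for m unfolding ps_def by (rule conv_along_smooth[OF gi _ mollifier_smooth compact_cball[of 0 d] mollifier_0]) (use d in auto)
   show "ps x = 0" if "x ~: thicken e K" for x
   proof -
    have "indicator ?K y * mollifier d (x - y) = 0" for y
    proof (cases "y : ?K")
     case True
     then obtain z where z: "z : K" "norm (y - z) <= d" by (auto elim: thickenE)
     have "\<not> norm (x - y) <= d"
     proof
      assume "norm (x - y) <= d"
      then have "norm (x - z) <= e" using z d norm_triangle_ineq[of "x - y" "y - z"] by simp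
      then show False using that z thickenI by blast
     qed
     then show ?thesis using mollifier_0[of d "x - y"] d by simp
    qed simp
    then show ?thesis unfolding ps_def conv_along_def by (simp only: Bochner_Integration.integral_zero)
   qed
  qed (use compact_thicken[OF assms(1)] e in auto)
  show "0 <= ps x" for x unfolding ps_def conv_along_def by (intro Bochner_Integration.integral_nonneg mult_nonneg_nonneg mollifier_nonneg) auto
  show "ps x <= 1" for x
  proof -
   have "ps x <= (LBINT y. mollifier d (x - y))" unfolding ps_def conv_along_def
    using inti' inti d by (intro integral_mono) (auto simp: indicator_def mollifier_nonneg)
   then show ?thesis using int by simp
  qed
  show "ps x = 1" if "x : K" for x
  proof -
   have "indicator ?K y * mollifier d (x - y) = mollifier d (x - y)" for y
    using thickenI[OF that, of y d] mollifier_0[of d "x - y"] d by (auto simp: indicator_def norm_minus_commute)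
   then show ?thesis unfolding ps_def conv_along_def by (simp only: int)
  qed
 qed
qed

lemma conv_along_mollifier_uniform:
 fixes ph :: "real^'n => real"
 assumes "compact S" "continuous_on UNIV ph" "!!x. x ~: S ==> ph x = 0"
  and d: "d > 0" "!!x y. dist x y <= d ==> \<bar>ph x - ph y\<bar> <= e"
 shows "\<bar>conv_along lborel (mollifier d) (%y. y) ph x - ph x\<bar> <= e"
proof -
 note mi = mollifier_integrable[OF less_imp_le[OF d(1)]]
 have i: "integrable lborel (%y. mollifier d y * ph (x - y))" by (rule conv_along_integrable[OF mi _ assms(1-3)]) auto
 have "(LBINT y. mollifier d (y::real^'n) * ph x) = ph x"
  using mollifier_integral[OF d(1)] by (metis integral_mult_left_zero mult_1)
 then have E: "conv_along lborel (mollifier d) (%y. y) ph x - ph x = (LBINT y. mollifier d y * (ph (x - y) - ph x))"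
  unfolding right_diff_distrib conv_along_def by (subst Bochner_Integration.integral_diff[OF i]) (use mi in auto)
 have "\<bar>\<integral>y. mollifier d y * (ph (x - y) - ph x) \<partial>lborel\<bar> <= (LBINT y. \<bar>mollifier d y * (ph (x - y) - ph x)\<bar>)"
  by (rule integral_abs_bound)
 also have "... <= (LBINT y. mollifier d (y::real^'n) * e)"
 proof (rule integral_mono)
  show "integrable lborel (%y. \<bar>mollifier d y * (ph (x - y) - ph x)\<bar>)"
   unfolding right_diff_distrib by (intro integrable_abs Bochner_Integration.integrable_diff[OF i]) (use mi in auto)
  fix y :: "real^'n"
  show "\<bar>mollifier d y * (ph (x - y) - ph x)\<bar> <= mollifier d y * e"
   using d(2)[of "x - y" x] mollifier_0[of d y] mollifier_nonneg[of d y] d(1) by (cases "norm y <= d") (auto simp: abs_mult dist_norm intro: mult_left_mono)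
 qed (use mi in auto)
 also have "... = e" using mollifier_integral[OF d(1)] by (metis integral_mult_left_zero mult_1)
 finally show ?thesis unfolding E .
qed

text \<open>Mollification commutes with differentiation, so the function and its gradient are
  approximated uniformly at the same radius; this is what extends an identity from smooth to C1 test
  functions.\<close>

lemma C1c_approx_step:
 fixes ph :: "real^'n => real"
 assumes ph: "C1c S ph" and U: "thicken r S <= U" "r > 0" and "e > 0"
 shows "\<exists>ph'\<in>test_fun U. (\<forall>x. x ~: thicken r S --> ph' x = 0) & (\<forall>x. \<bar>ph' x - ph x\<bar> <= e) \<and>
   (\<forall>i x. \<bar>pderiv_at i ph' x - pderiv_at i ph x\<bar> <= e)"
proof -
 have S: "compact S" and 0: "!!x. x ~: S ==> ph x = 0" using ph by (auto simp: C1c_def)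
 have c: "continuous_on UNIV ph" using ph by (rule C1c_continuous)
 have cp: "continuous_on UNIV (pderiv_at i ph)" for i
  using C1c_continuous_grad[OF ph] continuous_on_grad_iff by blast
 have p0: "pderiv_at i ph x = 0" if "x ~: S" for i x
  using C1c_grad_0[OF ph that] by (metis grad_nth zero_index)
 have u: "uniformly_continuous_on UNIV ph" "uniformly_continuous_on UNIV (grad ph)"
  using uniformly_continuous_compact_support[OF S C1c_continuous_grad[OF ph]] C1c_grad_0[OF ph]
   uniformly_continuous_compact_support[OF S c 0] by blast+
 obtain d1 where d1: "d1 > 0" "!!x y. dist x y < d1 ==> dist (ph x) (ph y) < e"
  using u(1) \<open>e > 0\<close> unfolding uniformly_continuous_on_def by (metis UNIV_I)
 obtain d2 where d2: "d2 > 0" "!!x y. dist x y < d2 ==> dist (grad ph x) (grad ph y) < e"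
  using u(2) \<open>e > 0\<close> unfolding uniformly_continuous_on_def by (metis UNIV_I)
 define d where "d = min r (min d1 d2) / 2"
 have d: "d > 0" "d <= r" "d < d1" "d < d2" using \<open>r > 0\<close> d1 d2 by (auto simp: d_def)
 let ?ph = "conv_along lborel (mollifier d) (%y. y) ph"
 note mi = mollifier_integrable[OF less_imp_le[OF d(1)]]
 have [measurable]: "ph : borel_measurable borel" "mollifier d : borel_measurable (borel :: (real^'n) measure)"
  using borel_measurable_continuous_onI[OF c] borel_measurable_integrable[OF mi] by auto
 \<comment> \<open>The two forms of the convolution serve different ends: in one the derivative
   falls on \<open>ph\<close>, which gives the estimates, in the other on the mollifier, which gives
   smoothness.\<close>
 have eq: "?ph = conv_along lborel ph (%y. y) (mollifier d)"
 proof
  fix x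
  have "?ph x = (LBINT y. mollifier d (x - (x - y)) * ph (x - y))" by (simp add: conv_along_def)
  also have "... = (LBINT y. mollifier d (x - y) * ph y)"
   by (rule lborel_integral_reflect[of "%y. mollifier d (x - y) * ph y"]) measurable
  finally show "?ph x = conv_along lborel ph (%y. y) (mollifier d) x" by (simp add: conv_along_def mult.commute)
 qed
 note G = conv_along_GDERIV[OF mi _ ph, of "%y. y"]
 have z: "?ph x = 0" if "x ~: thicken r S" for x
 proof -
  have "mollifier d y * ph (x - y) = 0" for y
  proof (cases "norm y <= d")
   case True
   then have "x - y ~: S" using that thickenI[of "x - y" S x r] d by auto
   then show ?thesis using 0 by simp
  qed (use mollifier_0[of d y] d in simp)
  then show ?thesis unfolding conv_along_def by (simp only: Bochner_Integration.integral_zero)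
 qed
 show ?thesis
 proof (intro bexI conjI allI impI)
  show "?ph : test_fun U"
  proof (rule test_funI[OF _ _ z])
   show "Ck_on m UNIV ?ph" for m unfolding eq
    by (rule conv_along_smooth[OF integrable_compact_support[OF S c 0] _ mollifier_smooth compact_cball[of 0 d] mollifier_0])
     (use d in auto)
  qed (use S U compact_thicken in auto)
  show "\<bar>?ph x - ph x\<bar> <= e" for x by (rule conv_along_mollifier_uniform[OF S c 0 d(1)])
    (use d1(2) d in \<open>fastforce simp: dist_real_def intro: less_imp_le\<close>)+
  show "\<bar>pderiv_at i ?ph x - pderiv_at i ph x\<bar> <= e" for i x
  proof -
   have "\<bar>pderiv_at i ph x - pderiv_at i ph y\<bar> <= e" if "dist x y <= d" for x y
    using d2(2)[of x y] component_le_norm_cart[of "grad ph x - grad ph y" i] that d by (simp add: dist_norm)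
   then have "\<bar>conv_along lborel (mollifier d) (%y. y) (pderiv_at i ph) x - pderiv_at i ph x\<bar> <= e"
    by (intro conv_along_mollifier_uniform[OF S cp p0 d(1)]) auto
   then show ?thesis using GDERIV_imp_pderiv_at[OF G, of i x] by simp
  qed
 qed (use z in auto)
qed

section \<open>Weak derivatives\<close>

lemma closed_not_in_ball:
 assumes "closed K" "x ~: K"
 obtains r where "r > 0" "!!y. y : K ==> dist y x >= r"
proof -
 have "open (- K)" "x : - K" using assms by auto
 then obtain r where "r > 0" "ball x r <= - K" using open_contains_ball by metis
 then show ?thesis by (intro that[of r]) (auto simp: subset_eq dist_commute not_less[symmetric])
qed

text \<open>Cut-offs equal to 1 on a compact set and supported in shrinking neighbourhoods show, by
  dominated convergence, that \<open>h\<close> has integral zero over every compact subset of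
  \<open>U\<close>. Closed sets form an intersection-stable generator of the Borel sets, so inside a
  compact \<open>L\<close> the integral over every Borel set vanishes, and \<open>h\<close> is zero
  almost everywhere there.\<close>

lemma fundamental_lemma:
 fixes h :: "real^'n => real"
 assumes U: "open U" and h[measurable]: "h : borel_measurable borel"
  and int: "!!K. compact K ==> K <= U ==> set_integrable lborel K h"
  and 0: "!!ph. ph : test_fun U ==> (LBINT x. h x * ph x) = 0"
 shows "AE x in lborel. x : U --> h x = 0"
proof -
 have K0: "(LINT x:K|lborel. h x) = 0" if K: "compact K" "K <= U" for K
 proof -
  obtain e where e: "e > 0" "thicken e K <= U" using thicken_subset_open[OF K(1) U K(2)] .
  define V where "V n = (\<Union>x\<in>K. ball x (e / (real n + 1)))" for n :: nat
  have V: "open (V n)" "K <= V n" for n using e by (auto simp: V_def)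
  have Vt: "V n <= thicken e K" for n
  proof
   fix y assume "y : V n"
   then obtain x where x: "x : K" "dist x y < e / (real n + 1)" by (auto simp: V_def)
   moreover have "e / (real n + 1) <= e" using e by (auto simp: field_simps)
   ultimately have "dist x y <= e" by linarith
   then show "y : thicken e K" using thickenI[OF x(1)] by (simp add: dist_norm norm_minus_commute)
  qed
  have "\<exists>ps. ps : test_fun (V n) & (\<forall>x. 0 <= ps x & ps x <= 1) & (\<forall>x\<in>K. ps x = 1)" for n
   by (rule smooth_cutoff[OF K(1) V]) blast
  then obtain ps where ps: "!!n. ps n : test_fun (V n)" "!!n x. 0 <= ps n x" "!!n x. ps n x <= 1"
   "!!n x. x : K ==> ps n x = 1" by metis
  have ps0: "ps n x = 0" if "x ~: V n" for n x
   using ps(1)[of n] that by (auto elim!: test_funE)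
  have psU: "ps n : test_fun U" for n
   using ps(1)[of n] Vt[of n] e(2) by (auto simp: test_fun_def)
  have [measurable]: "ps n : borel_measurable borel" for n
   using ps(1)[of n] by (auto elim!: test_funE intro!: borel_measurable_continuous_onI intro: C1c_continuous)
  have cK: "closed K" using K compact_imp_closed by blast
  have lim: "(%n. h x * ps n x) ~~> indicator K x *R h x" for x
  proof (cases "x : K")
   case True then show ?thesis using ps(4) by simp
  next
   case False
   then obtain r where r: "r > 0" "!!y. y : K ==> dist y x >= r" using closed_not_in_ball[OF cK] by blast
   have "\<forall>\<^sub>F n in sequentially. e / (real n + 1) < r"
    using order_tendstoD(2)[OF tendsto_mult_right_zero[OF LIMSEQ_inverse_real_of_nat, of e] r(1)] by (simp add: divide_inverse add.commute)
   then have "\<forall>\<^sub>F n in sequentially. h x * ps n x = indicator K x *R h x"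
   proof eventually_elim
    case (elim n)
    then have "x ~: V n" using r by (force simp: V_def)
    then show ?case using ps0 False by simp
   qed
   then show ?thesis by (rule tendsto_eventually)
  qed
  have "(%n. LBINT x. h x * ps n x) ~~> (LBINT x. indicator K x *R h x)"
  proof (rule integral_dominated_convergence[where w = "%x. \<bar>indicator (thicken e K) x *R h x\<bar>"])
   show "integrable lborel (%x. \<bar>indicator (thicken e K) x *R h x\<bar>)"
    using int[OF compact_thicken[OF K(1)] e(2)] by (auto simp: set_integrable_def)
   show "AE x in lborel. norm (h x * ps n x) <= \<bar>indicator (thicken e K) x *R h x\<bar>" for n
    using ps(2,3)[of n] ps0[of _ n] Vt[of n] by (intro AE_I2) (fastforce simp: indicator_def abs_mult mult_left_le)
   show "(%x. indicator K x *R h x) : borel_measurable lborel"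
    using int[OF K] by (auto simp: set_integrable_def dest: borel_measurable_integrable)
  qed (use lim in auto)
  moreover have "(LBINT x. h x * ps n x) = 0" for n by (rule 0[OF psU])
  ultimately show ?thesis by (simp add: set_lebesgue_integral_def LIMSEQ_const_iff)
 qed
 have L0: "AE x in lborel. x : L --> h x = 0" if L: "compact L" "L <= U" for L
 proof -
  let ?f = "%x. indicator L x *R h x"
  have f: "integrable lborel ?f" using int[OF L] by (simp add: set_integrable_def)
  have fs: "set_integrable lborel E ?f" if "E : sets borel" for E
   unfolding set_integrable_def using integrable_mult_indicator[OF _ f, of E] that by simp
  have "(LINT x:E|lborel. ?f x) = 0" if "E : sets lborel" for E
  proof -
   have E: "E : sigma_sets UNIV (Collect closed)"
    using that by (simp add: borel_eq_closed)
   have "Int_stable (Collect closed :: (real^'n) set set)" by (auto simp: Int_stable_def)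
   moreover have "(Collect closed :: (real^'n) set set) <= Pow UNIV" by simp
   moreover note E
   ultimately show ?thesis
   proof (induction E rule: sigma_sets_induct_disjoint[consumes 3])
    case (basic A)
    then have "compact (A \<inter> L)" "A \<inter> L <= U" using L by (auto intro: closed_Int_compact)
    from K0[OF this] show ?case by (simp add: set_lebesgue_integral_def indicator_inter_arith mult.assoc)
   next
    case empty then show ?case by (simp add: set_lebesgue_integral_def)
   next
    case (compl A)
    then have A: "A : sets borel" by (simp add: borel_eq_closed)
    have "(LINT x:UNIV - A|lborel. ?f x) = (LINT x|lborel. ?f x - indicator A x *R ?f x)"
     unfolding set_lebesgue_integral_def by (intro Bochner_Integration.integral_cong) (auto simp: indicator_def)
    also have "... = (LINT x|lborel. ?f x) - (LINT x:A|lborel. ?f x)"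
     unfolding set_lebesgue_integral_def by (rule Bochner_Integration.integral_diff[OF f fs[OF A, unfolded set_integrable_def]])
    also have "(LINT x|lborel. ?f x) = 0" using K0[OF L] by (simp add: set_lebesgue_integral_def)
    finally show ?case using compl by simp
   next
    case (union A)
    then have A: "A i : sets borel" for i by (auto simp: borel_eq_closed)
    have "(LINT x:(\<Union>i. A i)|lborel. ?f x) = (\<Sum>i. (LINT x:(A i)|lborel. ?f x))" by (rule lebesgue_integral_countable_add)
      (use A union(1) fs[of "\<Union>i. A i"] in \<open>auto simp: disjoint_family_on_def\<close>)
    then show ?case using union by simp
   qed
  qed
  then have "AE x in lborel. ?f x = 0" by (rule sigma_finite_measure.density_zero[OF sigma_finite_lborel f])
  then show ?thesis by eventually_elim (auto simp: indicator_def)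
 qed
 obtain C :: "nat => (real^'n) set" where C: "!!n. compact (C n)" "!!n. C n <= U" "\<Union>(range C) = U"
  by (rule open_Union_compact_subsets[OF U]) blast
 have "AE x in lborel. \<forall>n. x : C n --> h x = 0"
  unfolding AE_all_countable using L0 C by blast
 then show ?thesis by eventually_elim (use C(3) in blast)
qed

section \<open>C1 functions of compact support\<close>

lemma C1c_bound_diff_quotient:
 assumes "C1c S ph"
 obtains C where "C > 0" "!!x v. \<bar>ph (x + v) - ph x\<bar> <= C * norm v" "!!x. norm (grad ph x) <= C"
proof -
 have S: "compact S" using assms by (auto simp: C1c_def)
 obtain C where C: "C > 0" "!!x. norm (grad ph x) <= C"
  using bounded_compact_support[OF S C1c_continuous_grad[OF assms] C1c_grad_0[OF assms]] by blast
 have "\<bar>ph (x + v) - ph x\<bar> <= (3 * C) * norm v" for x v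
 proof -
  have "\<bar>ph (x + v) - ph x - inner v (grad ph x)\<bar> <= (2 * C) * norm v"
  proof (rule GDERIV_linearization_bound)
   show "norm (grad ph y - grad ph x) <= 2 * C" for y
    using norm_triangle_ineq4[of "grad ph y" "grad ph x"] C(2)[of x] C(2)[of y] by linarith
  qed (use assms in \<open>auto simp: C1c_def\<close>)
  moreover have "\<bar>inner v (grad ph x)\<bar> <= C * norm v"
   using Cauchy_Schwarz_ineq2[of v "grad ph x"] mult_left_mono[OF C(2)[of x], of "norm v"] by (simp add: mult.commute)
  ultimately show ?thesis by (auto simp: abs_le_iff)
 qed
 then show ?thesis by (intro that[of "3 * C"]) (use C in \<open>auto intro: order_trans[of _ C]\<close>)
qed

lemma C1c_measurable: "C1c S ph ==> ph : borel_measurable borel" by (intro borel_measurable_continuous_onI C1c_continuous)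

lemma C1c_measurable_pderiv: "C1c S ph ==> pderiv_at i ph : borel_measurable borel"
 using C1c_continuous_grad[of S ph UNIV] continuous_on_grad_iff by (blast intro: borel_measurable_continuous_onI)

lemma C1c_pderiv_0: "C1c S ph ==> x ~: S ==> pderiv_at i ph x = 0" by (metis C1c_grad_0 grad_nth zero_index)

text \<open>Translation invariance makes the integral of every difference quotient zero, and the
  quotients are dominated by a Lipschitz constant on a compact set. No iterated integration is
  involved.\<close>

lemma C1c_integral_pderiv:
 fixes ph :: "real^'n => real"
 assumes ph: "C1c S ph"
 shows "(LBINT x. pderiv_at i ph x) = 0"
proof -
 define e where "e = axis i (1::real)"
 have e1: "norm e = 1" by (simp add: e_def)
 have S: "compact S" and 0: "!!x. x ~: S ==> ph x = 0" using ph by (auto simp: C1c_def)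
 note [measurable] = C1c_measurable[OF ph]
 have I: "integrable lborel ph" by (rule integrable_compact_support[OF S C1c_continuous[OF ph] 0])
 obtain C where C: "C > 0" "!!x v. \<bar>ph (x + v) - ph x\<bar> <= C * norm v"
  using C1c_bound_diff_quotient[OF ph] by metis
 define h where "h n = 1 / (real n + 1)" for n :: nat
 have h: "h n > 0" "h n <= 1" for n by (auto simp: h_def)
 have hlim: "h ~~> 0" unfolding h_def using LIMSEQ_inverse_real_of_nat by (simp add: divide_inverse add.commute)
 define D where "D n x = (ph (x + h n *R e) - ph x) / h n" for n x
 have "(%n. LBINT x. D n x) ~~> (LBINT x. pderiv_at i ph x)"
 proof (rule integral_dominated_convergence[where w = "%x. C * indicator (thicken 1 S) x"])
  show "pderiv_at i ph : borel_measurable lborel" using C1c_measurable_pderiv[OF ph] by simp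
  show "D n : borel_measurable lborel" for n unfolding D_def by measurable
  show "integrable lborel (%x. C * indicator (thicken 1 S) x)"
   using compact_thicken[OF S] emeasure_compact_finite[OF compact_thicken[OF S]] by (auto simp: borel_compact intro!: integrable_real_mult_indicator)
  show "AE x in lborel. (%n. D n x) ~~> pderiv_at i ph x"
  proof (rule AE_I2)
   fix x
   have "GDERIV ph (x + 0 *R e) :> grad ph x" using ph by (auto simp: C1c_def intro: GDERIV_grad)
   from GDERIV_line[OF this] have "((%t. ph (x + t *R e)) has_real_derivative pderiv_at i ph x) (at 0)" by (simp add: e_def inner_axis')
   then have "((%t. (ph (x + t *R e) - ph x) / t) \<longlongrightarrow> pderiv_at i ph x) (at 0)" by (simp add: DERIV_def)
   moreover have "filterlim h (at 0) sequentially"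
    using hlim h by (auto simp: filterlim_at intro!: always_eventually less_imp_neq[symmetric])
   ultimately show "(%n. D n x) ~~> pderiv_at i ph x"
    unfolding D_def by (rule filterlim_compose)
  qed
  show "AE x in lborel. norm (D n x) <= C * indicator (thicken 1 S) x" for n
  proof (rule AE_I2)
   fix x
   show "norm (D n x) <= C * indicator (thicken 1 S) x"
   proof (cases "x : thicken 1 S")
    case True
    then show ?thesis using C(2)[of x "h n *R e"] h[of n] e1 by (simp add: D_def divide_le_eq)
   next
    case False
    then have "x ~: S" "x + h n *R e ~: S"
     using thickenI[of x S x 1] thickenI[of "x + h n *R e" S x 1] h[of n] e1 by auto
    then show ?thesis using 0 C(1) by (simp add: D_def)
   qed
  qed
 qed
 moreover have "(LBINT x. D n x) = 0" for n
  unfolding D_def using I lborel_integrable_shift[OF I] lborel_integral_shift[of ph] by (simp add: diff_divide_distrib)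
 ultimately show ?thesis by (simp add: LIMSEQ_const_iff)
qed

text \<open>\<open>U\<close> and the complement of \<open>S\<close> are open and cover the space;
  the gradient is continuous on each, being zero on the second.\<close>

lemma C1cI:
 assumes "compact S" "open U" "S <= U" "!!x. x : U ==> GDERIV k x :> G x" "continuous_on U G"
  "!!x. x ~: S ==> k x = 0"
 shows "C1c S k" "!!x. x : U ==> grad k x = G x"
proof -
 have cl: "closed S" using assms(1) compact_imp_closed by blast
 have out: "GDERIV k x :> 0" if "x ~: S" for x by (rule GDERIV_outside_support[OF cl assms(6) that])
 show g: "grad k x = G x" if "x : U" for x using assms(4)[OF that] by (simp add: GDERIV_iff_grad)
 have "continuous_on (U \<union> (- S)) (grad k)"
 proof (rule continuous_on_open_Un)
  show "continuous_on U (grad k)" using assms(5) g by (auto cong: continuous_on_cong)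
  have "grad k x = 0" if "x : - S" for x using out[of x] that by (simp add: GDERIV_iff_grad)
  then show "continuous_on (- S) (grad k)" by (subst continuous_on_cong[OF refl]) auto
 qed (use assms cl in auto)
 moreover have "U \<union> - S = UNIV" using assms(3) by auto
 moreover have "k differentiable at x" for x
  using out[of x] assms(3) assms(4)[of x] by (cases "x : S") (auto simp: GDERIV_iff_grad)
 ultimately show "C1c S k" using assms by (auto simp: C1c_def)
qed

lemma C1c_mult:
 assumes U: "open U" "S <= U" "!!x. x : U ==> g differentiable (at x)" "continuous_on U (grad g)" and ph: "C1c S ph"
 shows "C1c S (%x. g x * ph x)"
  "x : U ==> grad (%x. g x * ph x) x = g x *R grad ph x + ph x *R grad g x"
  "pderiv_at i (%x. g x * ph x) x = g x * pderiv_at i ph x + ph x * pderiv_at i g x"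
proof -
 let ?G = "%x. g x *R grad ph x + ph x *R grad g x"
 have cg: "continuous_on U g"
  using U by (auto intro!: continuous_at_imp_continuous_on differentiable_imp_continuous_within)
 have S: "compact S" and 0: "!!x. x ~: S ==> g x * ph x = 0" using ph by (auto simp: C1c_def)
 have G: "GDERIV (%x. g x * ph x) x :> ?G x" if "x : U" for x
  using U(3)[OF that] ph by (intro GDERIV_mult GDERIV_grad) (auto simp: C1c_def)
 have c: "continuous_on U ?G" by (intro continuous_intros cg U(4) C1c_continuous[OF ph] C1c_continuous_grad[OF ph])
 note R = C1cI[OF S U(1,2) G c 0]
 show C: "C1c S (%x. g x * ph x)" and X: "x : U ==> grad (%x. g x * ph x) x = ?G x" using R by auto
 show "pderiv_at i (%x. g x * ph x) x = g x * pderiv_at i ph x + ph x * pderiv_at i g x"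
 proof (cases "x : U")
  case True
  then have "grad (%x. g x * ph x) x $ i = ?G x $ i" using X by simp
  then show ?thesis by simp
 next
  case False
  then have "x ~: S" using U(2) by auto
  then show ?thesis using C1c_pderiv_0[OF C] C1c_pderiv_0[OF ph] ph by (simp add: C1c_def)
 qed
qed

text \<open>The notion of weak derivative in terms of Borel functions and the measure \<^term>\<open>lborel\<close>.\<close>
definition wderiv :: "(real^'n) set => 'n => (real^'n => real) => (real^'n => real) => bool" where
 "wderiv U i g h \<longleftrightarrow> g : borel_measurable borel & h : borel_measurable borel \<and>
   (\<forall>K. compact K & K <= U --> set_integrable lborel K g & set_integrable lborel K h) \<and>
   (\<forall>ph\<in>test_fun U. (LBINT x. g x * pderiv_at i ph x) = - (LBINT x. h x * ph x))"

lemma integrable_mult_compact_support: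
 fixes g k :: "real^'n => real"
 assumes "set_integrable lborel S g" "continuous_on UNIV k" "compact S" "!!x. x ~: S ==> k x = 0"
 shows "integrable lborel (%x. g x * k x)"
proof -
 obtain C where C: "!!x. norm (k x) <= C" by (rule bounded_compact_support[OF assms(3,2,4)]) auto
 have [measurable]: "k : borel_measurable borel" by (rule borel_measurable_continuous_onI[OF assms(2)])
 have i: "integrable lborel (%x. indicator S x *R g x)" using assms(1) by (simp add: set_integrable_def)
 have eq: "(%x. g x * k x) = (%x. (indicator S x *R g x) * k x)"
  using assms(4) by (intro ext) (auto simp: indicator_def)
 show ?thesis unfolding eq
 proof (rule Bochner_Integration.integrable_bound[where f = "%x. C * (indicator S x *R g x)"])
  show "AE x in lborel. norm (indicator S x *R g x * k x) <= norm (C * (indicator S x *R g x))"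
  proof (rule AE_I2)
   fix x
   have "\<bar>k x\<bar> <= \<bar>C\<bar>" using C[of x] by simp
   then show "norm (indicator S x *R g x * k x) <= norm (C * (indicator S x *R g x))"
    by (auto simp: abs_mult indicator_def mult.commute[of "\<bar>C\<bar>"] intro: mult_left_mono)
  qed
  show "(%x. (indicator S x *R g x) * k x) : borel_measurable lborel"
   using borel_measurable_integrable[OF i] by measurable
 qed (use i in simp)
qed

text \<open>Membership in \<open>Lp_loc\<close> constrains \<open>g\<close> only on compact subsets
  of \<open>U\<close>. Exhausting \<open>U\<close> by compact sets makes the cut-off function
  Lebesgue measurable, and a measurable function for the completed measure agrees almost everywhere
  with a Borel one.\<close>

lemma Lp_loc_1_borel:
 fixes g :: "real^'n => real"
 assumes U: "open U" and g: "g : Lp_loc 1 U"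
 obtains g' where "g' : borel_measurable borel" "AE x in lborel. x : U --> g x = g' x"
  "!!K. compact K ==> K <= U ==> set_integrable lborel K g'"
  "(%x. indicator U x * g x) : borel_measurable lebesgue"
proof -
 obtain C :: "nat => (real^'n) set" where C: "!!n. compact (C n)" "!!n. C n <= U" "!!n. C n <= interior (C (Suc n))" "\<Union>(range C) = U"
  by (rule open_Union_compact_subsets[OF U]) blast
 have gK: "set_borel_measurable lebesgue K g & (%x. \<bar>g x\<bar> powr 1) absolutely_integrable_on K" if "compact K" "K <= U" for K
  using g that by (auto simp: Lp_loc_def Lp_on_def)
 have inc: "C m <= C n" if "m <= n" for m n
  using that by (induction n rule: dec_induct) (use C(3) interior_subset in blast)+
 have m: "(%x. indicator U x * g x) : borel_measurable lebesgue"
 proof (rule borel_measurable_LIMSEQ_real)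
  show "(%n. indicator (C n) x *R g x) ~~> indicator U x * g x" for x
  proof (cases "x : U")
   case True
   then obtain N where "x : C N" using C(4) by blast
   then have "\<forall>\<^sub>F n in sequentially. indicator (C n) x *R g x = indicator U x * g x"
    using inc True by (intro eventually_sequentiallyI[of N]) (auto simp: indicator_def)
   then show ?thesis by (rule tendsto_eventually)
  next
   case False then have "x ~: C n" for n using C(2) by blast
   then show ?thesis using False by simp
  qed
  show "(%x. indicator (C n) x *R g x) : borel_measurable lebesgue" for n
   using gK[OF C(1,2)] by (simp add: set_borel_measurable_def)
 qed
 then obtain g' where g': "g' : borel_measurable lborel" "AE x in lborel. indicator U x * g x = g' x"
  using completion_ex_borel_measurable_real by blast
 have g'b[measurable]: "g' : borel_measurable borel" using g' by simp
 show ?thesis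
 proof (rule that[OF g'b _ _ m])
  show "AE x in lborel. x : U --> g x = g' x" using g'(2) by eventually_elim (auto simp: indicator_def)
  fix K assume K: "compact K" "K <= U"
  have Kb[measurable]: "K : sets borel" using K by (simp add: borel_compact)
  have "integrable lebesgue (%x. indicator K x *R \<bar>g x\<bar>)"
   using gK[OF K] by (simp add: set_integrable_def)
  then have "integrable lebesgue (%x. indicator K x *R \<bar>g' x\<bar>)"
  proof (rule integrable_cong_AE_imp)
   show "(%x. indicator K x *R \<bar>g' x\<bar>) : borel_measurable lebesgue" by (intro measurable_completion) measurable
   show "AE x in lebesgue. indicator K x *R \<bar>g x\<bar> = indicator K x *R \<bar>g' x\<bar>"
    unfolding AE_completion_iff using g'(2) by eventually_elim (use K in \<open>auto simp: indicator_def\<close>)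
  qed
  then have "integrable lborel (%x. indicator K x *R \<bar>g' x\<bar>)" by (subst (asm) integrable_completion) auto
  then have "integrable lborel (%x. indicator K x *R g' x)" by (rule Bochner_Integration.integrable_bound) (auto simp: abs_mult)
  then show "set_integrable lborel K g'" by (simp add: set_integrable_def)
 qed
qed

lemma LINT_lebesgue_to_lborel:
 fixes g g' k :: "real^'n => real"
 assumes m: "(%x. indicator U x * g x) : borel_measurable lebesgue" and g'[measurable]: "g' : borel_measurable borel"
  and k[measurable]: "k : borel_measurable borel" and ae: "AE x in lborel. x : U --> g x = g' x" and k0: "!!x. x ~: U ==> k x = 0"
 shows "(LINT x:U|lebesgue. g x * k x) = (LBINT x. g' x * k x)"
proof -
 have [measurable]: "k : borel_measurable lebesgue" "g' : borel_measurable lebesgue" by (intro measurable_completion; simp)+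
 have "(LINT x:U|lebesgue. g x * k x) = (\<integral>x. (indicator U x * g x) * k x \<partial>lebesgue)"
  unfolding set_lebesgue_integral_def by (simp add: mult.assoc)
 also have "... = (\<integral>x. g' x * k x \<partial>lebesgue)"
 proof (rule integral_cong_AE)
  show "AE x in lebesgue. indicator U x * g x * k x = g' x * k x"
   unfolding AE_completion_iff using ae by eventually_elim (use k0 in \<open>auto simp: indicator_def\<close>)
 qed (use m in measurable)
 also have "... = (LBINT x. g' x * k x)" by (rule integral_completion) measurable
 finally show ?thesis .
qed

lemma weak_pderiv_imp_wderiv:
 fixes g h :: "real^'n => real"
 assumes U: "open U" and w: "weak_pderiv U i g h"
 obtains g' h' where "wderiv U i g' h'" "AE x in lborel. x : U --> g x = g' x & h x = h' x"
proof -
 obtain g' where g': "g' : borel_measurable borel" "AE x in lborel. x : U --> g x = g' x"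
  "!!K. compact K ==> K <= U ==> set_integrable lborel K g'"
  "(%x. indicator U x * g x) : borel_measurable lebesgue"
  using Lp_loc_1_borel[OF U, of g] w by (auto simp: weak_pderiv_def)
 obtain h' where h': "h' : borel_measurable borel" "AE x in lborel. x : U --> h x = h' x"
  "!!K. compact K ==> K <= U ==> set_integrable lborel K h'"
  "(%x. indicator U x * h x) : borel_measurable lebesgue"
  using Lp_loc_1_borel[OF U, of h] w by (auto simp: weak_pderiv_def)
 have "wderiv U i g' h'"
  unfolding wderiv_def
 proof (intro conjI ballI)
  fix ph assume ph: "ph : test_fun U"
  obtain S where S: "C1c S ph" "S <= U" using ph by (rule test_funE)
  have "(LINT x:U|lebesgue. g x * pderiv_at i ph x) = (LBINT x. g' x * pderiv_at i ph x)"
   by (rule LINT_lebesgue_to_lborel[OF g'(4,1) C1c_measurable_pderiv[OF S(1)] g'(2)])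
    (use S C1c_pderiv_0[OF S(1)] in auto)
  moreover have "(LINT x:U|lebesgue. h x * ph x) = (LBINT x. h' x * ph x)"
   by (rule LINT_lebesgue_to_lborel[OF h'(4,1) C1c_measurable[OF S(1)] h'(2)])
    (use S in \<open>auto simp: C1c_def\<close>)
  ultimately show "(LBINT x. g' x * pderiv_at i ph x) = - (LBINT x. h' x * ph x)"
   using w ph by (simp add: weak_pderiv_def)
 qed (use g' h' in auto)
 moreover have "AE x in lborel. x : U --> g x = g' x & h x = h' x"
  using g'(2) h'(2) by eventually_elim auto
 ultimately show ?thesis by (rule that)
qed

lemma Lp_on_borelI:
 fixes g g' :: "real^'n => real"
 assumes K[measurable]: "K : sets borel" and g'[measurable]: "g' : borel_measurable borel"
  and eq: "!!x. x : K ==> g x = g' x" and int: "integrable lborel (%x. indicator K x * \<bar>g' x\<bar> powr s)"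
 shows "g : Lp_on s K"
proof -
 have 1: "(%x. indicator K x *R g x) = (%x. indicator K x * g' x)"
  using eq by (intro ext) (auto simp: indicator_def)
 have 2: "(%x. indicator K x *R \<bar>g x\<bar> powr s) = (%x. indicator K x * \<bar>g' x\<bar> powr s)"
  using eq by (intro ext) (auto simp: indicator_def)
 show ?thesis
  unfolding Lp_on_def set_borel_measurable_def set_integrable_def mem_Collect_eq 1 2
  using int by (auto intro!: measurable_completion simp: integrable_completion)
qed

text \<open>For a test function supported in \<open>V\<close> the product with \<open>g\<close> is
  C1 with compact support, so its derivative integrates to zero. Comparison with the weak identity
  and the fundamental lemma give equality almost everywhere on \<open>V\<close>.\<close>

lemma wderiv_C1_unique:
 assumes U: "open U" and V: "open V" "V <= U" and w: "wderiv U i g' h'"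
  and ae: "AE x in lborel. x : V --> g x = g' x"
  and g: "!!x. x : V ==> g differentiable (at x)" "continuous_on V (grad g)"
 shows "AE x in lborel. x : V --> h' x = pderiv_at i g x"
proof -
 let ?d = "%x. indicator V x * pderiv_at i g x"
 have cd: "continuous_on V (pderiv_at i g)" using g(2) continuous_on_grad_iff by blast
 have dm[measurable]: "?d : borel_measurable borel"
  using borel_measurable_continuous_on_indicator[OF _ cd] V(1) by simp
 have h'm[measurable]: "h' : borel_measurable borel" and g'm[measurable]: "g' : borel_measurable borel" using w by (auto simp: wderiv_def)
 have dK: "set_integrable lborel K ?d" if "compact K" "K <= V" for K
 proof -
  have "integrable lborel (%x. indicator K x *R pderiv_at i g x)"
   by (rule borel_integrable_compact[OF that(1)]) (use cd that continuous_on_subset in blast)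
  moreover have "(%x. indicator K x *R pderiv_at i g x) = (%x. indicator K x *R ?d x)"
   using that by (intro ext) (auto simp: indicator_def)
  ultimately show ?thesis by (simp add: set_integrable_def)
 qed
 have "AE x in lborel. x : V --> h' x - ?d x = 0"
 proof (rule fundamental_lemma[OF V(1)])
  show K: "set_integrable lborel K (%x. h' x - ?d x)" if "compact K" "K <= V" for K
   using dK[OF that] w that V(2) by (intro set_integral_diff(1)) (auto simp: wderiv_def)
  fix ph assume ph: "ph : test_fun V"
  then have phU: "ph : test_fun U" using V by (auto simp: test_fun_def)
  obtain S where S: "C1c S ph" "S <= V" "compact S" using ph by (rule test_funE)
  note [measurable] = C1c_measurable[OF S(1)] C1c_measurable_pderiv[OF S(1)]
  have S0: "ph x = 0" "pderiv_at i ph x = 0" if "x ~: S" for x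
   using S(1) that C1c_pderiv_0[OF S(1) that] by (auto simp: C1c_def)
  have i1: "integrable lborel (%x. h' x * ph x)" "integrable lborel (%x. ?d x * ph x)"
   using w S V(2) by (auto intro!: integrable_mult_compact_support[OF _ C1c_continuous[OF S(1)] S(3) S0(1)] dK simp: wderiv_def)
  have "continuous_on UNIV (pderiv_at i ph)" using C1c_continuous_grad[OF S(1)] continuous_on_grad_iff by blast
  then have i2: "integrable lborel (%x. g' x * pderiv_at i ph x)"
   using w S V(2) by (auto intro!: integrable_mult_compact_support[OF _ _ S(3) S0(2)] simp: wderiv_def)
  have "(LBINT x. ?d x * ph x) + (LBINT x. g' x * pderiv_at i ph x) = (LBINT x. ?d x * ph x + g' x * pderiv_at i ph x)"
   using i1 i2 by simp
  also have "... = (LBINT x. pderiv_at i (%x. g x * ph x) x)"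
  proof (rule integral_cong_AE)
   show "pderiv_at i (%x. g x * ph x) : borel_measurable lborel"
    using C1c_measurable_pderiv[OF C1c_mult(1)[OF V(1) S(2) g S(1)]] by simp
   show "AE x in lborel. ?d x * ph x + g' x * pderiv_at i ph x = pderiv_at i (%x. g x * ph x) x"
    using ae
   proof eventually_elim
    case (elim x)
    then show ?case using S0[of x] S(2) C1c_mult(3)[OF V(1) S(2) g S(1), of i x] by (cases "x : V"; cases "x : S") (auto simp: indicator_def)
   qed
  qed measurable
  also have "... = 0" by (rule C1c_integral_pderiv[OF C1c_mult(1)[OF V(1) S(2) g S(1)]])
  finally have "(LBINT x. ?d x * ph x) = (LBINT x. h' x * ph x)"
   using w phU by (simp add: wderiv_def)
  then show "(LBINT x. (h' x - ?d x) * ph x) = 0"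
   using i1 by (simp add: left_diff_distrib)
 qed measurable
 then show ?thesis by eventually_elim simp
qed

section \<open>Weak derivatives along lines\<close>

text \<open>A Vitali argument. A disjoint subfamily of the bad intervals, tagged at their endpoints
  in \<open>E\<close>, is a fine partial division, so Henstock's lemma bounds the sum of their
  errors. Each error exceeds \<open>\<mu>\<close> times the length, so the total length is small,
  and the fivefold enlargements still cover \<open>E\<close>.\<close>

lemma Henstock_endpoint_cover_null:
 fixes k :: "real => real" and E :: "real set"
 assumes k: "k integrable_on {a..b}" and "\<mu> > 0"
  and E: "!!t d. t : E ==> d > 0 ==> \<exists>l r. l < r & (t = l \<or> t = r) & r - l < d & {l..r} <= {a..b} \<and>
    \<bar>integral {l..r} k - k t * (r - l)\<bar> > \<mu> * (r - l)"
 shows "negligible E"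
proof (subst negligible_outer, intro allI impI)
 fix e :: real assume "e > 0"
 \<comment> \<open>The 10 is the Vitali factor 5 times a factor 2, which makes the final measure at
   most \<open>e / 2\<close> and hence strictly below \<open>e\<close>.\<close>
 define e' where "e' = e * \<mu> / 10"
 have "e' > 0" using \<open>e > 0\<close> \<open>\<mu> > 0\<close> by (simp add: e'_def)
 obtain \<gamma> where \<gamma>: "gauge \<gamma>" "!!p. [|p tagged_partial_division_of (cbox a b); \<gamma> fine p|] ==>
       sum (%(x,j). norm(Henstock_Kurzweil_Integration.content j *R k x - integral j k)) p < e'"
  using Henstock_lemma[of k a b e'] k \<open>e' > 0\<close> by (auto simp: cbox_interval)
 have "\<forall>t. \<exists>q. t : E --> fst q < snd q & (t = fst q \<or> t = snd q) & snd q - fst q < 1 & {fst q..snd q} <= {a..b} & {fst q..snd q} <= \<gamma> t \<and>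
    \<bar>integral {fst q..snd q} k - k t * (snd q - fst q)\<bar> > \<mu> * (snd q - fst q)"
 proof
  fix t
  have "\<exists>q. fst q < snd q & (t = fst q \<or> t = snd q) & snd q - fst q < 1 & {fst q..snd q} <= {a..b} & {fst q..snd q} <= \<gamma> t \<and>
    \<bar>integral {fst q..snd q} k - k t * (snd q - fst q)\<bar> > \<mu> * (snd q - fst q)" if "t : E"
  proof -
  have "t : \<gamma> t" "open (\<gamma> t)" using \<gamma>(1) by (auto simp: gauge_def)
  then obtain d where d: "d > 0" "ball t d <= \<gamma> t" using open_contains_ball by blast
  from E[OF that, of "min d 1"] d obtain l r where lr: "l < r" "t = l \<or> t = r" "r - l < min d 1" "{l..r} <= {a..b}"
   "\<bar>integral {l..r} k - k t * (r - l)\<bar> > \<mu> * (r - l)" by auto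
  have "{l..r} <= ball t d" using lr by (auto simp: dist_real_def)
  then show ?thesis using lr d by (intro exI[of _ "(l, r)"]) auto
  qed
  then show "\<exists>q. t : E --> fst q < snd q & (t = fst q \<or> t = snd q) & snd q - fst q < 1 & {fst q..snd q} <= {a..b} & {fst q..snd q} <= \<gamma> t \<and>
    \<bar>integral {fst q..snd q} k - k t * (snd q - fst q)\<bar> > \<mu> * (snd q - fst q)" by blast
 qed
 from choice[OF this] obtain q where q: "\<forall>t. t : E --> fst (q t) < snd (q t) & (t = fst (q t) \<or> t = snd (q t)) & snd (q t) - fst (q t) < 1
   & {fst (q t)..snd (q t)} <= {a..b} & {fst (q t)..snd (q t)} <= \<gamma> t \<and>
    \<bar>integral {fst (q t)..snd (q t)} k - k t * (snd (q t) - fst (q t))\<bar> > \<mu> * (snd (q t) - fst (q t))" ..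
 define l where "l t = fst (q t)" for t
 define r where "r t = snd (q t)" for t
 have lr: "!!t. t : E ==> l t < r t" "!!t. t : E ==> t = l t \<or> t = r t"
  "!!t. t : E ==> r t - l t < 1" "!!t. t : E ==> {l t..r t} <= {a..b}" "!!t. t : E ==> {l t..r t} <= \<gamma> t"
  "!!t. t : E ==> \<bar>integral {l t..r t} k - k t * (r t - l t)\<bar> > \<mu> * (r t - l t)"
  using q unfolding l_def r_def by blast+
 define c where "c t = (l t + r t) / 2" for t
 define \<rho> where "\<rho> t = (r t - l t) / 2" for t
 have cb: "cball (c t) (\<rho> t) = {l t..r t}" for t by (simp add: cball_eq_atLeastAtMost c_def \<rho>_def field_simps)
 have "E <= (\<Union>t\<in>E. cball (c t) (\<rho> t))"
 proof
  fix t assume "t : E" then show "t : (\<Union>t\<in>E. cball (c t) (\<rho> t))"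
   unfolding cb using lr(1,2)[of t] by (intro UN_I[of t]) auto
 qed
 then obtain C where C: "countable C" "C <= E"
   "pairwise (%i j. disjnt (cball (c i) (\<rho> i)) (cball (c j) (\<rho> j))) C"
   "E <= (\<Union>i\<in>C. cball (c i) (5 * \<rho> i))"
  by (rule Vitali_covering_lemma_cballs[where B = 1]) (use lr(1,3) in \<open>force simp: \<rho>_def\<close>)+
 have fin: "(\<Sum>t\<in>D. measure lebesgue (cball (c t) (5 * \<rho> t))) <= e / 2" if D: "D <= C" "finite D" for D
 proof -
  let ?p = "(%t. (t, {l t..r t})) ` D"
  have inj: "inj_on (%t. (t, {l t..r t})) D" by (auto simp: inj_on_def)
  have DE: "t : E" if "t : D" for t using that D C by auto
  have "?p tagged_partial_division_of (cbox a b)"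
   unfolding tagged_partial_division_of_def
  proof (intro conjI allI impI; (elim conjE)?)
   show "finite ?p" using D by simp
   fix x j assume "(x, j) : ?p"
   then have x: "x : D" "j = {l x..r x}" by auto
   show "x : j" using lr(1,2)[OF DE[OF x(1)]] x by auto
   show "j <= cbox a b" using lr(4)[OF DE[OF x(1)]] x by (simp add: cbox_interval)
   show "\<exists>a b. j = cbox a b" using x by (auto simp: cbox_interval)
   fix x' j' assume "(x', j') : ?p" "(x, j) ~= (x', j')"
   then have x': "x' : D" "j' = {l x'..r x'}" "x ~= x'" using x by auto
   then have "disjnt {l x..r x} {l x'..r x'}"
    using C(3) D x unfolding pairwise_def cb by (meson subsetD)
   then show "interior j \<inter> interior j' = {}"
    using x x' interior_subset unfolding disjnt_def by blast
  qed
  moreover have "\<gamma> fine ?p" using lr(5)[OF DE] by (auto simp: fine_def)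
  ultimately have "sum (%(x,j). norm(Henstock_Kurzweil_Integration.content j *R k x - integral j k)) ?p < e'" by (rule \<gamma>(2))
  then have "(\<Sum>t\<in>D. \<bar>(r t - l t) * k t - integral {l t..r t} k\<bar>) < e'"
   using lr(1)[OF DE] by (subst (asm) sum.reindex[OF inj]) (auto simp: o_def less_imp_le cong: sum.cong)
  moreover have "(\<Sum>t\<in>D. \<mu> * (r t - l t)) <= (\<Sum>t\<in>D. \<bar>(r t - l t) * k t - integral {l t..r t} k\<bar>)"
   by (intro sum_mono) (use lr(6)[OF DE] in \<open>auto simp: abs_minus_commute mult.commute intro: less_imp_le\<close>)
  ultimately have "\<mu> * (\<Sum>t\<in>D. r t - l t) < e * \<mu> / 10" by (simp add: sum_distrib_left e'_def)
  then have s: "(\<Sum>t\<in>D. r t - l t) < e / 10" using \<open>\<mu> > 0\<close> by (simp add: field_simps)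
  have "(\<Sum>t\<in>D. measure lebesgue (cball (c t) (5 * \<rho> t))) = (\<Sum>t\<in>D. 5 * (r t - l t))"
  proof (rule sum.cong[OF refl])
   fix t assume "t : D"
   then have "l t < r t" using lr(1) DE by blast
   then show "measure lebesgue (cball (c t) (5 * \<rho> t)) = 5 * (r t - l t)" by (subst cball_eq_atLeastAtMost) (simp add: \<rho>_def field_simps)
  qed
  also have "... = 5 * (\<Sum>t\<in>D. r t - l t)" by (simp add: sum_distrib_left)
  finally show ?thesis using s by simp
 qed
 let ?T = "\<Union>i\<in>C. cball (c i) (5 * \<rho> i)"
 have "?T : lmeasurable & measure lebesgue ?T <= e / 2"
 proof -
  have "measure lebesgue (\<Union>i\<in>D. cball (c i) (5 * \<rho> i)) <= e / 2" if "D <= C" "finite D" for D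
   using measure_UNION_le[OF that(2), of "%i. cball (c i) (5 * \<rho> i)" lebesgue] fin[OF that] by simp
  then show ?thesis by (intro conjI fmeasurable_UN_bound[OF C(1), where B = "e / 2"] measure_UN_bound[OF C(1)]) auto
 qed
 then show "\<exists>T. E <= T & T : lmeasurable & measure lebesgue T < e"
  using C(4) \<open>e > 0\<close> by (intro exI[of _ ?T]) auto
qed

text \<open>If the derivative at t is not \<open>k t\<close>, then for some tolerance 1/(m + 1)
  there are arbitrarily short intervals with endpoint t on which the mean of \<open>k\<close> misses
  \<open>k t\<close> by more. The exceptional set is thus covered by countably many null
  sets.\<close>

lemma lebesgue_differentiation_real:
 fixes k :: "real => real"
 assumes k: "k integrable_on {a..b}"
 shows "negligible {t : {a<..<b}. \<not> ((%s. integral {a..s} k) has_real_derivative k t) (at t)}"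
proof -
 define E where "E m = {t : {a<..<b}. \<forall>d>0. \<exists>l r. l < r & (t = l \<or> t = r) & r - l < d & {l..r} <= {a..b} \<and>
    \<bar>integral {l..r} k - k t * (r - l)\<bar> > inverse (real (Suc m)) * (r - l)}" for m
 have "negligible (E m)" for m by (rule Henstock_endpoint_cover_null[OF k, of "inverse (real (Suc m))"]) (auto simp: E_def)
 then have "negligible (\<Union>m. E m)" by (rule negligible_Union_nat)
 then have neg: "negligible (\<Union> (range E))" by simp
 have der: "((%s. integral {a..s} k) has_real_derivative k t) (at t)" if t: "a < t" "t < b" "!!m. t ~: E m" for t
 proof -
  have "\<exists>d>0. \<forall>s. \<bar>s - t\<bar> < d --> \<bar>integral {a..s} k - integral {a..t} k - (s - t) * k t\<bar> <= e * \<bar>s - t\<bar>" if "e > 0" for e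
  proof -
   obtain m where m: "inverse (real (Suc m)) < e" using reals_Archimedean[OF \<open>e > 0\<close>] by blast
   from t(3)[of m] t(1,2) obtain d where d0: "d > 0" "\<not> (\<exists>l r. l < r & (t = l \<or> t = r) & r - l < d & {l..r} <= {a..b} \<and>
     \<bar>integral {l..r} k - k t * (r - l)\<bar> > inverse (real (Suc m)) * (r - l))"
    unfolding E_def mem_Collect_eq greaterThanLessThan_iff by blast
   have d: "d > 0" "!!l r. l < r ==> t = l \<or> t = r ==> r - l < d ==> {l..r} <= {a..b} ==>
     \<bar>integral {l..r} k - k t * (r - l)\<bar> <= inverse (real (Suc m)) * (r - l)"
    using d0 by (blast intro: leI)+
   define d' where "d' = min d (min (t - a) (b - t))"
   have d': "d' > 0" "d' <= d" "d' <= t - a" "d' <= b - t" using d t by (auto simp: d'_def)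
   have "\<bar>integral {a..s} k - integral {a..t} k - (s - t) * k t\<bar> <= e * \<bar>s - t\<bar>" if s: "\<bar>s - t\<bar> < d'" for s
   proof -
    have comb: "integral {a..x} k + integral {x..y} k = integral {a..y} k" if "a <= x" "x <= y" "y <= b" for x y
     by (rule Henstock_Kurzweil_Integration.integral_combine) (use that k in \<open>auto intro: integrable_on_subinterval\<close>)
    consider "s = t" | "s > t" | "s < t" by linarith
    then show ?thesis
    proof cases
     case 2
     have "\<bar>integral {t..s} k - k t * (s - t)\<bar> <= inverse (real (Suc m)) * (s - t)"
      using 2 s d' t by (intro d(2)) auto
     also have "inverse (real (Suc m)) * (s - t) <= e * (s - t)" using 2 m by (intro mult_right_mono) auto
     finally have "\<bar>integral {t..s} k - k t * (s - t)\<bar> <= e * (s - t)" .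
     moreover have "integral {a..s} k - integral {a..t} k = integral {t..s} k" using comb[of t s] 2 s d' t by auto
     ultimately show ?thesis using 2 by (simp add: mult.commute[of "s - t" "k t"])
    next
     case 3
     have "\<bar>integral {s..t} k - k t * (t - s)\<bar> <= inverse (real (Suc m)) * (t - s)"
      using 3 s d' t by (intro d(2)) auto
     also have "inverse (real (Suc m)) * (t - s) <= e * (t - s)" using 3 m by (intro mult_right_mono) auto
     finally have "\<bar>integral {s..t} k - k t * (t - s)\<bar> <= e * (t - s)" .
     moreover have "integral {a..s} k - integral {a..t} k - (s - t) * k t = - (integral {s..t} k - k t * (t - s))"
      using comb[of s t] 3 s d' t by (auto simp: algebra_simps)
     ultimately show ?thesis using 3 by simp
    qed simp
   qed
   then show ?thesis using d'(1) by blast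
  qed
  then show ?thesis
   unfolding has_field_derivative_def has_derivative_at_alt by (auto simp: mult.commute bounded_linear_mult_right)
 qed
 show ?thesis by (rule negligible_subset[OF neg]) (use der in auto)
qed

section \<open>Fubini's theorem along lines\<close>

lemma AE_lborel_shift:
 fixes P :: "'a::euclidean_space => bool"
 assumes "AE x in lborel. P x"
 shows "AE x in lborel. P (x + c)"
proof -
 have "AE x in distr lborel borel ((+) c). P x" using assms unfolding lborel_distr_plus .
 then have "AE x in lborel. P (c + x)" by (rule AE_distrD[rotated]) simp
 then show ?thesis by (simp add: add.commute)
qed

lemma AE_lborel_Ex:
 assumes "AE x in (lborel :: 'a::euclidean_space measure). P x"
 shows "\<exists>x. P x"
proof (rule ccontr)
 assume a: "\<nexists>x. P x"
 obtain N :: "'a set" where N: "N : null_sets lborel" "{x. \<not> P x} <= N"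
  using assms unfolding eventually_ae_filter by auto
 then have "N = UNIV" using a by auto
 then show False using N(1) by (auto simp: null_sets_def)
qed

text \<open>Fubini along lines, without splitting off a coordinate: translate by \<open>t e\<close> on the product of the
  space with the real line.\<close>
lemma null_via_lines:
 fixes N :: "'a::euclidean_space set"
 assumes N[measurable]: "N : sets borel" and ae: "AE x in lborel. AE t::real in lborel. x + t *R e ~: N"
 shows "AE x in lborel. x ~: N"
proof -
 have m: "{p : space (lborel \<Otimes>\<^sub>M lborel). fst p + (snd p :: real) *R e ~: N} : sets (lborel \<Otimes>\<^sub>M lborel)" by measurable
 have "AE t::real in lborel. AE x in lborel. x + t *R e ~: N"
  using ae lborel_pair.AE_commute[OF m] by simp
 then obtain t :: real where "AE x in lborel. x + t *R e ~: N" using AE_lborel_Ex by blast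
 from AE_lborel_shift[OF this, of "- (t *R e)"] show ?thesis by simp
qed

lemma AE_lines:
 fixes P :: "'a::euclidean_space => bool"
 assumes ae: "AE x in lborel. P x"
 shows "AE x in lborel. AE t::real in lborel. P (x + t *R e)"
proof -
 obtain N where N: "N : null_sets lborel" "{x. \<not> P x} <= N"
  using ae unfolding eventually_ae_filter by auto
 then have Nb[measurable]: "N : sets borel" by auto
 have m: "{p : space (lborel \<Otimes>\<^sub>M lborel). fst p + (snd p :: real) *R e ~: N} : sets (lborel \<Otimes>\<^sub>M lborel)" by measurable
 have "AE x in lborel. x ~: N" using N(1) by (rule AE_not_in)
 from AE_lborel_shift[OF this] have "AE t::real in lborel. AE x in lborel. x + t *R e ~: N" by simp
 then have "AE x in lborel. AE t::real in lborel. x + t *R e ~: N"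
  using lborel_pair.AE_commute[OF m] by simp
 then show ?thesis
 proof eventually_elim
  case (elim x)
  then show ?case by eventually_elim (use N(2) in blast)
 qed
qed

lemma segment_image_compact:
 fixes e :: "real^'n"
 assumes "compact K"
 shows "compact ((%p. fst p + snd p *R e) ` (K \<times> {0..b}))"
 by (intro compact_continuous_image compact_Times assms compact_Icc) (auto intro!: continuous_intros)

lemma open_segment_in:
 fixes e :: "real^'n"
 assumes "open U"
 shows "open {x. \<forall>t\<in>{0..b}. x + t *R e : U}"
proof (cases "b < 0")
 case False
 show ?thesis
  unfolding open_contains_ball
 proof
  fix x assume x: "x : {x. \<forall>t\<in>{0..b}. x + t *R e : U}"
  let ?K = "(%p. fst p + snd p *R e) ` ({x} \<times> {0..b})"
  have "compact ?K" "?K <= U" using x segment_image_compact[of "{x}" e b] by auto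
  then obtain d where d: "d > 0" "thicken d ?K <= U" using thicken_subset_open[OF _ assms] by blast
  have "y + t *R e : U" if "y : ball x d" "t : {0..b}" for y t
  proof -
   have "x + t *R e : ?K" using that by force
   moreover have "norm ((y + t *R e) - (x + t *R e)) <= d" using that by (simp add: dist_norm norm_minus_commute)
   ultimately show ?thesis by (intro subsetD[OF d(2)] thickenI)
  qed
  then show "\<exists>d>0. ball x d <= {x. \<forall>t\<in>{0..b}. x + t *R e : U}"
   using d(1) by (intro exI[of _ d]) auto
 qed
qed simp

text \<open>For fixed t the slice is dominated by a translate of \<open>h\<close> cut off to
  \<open>K'\<close>, whose integral does not depend on t; Fubini then needs integrability only of a
  bounded function on \<open>{0..b}\<close>.\<close>

lemma segment_integrable:
 fixes h :: "real^'n => real" and e :: "real^'n"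
 assumes h[measurable]: "h : borel_measurable borel" and K: "compact K"
  and K': "compact K'" "set_integrable lborel K' h" "!!x t. x : K ==> t : {0..b} ==> x + t *R e : K'"
 shows "integrable (lborel \<Otimes>\<^sub>M lborel) (%(t, x). indicator K x * (indicator {0..b} t * h (x + t *R e)))"
proof -
 have [measurable]: "K : sets borel" "K' : sets borel" using K K' by (auto simp: borel_compact)
 let ?k = "%x t. indicator K x * (indicator {0..b} t * h (x + t *R e))"
 let ?I = "%t. LBINT x. norm (?k x t)"
 define g where "g x = indicator K' x * \<bar>h x\<bar>" for x
 have [measurable]: "g : borel_measurable borel" unfolding g_def by measurable
 have g: "integrable lborel g"
  using integrable_abs[OF K'(2)[unfolded set_integrable_def]] by (simp add: g_def[abs_def] abs_mult)
 have bd: "\<bar>?k x t\<bar> <= indicator {0..b} t * g (x + t *R e)" for x t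
  using K'(3)[of x t] by (auto simp: g_def indicator_def)
 have gi: "integrable lborel (%x. indicator {0..b} t * g (x + t *R e))" for t
  using lborel_integrable_shift[OF g] by simp
 have i2: "integrable lborel (%x. ?k x t)" for t by (rule Bochner_Integration.integrable_bound[OF gi[of t]])
   (auto intro!: AE_I2 order_trans[OF bd])
 have "?I : borel_measurable lborel" by measurable
 moreover have "\<bar>?I t\<bar> <= (LBINT x. g x) * indicator {0..b} t" for t
 proof -
  have "\<bar>?I t\<bar> =
   (?I t)" by (intro abs_of_nonneg Bochner_Integration.integral_nonneg) auto
  also have "... <= (LBINT x. indicator {0..b} t * g (x + t *R e))"
   using bd by (intro integral_mono integrable_norm i2 gi) auto
  also have "... = (LBINT x. g x) * indicator {0..b} t"
   using lborel_integral_shift[of g "t *R e"] by simp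
  finally show ?thesis .
 qed
 ultimately have i1: "integrable lborel ?I"
 proof -
  assume m: "?I : borel_measurable lborel"
   and bd: "!!t. \<bar>?I t\<bar> <= (LBINT x. g x) * indicator {0..b} t"
  have "integrable lborel (%t::real. (LBINT x. g x) * indicator {0..b} t)"
   by (intro integrable_mult_right) (simp add: integrable_indicator_iff emeasure_lborel_Icc_eq)
  then show ?thesis by (rule Bochner_Integration.integrable_bound[OF _ m]) (intro AE_I2, use bd in \<open>simp add: order_trans[OF _ abs_ge_self]\<close>)
 qed
 show ?thesis by (rule lborel_pair.Fubini_integrable) (use i1 i2 in auto)
qed

text \<open>The fundamental theorem of calculus along segments of one fixed length, for almost every
  starting point. In weak form it is the definition of the weak derivative tested with the average
  of a test function along the reversed segment; the fundamental lemma makes it pointwise. The null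
  set depends on \<open>b\<close>.\<close>

lemma wderiv_shift:
 fixes v h :: "real^'n => real"
 assumes U: "open U" and w: "wderiv U j v h" and b: "b > 0" and e: "e = axis j 1"
 shows "AE x in lborel. (\<forall>t\<in>{0..b}. x + t *R e : U) -->
  set_integrable lborel {0..b} (%t. h (x + t *R e)) \<and>
  v (x + b *R e) - v x = (LINT t:{0..b}|lborel. h (x + t *R e))"
proof -
 define Ub where "Ub = {x. \<forall>t\<in>{0..b}. x + t *R e : U}"
 have Ub: "open Ub" unfolding Ub_def by (rule open_segment_in[OF U])
 have vm[measurable]: "v : borel_measurable borel" and hm[measurable]: "h : borel_measurable borel"
  and loc: "!!K. compact K ==> K <= U ==> set_integrable lborel K v & set_integrable lborel K h"
  using w by (auto simp: wderiv_def)
 let ?seg = "%K. (%p. fst p + snd p *R e) ` (K \<times> {0..b})"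
 have seg: "compact (?seg K)" "?seg K <= U" "!!x t. x : K ==> t : {0..b} ==> x + t *R e : ?seg K"
  if "compact K" "K <= Ub" for K
  using segment_image_compact[OF that(1)] that(2) by (auto simp: Ub_def image_def) (force+)?
 define F where "F K = (%(t::real, x). indicator K x * (indicator {0..b} t * h (x + t *R e)))" for K :: "(real^'n) set"
 have F: "integrable (lborel \<Otimes>\<^sub>M lborel) (F K)" if "compact K" "K <= Ub" for K
  unfolding F_def by (rule segment_integrable[OF hm that(1) seg(1)[OF that] _ seg(3)[OF that]]) (use loc seg(1,2)[OF that] in auto)
 define H where "H x = (LBINT t. indicator {0..b} t * h (x + t *R e))" for x
 have Hm[measurable]: "H : borel_measurable borel" unfolding H_def by measurable
 have aeK: "AE x in lborel. x : K --> set_integrable lborel {0..b} (%t. h (x + t *R e))" if "compact K" "K <= Ub" for K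
  using lborel_pair.AE_integrable_snd[of "%t x. F K (t, x)"] F[OF that] by (auto simp: F_def set_integrable_def elim!: eventually_mono)
 have HK: "set_integrable lborel K H" if "compact K" "K <= Ub" for K
 proof -
  have "integrable lborel (%x. LBINT t. F K (t, x))"
   using lborel_pair.integrable_snd[of "%t x. F K (t, x)"] F[OF that] by simp
  then show ?thesis by (simp add: F_def H_def[abs_def] set_integrable_def)
 qed
 have vK: "set_integrable lborel K v" "set_integrable lborel K (%x. v (x + b *R e))" if "compact K" "K <= Ub" for K
 proof -
  have [measurable]: "K : sets borel" using that by (simp add: borel_compact)
  have "x + 0 *R e : U" if "x : K" for x using that \<open>K <= Ub\<close> b unfolding Ub_def by fastforce
  then have "K <= U" by auto
  then show "set_integrable lborel K v" using loc that by blast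
  let ?K' = "(%x. b *R e + x) ` K"
  have "compact ?K'" by (rule compact_translation[OF that(1)])
  moreover have "?K' <= U" using that(2) b by (auto simp: Ub_def add.commute)
  ultimately have "integrable lborel (%x. indicator ?K' x *R v x)" using loc by (auto simp: set_integrable_def)
  from lborel_integrable_shift[OF this, of "b *R e"]
  have "integrable lborel (%x. indicator ?K' (x + b *R e) *R v (x + b *R e))" .
  moreover have "indicator ?K' (x + b *R e) = (indicator K x :: real)" for x by (auto simp: indicator_def image_def add.commute)
  ultimately show "set_integrable lborel K (%x. v (x + b *R e))" by (simp add: set_integrable_def)
 qed
 have "AE x in lborel. x : Ub --> v (x + b *R e) - v x - H x = 0"
 proof (rule fundamental_lemma[OF Ub])
  show "set_integrable lborel K (%x. v (x + b *R e) - v x - H x)" if "compact K" "K <= Ub" for K by (intro set_integral_diff(1) vK HK that)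
  fix ph assume ph: "ph : test_fun Ub"
  obtain S where S: "C1c S ph" "S <= Ub" "compact S" "!!x. x ~: S ==> ph x = 0" "!!m. Ck_on m UNIV ph"
   using ph by (rule test_funE) (rule that)
  note [measurable] = C1c_measurable[OF S(1)] C1c_measurable_pderiv[OF S(1)]
  \<comment> \<open>Its derivative in the direction of the segment telescopes to the difference of
    \<open>ph\<close> at the two ends.\<close>
  define \<Phi> where "\<Phi> = conv_along lborel (indicator {0..b}) (%t. t *R e) ph"
  have gi: "integrable lborel (indicator {0..b} :: real => real)" by (simp add: integrable_indicator_iff emeasure_lborel_Icc_eq)
  have \<Phi>0: "\<Phi> y = 0" if "y ~: ?seg S" for y
  proof -
   have "indicator {0..b} t * ph (y - t *R e) = 0" for t
   proof (cases "t : {0..b}")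
    case True
    then have "y - t *R e ~: S" using that seg(3)[OF S(3,2), of "y - t *R e" t] by auto
    then show ?thesis using S(4) by simp
   qed simp
   then show ?thesis unfolding \<Phi>_def conv_along_def by (simp only: Bochner_Integration.integral_zero)
  qed
  have \<Phi>T: "\<Phi> : test_fun U" by (rule test_funI[OF _ seg(1)[OF S(3,2)] \<Phi>0 seg(2)[OF S(3,2)]])
    (auto simp: \<Phi>_def intro!: conv_along_smooth[OF gi _ S(5) S(3) S(4)])
  obtain S' where S': "C1c S' \<Phi>" "compact S'" "S' <= U" using \<Phi>T by (rule test_funE)
  have d\<Phi>: "pderiv_at j \<Phi> y = ph y - ph (y - b *R e)" for y
  proof -
   have "pderiv_at j \<Phi> y = (LBINT t. indicator {0..b} t * pderiv_at j ph (y - t *R e))"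
    using GDERIV_imp_pderiv_at[OF conv_along_GDERIV[OF gi _ S(1), of "%t. t *R e"], of j y] by (simp add: \<Phi>_def conv_along_def)
   also have "... = (LBINT t. pderiv_at j ph (y - t *R e) * indicator {0..b} t)" by (simp add: mult.commute)
   also have "... = - ph (y - b *R e) - - ph (y - 0 *R e)"
   proof (rule integral_FTC_Icc_real)
    show "((%t. - ph (y - t *R e)) has_real_derivative pderiv_at j ph (y - t *R e)) (at t)" for t
    proof -
     have "GDERIV ph (y + t *R (- e)) :> grad ph (y - t *R e)"
      using S(1) GDERIV_grad[of ph "y - t *R e"] by (simp add: C1c_def)
     from GDERIV_line[OF this]
     have "((%t. ph (y + t *R (- e))) has_real_derivative - pderiv_at j ph (y - t *R e)) (at t)" by (simp add: e inner_axis')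
     from DERIV_minus[OF this] show ?thesis by simp
    qed
    have "continuous_on UNIV (pderiv_at j ph)" using C1c_continuous_grad[OF S(1)] continuous_on_grad_iff by blast
    then have "continuous_on UNIV (%t. pderiv_at j ph (y - t *R e))" by (rule continuous_on_compose2) (auto intro!: continuous_intros)
    then show "isCont (%t. pderiv_at j ph (y - t *R e)) t" for t by (simp add: continuous_on_eq_continuous_at)
   qed (use b in auto)
   finally show ?thesis by simp
  qed
  note im = integrable_mult_compact_support[OF _ C1c_continuous[OF S(1)] S(3,4)]
  have i1: "integrable lborel (%x. v x * ph x)" "integrable lborel (%x. v (x + b *R e) * ph x)" "integrable lborel (%x. H x * ph x)"
   using im[OF vK(1)[OF S(3,2)]] im[OF vK(2)[OF S(3,2)]] im[OF HK[OF S(3,2)]] by auto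
  have i3: "integrable lborel (%y. v y * ph (y - b *R e))"
   using lborel_integrable_shift[OF i1(2), of "- (b *R e)"] by simp
  have "(LBINT x. v (x + b *R e) * ph x) = (LBINT y. v y * ph (y - b *R e))"
   using lborel_integral_shift[of "%y. v y * ph (y - b *R e)" "b *R e"] by simp
  moreover have "(LBINT y. v y * pderiv_at j \<Phi> y) = (LBINT y. v y * ph y) - (LBINT y. v y * ph (y - b *R e))"
   unfolding d\<Phi> using i1 i3 by (simp add: right_diff_distrib)
  moreover have "(LBINT y. v y * pderiv_at j \<Phi> y) = - (LBINT y. h y * \<Phi> y)"
   using w \<Phi>T by (auto simp: wderiv_def)
  moreover have "(LBINT y. h y * \<Phi> y) = (LBINT x. H x * ph x)"
  proof -
   have A: "integrable (lborel \<Otimes>\<^sub>M lborel) (%(t, x). indicator {0..b} t * h (x + t *R e) * ph x)"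
   proof -
    obtain C where C: "!!x. norm (ph x) <= C" by (rule bounded_compact_support[OF S(3) C1c_continuous[OF S(1)] S(4)]) auto
    show ?thesis
    proof (rule Bochner_Integration.integrable_bound[of _ "%p. C * F S p"])
     show "integrable (lborel \<Otimes>\<^sub>M lborel) (%p. C * F S p)" using F[OF S(3,2)] by simp
     have "\<bar>indicator {0..b} t * h (x + t *R e) * ph x\<bar> <= \<bar>C * F S (t, x)\<bar>" for t x
      using order_trans[OF C[of x] abs_ge_self] S(4)[of x] by (auto simp: F_def indicator_def abs_mult mult.commute[of "\<bar>C\<bar>"] intro!: mult_left_mono)
     then show "AE p in lborel \<Otimes>\<^sub>M lborel. norm (case p of (t, x) => indicator {0..b} t * h (x + t *R e) * ph x) <= norm (C * F S p)"
      by (intro AE_I2) (auto split: prod.split)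
    qed measurable
   qed
   have B: "integrable (lborel \<Otimes>\<^sub>M lborel) (%(t, y). indicator {0..b} t * h y * ph (y - t *R e))"
   proof (rule lborel_pair.Fubini_integrable)
    have *: "(LBINT y. norm (indicator {0..b} t * h y * ph (y - t *R e))) =
      (LBINT x. norm (indicator {0..b} t * h (x + t *R e) * ph x))" for t
     using lborel_integral_shift[of "%y. norm (indicator {0..b} t * h y * ph (y - t *R e))" "t *R e"] by simp
    have "integrable lborel (%t. LBINT x. norm (case (t, x) of (t, x) => indicator {0..b} t * h (x + t *R e) * ph x))"
     by (rule lborel_pair.integrable_fst'[OF integrable_norm[OF A]])
    then show "integrable lborel (%t. LBINT y. norm (case (t, y) of (t, y) => indicator {0..b} t * h y * ph (y - t *R e)))"
     using * by simp
    have "AE t in lborel. integrable lborel (%x. indicator {0..b} t * h (x + t *R e) * ph x)"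
     using lborel_pair.AE_integrable_fst'[OF A] by simp
    then show "AE t in lborel. integrable lborel (%y. case (t, y) of (t, y) => indicator {0..b} t * h y * ph (y - t *R e))"
    proof eventually_elim
     case (elim t)
     from lborel_integrable_shift[OF this, of "- (t *R e)"] show ?case by simp
    qed
   qed measurable
   have "(LBINT y. h y * \<Phi> y) = (LBINT y. LBINT t. indicator {0..b} t * h y * ph (y - t *R e))"
   proof (rule Bochner_Integration.integral_cong[OF refl])
    fix y
    have "h y * \<Phi> y = (LBINT t. h y * (indicator {0..b} t * ph (y - t *R e)))"
     unfolding \<Phi>_def conv_along_def by simp
    then show "h y * \<Phi> y = (LBINT t. indicator {0..b} t * h y * ph (y - t *R e))" by (simp add: mult_ac)
   qed
   also have "... = (LBINT t. LBINT y. indicator {0..b} t * h y * ph (y - t *R e))"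
    by (rule lborel_pair.Fubini_integral[OF B])
   also have "... = (LBINT t. LBINT x. indicator {0..b} t * h (x + t *R e) * ph x)"
   proof (rule Bochner_Integration.integral_cong[OF refl])
    fix t :: real
    show "(LBINT y. indicator {0..b} t * h y * ph (y - t *R e)) = (LBINT x. indicator {0..b} t * h (x + t *R e) * ph x)"
     using lborel_integral_shift[of "%y. indicator {0..b} t * h y * ph (y - t *R e)" "t *R e"] by simp
   qed
   also have "... = (LBINT x. LBINT t. indicator {0..b} t * h (x + t *R e) * ph x)"
    by (rule lborel_pair.Fubini_integral[OF A, symmetric])
   also have "... = (LBINT x. H x * ph x)" by (simp add: H_def)
   finally show ?thesis .
  qed
  ultimately have "(LBINT x. v (x + b *R e) * ph x) - (LBINT x. v x * ph x) - (LBINT x. H x * ph x) = 0" by simp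
  then show "(LBINT x. (v (x + b *R e) - v x - H x) * ph x) = 0"
   using i1 by (simp add: left_diff_distrib)
 qed measurable
 moreover have "AE x in lborel. x : Ub --> set_integrable lborel {0..b} (%t. h (x + t *R e))"
 proof -
  obtain C :: "nat => (real^'n) set" where C: "!!n. compact (C n)" "!!n. C n <= Ub" "\<Union>(range C) = Ub"
   by (rule open_Union_compact_subsets[OF Ub]) blast
  have "AE x in lborel. \<forall>n. x : C n --> set_integrable lborel {0..b} (%t. h (x + t *R e))"
   unfolding AE_all_countable using aeK C by blast
  then show ?thesis by eventually_elim (use C(3) in blast)
 qed
 ultimately show ?thesis by eventually_elim (auto simp: Ub_def H_def set_lebesgue_integral_def)
qed

section \<open>Differentiability on almost every line\<close>

lemma countable_separated_reals:
 fixes T :: "real set"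
 assumes "de > 0" "!!s t. s : T ==> t : T ==> s ~= t ==> \<bar>s - t\<bar> >= de"
 shows "countable T"
proof -
 let ?F = "(%t. ball t (de/2)) ` T"
 have "pairwise disjnt ?F"
 proof (rule pairwiseI)
  fix A B assume "A : ?F" "B : ?F" "A ~= B"
  then obtain s t where st: "s : T" "t : T" "A = ball s (de/2)" "B = ball t (de/2)" "s ~= t" by auto
  then have "\<bar>s - t\<bar> >= de" using assms by blast
  moreover have False if "x : A" "x : B" "de <= \<bar>s - t\<bar>" for x
  proof -
   have "\<bar>s - x\<bar> < de/2" "\<bar>t - x\<bar> < de/2" using that st by (auto simp: dist_real_def)
   then show False using that(3) by linarith
  qed
  ultimately show "disjnt A B" unfolding disjnt_def by blast
 qed
 then have "countable ?F" by (intro countable_disjoint_open_subsets) auto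
 moreover have "inj_on (%t. ball t (de/2)) T"
  using assms(1) by (auto simp: inj_on_def ball_eq_ball_iff)
 ultimately show ?thesis by (simp add: countable_image_inj_eq)
qed

text \<open>Differentiability is expressed by countably many conditions, with rational increments
  and tolerances 1/(k + 1); continuity extends the estimate to real increments. The point is
  measurability: the set of points that pass such a test is visibly Borel.\<close>

lemma DERIV_countable_test:
 fixes g :: "real => real"
 assumes d: "d0 > 0" "continuous_on {-d0..d0} g"
  and q: "!!k::nat. \<exists>m::nat. \<forall>q::rat. \<bar>of_rat q\<bar> < inverse (real (Suc m)) -->
   \<bar>g (of_rat q) - g 0 - of_rat q * c\<bar> <= inverse (real (Suc k)) * \<bar>of_rat q\<bar>"
 shows "(g has_real_derivative c) (at 0)"
proof -
 have "\<exists>de>0. \<forall>s. \<bar>s\<bar> < de --> \<bar>g s - g 0 - s * c\<bar> <= e * \<bar>s\<bar>" if "e > 0" for e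
 proof -
  obtain k where k: "inverse (real (Suc k)) < e" using reals_Archimedean[OF \<open>e > 0\<close>] by blast
  obtain m where m: "!!q::rat. \<bar>of_rat q\<bar> < inverse (real (Suc m)) ==>
   \<bar>g (of_rat q) - g 0 - of_rat q * c\<bar> <= inverse (real (Suc k)) * \<bar>of_rat q\<bar>" using q[of k] by blast
  define de where "de = min d0 (inverse (real (Suc m)))"
  have de: "de > 0" using d by (simp add: de_def)
  have "\<bar>g s - g 0 - s * c\<bar> <= e * \<bar>s\<bar>" if s: "\<bar>s\<bar> < de" for s
  proof -
   have "\<exists>q::rat. s < of_rat q & of_rat q < s + min (de - s) (inverse (real (Suc n)))" for n
    using s by (intro of_rat_dense) auto
   then obtain q :: "nat => rat" where q: "!!n. s < of_rat (q n)" "!!n. of_rat (q n) < s + min (de - s) (inverse (real (Suc n)))" by metis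
   have qlim: "(%n. of_rat (q n) :: real) ~~> s"
   proof (rule tendsto_sandwich[of "%_. s" _ _ "%n. s + inverse (real (Suc n))"])
    show "(%n. s + inverse (real (Suc n))) ~~> s"
     using tendsto_add[OF tendsto_const[of s] LIMSEQ_inverse_real_of_nat] by simp
    show "\<forall>\<^sub>F n in sequentially. of_rat (q n) <= s + inverse (real (Suc n))"
     using q(2) by (intro always_eventually allI) (smt (verit))
   qed (use q(1) in \<open>auto intro!: always_eventually less_imp_le\<close>)
   have qd: "\<bar>of_rat (q n) :: real\<bar> < de" for n using q[of n] s by linarith
   have "of_rat (q n) : {-d0..d0}" for n
   proof -
    have "\<bar>of_rat (q n) :: real\<bar> < d0" using qd[of n] unfolding de_def by linarith
    then show ?thesis unfolding atLeastAtMost_iff by linarith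
   qed
   moreover have "s : {-d0..d0}" using s unfolding de_def atLeastAtMost_iff by linarith
   ultimately have "(%n. g (of_rat (q n))) ~~> g s"
    by (intro continuous_on_tendsto_compose[OF d(2) qlim]) (auto intro!: always_eventually)
   then have "(%n. \<bar>g (of_rat (q n)) - g 0 - of_rat (q n) * c\<bar>) ~~> \<bar>g s - g 0 - s * c\<bar>"
    by (intro tendsto_intros qlim)
   moreover have "(%n. e * \<bar>of_rat (q n) :: real\<bar>) ~~> e * \<bar>s\<bar>" by (intro tendsto_intros qlim)
   moreover have le: "\<bar>g (of_rat (q n)) - g 0 - of_rat (q n) * c\<bar> <= e * \<bar>of_rat (q n)\<bar>" for n
   proof -
    have "\<bar>of_rat (q n) :: real\<bar> < inverse (real (Suc m))" using qd[of n] unfolding de_def by linarith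
    from m[OF this] show ?thesis using mult_right_mono[OF less_imp_le[OF k], of "\<bar>of_rat (q n)\<bar>"] by linarith
   qed
   ultimately show ?thesis using le by (intro LIMSEQ_le) blast+
  qed
  then show ?thesis using de by blast
 qed
 then show ?thesis
  unfolding has_field_derivative_def has_derivative_at_alt by (auto simp: mult.commute bounded_linear_mult_right)
qed

lemma DERIV_countable_test_converse:
 fixes g :: "real => real"
 assumes "(g has_real_derivative c) (at 0)"
 shows "\<exists>m::nat. \<forall>q::rat. \<bar>of_rat q\<bar> < inverse (real (Suc m)) -->
   \<bar>g (of_rat q) - g 0 - of_rat q * c\<bar> <= inverse (real (Suc k)) * \<bar>of_rat q\<bar>"
proof -
 have "inverse (real (Suc k)) > 0" by simp
 then obtain d where d: "d > 0" "!!y. \<bar>y - 0\<bar> < d ==> \<bar>g y - g 0 - c * (y - 0)\<bar> <= inverse (real (Suc k)) * \<bar>y - 0\<bar>"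
  using assms unfolding has_field_derivative_def has_derivative_at_alt real_norm_def by metis
 obtain m where "inverse (real (Suc m)) < d" using reals_Archimedean[OF d(1)] by blast
 then have "\<bar>g (of_rat q) - g 0 - of_rat q * c\<bar> <= inverse (real (Suc k)) * \<bar>of_rat q\<bar>"
  if "\<bar>of_rat q :: real\<bar> < inverse (real (Suc m))" for q :: rat
  using d(2)[of "of_rat q"] that unfolding diff_0_right mult.commute[of c] by linarith
 then show ?thesis by blast
qed

text \<open>A continuous representative of a weakly differentiable function is partially differentiable
  almost everywhere: it is absolutely continuous on almost every line.\<close>
lemma wderiv_imp_DERIV:
 fixes v h :: "real^'n => real"
 assumes U: "open U" and w: "wderiv U j v h" and cont: "continuous_on U v" and e: "e = axis j 1"
 shows "AE x in lborel. x : U --> ((%t. v (x + t *R e)) has_real_derivative h x) (at 0)"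
proof -
 have vm[measurable]: "v : borel_measurable borel" and hm[measurable]: "h : borel_measurable borel"
  using w by (auto simp: wderiv_def)
 have [measurable]: "U : sets borel" using U by simp
 \<comment> \<open>The points where \<open>v\<close> has derivative \<open>h x\<close> along
   \<open>e\<close>, described through rational increments so that the set is Borel and
   \<open>null_via_lines\<close> applies to its complement in \<open>U\<close>.\<close>
 define G where "G = {x : U. \<forall>k::nat. \<exists>m::nat. \<forall>q::rat. \<bar>of_rat q :: real\<bar> < inverse (real (Suc m)) -->
   \<bar>v (x + of_rat q *R e) - v x - of_rat q * h x\<bar> <= inverse (real (Suc k)) * \<bar>of_rat q\<bar>}"
 have Gm[measurable]: "G : sets borel" unfolding G_def by measurable
 have cl: "continuous_on {t. x + t *R e : U} (%t. v (x + t *R e))" for x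
  by (rule continuous_on_compose2[OF cont]) (auto intro!: continuous_intros)
 have oT: "open {t::real. x + t *R e : U}" for x
 proof -
  have "open ((%t::real. x + t *R e) -` U)" by (rule open_vimage[OF U]) (auto intro!: continuous_intros)
  then show ?thesis by (simp add: vimage_def)
 qed
 have G_D: "((%t. v (x + t *R e)) has_real_derivative h x) (at 0)" if "x : G" for x
 proof -
  have "x : U" using that by (auto simp: G_def)
  then have "0 : {t. x + t *R e : U}" by simp
  then obtain d where d: "d > 0" "cball 0 d <= {t. x + t *R e : U}"
   using oT[of x, unfolded open_contains_cball] by blast
  have "{-d..d} <= {t. x + t *R e : U}" using d by (auto simp: subset_eq dist_real_def)
  then show ?thesis
   using that d(1) by (intro DERIV_countable_test[of d] continuous_on_subset[OF cl]) (auto simp: G_def)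
 qed
 have D_G: "x : G" if "x : U" "((%t. v (x + t *R e)) has_real_derivative h x) (at 0)" for x
  using DERIV_countable_test_converse[OF that(2)] that(1) by (simp add: G_def)
 \<comment> \<open>The integral identity has an exceptional set for each segment length, so it can
   be had at once only for the countably many segments with rational data.\<close>
 have "AE x in lborel. \<forall>a::rat. \<forall>b::rat. b > 0 --> (\<forall>t\<in>{0..of_rat b}. (x + of_rat a *R e) + t *R e : U) -->
  set_integrable lborel {0..of_rat b} (%t. h ((x + of_rat a *R e) + t *R e)) \<and>
  v ((x + of_rat a *R e) + of_rat b *R e) - v (x + of_rat a *R e) = (LINT t:{0..of_rat b}|lborel. h ((x + of_rat a *R e) + t *R e))"
  unfolding AE_all_countable
 proof (intro allI)
  fix a b :: rat
  show "AE x in lborel. b > 0 --> (\<forall>t\<in>{0..of_rat b}. (x + of_rat a *R e) + t *R e : U) -->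
  set_integrable lborel {0..of_rat b} (%t. h ((x + of_rat a *R e) + t *R e)) \<and>
  v ((x + of_rat a *R e) + of_rat b *R e) - v (x + of_rat a *R e) = (LINT t:{0..of_rat b}|lborel. h ((x + of_rat a *R e) + t *R e))"
  proof (cases "b > 0")
   case True
   then have "of_rat b > (0::real)" by simp
   from AE_lborel_shift[OF wderiv_shift[OF U w this e], of "of_rat a *R e"] show ?thesis by eventually_elim blast
  qed simp
 qed
 then have "AE x in lborel. AE t::real in lborel. x + t *R e ~: U - G"
 proof eventually_elim
  case (elim x)
  let ?T = "{t. x + t *R e : U}"
  let ?k = "%t. h (x + t *R e)"
  have loc: "AE t in lborel. t : {of_rat a<..<of_rat c} --> x + t *R e ~: U - G" if ac: "{of_rat a..of_rat c} <= ?T" "a < c" for a c :: rat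
  proof -
   let ?a = "of_rat a :: real" and ?c = "of_rat c :: real"
   have lac: "?a < ?c" using ac(2) by (simp add: of_rat_less)
   have id: "set_integrable lborel {?a..of_rat s} ?k & v (x + of_rat s *R e) - v (x + ?a *R e) = (LINT t:{?a..of_rat s}|lborel. ?k t)"
    if s: "a < s" "s <= c" for s :: rat
   proof -
    have rs: "of_rat (s - a) = of_rat s - ?a" by (simp add: of_rat_diff)
    have ineq: "?a < of_rat s" "of_rat s <= ?c" using s by (auto simp: of_rat_less of_rat_less_eq)
    have "\<forall>t\<in>{0..of_rat (s - a)}. (x + ?a *R e) + t *R e : U"
    proof
     fix t :: real assume "t : {0..of_rat (s - a)}"
     then have "?a + t : {?a..?c}" using ineq rs by auto
     then have "x + (?a + t) *R e : U" using ac(1) by blast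
     then show "(x + ?a *R e) + t *R e : U" by (simp add: algebra_simps)
    qed
    moreover have "s - a > 0" using s by simp
    ultimately have *: "set_integrable lborel {0..of_rat (s - a)} (%t. h ((x + ?a *R e) + t *R e))"
     "v ((x + ?a *R e) + of_rat (s - a) *R e) - v (x + ?a *R e) = (LINT t:{0..of_rat (s - a)}|lborel. h ((x + ?a *R e) + t *R e))"
     using elim by blast+
    have ind: "indicator {0..of_rat (s - a)} (t - ?a) = (indicator {?a..of_rat s} t :: real)" for t by (auto simp: indicator_def rs)
    have pt: "(x + ?a *R e) + (t - ?a) *R e = x + t *R e" for t by (simp add: algebra_simps)
    have i: "integrable lborel (%t. indicator {?a..of_rat s} t *R ?k t)"
     using lborel_integrable_shift[OF *(1)[unfolded set_integrable_def], of "- ?a"] by (simp only: diff_conv_add_uminus[symmetric] ind pt)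
    have l: "(LINT t:{0..of_rat (s - a)}|lborel. h ((x + ?a *R e) + t *R e)) = (LINT t:{?a..of_rat s}|lborel. ?k t)"
     unfolding set_lebesgue_integral_def
     using lborel_integral_shift[of "%t. indicator {0..of_rat (s - a)} t *R h ((x + ?a *R e) + t *R e)" "- ?a"]
     by (simp only: diff_conv_add_uminus[symmetric] ind pt) simp
    have "(x + ?a *R e) + of_rat (s - a) *R e = x + of_rat s *R e" by (simp add: rs algebra_simps)
    from *(2)[unfolded this l] show ?thesis unfolding set_integrable_def by (rule conjI[OF i])
   qed
   have ki: "set_integrable lborel {?a..?c} ?k" using id[of c] ac by auto
   have kab: "?k absolutely_integrable_on {?a..?c}"
    using ki unfolding set_integrable_def by (simp add: integrable_completion borel_measurable_integrable)
   then have kI: "?k integrable_on {?a..?c}" by (rule set_lebesgue_integral_eq_integral(1))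
   \<comment> \<open>Both sides are continuous in s and agree at rational s. After this,
     differentiability of the indefinite integral at almost every s passes to
     \<open>v\<close>.\<close>
   have I: "v (x + s *R e) = v (x + ?a *R e) + integral {?a..s} ?k" if s: "s : {?a<..<?c}" for s
   proof -
    have "continuous_on {?a..?c} (%s. v (x + s *R e) - (v (x + ?a *R e) + integral {?a..s} ?k))"
     by (intro continuous_intros continuous_on_subset[OF cl ac(1)] indefinite_integral_continuous_1 kI)
    moreover have z: "v (x + of_rat q *R e) - (v (x + ?a *R e) + integral {?a..of_rat q} ?k) = 0" if "a < q" "q <= c" for q
    proof -
     have "set_integrable lborel {?a..of_rat q} ?k" using id[OF that] by auto
     then have "(LINT t:{?a..of_rat q}|lborel. ?k t) = integral {?a..of_rat q} ?k" by (rule set_borel_integral_eq_integral(2))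
     then show ?thesis using id[OF that] by simp
    qed
    moreover have "\<exists>q::nat => rat. (\<forall>n. a < q n & q n <= c) & (%n. of_rat (q n) :: real) ~~> s"
    proof -
     have "\<exists>q::rat. s < of_rat q & of_rat q < s + min (?c - s) (inverse (real (Suc n)))" for n
      using s by (intro of_rat_dense) auto
     then obtain q :: "nat => rat" where q: "!!n. s < of_rat (q n)" "!!n. of_rat (q n) < s + min (?c - s) (inverse (real (Suc n)))" by metis
     have "(%n. of_rat (q n) :: real) ~~> s"
     proof (rule tendsto_sandwich[of "%_. s" _ _ "%n. s + inverse (real (Suc n))"])
      show "(%n. s + inverse (real (Suc n))) ~~> s"
       using tendsto_add[OF tendsto_const[of s] LIMSEQ_inverse_real_of_nat] by simp
      show "\<forall>\<^sub>F n in sequentially. of_rat (q n) <= s + inverse (real (Suc n))"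
       using q(2) by (intro always_eventually allI) (smt (verit))
     qed (use q(1) in \<open>auto intro!: always_eventually less_imp_le\<close>)
     moreover have "a < q n & q n <= c" for n
     proof -
      have "?a < of_rat (q n)" "of_rat (q n) < ?c" using q[of n] s by auto
      then show ?thesis by (simp add: of_rat_less)
     qed
     ultimately show ?thesis by blast
    qed
    then obtain q :: "nat => rat" where q: "!!n. a < q n" "!!n. q n <= c" "(%n. of_rat (q n) :: real) ~~> s" by blast
    have "?a < of_rat (q n)" "of_rat (q n) <= ?c" for n using q(1,2)[of n] by (auto simp: of_rat_less of_rat_less_eq)
    then have "\<forall>\<^sub>F n in sequentially. of_rat (q n) : {?a..?c}" by (auto intro!: always_eventually less_imp_le)
    from continuous_on_tendsto_compose[OF \<open>continuous_on {?a..?c} _\<close> q(3) _ this] s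
    have "(%n. v (x + of_rat (q n) *R e) - (v (x + ?a *R e) + integral {?a..of_rat (q n)} ?k)) ~~> v (x + s *R e) - (v (x + ?a *R e) + integral {?a..s} ?k)"
     by auto
    then show ?thesis using z[OF q(1,2)] by (simp add: LIMSEQ_const_iff)
   qed
   have "negligible {t : {?a<..<?c}. \<not> ((%s. integral {?a..s} ?k) has_real_derivative ?k t) (at t)}" by (rule lebesgue_differentiation_real[OF kI])
   then have "AE t in lebesgue. t ~: {t : {?a<..<?c}. \<not> ((%s. integral {?a..s} ?k) has_real_derivative ?k t) (at t)}"
    unfolding negligible_iff_null_sets by (rule AE_not_in)
   then have "AE t in lborel. t ~: {t : {?a<..<?c}. \<not> ((%s. integral {?a..s} ?k) has_real_derivative ?k t) (at t)}"
    by (simp only: AE_completion_iff)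
   then show ?thesis
   proof eventually_elim
    case (elim t)
    show ?case
    proof
     assume t: "t : {?a<..<?c}"
     then have "((%s. integral {?a..s} ?k) has_real_derivative ?k t) (at t)" using elim by blast
     then have "((%s. v (x + ?a *R e) + integral {?a..s} ?k) has_real_derivative ?k t) (at t)" by (auto intro!: derivative_eq_intros)
     then have "((%s. v (x + s *R e)) has_real_derivative ?k t) (at t)"
      by (rule has_field_derivative_transform_within_open[of _ _ _ "{?a<..<?c}"]) (use t I in auto)
     then have "((%s. v ((x + t *R e) + s *R e)) has_real_derivative h (x + t *R e)) (at 0)"
      using DERIV_shift[of "%s. v (x + s *R e)" "?k t" 0 t] by (simp add: algebra_simps)
     then have "x + t *R e : G" using D_G ac(1) t by (auto simp: subset_eq)
     then show "x + t *R e ~: U - G" by blast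
    qed
   qed
  qed
  have "AE t in lborel. \<forall>a c :: rat. {of_rat a..of_rat c} <= ?T & a < c --> t : {of_rat a<..<of_rat c} --> x + t *R e ~: U - G"
   unfolding AE_all_countable
  proof (intro allI)
   fix a c :: rat
   show "AE t in lborel. {of_rat a..of_rat c} <= ?T & a < c --> t : {of_rat a<..<of_rat c} --> x + t *R e ~: U - G"
    using loc[of a c] by (cases "{of_rat a..of_rat c} <= ?T & a < c") auto
  qed
  then show ?case
  proof eventually_elim
   case (elim t)
   show ?case
   proof (cases "x + t *R e : U")
    case True
    then have "t : ?T" by simp
    then obtain d where d: "d > 0" "cball t d <= ?T" using oT[of x, unfolded open_contains_cball] by blast
    obtain a :: rat where a: "t - d < of_rat a" "of_rat a < t" using of_rat_dense[of "t - d" t] d by auto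
    obtain c :: rat where c: "t < of_rat c" "of_rat c < t + d" using of_rat_dense[of t "t + d"] d by auto
    have "{of_rat a..of_rat c} <= ?T" using a c d(2) by (auto simp: subset_eq dist_real_def)
    moreover have "a < c" using a c of_rat_less[of a c, where ?'a = real] by linarith
    ultimately show ?thesis using elim a c by auto
   qed simp
  qed
 qed
 then have "AE x in lborel. x ~: U - G" by (rule null_via_lines[rotated]) measurable
 then show ?thesis by eventually_elim (use G_D in blast)
qed

text \<open>On almost every line the derivative exists at almost every point. A zero of
  \<open>v\<close> with nonzero derivative is isolated among the zeros on its line, and isolated
  points are countable, hence a null set on the line.\<close>

lemma wderiv_zero_on_zeros:
 fixes v h :: "real^'n => real"
 assumes U: "open U" and w: "wderiv U j v h" and cont: "continuous_on U v"
 shows "AE x in lborel. x : U --> v x = 0 --> h x = 0"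
proof -
 define e :: "real^'n" where "e = axis j 1"
 have vm[measurable]: "v : borel_measurable borel" and hm[measurable]: "h : borel_measurable borel"
  using w by (auto simp: wderiv_def)
 have [measurable]: "U : sets borel" using U by simp
 define N where "N = {x : U. v x = 0 & h x ~= 0}"
 have Nm[measurable]: "N : sets borel" unfolding N_def by measurable
 have "AE x in lborel. AE t::real in lborel. x + t *R e : U --> ((%s. v ((x + t *R e) + s *R e)) has_real_derivative h (x + t *R e)) (at 0)"
  by (rule AE_lines[OF wderiv_imp_DERIV[OF U w cont e_def]])
 then have "AE x in lborel. AE t::real in lborel. x + t *R e ~: N"
 proof eventually_elim
  case (elim x)
  \<comment> \<open>Points of \<open>N\<close> without another zero of \<open>v\<close> within
    distance 1/(m + 1); any two of them are therefore at least that far apart.\<close>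
  define Z where "Z m = {t. x + t *R e : N & (\<forall>s. s ~= t & \<bar>s - t\<bar> < inverse (real (Suc m)) --> v (x + s *R e) ~= 0)}" for m
  have "countable (Z m)" for m
  proof (rule countable_separated_reals[of "inverse (real (Suc m))"])
   fix s t assume st: "s : Z m" "t : Z m" "s ~= t"
   then have "v (x + s *R e) = 0" by (simp add: Z_def N_def)
   then show "inverse (real (Suc m)) <= \<bar>s - t\<bar>" using st by (force simp: Z_def not_less[symmetric])
  qed simp
  then have "countable (\<Union>m. Z m)" by auto
  then have "AE t in lborel. t ~: (\<Union>m. Z m)" by (intro AE_not_in countable_imp_null_set_lborel)
  with elim show ?case
  proof eventually_elim
   case (elim t)
   show ?case
   proof
    assume N: "x + t *R e : N"
    then have "((%s. v ((x + t *R e) + s *R e)) has_real_derivative h (x + t *R e)) (at 0)" using elim by (simp add: N_def)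
    then have "((%s. (v ((x + t *R e) + s *R e) - v (x + t *R e)) / s) \<longlongrightarrow> h (x + t *R e)) (at 0)"
     by (simp add: DERIV_def)
    then have "\<forall>\<^sub>F s in at 0. (v ((x + t *R e) + s *R e) - v (x + t *R e)) / s ~= 0"
     using N by (intro tendsto_imp_eventually_ne) (auto simp: N_def)
    then obtain d where d: "d > 0" "!!s. s ~= 0 ==> \<bar>s\<bar> < d ==> v ((x + t *R e) + s *R e) ~= v (x + t *R e)"
     unfolding eventually_at by (auto simp: dist_real_def)
    obtain m where m: "inverse (real (Suc m)) < d" using reals_Archimedean[OF d(1)] by blast
    have "t : Z m"
     unfolding Z_def
    proof (intro CollectI conjI allI impI N, elim conjE)
     fix s assume "s ~= t" "\<bar>s - t\<bar> < inverse (real (Suc m))"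
     then have "v ((x + t *R e) + (s - t) *R e) ~= v (x + t *R e)" using m by (intro d(2)) auto
     then show "v (x + s *R e) ~= 0" using N by (simp add: N_def algebra_simps)
    qed
    then show False using elim by blast
   qed
  qed
 qed
 then have "AE x in lborel. x ~: N" by (rule null_via_lines[rotated]) measurable
 then show ?thesis by eventually_elim (auto simp: N_def)
qed

section \<open>The local problem\<close>

lemma powr_ge_min:
 fixes r s \<alpha> \<beta> :: real
 assumes "0 < \<alpha>" "\<alpha> <= s" "s <= \<beta>"
 shows "min (\<alpha> powr r) (\<beta> powr r) <= s powr r"
proof (cases "r >= 0")
 case True then have "\<alpha> powr r <= s powr r" using assms by (intro powr_mono2) auto
 then show ?thesis by linarith
next
 case False then have "\<beta> powr r <= s powr r" using assms by (intro powr_mono2') auto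
 then show ?thesis by linarith
qed

lemma real_C1_lipschitz:
 fixes g g' :: "real => real"
 assumes "!!t. t : {a..b} ==> (g has_real_derivative g' t) (at t within {a..b})" "continuous_on {a..b} g'"
 obtains L where "L > 0" "!!s t. s : {a..b} ==> t : {a..b} ==> \<bar>g s - g t\<bar> <= L * \<bar>s - t\<bar>"
proof -
 have "bounded (g' ` {a..b})" using assms(2) by (intro compact_imp_bounded compact_continuous_image) auto
 then obtain L where L: "L > 0" "!!t. t : {a..b} ==> \<bar>g' t\<bar> <= L" by (auto simp: bounded_pos)
 show ?thesis
 proof (rule that[OF L(1)])
  fix s t assume "s : {a..b}" "t : {a..b}"
  then have "norm (g s - g t) <= L * norm (s - t)" by (intro field_differentiable_bound[where S = "{a..b}" and f' = g']) (use assms(1) L in auto)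
  then show "\<bar>g s - g t\<bar> <= L * \<bar>s - t\<bar>" by simp
 qed
qed

lemma mvt_direction:
 fixes u :: "real^'n => real"
 assumes "h > 0" "!!t. t : {0..h} ==> u differentiable (at (x + t *R e))"
 obtains z where "0 < z" "z < h" "u (x + h *R e) - u x = h * inner e (grad u (x + z *R e))"
proof -
 have "((%t. u (x + t *R e)) has_real_derivative inner e (grad u (x + t *R e))) (at t)" if "0 <= t" "t <= h" for t
  using GDERIV_line[OF GDERIV_grad[OF assms(2)]] that by auto
 from MVT2[OF assms(1) this] obtain z where "0 < z" "z < h"
   "u (x + h *R e) - u (x + 0 *R e) = (h - 0) * inner e (grad u (x + z *R e))" by blast
 then show ?thesis by (intro that[of z]) auto
qed

lemma grad_square_mult:
 fixes w ps :: "real^'n => real"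
 assumes "GDERIV ps x :> P" "GDERIV w x :> W"
 shows "GDERIV (%x. (ps x)^2 * w x) x :> (ps x)^2 *R W + (2 * ps x * w x) *R P"
proof -
 have "GDERIV (%x. (ps x * ps x) * w x) x :> (ps x * ps x) *R W + w x *R (ps x *R P + ps x *R P)"
  by (intro GDERIV_mult assms)
 then have "GDERIV (%x. (ps x * ps x) * w x) x :> (ps x)^2 *R W + (2 * ps x * w x) *R P"
  by (rule GDERIV_subst) (simp add: power2_eq_square algebra_simps flip: scaleR_2)
 then show ?thesis by (simp add: power2_eq_square)
qed

text \<open>The problem on \<open>U\<close>, which will be the domain without the origin.
  \<open>G\<close> is the whole right hand side; it is asked to be bounded, Lipschitz along the axes
  and bounded below by a positive constant on compact sets. The Lipschitz condition has constants
  uniform in direction and increment, but its null set may depend on both, which is all that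
  difference quotients require. \<open>m\<close> and \<open>M\<close> are real bounds for t A'(t) /
  A(t).\<close>

locale local_solution =
 fixes U :: "(real^'n) set" and u :: "real^'n => real" and A B B' :: "real => real" and G :: "real^'n => real"
  and p c2 m M CB :: real
 assumes U: "open U"
  and u_diff: "!!x. x : U ==> u differentiable (at x)" and u_cont: "continuous_on U (grad u)"
  and A_pos: "!!t. t > 0 ==> A t > 0" and A_diff: "!!t. t > 0 ==> A differentiable (at t)"
  and A_cont: "continuous_on {0<..} (deriv A)" and A_mono: "mono_on {0<..} (%t. t * A t)"
  and c2: "c2 > 0" and A_ell: "!!et et' :: real^'n. et ~= 0 \<or> et' ~= 0 ==>
    (A (norm et) *R et - A (norm et') *R et') \<bullet> (et - et')
     >= c2 * (norm et + norm et') powr (p - 2) * (norm (et - et'))^2"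
  and m: "- 1 < m" and A_m: "!!t. t > 0 ==> m <= t * deriv A t / A t"
  and A_M: "!!t. t > 0 ==> t * deriv A t / A t <= M"
  and B_nonneg: "!!t. t >= 0 ==> B t >= 0" and B_0: "B 0 = 0"
  and B_der: "!!t. t >= 0 ==> (B has_real_derivative B' t) (at t within {0..})"
  and B_cont: "continuous_on {0..} B'" and CB: "CB > 0" and B_le: "!!t. t > 0 ==> B' t <= CB * (t * A t)"
  and G_meas: "G : borel_measurable borel"
  and G_bd: "!!K. compact K ==> K <= U ==> \<exists>L>0. AE x in lborel. x : K --> \<bar>G x\<bar> <= L"
  and G_lip: "!!K. compact K ==> K <= U ==> \<exists>L>0. \<exists>de>0. \<forall>i. \<forall>h. 0 < h & h < de -->
    (AE x in lborel. x : K --> \<bar>G (x + h *R axis i 1) - G x\<bar> <= L * h)"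
  and G_pos: "!!K. compact K ==> K <= U ==> \<exists>c>0. AE x in lborel. x : K --> c <= G x"
  and equation: "!!S ph. C1c S ph ==> S <= U ==>
    (LBINT x. A (norm (grad u x)) * (grad u x \<bullet> grad ph x)) + (LBINT x. B (norm (grad u x)) * ph x)
    = (LBINT x. G x * ph x)"
begin

text \<open>The gradient, set to zero outside \<open>U\<close> so that it and all its translates are
  Borel functions on the whole space.\<close>

definition D :: "real^'n => real^'n" where "D x = (if x : U then grad u x else 0)"
definition a :: "real^'n => real^'n" where "a et = A (norm et) *R et"
definition bb :: "real^'n => real" where "bb et = B (norm et)"

section \<open>Measurability and local bounds of the gradient and the nonlinear terms\<close>

lemma D_U: "x : U ==> D x = grad u x" by (simp add: D_def)

lemma D_cont: "continuous_on U D"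
 using u_cont by (rule continuous_on_cong[THEN iffD1, rotated 2]) (auto simp: D_U)

lemma D_meas[measurable]: "D : borel_measurable borel"
proof -
 have "D = (%x. indicator U x *R grad u x)" by (auto simp: D_def)
 then show ?thesis using borel_measurable_continuous_on_indicator[OF _ u_cont] U by simp
qed

lemma A_isCont: "t > 0 ==> isCont A t"
 using A_diff differentiable_imp_continuous_within by blast

lemma A_contOn: "continuous_on {0<..} A" by (intro continuous_at_imp_continuous_on) (auto intro: A_isCont)

lemma A_DERIV: "t > 0 ==> (A has_real_derivative deriv A t) (at t)"
 using A_diff real_differentiable_def DERIV_deriv_iff_real_differentiable by blast

lemma a_meas[measurable]: "a : borel_measurable borel"
proof -
 have [measurable]: "(%t. indicator {0<..} t *R A t) : borel_measurable borel" by (rule borel_measurable_continuous_on_indicator[OF _ A_contOn]) simp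
 have eq: "a = (%et. (indicator {0<..} (norm et) *R A (norm et)) *R et)" by (auto simp: a_def indicator_def)
 show ?thesis unfolding eq by measurable
qed

lemma B_contOn: "continuous_on {0..} B"
 using B_der by (meson DERIV_continuous_on atLeast_iff)

lemma bb_meas[measurable]: "bb : borel_measurable borel"
proof -
 have "continuous_on UNIV (%t. B (max 0 t))" by (rule continuous_on_compose2[OF B_contOn]) (auto intro!: continuous_intros)
 then have [measurable]: "(%t. B (max 0 t)) : borel_measurable borel" by (rule borel_measurable_continuous_onI)
 have eq: "bb = (%et. B (max 0 (norm et)))" by (auto simp: bb_def)
 show ?thesis unfolding eq by measurable
qed

lemma norm_a: "et ~= 0 ==> norm (a et) = norm et * A (norm et)"
 using A_pos[of "norm et"] by (simp add: a_def)

lemma tA_mono: "0 < s ==> s <= t ==> s * A s <= t * A t"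
 using A_mono by (auto simp: mono_on_def)

lemma norm_a_le: "norm et <= R ==> R > 0 ==> norm (a et) <= R * A R"
 using tA_mono[of "norm et" R] A_pos[of R] by (cases "et = 0") (auto simp: norm_a, simp add: a_def)

lemma D_bound:
 assumes "compact K" "K <= U"
 obtains R where "R > 0" "!!x. x : K ==> norm (D x) <= R"
proof -
 have "bounded (D ` K)" by (intro compact_imp_bounded compact_continuous_image continuous_on_subset[OF D_cont] assms)
 then show ?thesis using that by (auto simp: bounded_pos)
qed

lemma B_lipschitz:
 obtains L where "L > 0" "!!s t. 0 <= s ==> s <= R ==> 0 <= t ==> t <= R ==> \<bar>B s - B t\<bar> <= L * \<bar>s - t\<bar>"
proof -
 obtain L where L: "L > 0" "!!s t. s : {0..R} ==> t : {0..R} ==> \<bar>B s - B t\<bar> <= L * \<bar>s - t\<bar>"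
 proof (rule real_C1_lipschitz[of 0 R B B'])
  show "(B has_real_derivative B' t) (at t within {0..R})" if "t : {0..R}" for t
   using DERIV_subset[OF B_der] that by auto
 qed (use continuous_on_subset[OF B_cont] in auto)
 show ?thesis by (rule that[OF L(1)]) (use L(2) in auto)
qed

lemma bb_lipschitz:
 obtains L where "L > 0" "!!et et'. norm et <= R ==> norm et' <= R ==> \<bar>bb et - bb et'\<bar> <= L * norm (et - et')"
proof -
 obtain L where L: "L > 0" "!!s t. 0 <= s ==> s <= R ==> 0 <= t ==> t <= R ==> \<bar>B s - B t\<bar> <= L * \<bar>s - t\<bar>" by (rule B_lipschitz[of R]) blast
 show ?thesis
 proof (rule that[OF L(1)])
  fix et et' :: "real^'n" assume "norm et <= R" "norm et' <= R"
  then have "\<bar>bb et - bb et'\<bar> <= L * \<bar>norm et - norm et'\<bar>" unfolding bb_def by (intro L(2)) auto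
  also have "... <= L * norm (et - et')" using norm_triangle_ineq3 L(1) by (intro mult_left_mono) auto
  finally show "\<bar>bb et - bb et'\<bar> <= L * norm (et - et')" .
 qed
qed

text \<open>Away from zero \<open>A\<close> is C1 and hence Lipschitz on \<open>{ep..R}\<close>, and
  monotonicity of t A(t) bounds A there by R A(R) / ep. Near zero the vector field may fail to be
  Lipschitz, which is why \<open>ep\<close> appears.\<close>

lemma a_lipschitz:
 assumes "ep > 0" "ep <= R"
 obtains L where "L > 0" "!!et et'. ep <= norm et ==> norm et <= R ==> ep <= norm et' ==> norm et' <= R ==> norm (a et - a et') <= L * norm (et - et')"
proof -
 obtain L where L: "L > 0" "!!s t. s : {ep..R} ==> t : {ep..R} ==> \<bar>A s - A t\<bar> <= L * \<bar>s - t\<bar>"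
 proof (rule real_C1_lipschitz[of ep R A "deriv A"])
  show "(A has_real_derivative deriv A t) (at t within {ep..R})" if "t : {ep..R}" for t
   using A_DERIV[of t] that assms by (auto intro: DERIV_subset)
 qed (rule continuous_on_subset[OF A_cont], use assms in auto)
 have RA: "R * A R > 0" using assms A_pos[of R] by simp
 show ?thesis
 proof (rule that[of "R * A R / ep + L * R"])
  show "R * A R / ep + L * R > 0" using RA assms L by (simp add: add_pos_pos)
  fix et et' :: "real^'n" assume n: "ep <= norm et" "norm et <= R" "ep <= norm et'" "norm et' <= R"
  have An: "A (norm et) > 0" using n(1) assms(1) by (intro A_pos) linarith
  have "a et - a et' = A (norm et) *R (et - et') + (A (norm et) - A (norm et')) *R et'" by (simp add: a_def algebra_simps)
  then have "norm (a et - a et') <= \<bar>A (norm et)\<bar> * norm (et - et') + \<bar>A (norm et) - A (norm et')\<bar> * norm et'"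
   by (metis norm_triangle_ineq norm_scaleR)
  also have "\<bar>A (norm et)\<bar> * norm (et - et') <= R * A R / ep * norm (et - et')"
  proof (rule mult_right_mono)
   have "ep * A (norm et) <= norm et * A (norm et)" using n An by (intro mult_right_mono) auto
   also have "... <= R * A R" using n assms by (intro tA_mono) auto
   finally show "\<bar>A (norm et)\<bar> <= R * A R / ep" using An assms by (simp add: field_simps)
  qed simp
  also have "\<bar>A (norm et) - A (norm et')\<bar> * norm et' <= (L * norm (et - et')) * R"
  proof (rule mult_mono)
   have "\<bar>A (norm et) - A (norm et')\<bar> <= L * \<bar>norm et - norm et'\<bar>" using n by (intro L(2)) auto
   also have "... <= L * norm (et - et')" using norm_triangle_ineq3 L(1) by (intro mult_left_mono) auto
   finally show "\<bar>A (norm et) - A (norm et')\<bar> <= L * norm (et - et')" .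
  qed (use n L in auto)
  finally show "norm (a et - a et') <= (R * A R / ep + L * R) * norm (et - et')" by (simp add: algebra_simps)
 qed
qed

lemma a_monotone:
 assumes "ep > 0" "ep <= R"
 obtains c where "c > 0" "!!et et'. ep <= norm et ==> norm et <= R ==> ep <= norm et' ==> norm et' <= R ==>
   c * (norm (et - et'))^2 <= (a et - a et') \<bullet> (et - et')"
proof (rule that)
 \<comment> \<open>The sum of the two norms lies between \<open>2 * ep\<close> and
   \<open>2 * R\<close>; the minimum of the endpoint values covers both signs of
   \<open>p - 2\<close>.\<close>
 let ?c = "c2 * min ((2 * ep) powr (p - 2)) ((2 * R) powr (p - 2))"
 show "?c > 0" using c2 assms by simp
 fix et et' :: "real^'n" assume n: "ep <= norm et" "norm et <= R" "ep <= norm et'" "norm et' <= R"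
 have "?c * (norm (et - et'))^2 <= c2 * (norm et + norm et') powr (p - 2) * (norm (et - et'))^2"
  using n assms c2 by (intro mult_right_mono mult_left_mono powr_ge_min) auto
 also have "... <= (a et - a et') \<bullet> (et - et')"
  unfolding a_def by (rule A_ell) (use n assms in auto)
 finally show "?c * (norm (et - et'))^2 <= (a et - a et') \<bullet> (et - et')" .
qed

lemma aD_integrable:
 assumes S: "compact S" "S <= U" and k: "k : borel_measurable borel" "!!x. norm (k x) <= C" "!!x. x ~: S ==> k x = 0"
 shows "integrable lborel (%x. a (D x) \<bullet> k x)"
proof -
 obtain R where R: "R > 0" "!!x. x : S ==> norm (D x) <= R" by (rule D_bound[OF S]) blast
 note k(1)[measurable]
 have [measurable]: "S : sets borel" using S by (simp add: borel_compact)
 have "integrable lborel (%x. (R * A R * C) * indicator S x)"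
  using emeasure_compact_finite[OF S(1)] by (intro integrable_mult_right) (simp add: integrable_indicator_iff)
 then show ?thesis
 proof (rule Bochner_Integration.integrable_bound)
  show "AE x in lborel. norm (a (D x) \<bullet> k x) <= norm (R * A R * C * indicator S x)"
  proof (rule AE_I2)
   fix x
   show "norm (a (D x) \<bullet> k x) <= norm (R * A R * C * indicator S x)"
   proof (cases "x : S")
    case True
    have "\<bar>a (D x) \<bullet> k x\<bar> <= norm (a (D x)) * norm (k x)" by (rule Cauchy_Schwarz_ineq2)
    also have "... <= (R * A R) * C" using True R k(2) A_pos[of R] by (intro mult_mono norm_a_le) auto
    finally show ?thesis using True by simp
   qed (use k(3) in simp)
  qed
 qed simp
qed

lemma bD_integrable:
 assumes S: "compact S" "S <= U" and k: "k : borel_measurable borel" "!!x. \<bar>k x\<bar> <= C" "!!x. x ~: S ==> k x = 0"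
 shows "integrable lborel (%x. bb (D x) * k x)"
proof -
 obtain R where R: "R > 0" "!!x. x : S ==> norm (D x) <= R" by (rule D_bound[OF S]) blast
 obtain L where L: "L > 0" "!!et et'. norm et <= R ==> norm et' <= R ==> \<bar>bb et - bb et'\<bar> <= L * norm (et - et')"
  by (rule bb_lipschitz[of R]) blast
 note k(1)[measurable]
 have [measurable]: "S : sets borel" using S by (simp add: borel_compact)
 have "integrable lborel (%x. (L * R * C) * indicator S x)"
  using emeasure_compact_finite[OF S(1)] by (intro integrable_mult_right) (simp add: integrable_indicator_iff)
 then show ?thesis
 proof (rule Bochner_Integration.integrable_bound)
  show "AE x in lborel. norm (bb (D x) * k x) <= norm (L * R * C * indicator S x)"
  proof (rule AE_I2)
   fix x
   show "norm (bb (D x) * k x) <= norm (L * R * C * indicator S x)"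
   proof (cases "x : S")
    case True
    have "\<bar>bb (D x)\<bar> <= L * norm (D x)" using L(2)[of "D x" 0] R True by (simp add: bb_def B_0)
    also have "... <= L * R" using R True L by simp
    finally have "\<bar>bb (D x)\<bar> * \<bar>k x\<bar> <= (L * R) * C" using k(2) L R by (intro mult_mono) auto
    then show ?thesis using True by (simp add: abs_mult) (metis abs_ge_self abs_mult order_trans)
   qed (use k(3) in simp)
  qed
 qed simp
qed

lemma G_integrable:
 assumes S: "compact S" "S <= U" and k: "k : borel_measurable borel" "!!x. \<bar>k x\<bar> <= C" "!!x. x ~: S ==> k x = 0"
 shows "integrable lborel (%x. G x * k x)"
proof -
 obtain L where L: "L > 0" "AE x in lborel. x : S --> \<bar>G x\<bar> <= L" using G_bd[OF S] by blast
 note k(1)[measurable] G_meas[measurable]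
 have [measurable]: "S : sets borel" using S by (simp add: borel_compact)
 have "integrable lborel (%x. (L * C) * indicator S x)"
  using emeasure_compact_finite[OF S(1)] by (intro integrable_mult_right) (simp add: integrable_indicator_iff)
 then show ?thesis
 proof (rule Bochner_Integration.integrable_bound)
  show "AE x in lborel. norm (G x * k x) <= norm (L * C * indicator S x)"
   using L(2)
  proof eventually_elim
   case (elim x)
   show ?case
   proof (cases "x : S")
    case True
    have "\<bar>G x\<bar> * \<bar>k x\<bar> <= L * C" using k(2) L elim True by (intro mult_mono) auto
    then show ?thesis using True by (simp add: abs_mult) (metis abs_ge_self abs_mult order_trans)
   qed (use k(3) in simp)
  qed
 qed simp
qed

lemma equation':
 assumes "C1c S ph" "S <= U"
 shows "(LBINT x. a (D x) \<bullet> grad ph x) + (LBINT x. bb (D x) * ph x) = (LBINT x. G x * ph x)"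
proof -
 have "(%x. a (D x) \<bullet> grad ph x) = (%x. A (norm (grad u x)) * (grad u x \<bullet> grad ph x))"
  using C1c_grad_0[OF assms(1)] assms(2) by (intro ext) (auto simp: a_def D_def subset_eq)
 moreover have "(%x. bb (D x) * ph x) = (%x. B (norm (grad u x)) * ph x)"
  using assms by (intro ext) (auto simp: bb_def D_def subset_eq C1c_def)
 ultimately show ?thesis using equation[OF assms] by simp
qed

lemma C1c_shift:
 assumes "C1c S ph"
 shows "C1c ((%x. x + c) ` S) (%x. ph (x - c))" "grad (%x. ph (x - c)) x = grad ph (x - c)"
proof -
 have G: "GDERIV (%x. ph (x - c)) x :> grad ph (x - c)" for x
  using GDERIV_translate[of ph x "-c"] GDERIV_grad[of ph "x - c"] assms by (simp add: C1c_def)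
 then show g: "grad (%x. ph (x - c)) x = grad ph (x - c)" for x by (simp add: GDERIV_iff_grad)
 have "continuous_on UNIV (%x. grad ph (x - c))" by (rule continuous_on_compose2[OF C1c_continuous_grad[OF assms]]) (auto intro!: continuous_intros)
 moreover have "ph (x - c) = 0" if "x ~: (%x. x + c) ` S" for x
 proof -
  have "x - c ~: S" using that by (metis diff_add_cancel image_eqI)
  then show ?thesis using assms by (simp add: C1c_def)
 qed
 ultimately show "C1c ((%x. x + c) ` S) (%x. ph (x - c))"
  using assms G by (auto simp: C1c_def g[abs_def] GDERIV_iff_grad compact_translation_subtract intro!: compact_continuous_image continuous_intros)
qed

text \<open>The equation is tested with \<open>w\<close> and with its translate by \<open>c\<close>,
  and the results are subtracted: a discrete form of the linearised equation.\<close>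

lemma difference_equation:
 assumes \<chi>: "C1c S w" and S: "S <= U" "(%x. x + c) ` S <= U"
 shows "integrable lborel (%x. (a (D (x + c)) - a (D x)) \<bullet> grad w x + (bb (D (x + c)) - bb (D x)) * w x - (G (x + c) - G x) * w x)"
  and "(LBINT x. (a (D (x + c)) - a (D x)) \<bullet> grad w x + (bb (D (x + c)) - bb (D x)) * w x - (G (x + c) - G x) * w x) = 0"
proof -
 note G_meas[measurable]
 have cS: "compact S" using \<chi> by (simp add: C1c_def)
 have [measurable]: "w : borel_measurable borel" by (rule C1c_measurable[OF \<chi>])
 have [measurable]: "grad w : borel_measurable borel" by (rule borel_measurable_continuous_onI[OF C1c_continuous_grad[OF \<chi>]])
 note \<chi>' = C1c_shift[OF \<chi>, of c]
 have cS': "compact ((%x. x + c) ` S)" using \<chi>'(1) by (simp add: C1c_def)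
 obtain C1 where C1: "!!x. norm (w x) <= C1" by (rule bounded_compact_support[OF cS C1c_continuous[OF \<chi>]]) (use \<chi> in \<open>auto simp: C1c_def\<close>)
 obtain C2 where C2: "!!x. norm (grad w x) <= C2" by (rule bounded_compact_support[OF cS C1c_continuous_grad[OF \<chi>] C1c_grad_0[OF \<chi>]]) auto
 have z: "w x = 0" "grad w x = 0" if "x ~: S" for x using \<chi> that C1c_grad_0[OF \<chi>] by (auto simp: C1c_def)
 have z': "w (x - c) = 0" "grad w (x - c) = 0" if "x ~: (%x. x + c) ` S" for x
 proof -
  have "x - c ~: S" using that by (metis diff_add_cancel image_eqI)
  then show "w (x - c) = 0" "grad w (x - c) = 0" using z by auto
 qed
 have i1: "integrable lborel (%x. a (D x) \<bullet> grad w x)" "integrable lborel (%x. bb (D x) * w x)" "integrable lborel (%x. G x * w x)"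
  using aD_integrable[OF cS S(1) _ C2 z(2)] bD_integrable[OF cS S(1) _ C1[unfolded real_norm_def] z(1)]
   G_integrable[OF cS S(1) _ C1[unfolded real_norm_def] z(1)] by auto
 have i2: "integrable lborel (%x. a (D x) \<bullet> grad w (x - c))" "integrable lborel (%x. bb (D x) * w (x - c))" "integrable lborel (%x. G x * w (x - c))"
  using aD_integrable[OF cS' S(2) _ C2 z'(2)] bD_integrable[OF cS' S(2) _ C1[unfolded real_norm_def] z'(1)]
   G_integrable[OF cS' S(2) _ C1[unfolded real_norm_def] z'(1)] by auto
 have i3: "integrable lborel (%x. a (D (x + c)) \<bullet> grad w x)" "integrable lborel (%x. bb (D (x + c)) * w x)" "integrable lborel (%x. G (x + c) * w x)"
  using lborel_integrable_shift[OF i2(1), of c] lborel_integrable_shift[OF i2(2), of c] lborel_integrable_shift[OF i2(3), of c] by auto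
 have s: "(LBINT x. a (D (x + c)) \<bullet> grad w x) = (LBINT x. a (D x) \<bullet> grad w (x - c))"
  "(LBINT x. bb (D (x + c)) * w x) = (LBINT x. bb (D x) * w (x - c))"
  "(LBINT x. G (x + c) * w x) = (LBINT x. G x * w (x - c))"
  using lborel_integral_shift[of "%x. a (D x) \<bullet> grad w (x - c)" c] lborel_integral_shift[of "%x. bb (D x) * w (x - c)" c]
   lborel_integral_shift[of "%x. G x * w (x - c)" c] by auto
 have e1: "(LBINT x. a (D (x + c)) \<bullet> grad w x) + (LBINT x. bb (D (x + c)) * w x) = (LBINT x. G (x + c) * w x)"
  using equation'[OF \<chi>'(1) S(2)] unfolding s \<chi>'(2) .
 have e0: "(LBINT x. a (D x) \<bullet> grad w x) + (LBINT x. bb (D x) * w x) = (LBINT x. G x * w x)"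
  by (rule equation'[OF \<chi> S(1)])
 show "integrable lborel (%x. (a (D (x + c)) - a (D x)) \<bullet> grad w x + (bb (D (x + c)) - bb (D x)) * w x - (G (x + c) - G x) * w x)"
  unfolding inner_diff_left left_diff_distrib using i1 i3 by (intro Bochner_Integration.integrable_diff Bochner_Integration.integrable_add)
 show "(LBINT x. (a (D (x + c)) - a (D x)) \<bullet> grad w x + (bb (D (x + c)) - bb (D x)) * w x - (G (x + c) - G x) * w x) = 0"
  unfolding inner_diff_left left_diff_distrib using i1 i3 e1 e0 by simp
qed

end

section \<open>Riesz representation in \<open>L\<^sup>2\<close>\<close>

lemma square_integrable_mult:
 fixes f g :: "'a => real"
 assumes [measurable]: "f : borel_measurable M" "g : borel_measurable M"
  and "integrable M (%x. (f x)^2)" "integrable M (%x. (g x)^2)"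
 shows "integrable M (%x. f x * g x)"
proof (rule Bochner_Integration.integrable_bound[of _ "%x. (f x)^2 + (g x)^2"])
 have "\<bar>f x * g x\<bar> <= (f x)^2 + (g x)^2" for x
 proof -
  have "0 <= (\<bar>f x\<bar> - \<bar>g x\<bar>)^2" by simp
  then have "2 * \<bar>f x * g x\<bar> <= (f x)^2 + (g x)^2" by (simp add: power2_diff abs_mult)
  then show ?thesis using abs_ge_zero[of "f x * g x"] by linarith
 qed
 then show "AE x in M. norm (f x * g x) <= norm ((f x)^2 + (g x)^2)" by (intro AE_I2) simp
qed (use assms in auto)

lemma square_integrable_lincomb:
 fixes f g :: "'a => real"
 assumes [measurable]: "f : borel_measurable M" "g : borel_measurable M"
  and i: "integrable M (%x. (f x)^2)" "integrable M (%x. (g x)^2)"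
 shows "integrable M (%x. (s * f x + t * g x)^2)"
  and "(\<integral>x. (s * f x + t * g x)^2 \<partial>M) = s^2 * (\<integral>x. (f x)^2 \<partial>M) + 2 * s * t * (\<integral>x. f x * g x \<partial>M) + t^2 * (\<integral>x. (g x)^2 \<partial>M)"
proof -
 note j = square_integrable_mult[OF assms]
 have e: "(%x. (s * f x + t * g x)^2) = (%x. s^2 * (f x)^2 + 2 * s * t * (f x * g x) + t^2 * (g x)^2)"
  by (intro ext) (simp add: power2_eq_square algebra_simps)
 show "integrable M (%x. (s * f x + t * g x)^2)" unfolding e using i j by auto
 show "(\<integral>x. (s * f x + t * g x)^2 \<partial>M) = s^2 * (\<integral>x. (f x)^2 \<partial>M) + 2 * s * t * (\<integral>x. f x * g x \<partial>M) + t^2 * (\<integral>x. (g x)^2 \<partial>M)"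
  unfolding e using i j by simp
qed

text \<open>At this rate the squared increments, even multiplied by \<open>2^n\<close>, have a
  finite sum of integrals. Hence almost everywhere the increments are bounded by a geometric
  sequence and the functions converge pointwise; Fatou's lemma transfers the norm bounds to the
  limit.\<close>

lemma L2_complete_fast:
 fixes ph :: "nat => 'a => real"
 assumes m[measurable]: "!!n. ph n : borel_measurable M" and i: "!!n. integrable M (%x. (ph n x)^2)"
  and c: "!!n k. n <= k ==> (\<integral>x. (ph n x - ph k x)^2 \<partial>M) <= 4 * (1/8)^n"
 obtains g where "g : borel_measurable M" "integrable M (%x. (g x)^2)" "!!n. (\<integral>x. (ph n x - g x)^2 \<partial>M) <= 4 * (1/8)^n"
proof -
 let ?d = "%n x. ph n x - ph (Suc n) x"
 let ?s = "%n x. 2^n * (?d n x)^2"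
 have id: "integrable M (%x. (ph n x - ph k x)^2)" for n k
  using square_integrable_lincomb(1)[OF m m i i, of 1 n "-1" k] by simp
 have nn: "(\<integral>\<^sup>+x. ennreal ((ph n x - ph k x)^2) \<partial>M) <= ennreal (4 * (1/8)^n)" if "n <= k" for n k
  using nn_integral_eq_integral[OF id[of n k]] c[OF that] by (simp add: ennreal_leI)
 have "(\<integral>\<^sup>+x. (\<Sum>n. ennreal (?s n x)) \<partial>M) = (\<Sum>n. \<integral>\<^sup>+x. ennreal (?s n x) \<partial>M)"
  by (rule nn_integral_suminf) measurable
 also have "... <= (\<Sum>n. ennreal (4 * (1/4)^n))"
 proof (rule suminf_le)
  fix n
  have "(\<integral>\<^sup>+x. ennreal (?s n x) \<partial>M) = ennreal (2^n) * (\<integral>\<^sup>+x. ennreal ((?d n x)^2) \<partial>M)"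
   by (subst nn_integral_cmult[symmetric]) (auto simp: ennreal_mult)
  also have "... <= ennreal (2^n) * ennreal (4 * (1/8)^n)" by (intro mult_left_mono nn) auto
  also have "... = ennreal (4 * (1/4)^n)" by (subst ennreal_mult[symmetric]) (auto simp: power_mult_distrib[symmetric] mult.left_commute)
  finally show "(\<integral>\<^sup>+x. ennreal (?s n x) \<partial>M) <= ennreal (4 * (1/4)^n)" .
 qed auto
 also have "... = ennreal (\<Sum>n. 4 * (1/4)^n)" by (intro suminf_ennreal2) (auto intro!: summable_mult summable_geometric)
 finally have "(\<integral>\<^sup>+x. (\<Sum>n. ennreal (?s n x)) \<partial>M) < \<infinity>" by (auto simp: le_less_trans)
 then have "AE x in M. (\<Sum>n. ennreal (?s n x)) ~= \<infinity>" by (intro nn_integral_PInf_AE) auto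
 then have conv: "AE x in M. (%n. ph n x) ~~> lim (%n. ph n x)"
 proof eventually_elim
  case (elim x)
  then have "summable (%n. ?s n x)" by (intro summable_suminf_not_top) auto
  then have "(%n. ?s n x) ~~> 0" by (rule summable_LIMSEQ_zero)
  then have "Bseq (%n. ?s n x)" by (rule convergent_imp_Bseq[OF convergentI])
  then obtain K where K: "K > 0" "!!n. \<bar>?s n x\<bar> <= K" unfolding Bseq_def by auto
  have bd: "\<bar>?d n x\<bar> <= sqrt K * (1 / sqrt 2)^n" for n
  proof -
   have "(?d n x)^2 <= K / 2^n" using K(2)[of n] by (simp add: field_simps abs_mult)
   then have "\<bar>?d n x\<bar> <= sqrt (K / 2^n)" using real_sqrt_le_mono by fastforce
   then show ?thesis by (simp add: real_sqrt_divide real_sqrt_power power_divide)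
  qed
  have "summable (%n. sqrt K * (1 / sqrt 2)^n)" by (intro summable_mult summable_geometric) auto
  then have "summable (%n. ph (Suc n) x - ph n x)"
   by (rule summable_comparison_test'[where N = 0]) (use bd in \<open>auto simp: abs_minus_commute\<close>)
  then have "convergent (%n. \<Sum>k<n. ph (Suc k) x - ph k x)" by (simp add: summable_iff_convergent)
  then have "convergent (%n. ph n x - ph 0 x)" by (simp only: sum_lessThan_telescope[of "%n. ph n x"])
  then obtain l where "(%n. ph n x - ph 0 x) ~~> l" by (auto simp: convergent_def)
  from tendsto_add[OF this tendsto_const[of "ph 0 x"]] have "convergent (%n. ph n x)" by (auto simp: convergent_def)
  then show ?case by (simp add: convergent_LIMSEQ_iff)
 qed
 define g where "g x = lim (%n. ph n x)" for x
 have gm[measurable]: "g : borel_measurable M" unfolding g_def by measurable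
 have lim: "AE x in M. (%n. ph n x) ~~> g x" using conv by (simp add: g_def)
 have ng: "(\<integral>\<^sup>+x. ennreal ((ph n x - g x)^2) \<partial>M) <= ennreal (4 * (1/8)^n)" for n
 proof -
  have "(\<integral>\<^sup>+x. ennreal ((ph n x - g x)^2) \<partial>M) = (\<integral>\<^sup>+x. liminf (%k. ennreal ((ph n x - ph k x)^2)) \<partial>M)"
  proof (rule nn_integral_cong_AE)
   show "AE x in M. ennreal ((ph n x - g x)^2) = liminf (%k. ennreal ((ph n x - ph k x)^2))"
    using lim
   proof eventually_elim
    case (elim x)
    have "(%k. ennreal ((ph n x - ph k x)^2)) ~~> ennreal ((ph n x - g x)^2)"
     by (intro tendsto_ennrealI tendsto_intros elim)
    then show ?case using lim_imp_Liminf[OF sequentially_bot] by metis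
   qed
  qed
  also have "... <= liminf (%k. \<integral>\<^sup>+x. ennreal ((ph n x - ph k x)^2) \<partial>M)" by (rule nn_integral_liminf) measurable
  also have "... <= liminf (%k. ennreal (4 * (1/8)^n))" by (intro Liminf_mono eventually_sequentiallyI[of n] nn)
  also have "... = ennreal (4 * (1/8)^n)" by (simp add: Liminf_const)
  finally show ?thesis .
 qed
 have ig: "integrable M (%x. (ph n x - g x)^2)" for n
  by (rule integrableI_nonneg) (use ng[of n] in \<open>auto simp: le_less_trans[OF _ ennreal_less_top]\<close>)
 show ?thesis
 proof (rule that[OF gm])
  have "integrable M (%x. (1 * ph 0 x + (-1) * (ph 0 x - g x))^2)" by (rule square_integrable_lincomb(1)[OF _ _ i ig]) measurable
  then show "integrable M (%x. (g x)^2)" by simp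
  fix n
  show "(\<integral>x. (ph n x - g x)^2 \<partial>M) <= 4 * (1/8)^n"
   using ng[of n] nn_integral_eq_integral[OF ig[of n]] by (simp add: ennreal_le_iff)
 qed
qed

text \<open>The hypothesis on \<open>l\<close> says that
  the functional minimised in the proof is bounded below; it is equivalent to boundedness of \<open>l\<close>.\<close>
lemma riesz_L2:
 fixes T :: "('a => real) set" and l :: "('a => real) => real"
 assumes ne: "T ~= {}" and lin: "!!ph ps s t. ph : T ==> ps : T ==> (%x. s * ph x + t * ps x) : T"
  and m: "!!ph. ph : T ==> ph : borel_measurable M" and i: "!!ph. ph : T ==> integrable M (%x. (ph x)^2)"
  and l: "!!ph ps s t. ph : T ==> ps : T ==> l (%x. s * ph x + t * ps x) = s * l ph + t * l ps"
  and bd: "!!ph. ph : T ==> 2 * l ph <= C + (\<integral>x. (ph x)^2 \<partial>M)"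
 obtains g where "g : borel_measurable M" "integrable M (%x. (g x)^2)" "!!ph. ph : T ==> l ph = (\<integral>x. g x * ph x \<partial>M)"
proof -
 let ?ip = "%f g. \<integral>x. f x * g x \<partial>M" and ?sq = "%f. \<integral>x. (f x)^2 \<partial>M"
 define J where "J ph = ?sq ph - 2 * l ph" for ph
 have J: "J (%x. s * ph x + t * ps x) = s^2 * ?sq ph + 2 * s * t * ?ip ph ps + t^2 * ?sq ps - 2 * (s * l ph + t * l ps)"
  if "ph : T" "ps : T" for ph ps s t
  unfolding J_def using square_integrable_lincomb(2)[OF m m i i, of ph ps s t] l[OF that, of s t] that by simp
 have "- C <= J ph" if "ph : T" for ph using bd[OF that] by (simp add: J_def)
 then have bdb: "bdd_below (J ` T)" by (rule bdd_belowI2)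
 define J0 where "J0 = Inf (J ` T)"
 have J0: "J0 <= J ph" if "ph : T" for ph unfolding J0_def using bdb that by (auto intro: cInf_lower)
 have "\<exists>ph\<in>T. J ph < J0 + (1/8)^n" for n :: nat
 proof -
  have "Inf (J ` T) < J0 + (1/8)^n" by (simp add: J0_def)
  then show ?thesis using ne bdb by (subst (asm) cInf_less_iff) auto
 qed
 then obtain ph where ph: "!!n::nat. ph n : T" "!!n. J (ph n) < J0 + (1/8)^n" by metis
 \<comment> \<open>Parallelogram identity: \<open>J\<close> at the midpoint of two near-minimisers
   cannot lie below \<open>J0\<close>, which forces them to be close. The tolerance
   \<open>(1/8)^n\<close> was chosen so that the result has the rate of
   \<open>L2_complete_fast\<close>.\<close>
 have cau: "(\<integral>x. (ph n x - ph k x)^2 \<partial>M) <= 4 * (1/8)^n" if "n <= k" for n k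
 proof -
  have e1: "(\<integral>x. (ph n x - ph k x)^2 \<partial>M) = ?sq (ph n) - 2 * ?ip (ph n) (ph k) + ?sq (ph k)"
   using square_integrable_lincomb(2)[OF m m i i, of "ph n" "ph k" 1 "-1"] ph(1) by simp
  have "J0 <= J (%x. (1/2) * ph n x + (1/2) * ph k x)" by (intro J0 lin ph)
  then have "4 * J0 <= ?sq (ph n) + 2 * ?ip (ph n) (ph k) + ?sq (ph k) - 4 * (l (ph n) + l (ph k))"
   unfolding J[OF ph(1) ph(1)] by (simp add: power2_eq_square field_simps)
  moreover have "2 * J (ph n) + 2 * J (ph k) <= 4 * J0 + 4 * (1/8)^n"
  proof -
   have "(1/8::real)^k <= (1/8)^n" using that by (intro power_decreasing) auto
   then show ?thesis using ph(2)[of n] ph(2)[of k] by linarith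
  qed
  have "4 * J0 <= na + 2 * nx + nb - 4 * (ln + lk) ==> 2 * (na - 2 * ln) + 2 * (nb - 2 * lk) <= 4 * J0 + q ==>
    na - 2 * nx + nb <= q" for na nx nb ln lk q :: real by argo
  note this[of "?sq (ph n)" "?ip (ph n) (ph k)" "?sq (ph k)" "l (ph n)" "l (ph k)" "4 * (1/8)^n"]
  then show ?thesis unfolding e1 using \<open>4 * J0 <= _\<close> \<open>2 * J (ph n) + 2 * J (ph k) <= _\<close> unfolding J_def by blast
 qed
 obtain g where g: "g : borel_measurable M" "integrable M (%x. (g x)^2)" "!!n. (\<integral>x. (ph n x - g x)^2 \<partial>M) <= 4 * (1/8)^n"
  by (rule L2_complete_fast[of ph M]) (use ph(1) m i cau in blast)+
 note [measurable] = g(1)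
 have "l ps = ?ip g ps" if ps: "ps : T" for ps
 proof -
  note [measurable] = m[OF ps] m[OF ph(1)]
  define P where "P = ?sq ps"
  have idg: "integrable M (%x. (ph n x - g x)^2)" for n
   using square_integrable_lincomb(1)[OF _ _ i[OF ph(1)] g(2), of n 1 "-1"] m[OF ph(1)] by simp
  have lim: "(%n. ?ip (ph n) ps) ~~> ?ip g ps"
  proof -
   have "\<bar>?ip (ph n) ps - ?ip g ps\<bar> <= (4 + P) * (1/2)^n" for n
   proof -
    have ii: "integrable M (%x. ph n x * ps x)" "integrable M (%x. g x * ps x)"
     by (rule square_integrable_mult[OF _ _ i[OF ph(1)] i[OF ps]] square_integrable_mult[OF _ _ g(2) i[OF ps]]; measurable)+
    have id': "integrable M (%x. (ph n x - g x) * ps x)" using ii by (simp add: left_diff_distrib)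
    have f1: "?ip (ph n) ps - ?ip g ps = (\<integral>x. (ph n x - g x) * ps x \<partial>M)"
     using ii by (simp add: left_diff_distrib)
    have f2: "\<bar>\<integral>x. (ph n x - g x) * ps x \<partial>M\<bar> <= (\<integral>x. \<bar>(ph n x - g x) * ps x\<bar> \<partial>M)" by (rule integral_abs_bound)
    have f3: "(\<integral>x. \<bar>(ph n x - g x) * ps x\<bar> \<partial>M) <= (\<integral>x. 2^n * (ph n x - g x)^2 + (1/2)^n * (ps x)^2 \<partial>M)"
    proof (rule integral_mono)
     show "integrable M (%x. \<bar>(ph n x - g x) * ps x\<bar>)" using id' by (rule integrable_abs)
     show "integrable M (%x. 2^n * (ph n x - g x)^2 + (1/2)^n * (ps x)^2)" using idg i[OF ps] by simp
     fix x
     have "0 <= (1/2)^n * (2^n * \<bar>ph n x - g x\<bar> - \<bar>ps x\<bar>)^2" by simp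
     also have "... = 2^n * (ph n x - g x)^2 + (1/2)^n * (ps x)^2 - 2 * \<bar>(ph n x - g x) * ps x\<bar>"
     proof -
      have "(1/2)^n * (2^n * s - t)^2 = 2^n * s^2 + (1/2)^n * t^2 - 2 * (s * t)" for s t :: real
       by (simp add: power2_eq_square field_simps power_one_over)
      then show ?thesis by (simp add: abs_mult)
     qed
     finally show "\<bar>(ph n x - g x) * ps x\<bar> <= 2^n * (ph n x - g x)^2 + (1/2)^n * (ps x)^2"
      using abs_ge_zero[of "(ph n x - g x) * ps x"] by linarith
    qed
    have f4: "(\<integral>x. 2^n * (ph n x - g x)^2 + (1/2)^n * (ps x)^2 \<partial>M) = 2^n * (\<integral>x. (ph n x - g x)^2 \<partial>M) + (1/2)^n * P"
     using idg i[OF ps] by (simp add: P_def)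
    have f5: "2^n * (\<integral>x. (ph n x - g x)^2 \<partial>M) <= 2^n * (4 * (1/8)^n)" by (intro mult_left_mono g(3)) auto
    have f6: "2^n * (4 * (1/8::real)^n) = 4 * (1/4)^n" by (simp add: power_mult_distrib[symmetric] mult.left_commute)
    have f7: "(1/4::real)^n <= (1/2)^n" by (intro power_mono) auto
    have A: "\<bar>?ip (ph n) ps - ?ip g ps\<bar> <= 2^n * (\<integral>x. (ph n x - g x)^2 \<partial>M) + (1/2)^n * P"
     unfolding f1 using order_trans[OF f2 f3] unfolding f4 .
    have "2^n * (\<integral>x. (ph n x - g x)^2 \<partial>M) <= 4 * (1/2)^n"
     using f5 unfolding f6 by (rule order_trans) (rule mult_left_mono[OF f7], simp)
    from order_trans[OF A add_right_mono[OF this]] show ?thesis by (simp add: distrib_right mult.commute[of P])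
   qed
   moreover have "(%n. (4 + P) * (1/2)^n) ~~> 0" by (intro tendsto_mult_right_zero LIMSEQ_power_zero) auto
   ultimately have "(%n. ?ip (ph n) ps - ?ip g ps) ~~> 0"
    by (intro Lim_null_comparison[where f = "%n. ?ip (ph n) ps - ?ip g ps"]) auto
   then show ?thesis by (simp add: LIM_zero_iff)
  qed
  \<comment> \<open>First variation of \<open>J\<close> in the direction \<open>ps\<close>.
    Near-minimisers satisfy it up to \<open>(1/8)^n\<close>, and the inner products
    converge.\<close>
  have el: "0 <= 2 * t * (?ip g ps - l ps) + t^2 * P" for t
  proof (rule LIMSEQ_le)
   show "(%n. - ((1/8)^n)) ~~> (0::real)" using tendsto_minus[OF LIMSEQ_power_zero[of "1/8::real"]] by simp
   show "(%n. 2 * t * (?ip (ph n) ps - l ps) + t^2 * P) ~~> 2 * t * (?ip g ps - l ps) + t^2 * P"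
    by (intro tendsto_intros lim)
   have "- ((1/8)^n) <= 2 * t * (?ip (ph n) ps - l ps) + t^2 * P" for n
   proof -
    have "J0 <= J (%x. 1 * ph n x + t * ps x)" by (intro J0 lin ph ps)
    also have "... = J (ph n) + 2 * t * (?ip (ph n) ps - l ps) + t^2 * P"
     unfolding J[OF ph(1) ps] P_def by (simp add: J_def algebra_simps)
    finally show ?thesis using ph(2)[of n] by linarith
   qed
   then show "\<exists>N. \<forall>n\<ge>N. - ((1/8)^n) <= 2 * t * (?ip (ph n) ps - l ps) + t^2 * P" by blast
  qed
  define X where "X = ?ip g ps - l ps"
  have P: "P >= 0" by (simp add: P_def)
  have "X = 0"
  proof (rule ccontr)
   assume "X ~= 0"
   \<comment> \<open>This t makes the quadratic negative unless \<open>X\<close> is zero;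
     \<open>P + 1\<close> is taken because \<open>P\<close> itself may vanish.\<close>
   have "0 <= 2 * (- X / (P + 1)) * X + (- X / (P + 1))^2 * P" using el[of "- X / (P + 1)"] by (simp add: X_def)
   also have "... = - (X^2 * (P + 2)) / (P + 1)^2"
    using P by (simp add: power2_eq_square field_simps add_nonneg_eq_0_iff)
   finally have "X^2 * (P + 2) / (P + 1)^2 <= 0" by simp
   moreover have "X^2 * (P + 2) / (P + 1)^2 > 0" using \<open>X ~= 0\<close> P by simp
   ultimately show False by linarith
  qed
  then show ?thesis by (simp add: X_def)
 qed
 then show ?thesis using that g by blast
qed

section \<open>Second derivatives off the critical set\<close>

lemma test_fun_lincomb:
 assumes "ph : test_fun U" "ps : test_fun U"
 shows "(%x. s * ph x + t * ps x) : test_fun U"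
proof -
 obtain S where S: "S <= U" "compact S" "!!x. x ~: S ==> ph x = 0" "!!m. Ck_on m UNIV ph" by (rule test_funE[OF assms(1)]) blast
 obtain S' where S': "S' <= U" "compact S'" "!!x. x ~: S' ==> ps x = 0" "!!m. Ck_on m UNIV ps" by (rule test_funE[OF assms(2)]) blast
 show ?thesis by (rule test_funI[of _ "S \<union> S'"]) (use S S' in \<open>auto intro!: Ck_on_add Ck_on_mult Ck_on_const\<close>)
qed

lemma pderiv_at_lincomb:
 assumes "C1c S ph" "C1c S' ps"
 shows "pderiv_at i (%x. s * ph x + t * ps x) x = s * pderiv_at i ph x + t * pderiv_at i ps x"
proof -
 have "GDERIV (%x. s * ph x + t * ps x) x :> (s *R grad ph x + ph x *R 0) + (t *R grad ps x + ps x *R 0)"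
  by (intro GDERIV_add GDERIV_mult GDERIV_const GDERIV_grad) (use assms in \<open>auto simp: C1c_def\<close>)
 from GDERIV_imp_pderiv_at[OF this, of i] show ?thesis by simp
qed

definition hs :: "nat => real" where "hs n = inverse (real (Suc n))"

lemma hs_pos: "hs n > 0" and hs_le: "hs n <= 1" and hs_lim: "hs ~~> 0"
 using LIMSEQ_inverse_real_of_nat by (auto simp: hs_def[abs_def] inverse_le_1_iff)

lemma hs_at_0: "filterlim hs (at 0) sequentially"
 using hs_lim hs_pos by (auto simp: filterlim_at intro!: always_eventually less_imp_neq[symmetric])

lemma hs_eventually_less: "d > 0 ==> \<forall>\<^sub>F n in sequentially. hs n < d"
 using order_tendstoD(2)[OF hs_lim] .

lemma DERIV_hs:
 fixes g :: "real^'n => real"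
 assumes "((%t. g (x + t *R e)) has_real_derivative c) (at 0)"
 shows "(%n. (g (x + hs n *R e) - g x) / hs n) ~~> c"
proof -
 have "((%t. (g (x + t *R e) - g x) / t) \<longlongrightarrow> c) (at 0)" using assms by (simp add: DERIV_def)
 then show ?thesis by (rule filterlim_compose[OF _ hs_at_0])
qed

lemma integrable_bounded_compact:
 fixes f :: "real^'n => real"
 assumes "compact S" "f : borel_measurable borel" "!!x. x : S ==> \<bar>f x\<bar> <= C" "!!x. x ~: S ==> f x = 0"
 shows "integrable lborel f"
proof -
 have "integrable lborel (%x. C * indicator S x)"
  using emeasure_compact_finite[OF assms(1)] assms(1) by (intro integrable_mult_right) (simp add: integrable_indicator_iff borel_compact)
 then show ?thesis
 proof (rule Bochner_Integration.integrable_bound)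
  show "AE x in lborel. norm (f x) <= norm (C * indicator S x)"
  proof (rule AE_I2)
   fix x show "norm (f x) <= norm (C * indicator S x)" using assms(3)[of x] assms(4)[of x] by (cases "x : S") auto
  qed
 qed (use assms in simp)
qed

text \<open>Young's inequality at the scale of the increment: a linear term without the factor 1/h
  costs half of the main term and an error of order h only.\<close>

lemma quadratic_absorb:
 fixes c h s Q :: real
 assumes "c > 0" "h > 0"
 shows "c * s^2 / h - Q * s >= c / 2 * s^2 / h - Q^2 / (2 * c) * h"
proof -
 have "0 <= (c * s - Q * h)^2 / (2 * c * h)" using assms by simp
 also have "... = (c * s^2 / h - Q * s) - (c / 2 * s^2 / h - Q^2 / (2 * c) * h)" using assms by (simp add: power2_eq_square field_simps)
 finally show ?thesis by (simp only: diff_ge_0_iff_ge)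
qed

section \<open>Difference quotients of the solution and the nondegenerate estimate\<close>

context local_solution
begin

definition V :: "(real^'n) set" where "V = {x : U. D x ~= 0}"

lemma V_open: "open V"
proof -
 have "open (U \<inter> D -` (- {0}))" by (rule continuous_open_preimage[OF D_cont U]) auto
 moreover have "U \<inter> D -` (- {0}) = V" by (auto simp: V_def)
 ultimately show ?thesis by simp
qed

lemma V_subset: "V <= U" by (auto simp: V_def)

text \<open>The admissible substitute for u_i: it is C1 because \<open>u\<close> is, and its
  gradient is the difference quotient of \<open>D\<close>, the quantity to be estimated.\<close>

definition w :: "real => 'n => real^'n => real" where
 "w h i x = (u (x + h *R axis i 1) - u x) / h"

lemma w_GDERIV:
 assumes "x : U" "x + h *R axis i 1 : U"
 shows "GDERIV (w h i) x :> (1 / h) *R (D (x + h *R axis i 1) - D x)"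
proof -
 have "GDERIV (%x. (1 / h) * (u (x + h *R axis i 1) - u x)) x :>
   (1 / h) *R (D (x + h *R axis i 1) - D x) + (u (x + h *R axis i 1) - u x) *R 0"
  unfolding D_U[OF assms(1)] D_U[OF assms(2)] by (intro GDERIV_mult GDERIV_const GDERIV_diff GDERIV_translate[OF GDERIV_grad] GDERIV_grad u_diff assms)
 then show ?thesis by (simp add: w_def[abs_def])
qed

lemma w_bound:
 assumes "h > 0" "!!t. t : {0..h} ==> x + t *R axis i 1 : U & norm (D (x + t *R axis i 1)) <= R"
 shows "\<bar>w h i x\<bar> <= R"
proof -
 obtain z where z: "0 < z" "z < h" "u (x + h *R axis i 1) - u x = h * (axis i 1 \<bullet> grad u (x + z *R axis i 1))"
  by (rule mvt_direction[OF assms(1)]) (use assms(2) u_diff in auto)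
 have "\<bar>w h i x\<bar> = \<bar>axis i 1 \<bullet> D (x + z *R axis i 1)\<bar>"
  using z assms D_U[of "x + z *R axis i 1"] by (simp add: w_def abs_mult)
 also have "... <= norm (axis i (1::real)) * norm (D (x + z *R axis i 1))" by (rule Cauchy_Schwarz_ineq2)
 also have "... <= R" using assms(2)[of z] z by simp
 finally show ?thesis .
qed

text \<open>Caccioppoli estimate for difference quotients near a point where the equation is nondegenerate.\<close>
lemma nondegenerate_bound:
 assumes x0: "x0 : V"
 shows "\<exists>r>0. \<exists>C. ball x0 r <= V & (\<forall>i h. 0 < h & h < r -->
   integrable lborel (%x. indicator (ball x0 r) x * (norm (D (x + h *R axis i 1) - D x))^2) \<and>
   (LBINT x. indicator (ball x0 r) x * (norm (D (x + h *R axis i 1) - D x))^2) <= C * h^2)"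
proof -
 \<comment> \<open>With this choice and \<open>R = 3 * ep\<close>, continuity keeps the norm of the
   gradient between one half and three halves of its value at \<open>x0\<close>, where
   \<open>a\<close> is Lipschitz and strongly monotone.\<close>
 define ep where "ep = norm (D x0) / 2"
 define R where "R = 3 * ep"
 have ep: "ep > 0" "ep <= R" "R > 0" using x0 by (auto simp: ep_def R_def V_def)
 have "open (U \<inter> D -` ball (D x0) ep)" by (rule continuous_open_preimage[OF D_cont U]) auto
 moreover have "x0 : U \<inter> D -` ball (D x0) ep" using x0 ep by (auto simp: V_def)
 ultimately obtain r3 where r3: "r3 > 0" "cball x0 r3 <= U \<inter> D -` ball (D x0) ep" using open_contains_cball by blast
 \<comment> \<open>Three radii: the cut-off is 1 up to r and supported within 2r, and shifts by less
   than r stay within 3r, where the gradient is under control.\<close>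
 define r where "r = r3 / 3"
 have r: "r > 0" "cball x0 (3 * r) <= U" using r3 by (auto simp: r_def)
 have Dn: "ep <= norm (D x)" "norm (D x) <= R" if "x : cball x0 (3 * r)" for x
 proof -
  have "norm (D x0 - D x) < ep" using that r3 by (auto simp: r_def dist_norm)
  then show "ep <= norm (D x)" "norm (D x) <= R"
   using norm_triangle_ineq2[of "D x0" "D x"] norm_triangle_ineq3[of "D x0" "D x"] by (auto simp: ep_def R_def)
 qed
 obtain L where L: "L > 0" "!!et et'. ep <= norm et ==> norm et <= R ==> ep <= norm et' ==> norm et' <= R ==> norm (a et - a et') <= L * norm (et - et')"
  by (rule a_lipschitz[OF ep(1,2)]) blast
 obtain c where c: "c > 0" "!!et et'. ep <= norm et ==> norm et <= R ==> ep <= norm et' ==> norm et' <= R ==>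
   c * (norm (et - et'))^2 <= (a et - a et') \<bullet> (et - et')" by (rule a_monotone[OF ep(1,2)]) blast
 obtain LB where LB: "LB > 0" "!!et et'. norm et <= R ==> norm et' <= R ==> \<bar>bb et - bb et'\<bar> <= LB * norm (et - et')" by (rule bb_lipschitz[of R]) blast
 obtain ps where ps: "ps : test_fun (ball x0 (2 * r))" "!!x. 0 <= ps x" "!!x. ps x <= 1" "!!x. x : cball x0 r ==> ps x = 1"
  by (rule smooth_cutoff[of "cball x0 r" "ball x0 (2 * r)"]) (use r in \<open>auto simp: subset_eq\<close>)
 obtain S where S: "C1c S ps" "S <= ball x0 (2 * r)" "compact S" "!!x. x ~: S ==> ps x = 0" by (rule test_funE[OF ps(1)]) blast
 note [measurable] = C1c_measurable[OF S(1)]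
 obtain P where P: "P > 0" "!!x. norm (grad ps x) <= P" using bounded_compact_support[OF S(3) C1c_continuous_grad[OF S(1)] C1c_grad_0[OF S(1)]] by blast
 have SU: "S <= U" using S(2) r by (auto simp: subset_eq)
 obtain LG de where LG: "LG > 0" "de > 0" "!!i h. 0 < h ==> h < de ==> AE x in lborel. x : S --> \<bar>G (x + h *R axis i 1) - G x\<bar> <= LG * h"
  using G_lip[OF S(3) SU] by blast
 \<comment> \<open>The coefficient of the terms linear in the increment of the gradient: one from
   the gradient of the cut-off, one from \<open>bb\<close>. In \<open>K\<close> it enters after
   absorption, and \<open>LG * R\<close> bounds the increment of \<open>G\<close>.\<close>
 define Q where "Q = 2 * R * L * P + LB * R"
 define K where "K = Q^2 / (2 * c) + LG * R"
 define mS :: real where "mS = (LBINT x. indicator S x)"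
 define r' where "r' = min r de"
 have r': "r' > 0" "r' <= r" "r' <= de" using r LG by (auto simp: r'_def)
 have main: "integrable lborel (%x. indicator (ball x0 r') x * (norm (D (x + h *R axis i 1) - D x))^2) \<and>
   (LBINT x. indicator (ball x0 r') x * (norm (D (x + h *R axis i 1) - D x))^2) <= (2 * K * mS / c) * h^2"
  if h: "0 < h" "h < r'" for i h
 proof -
  define e :: "real^'n" where "e = axis i 1"
  define \<Delta> where "\<Delta> x = D (x + h *R e) - D x" for x
  have [measurable]: "\<Delta> : borel_measurable borel" unfolding \<Delta>_def by measurable
  have seg: "x + t *R e : cball x0 (3 * r)" if "x : ball x0 (2 * r)" "t : {0..h}" for x t
  proof -
   have "dist x0 (x + t *R e) <= dist x0 x + norm (t *R e)" using norm_triangle_ineq4[of "x0 - x" "t *R e"] by (simp add: dist_norm diff_diff_eq)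
   then show ?thesis using that h r' by (simp add: e_def)
  qed
  have wR: "\<bar>w h i x\<bar> <= R" if "x : ball x0 (2 * r)" for x
   by (rule w_bound[OF h(1)]) (use seg[OF that] Dn(2) r(2) in \<open>auto simp: e_def[symmetric]\<close>)
  have bU: "ball x0 (2 * r) <= U" using r by (auto simp: subset_eq)
  let ?G = "%x. (ps x)^2 *R ((1 / h) *R \<Delta> x) + (2 * ps x * w h i x) *R grad ps x"
  have GD: "GDERIV (%x. (ps x)^2 * w h i x) x :> ?G x" if "x : ball x0 (2 * r)" for x
   unfolding \<Delta>_def e_def
   by (rule grad_square_mult[OF GDERIV_grad w_GDERIV]) (use S(1) that bU seg[OF that, of h] r(2) h in \<open>auto simp: C1c_def e_def\<close>)
  have cw: "continuous_on (ball x0 (2 * r)) (w h i)"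
   using w_GDERIV[of _ h i] seg[of _ h] bU r(2) h
   by (intro continuous_at_imp_continuous_on ballI differentiable_imp_continuous_within) (fastforce simp: GDERIV_iff_grad e_def)
  have cD: "continuous_on (ball x0 (2 * r)) \<Delta>"
   unfolding \<Delta>_def using seg[of _ h] r(2) h bU by (intro continuous_intros continuous_on_compose2[OF D_cont] continuous_on_subset[OF D_cont]) auto
  have cG: "continuous_on (ball x0 (2 * r)) ?G" by (intro continuous_intros cw cD C1c_continuous[OF S(1)] C1c_continuous_grad[OF S(1)])
  note X = C1cI[OF S(3) open_ball S(2) GD cG]
  have X1: "C1c S (%x. (ps x)^2 * w h i x)" by (rule X(1)) (use S(4) in auto)
  have X2: "grad (%x. (ps x)^2 * w h i x) x = ?G x" if "x : S" for x by (rule X(2)) (use S(2,4) that in auto)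
  have S': "(%x. x + h *R e) ` S <= U"
  proof (rule image_subsetI)
   fix x assume "x : S"
   then have "x + h *R e : cball x0 (3 * r)" using S(2) h by (intro seg) auto
   then show "x + h *R e : U" using r(2) by blast
  qed
  define I where "I x = (a (D (x + h *R e)) - a (D x)) \<bullet> grad (%x. (ps x)^2 * w h i x) x
    + (bb (D (x + h *R e)) - bb (D x)) * ((ps x)^2 * w h i x) - (G (x + h *R e) - G x) * ((ps x)^2 * w h i x)" for x
  have I: "integrable lborel I" "(LBINT x. I x) = 0"
   unfolding I_def using difference_equation[OF X1 SU S'] by auto
  define F where "F x = (ps x)^2 * (norm (\<Delta> x))^2" for x
  have Fm[measurable]: "F : borel_measurable borel" unfolding F_def by measurable
  have \<Delta>R: "norm (\<Delta> x) <= 2 * R" if "x : S" for x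
  proof -
   have "x : ball x0 (2 * r)" using that S(2) by blast
   then have "x + h *R e : cball x0 (3 * r)" "x : cball x0 (3 * r)" using seg[of x h] h r by auto
   from Dn(2)[OF this(1)] Dn(2)[OF this(2)] show ?thesis
    using norm_triangle_ineq4[of "D (x + h *R e)" "D x"] by (simp add: \<Delta>_def)
  qed
  have Fi: "integrable lborel F"
  proof (rule integrable_bounded_compact[OF S(3) Fm, of "(2 * R)^2"])
   fix x assume "x : S"
   then show "\<bar>F x\<bar> <= (2 * R)^2" unfolding F_def abs_mult abs_power2
    using power_mono[OF \<Delta>R[of x], of 2] power_le_one[OF ps(2,3), of x 2] mult_mono[of "(ps x)^2" 1 "(norm (\<Delta> x))^2" "(2 * R)^2"] by simp
  qed (use S(4) in \<open>simp add: F_def\<close>)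
  have "AE x in lborel. x : S --> \<bar>G (x + h *R e) - G x\<bar> <= LG * h" unfolding e_def by (rule LG(3)) (use h r' in auto)
  \<comment> \<open>\<open>I\<close> integrates to zero, so this bound says that 1/h times the
    integral of \<open>F\<close> is at most a constant times h, which is the required order
    h^2.\<close>
  then have low: "AE x in lborel. c / (2 * h) * F x - (K * h) * indicator S x <= I x"
  proof eventually_elim
   case (elim x)
   show ?case
   proof (cases "x : S")
    case False
    then show ?thesis using S(4) C1c_grad_0[OF X1] by (simp add: F_def I_def)
   next
    case True
    then have xb: "x : ball x0 (2 * r)" using S(2) by auto
    have x3: "x : cball x0 (3 * r)" "x + h *R e : cball x0 (3 * r)" using seg[OF xb, of h] xb h r by auto
    define s where "s = ps x * norm (\<Delta> x)"
    have s0: "s >= 0" using ps(2) by (simp add: s_def)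
    have w1: "\<bar>w h i x\<bar> <= R" by (rule wR[OF xb])
    have p1: "\<bar>ps x\<bar> <= 1" "(ps x)^2 <= ps x" using ps(2,3)[of x] by (auto simp: power2_eq_square mult_left_le)
    let ?da = "a (D (x + h *R e)) - a (D x)"
    have da: "norm ?da <= L * norm (\<Delta> x)" unfolding \<Delta>_def using Dn[OF x3(1)] Dn[OF x3(2)] by (intro L(2))
    have mono: "c * (norm (\<Delta> x))^2 <= ?da \<bullet> \<Delta> x" unfolding \<Delta>_def using Dn[OF x3(1)] Dn[OF x3(2)] by (intro c(2))
    have t1: "?da \<bullet> grad (%x. (ps x)^2 * w h i x) x = (ps x)^2 / h * (?da \<bullet> \<Delta> x) + 2 * ps x * w h i x * (?da \<bullet> grad ps x)"
     unfolding X2[OF True] by (simp add: inner_add_right)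
    have "(ps x)^2 / h * (c * (norm (\<Delta> x))^2) <= (ps x)^2 / h * (?da \<bullet> \<Delta> x)" by (intro mult_left_mono mono) (use h in auto)
    then have t2: "c * s^2 / h <= (ps x)^2 / h * (?da \<bullet> \<Delta> x)" by (simp add: s_def power_mult_distrib mult_ac)
    have "\<bar>?da \<bullet> grad ps x\<bar> <= norm ?da * norm (grad ps x)" by (rule Cauchy_Schwarz_ineq2)
    also have "... <= (L * norm (\<Delta> x)) * P" by (intro mult_mono da P) (use L in auto)
    finally have "\<bar>w h i x\<bar> * \<bar>?da \<bullet> grad ps x\<bar> <= R * (L * norm (\<Delta> x) * P)" using w1 ep by (intro mult_mono) auto
    then have "2 * ps x * (\<bar>w h i x\<bar> * \<bar>?da \<bullet> grad ps x\<bar>) <= 2 * ps x * (R * (L * norm (\<Delta> x) * P))" using ps(2) by (intro mult_left_mono) auto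
    then have t3: "\<bar>2 * ps x * w h i x * (?da \<bullet> grad ps x)\<bar> <= (2 * R * L * P) * s" using ps(2)[of x] by (simp add: abs_mult s_def mult_ac)
    have "\<bar>bb (D (x + h *R e)) - bb (D x)\<bar> <= LB * norm (\<Delta> x)" unfolding \<Delta>_def using Dn[OF x3(1)] Dn[OF x3(2)] by (intro LB(2))
    then have "\<bar>bb (D (x + h *R e)) - bb (D x)\<bar> * ((ps x)^2 * \<bar>w h i x\<bar>) <= (LB * norm (\<Delta> x)) * (ps x * R)"
     using w1 p1 ps(2)[of x] LB(1) by (intro mult_mono) auto
    then have t4: "\<bar>(bb (D (x + h *R e)) - bb (D x)) * ((ps x)^2 * w h i x)\<bar> <= (LB * R) * s" by (simp add: abs_mult s_def mult_ac)
    have "\<bar>G (x + h *R e) - G x\<bar> * ((ps x)^2 * \<bar>w h i x\<bar>) <= (LG * h) * (1 * R)"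
     using elim True w1 p1 ps(3)[of x] ps(2)[of x] LG(1) h by (intro mult_mono) (auto intro: power_le_one)
    then have t5: "\<bar>(G (x + h *R e) - G x) * ((ps x)^2 * w h i x)\<bar> <= LG * R * h" by (simp add: abs_mult mult_ac)
    have F1: "c * s^2 / h - Q * s - LG * R * h <= I x"
     using t2 abs_le_D2[OF t3] abs_le_D2[OF t4] abs_le_D1[OF t5] unfolding I_def t1 Q_def distrib_right by linarith
    have F2: "c * s^2 / h - Q * s >= c / 2 * s^2 / h - Q^2 / (2 * c) * h" by (rule quadratic_absorb[OF c(1) h(1)])
    have F3: "c / (2 * h) * F x = c / 2 * s^2 / h" by (simp add: F_def s_def power_mult_distrib)
    have F4: "indicator S x = (1::real)" using True by simp
    show ?thesis unfolding F3 F4 K_def mult_1_right distrib_right using F1 F2 by linarith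
   qed
  qed
  have iS: "integrable lborel (indicator S :: _ => real)"
   using emeasure_compact_finite[OF S(3)] S(3) by (simp add: integrable_indicator_iff borel_compact)
  have "(LBINT x. c / (2 * h) * F x - (K * h) * indicator S x) <= (LBINT x. I x)"
   by (rule integral_mono_AE[OF _ I(1) low]) (use Fi iS in auto)
  then have "c / (2 * h) * (LBINT x. F x) - K * h * mS <= 0" using Fi iS I(2) by (simp add: mS_def)
  then have Fb: "(LBINT x. F x) <= (2 * K * mS / c) * h^2" using c(1) h(1) by (simp add: field_simps power2_eq_square)
  have ile: "indicator (ball x0 r') x * (norm (\<Delta> x))^2 <= F x" for x
  proof (cases "x : ball x0 r'")
   case True then have "ps x = 1" using r' by (intro ps(4)) auto
   then show ?thesis using True by (simp add: F_def)
  qed (simp add: F_def)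
  have i1: "integrable lborel (%x. indicator (ball x0 r') x * (norm (\<Delta> x))^2)"
  proof (rule Bochner_Integration.integrable_bound[OF Fi])
   have [measurable]: "ball x0 r' : sets borel" by simp
   show "(%x. indicator (ball x0 r') x * (norm (\<Delta> x))^2) : borel_measurable lborel" by measurable
  qed (use order_trans[OF ile abs_ge_self] in \<open>auto simp: abs_mult\<close>)
  have "(LBINT x. indicator (ball x0 r') x * (norm (\<Delta> x))^2) <= (LBINT x. F x)"
   by (rule integral_mono[OF i1 Fi ile])
  then show ?thesis using i1 Fb unfolding \<Delta>_def e_def by simp
 qed
 have "ball x0 r' <= V"
 proof
  fix x assume "x : ball x0 r'"
  then have "x : cball x0 (3 * r)" using r' r by auto
  then show "x : V" using Dn(1) ep(1) r(2) by (fastforce simp: V_def)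
 qed
 then show ?thesis using main r'(1) by blast
qed

end

lemma wderiv_cong:
 assumes w: "wderiv U j v g" and m[measurable]: "v' : borel_measurable borel" "g' : borel_measurable borel"
  and ae: "AE x in lborel. x : U --> v x = v' x" "AE x in lborel. x : U --> g x = g' x"
 shows "wderiv U j v' g'"
 unfolding wderiv_def
proof (intro conjI allI impI ballI)
 have [measurable]: "v : borel_measurable borel" "g : borel_measurable borel" using w by (auto simp: wderiv_def)
 fix K assume K: "compact K & K <= U"
 then have [measurable]: "K : sets borel" by (simp add: borel_compact)
 have i: "integrable lborel (%x. indicator K x *R v x)" "integrable lborel (%x. indicator K x *R g x)"
  using w K by (auto simp: wderiv_def set_integrable_def)
 have "AE x in lborel. indicator K x *R v x = indicator K x *R v' x"
  using ae(1) by eventually_elim (use K in \<open>auto simp: indicator_def\<close>)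
 then show "set_integrable lborel K v'" unfolding set_integrable_def by (rule integrable_cong_AE_imp[OF i(1), rotated]) simp
 have "AE x in lborel. indicator K x *R g x = indicator K x *R g' x"
  using ae(2) by eventually_elim (use K in \<open>auto simp: indicator_def\<close>)
 then show "set_integrable lborel K g'" unfolding set_integrable_def by (rule integrable_cong_AE_imp[OF i(2), rotated]) simp
next
 fix ph assume ph: "ph : test_fun U"
 have [measurable]: "v : borel_measurable borel" "g : borel_measurable borel" using w by (auto simp: wderiv_def)
 obtain S where S: "C1c S ph" "S <= U" by (rule test_funE[OF ph]) blast
 have 0: "ph x = 0" "pderiv_at j ph x = 0" if "x ~: U" for x using that S C1c_pderiv_0[OF S(1), of x] by (auto simp: C1c_def)
 note [measurable] = C1c_measurable[OF S(1)] C1c_measurable_pderiv[OF S(1)]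
 have "AE x in lborel. v x * pderiv_at j ph x = v' x * pderiv_at j ph x"
  using ae(1) by eventually_elim (metis 0(2) mult_zero_right)
 then have "(LBINT x. v x * pderiv_at j ph x) = (LBINT x. v' x * pderiv_at j ph x)" by (rule integral_cong_AE[rotated 2]) auto
 moreover have "AE x in lborel. g x * ph x = g' x * ph x"
  using ae(2) by eventually_elim (metis 0(1) mult_zero_right)
 then have "(LBINT x. g x * ph x) = (LBINT x. g' x * ph x)" by (rule integral_cong_AE[rotated 2]) auto
 ultimately show "(LBINT x. v' x * pderiv_at j ph x) = - (LBINT x. g' x * ph x)"
  using w ph by (simp add: wderiv_def)
qed (use m in auto)

lemma set_integrable_of_square:
 fixes g :: "real^'n => real"
 assumes [measurable]: "g : borel_measurable borel" and i: "integrable lborel (%x. (g x)^2)" and K: "compact K"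
 shows "set_integrable lborel K g"
proof -
 have [measurable]: "K : sets borel" using K by (simp add: borel_compact)
 have iK: "integrable lborel (indicator K :: _ => real)"
  using emeasure_compact_finite[OF K] by (simp add: integrable_indicator_iff)
 show ?thesis
  unfolding set_integrable_def
 proof (rule Bochner_Integration.integrable_bound[of _ "%x. indicator K x + (g x)^2"])
  have "\<bar>g x\<bar> <= 1 + (g x)^2" for x
  proof -
   have "0 <= (\<bar>g x\<bar> - 1)^2" by simp
   then have "2 * \<bar>g x\<bar> <= 1 + (g x)^2" by (simp add: power2_diff)
   then show ?thesis using abs_ge_zero[of "g x"] by linarith
  qed
  then show "AE x in lborel. norm (indicator K x *R g x) <= norm (indicator K x + (g x)^2)" by (intro AE_I2) (auto simp: indicator_def)
 qed (use i iK in auto)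
qed

text \<open>Minus the integral of \<open>v\<close> times the derivative of a test function is the
  limit of the pairings of that function with the difference quotients. The uniform L2 bound gives
  the hypothesis of \<open>riesz_L2\<close>, whose representing function is the weak derivative; no
  weak compactness is used.\<close>

lemma wderiv_from_difference_quotients:
 fixes v :: "real^'n => real"
 assumes W: "open W" and vm[measurable]: "v : borel_measurable borel"
  and vb: "!!K. compact K ==> K <= W ==> \<exists>R. \<forall>x\<in>K. \<bar>v x\<bar> <= R"
  and bd: "!!n. n >= N ==> integrable lborel (%x. indicator W x * ((v (x + hs n *R axis j 1) - v x) / hs n)^2) \<and>
    (LBINT x. indicator W x * ((v (x + hs n *R axis j 1) - v x) / hs n)^2) <= C"
 obtains g where "wderiv W j v g" "integrable lborel (%x. (g x)^2)"
proof -
 define e :: "real^'n" where "e = axis j 1"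
 define q where "q n x = (v (x + hs n *R e) - v x) / hs n" for n x
 have [measurable]: "W : sets borel" using W by simp
 have qm[measurable]: "q n : borel_measurable borel" for n unfolding q_def by measurable
 define l where "l ph = - (LBINT x. v x * pderiv_at j ph x)" for ph
 have vK: "set_integrable lborel K v" if K: "compact K" "K <= W" for K
 proof -
  obtain R where R: "!!x. x : K ==> \<bar>v x\<bar> <= R" using vb[OF K] by blast
  have [measurable]: "K : sets borel" using K by (simp add: borel_compact)
  show ?thesis unfolding set_integrable_def by (rule integrable_bounded_compact[OF K(1), of _ R]) (use R in auto)
 qed
 have T1: "integrable lborel (%x. v x * pderiv_at j ph x)" if "C1c S ph" "S <= W" for S ph
 proof -
  have S: "compact S" using that by (simp add: C1c_def)
  have "continuous_on UNIV (pderiv_at j ph)" using C1c_continuous_grad[OF that(1)] continuous_on_grad_iff by blast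
  then show ?thesis by (intro integrable_mult_compact_support[OF vK[OF S that(2)] _ S]) (use C1c_pderiv_0[OF that(1)] in auto)
 qed
 have bound: "2 * l ph <= C + (LBINT x. (ph x)^2)" if ph: "ph : test_fun W" for ph
 proof -
  obtain S where S: "C1c S ph" "S <= W" "compact S" "!!x. x ~: S ==> ph x = 0" by (rule test_funE[OF ph]) blast
  note [measurable] = C1c_measurable[OF S(1)] C1c_measurable_pderiv[OF S(1)]
  obtain d where d: "d > 0" "thicken d S <= W" using thicken_subset_open[OF S(3) W S(2)] .
  note ct = compact_thicken[OF S(3), of d]
  obtain R where R: "!!x. x : thicken d S ==> \<bar>v x\<bar> <= R" using vb[OF ct d(2)] by blast
  obtain P where P: "P > 0" "!!x y. \<bar>ph (x + y) - ph x\<bar> <= P * norm y" using C1c_bound_diff_quotient[OF S(1)] by metis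
  define f where "f n x = v x * ((ph (x - hs n *R e) - ph x) / hs n)" for n x
  obtain N1 where N1: "!!n. n >= N1 ==> hs n < d" using hs_eventually_less[OF d(1)] unfolding eventually_sequentially by blast
  have phS: "integrable lborel (%x. (ph x)^2)"
   by (rule integrable_compact_support[OF S(3)]) (auto intro!: continuous_intros C1c_continuous[OF S(1)] simp: S(4))
  have fb: "\<bar>f n x\<bar> <= R * P" if "x : thicken d S" for n x
  proof -
   have "\<bar>ph (x - hs n *R e) - ph x\<bar> <= P * hs n" using P(2)[of x "- (hs n *R e)"] hs_pos[of n] by (simp add: e_def)
   then have "\<bar>(ph (x - hs n *R e) - ph x) / hs n\<bar> <= P" using hs_pos[of n] by (simp add: field_simps)
   then show ?thesis unfolding f_def abs_mult using R[OF that] P(1) by (intro mult_mono) auto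
  qed
  have f0: "f n x = 0" if "x ~: thicken d S" "n >= N1" for n x
  proof -
   have "x ~: S" using that(1) thicken_superset[of d S] d by auto
   moreover have "x - hs n *R e ~: S"
    using thickenI[of "x - hs n *R e" S x d] that(1) N1[OF that(2)] hs_pos[of n] by (auto simp: e_def)
   ultimately show ?thesis using S(4) by (simp add: f_def)
  qed
  have [measurable]: "f n : borel_measurable borel" for n unfolding f_def by measurable
  have lim: "(%n. LBINT x. f (n + N1) x) ~~> (LBINT x. v x * - pderiv_at j ph x)"
  proof (rule integral_dominated_convergence[where w = "%x. R * P * indicator (thicken d S) x"])
   show "integrable lborel (%x. R * P * indicator (thicken d S) x)"
    using emeasure_compact_finite[OF ct] ct by (intro integrable_mult_right) (simp add: integrable_indicator_iff borel_compact)
   show "AE x in lborel. (%n. f (n + N1) x) ~~> v x * - pderiv_at j ph x"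
   proof (rule AE_I2)
    fix x
    have "GDERIV ph (x + 0 *R (- e)) :> grad ph x" using S(1) by (auto simp: C1c_def intro: GDERIV_grad)
    from GDERIV_line[OF this] have "((%t. ph (x + t *R (- e))) has_real_derivative - pderiv_at j ph x) (at 0)" by (simp add: e_def inner_axis')
    from DERIV_hs[OF this] have "(%n. f n x) ~~> v x * - pderiv_at j ph x"
     unfolding f_def by (intro tendsto_mult tendsto_const) simp
    then show "(%n. f (n + N1) x) ~~> v x * - pderiv_at j ph x" by (rule LIMSEQ_ignore_initial_segment)
   qed
   show "AE x in lborel. norm (f (n + N1) x) <= R * P * indicator (thicken d S) x" for n
   proof (rule AE_I2)
    fix x show "norm (f (n + N1) x) <= R * P * indicator (thicken d S) x"
     using fb[of x "n + N1"] f0[of x "n + N1"] by (cases "x : thicken d S") auto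
   qed
  qed measurable
  have le: "2 * (LBINT x. f n x) <= C + (LBINT x. (ph x)^2)" if n: "n >= N1" "n >= N" for n
  proof -
   have iq: "integrable lborel (%x. indicator W x * (q n x)^2)" "(LBINT x. indicator W x * (q n x)^2) <= C"
    using bd[OF n(2)] by (auto simp: q_def e_def)
   have v1: "integrable lborel (%x. v x * ph x)" by (rule integrable_mult_compact_support[OF vK[OF S(3,2)] C1c_continuous[OF S(1)] S(3,4)])
   obtain P0 where P0: "!!x. norm (ph x) <= P0" by (rule bounded_compact_support[OF S(3) C1c_continuous[OF S(1)] S(4)]) auto
   have v2: "integrable lborel (%x. v x * ph (x - hs n *R e))"
   proof (rule integrable_bounded_compact[OF ct])
    show "\<bar>v x * ph (x - hs n *R e)\<bar> <= R * P0" if "x : thicken d S" for x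
     unfolding abs_mult using R[OF that] P0[of "x - hs n *R e"] by (intro mult_mono) auto
    show "v x * ph (x - hs n *R e) = 0" if "x ~: thicken d S" for x
     using thickenI[of "x - hs n *R e" S x d] that N1[OF n(1)] hs_pos[of n] S(4) by (auto simp: e_def)
   qed measurable
   have v3: "integrable lborel (%x. v (x + hs n *R e) * ph x)" using lborel_integrable_shift[OF v2, of "hs n *R e"] by simp
   have "(LBINT x. f n x) = ((LBINT x. v x * ph (x - hs n *R e)) - (LBINT x. v x * ph x)) / hs n"
    unfolding f_def using v1 v2 by (simp add: right_diff_distrib diff_divide_distrib)
   also have "(LBINT x. v x * ph (x - hs n *R e)) = (LBINT x. v (x + hs n *R e) * ph x)"
    using lborel_integral_shift[of "%x. v x * ph (x - hs n *R e)" "hs n *R e"] by simp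
   also have "((LBINT x. v (x + hs n *R e) * ph x) - (LBINT x. v x * ph x)) / hs n = (LBINT x. q n x * ph x)"
    unfolding q_def using v1 v3 by (simp add: left_diff_distrib diff_divide_distrib)
   finally have e1: "(LBINT x. f n x) = (LBINT x. q n x * ph x)" .
   have iqp: "integrable lborel (%x. q n x * ph x)"
    unfolding q_def using v1 v3 by (simp add: left_diff_distrib diff_divide_distrib)
   have "(LBINT x. 2 * (q n x * ph x)) <= (LBINT x. indicator W x * (q n x)^2 + (ph x)^2)"
   proof (rule integral_mono)
    show "integrable lborel (%x. 2 * (q n x * ph x))" using iqp by simp
    show "integrable lborel (%x. indicator W x * (q n x)^2 + (ph x)^2)" using iq phS by simp
    fix x
    show "2 * (q n x * ph x) <= indicator W x * (q n x)^2 + (ph x)^2"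
    proof (cases "x : W")
     case True
     have "0 <= (q n x - ph x)^2" by simp
     then show ?thesis using True by (simp add: power2_diff)
    next
     case False then have "ph x = 0" using S(2,4) by blast
     then show ?thesis by simp
    qed
   qed
   also have "... = (LBINT x. indicator W x * (q n x)^2) + (LBINT x. (ph x)^2)" using iq phS by simp
   finally show ?thesis using iq(2) by (simp add: e1)
  qed
  have "(%n. 2 * (LBINT x. f (n + N1) x)) ~~> 2 * l ph"
   using tendsto_mult[OF tendsto_const[of 2] lim] by (simp add: l_def)
  then show ?thesis by (rule LIMSEQ_le_const2) (use le in \<open>auto intro!: exI[of _ N]\<close>)
 qed
 obtain g where g: "g : borel_measurable lborel" "integrable lborel (%x. (g x)^2)" "!!ph. ph : test_fun W ==> l ph = (LBINT x. g x * ph x)"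
 proof (rule riesz_L2[of "test_fun W" lborel l C])
  have "(%x. 0) : test_fun W" by (rule test_funI[of _ "{}"]) (auto intro: Ck_on_const)
  then show "test_fun W ~= {}" by blast
  fix ph ps s t assume t: "ph : test_fun W" "ps : test_fun W"
  show "(%x. s * ph x + t * ps x) : test_fun W" by (rule test_fun_lincomb[OF t])
  obtain S where S: "C1c S ph" "S <= W" by (rule test_funE[OF t(1)]) blast
  obtain S' where S': "C1c S' ps" "S' <= W" by (rule test_funE[OF t(2)]) blast
  have "(%x. v x * pderiv_at j (%x. s * ph x + t * ps x) x) = (%x. s * (v x * pderiv_at j ph x) + t * (v x * pderiv_at j ps x))"
   by (intro ext) (simp add: pderiv_at_lincomb[OF S(1) S'(1)] algebra_simps)
  then show "l (%x. s * ph x + t * ps x) = s * l ph + t * l ps"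
   unfolding l_def using T1[OF S] T1[OF S'] by simp
 next
  fix ph assume t: "ph : test_fun W"
  obtain S where S: "C1c S ph" "compact S" "!!x. x ~: S ==> ph x = 0" by (rule test_funE[OF t]) blast
  show "ph : borel_measurable lborel" using C1c_measurable[OF S(1)] by simp
  show "integrable lborel (%x. (ph x)^2)"
   by (rule integrable_compact_support[OF S(2)]) (auto intro!: continuous_intros C1c_continuous[OF S(1)] simp: S(3))
  show "2 * l ph <= C + (LBINT x. (ph x)^2)" by (rule bound[OF t])
 qed blast
 have gm: "g : borel_measurable borel" using g(1) by simp
 have "wderiv W j v g"
  unfolding wderiv_def
 proof (intro conjI allI impI ballI vm gm)
  fix ph assume "ph : test_fun W"
  from g(3)[OF this] show "(LBINT x. v x * pderiv_at j ph x) = - (LBINT x. g x * ph x)" unfolding l_def by linarith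
 qed (use vK set_integrable_of_square[OF gm g(2)] in auto)
 then show ?thesis using g(2) by (rule that)
qed

section \<open>The Hessian on the regular set\<close>

context local_solution
begin

definition Hq :: "nat => 'n => 'n => real^'n => real" where
 "Hq n i j x = (D (x + hs n *R axis j 1) $ i - D x $ i) / hs n"

text \<open>A pointwise limit taken everywhere, with an unspecified value where it does not exist.
  This gives one global Borel function that all local weak derivatives agree with, so nothing has to
  be patched together.\<close>

definition H :: "'n => 'n => real^'n => real" where
 "H i j x = lim (%n. Hq n i j x)"

lemma D_nth_meas[measurable]: "(%x. D x $ i) : borel_measurable borel"
proof -
 have "(%x. D x $ i) = (%x. D x \<bullet> axis i 1)" by (simp add: inner_axis)
 then show ?thesis by simp
qed

lemma Hq_meas[measurable]: "Hq n i j : borel_measurable borel"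
proof -
 have "(%x. D (x + hs n *R axis j 1) $ i) : borel_measurable borel" by (rule measurable_compose[OF _ D_nth_meas]) measurable
 then show ?thesis unfolding Hq_def by measurable
qed

lemma H_meas[measurable]: "H i j : borel_measurable borel"
 unfolding H_def by measurable

lemma D_nth_cont: "continuous_on U (%x. D x $ i)" by (intro continuous_intros D_cont)

lemma H_eqI: "((%t. D (x + t *R axis j 1) $ i) has_real_derivative c) (at 0) ==> H i j x = c"
 unfolding H_def Hq_def by (intro limI) (rule DERIV_hs[of "%x. D x $ i"])

text \<open>The local weak derivative is almost everywhere the classical derivative along the axis,
  because \<open>D\<close> is continuous; where that derivative exists it is the limit defining
  \<open>H\<close>.\<close>

lemma H_local:
 assumes x0: "x0 : V"
 shows "\<exists>r>0. ball x0 r <= V & (\<forall>i j. wderiv (ball x0 r) j (%x. D x $ i) (H i j) \<and>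
   integrable lborel (%x. indicator (ball x0 r) x * (H i j x)^2) \<and>
   (AE x in lborel. x : ball x0 r --> ((%t. D (x + t *R axis j 1) $ i) has_real_derivative H i j x) (at 0)))"
proof -
 obtain r C where r: "r > 0" "ball x0 r <= V" and bd: "!!i h. 0 < h ==> h < r ==>
   integrable lborel (%x. indicator (ball x0 r) x * (norm (D (x + h *R axis i 1) - D x))^2)"
   "!!i h. 0 < h ==> h < r ==> (LBINT x. indicator (ball x0 r) x * (norm (D (x + h *R axis i 1) - D x))^2) <= C * h^2"
  using nondegenerate_bound[OF x0] by blast
 let ?W = "ball x0 r"
 have WU: "?W <= U" using r V_subset by blast
 obtain N where N: "!!n. n >= N ==> hs n < r" using hs_eventually_less[OF r(1)] unfolding eventually_sequentially by blast
 have "wderiv ?W j (%x. D x $ i) (H i j) & integrable lborel (%x. indicator ?W x * (H i j x)^2) \<and>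
   (AE x in lborel. x : ?W --> ((%t. D (x + t *R axis j 1) $ i) has_real_derivative H i j x) (at 0))" for i j
 proof -
  obtain g where g: "wderiv ?W j (%x. D x $ i) g" "integrable lborel (%x. (g x)^2)"
  proof (rule wderiv_from_difference_quotients[of ?W "%x. D x $ i" N j C])
   show "\<exists>R. \<forall>x\<in>K. \<bar>D x $ i\<bar> <= R" if K: "compact K" "K <= ?W" for K
   proof -
    obtain R where "!!x. x : K ==> norm (D x) <= R" by (rule D_bound[OF K(1)]) (use K WU in auto)
    then show ?thesis using component_le_norm_cart order_trans by blast
   qed
   fix n assume n: "n >= N"
   note b = bd[OF hs_pos N[OF n], of j]
   have le: "indicator ?W x * ((D (x + hs n *R axis j 1) $ i - D x $ i) / hs n)^2 \<le>
     indicator ?W x * (norm (D (x + hs n *R axis j 1) - D x))^2 / (hs n)^2" for x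
   proof -
    have "\<bar>D (x + hs n *R axis j 1) $ i - D x $ i\<bar> <= norm (D (x + hs n *R axis j 1) - D x)"
     using component_le_norm_cart[of "D (x + hs n *R axis j 1) - D x" i] by simp
    then have "(D (x + hs n *R axis j 1) $ i - D x $ i)^2 <= (norm (D (x + hs n *R axis j 1) - D x))^2"
     by (metis abs_ge_zero power2_abs power_mono)
    then show ?thesis by (auto simp: indicator_def power_divide intro!: divide_right_mono)
   qed
   have i1: "integrable lborel (%x. indicator ?W x * (norm (D (x + hs n *R axis j 1) - D x))^2 / (hs n)^2)"
    using b(1) by simp
   have i2: "integrable lborel (%x. indicator ?W x * (Hq n i j x)^2)"
   proof (rule Bochner_Integration.integrable_bound[OF i1])
    have [measurable]: "ball x0 r : sets borel" by simp
    show "(%x. indicator ?W x * (Hq n i j x)^2) : borel_measurable lborel" by measurable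
   qed (use le in \<open>auto simp: Hq_def abs_mult intro!: AE_I2\<close>)
   have "(LBINT x. indicator ?W x * (Hq n i j x)^2) <= (LBINT x. indicator ?W x * (norm (D (x + hs n *R axis j 1) - D x))^2 / (hs n)^2)"
    by (rule integral_mono[OF i2 i1]) (use le in \<open>simp add: Hq_def\<close>)
   also have "... <= C" using b(2) hs_pos[of n] by (simp add: divide_le_eq)
   finally show "integrable lborel (%x. indicator ?W x * ((D (x + hs n *R axis j 1) $ i - D x $ i) / hs n)^2) \<and>
     (LBINT x. indicator ?W x * ((D (x + hs n *R axis j 1) $ i - D x $ i) / hs n)^2) <= C"
    using i2 by (simp add: Hq_def)
  qed (auto, measurable)
  have gm[measurable]: "g : borel_measurable borel" using g by (simp add: wderiv_def)
  have der: "AE x in lborel. x : ?W --> ((%t. D (x + t *R axis j 1) $ i) has_real_derivative g x) (at 0)"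
   by (rule wderiv_imp_DERIV[OF open_ball g(1) continuous_on_subset[OF D_nth_cont WU] refl])
  then have eq: "AE x in lborel. x : ?W --> g x = H i j x" by eventually_elim (use H_eqI in metis)
  have "wderiv ?W j (%x. D x $ i) (H i j)" by (rule wderiv_cong[OF g(1) D_nth_meas H_meas AE_I2 eq]) simp
  moreover have "integrable lborel (%x. indicator ?W x * (H i j x)^2)"
  proof (rule integrable_cong_AE_imp[of _ "%x. indicator ?W x * (g x)^2"])
   have [measurable]: "?W : sets borel" by simp
   show "(%x. indicator ?W x * (H i j x)^2) : borel_measurable lborel" by measurable
   show "integrable lborel (%x. indicator ?W x * (g x)^2)"
    using integrable_mult_indicator[OF _ g(2), of ?W] by simp
   show "AE x in lborel. indicator ?W x * (g x)^2 = indicator ?W x * (H i j x)^2"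
    using eq by eventually_elim (auto simp: indicator_def)
  qed
  moreover have "AE x in lborel. x : ?W --> ((%t. D (x + t *R axis j 1) $ i) has_real_derivative H i j x) (at 0)"
   using der eq by eventually_elim auto
  ultimately show ?thesis by blast
 qed
 then show ?thesis using r by blast
qed

end

text \<open>The integral of the squared deviation from the mean is nonnegative. The extended form
  avoids assuming that the square is integrable.\<close>

lemma jensen_segment:
 fixes k :: "real => real"
 assumes b: "b > 0" and [measurable]: "k : borel_measurable borel" and k: "set_integrable lborel {0..b} k"
 shows "ennreal ((LINT t:{0..b}|lborel. k t)^2) <= ennreal b * (\<integral>\<^sup>+t. indicator {0..b} t * ennreal ((k t)^2) \<partial>lborel)"
proof (cases "(\<integral>\<^sup>+t. indicator {0..b} t * ennreal ((k t)^2) \<partial>lborel) = \<infinity>")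
 case True then show ?thesis using b by (simp add: ennreal_mult_top)
next
 case False
 have nn: "(\<integral>\<^sup>+t. indicator {0..b} t * ennreal ((k t)^2) \<partial>lborel) = (\<integral>\<^sup>+t. ennreal (indicator {0..b} t * (k t)^2) \<partial>lborel)"
  by (intro nn_integral_cong) (auto simp: indicator_def)
 have Q: "integrable lborel (%t. indicator {0..b} t * (k t)^2)"
  by (rule integrableI_nonneg) (use False nn in \<open>auto simp: top.not_eq_extremum\<close>)
 have k': "integrable lborel (%t. indicator {0..b} t * k t)" using k by (simp add: set_integrable_def)
 have i1: "integrable lborel (indicator {0..b} :: real => real)" using b by (simp add: integrable_indicator_iff)
 define I where "I = (LBINT t. indicator {0..b} t * k t)"
 define S where "S = (LBINT t. indicator {0..b} t * (k t)^2)"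
 have "0 <= (LBINT t. indicator {0..b} t * (k t - I / b)^2)" by (intro Bochner_Integration.integral_nonneg) auto
 also have "(%t. indicator {0..b} t * (k t - I / b)^2) =
   (%t. indicator {0..b} t * (k t)^2 - 2 * (I / b) * (indicator {0..b} t * k t) + (I / b)^2 * indicator {0..b} t)"
  by (intro ext) (simp add: power2_diff algebra_simps)
 also have "(LBINT t. indicator {0..b} t * (k t)^2 - 2 * (I / b) * (indicator {0..b} t * k t) + (I / b)^2 * indicator {0..b} t)
   = S - 2 * (I / b) * I + (I / b)^2 * b"
  using Q k' i1 b by (simp add: I_def S_def)
 also have "... = S - I^2 / b" using b by (simp add: power2_eq_square field_simps)
 finally have "I^2 <= b * S" using b by (simp add: field_simps)
 moreover have "(LINT t:{0..b}|lborel. k t) = I" by (simp add: set_lebesgue_integral_def I_def)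
 moreover have "(\<integral>\<^sup>+t. ennreal (indicator {0..b} t * (k t)^2) \<partial>lborel) = ennreal S"
  unfolding S_def by (rule nn_integral_eq_integral[OF Q]) auto
 ultimately show ?thesis unfolding nn using b by (simp add: ennreal_mult'[symmetric] ennreal_leI)
qed

section \<open>Strong convergence of difference quotients on compact parts of the regular
  set\<close>

context local_solution
begin

lemma finite_H_cover:
 assumes C: "compact C" "C <= V"
 obtains F r where "finite F" "C <= (\<Union>x\<in>F. ball x (r x))" "!!x. x : F ==> ball x (r x) <= V"
  "!!x i j. x : F ==> wderiv (ball x (r x)) j (%x. D x $ i) (H i j)"
  "!!x i j. x : F ==> integrable lborel (%y. indicator (ball x (r x)) y * (H i j y)^2)"
  "!!x i j. x : F ==> AE y in lborel. y : ball x (r x) --> ((%t. D (y + t *R axis j 1) $ i) has_real_derivative H i j y) (at 0)"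
proof -
 have "\<forall>x0. \<exists>r. x0 : V --> r > 0 & ball x0 r <= V & (\<forall>i j. wderiv (ball x0 r) j (%x. D x $ i) (H i j) \<and>
   integrable lborel (%x. indicator (ball x0 r) x * (H i j x)^2) \<and>
   (AE x in lborel. x : ball x0 r --> ((%t. D (x + t *R axis j 1) $ i) has_real_derivative H i j x) (at 0)))"
  using H_local by blast
 from choice[OF this] obtain r where r: "\<forall>x0. x0 : V --> r x0 > 0 & ball x0 (r x0) <= V & (\<forall>i j. wderiv (ball x0 (r x0)) j (%x. D x $ i) (H i j) \<and>
   integrable lborel (%x. indicator (ball x0 (r x0)) x * (H i j x)^2) \<and>
   (AE x in lborel. x : ball x0 (r x0) --> ((%t. D (x + t *R axis j 1) $ i) has_real_derivative H i j x) (at 0)))" ..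
 have "C <= (\<Union>x\<in>V. ball x (r x))" using C(2) r by force
 then obtain F where F: "F <= V" "finite F" "C <= (\<Union>x\<in>F. ball x (r x))"
  using compactE_image[OF C(1), of V "%x. ball x (r x)"] by auto
 show ?thesis by (rule that[OF F(2,3)]) (use r F(1) in blast)+
qed

lemma AE_H: "AE x in lborel. x : V --> (\<forall>i j. ((%t. D (x + t *R axis j 1) $ i) has_real_derivative H i j x) (at 0))"
proof -
 obtain K :: "nat => (real^'n) set" where K: "!!n. compact (K n)" "!!n. K n <= V" "\<Union>(range K) = V"
  by (rule open_Union_compact_subsets[OF V_open]) blast
 have "AE x in lborel. x : K n --> ((%t. D (x + t *R axis j 1) $ i) has_real_derivative H i j x) (at 0)" for n i j
 proof -
  obtain F r where F: "finite F" "K n <= (\<Union>x\<in>F. ball x (r x))"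
   "!!x i j. x : F ==> AE y in lborel. y : ball x (r x) --> ((%t. D (y + t *R axis j 1) $ i) has_real_derivative H i j y) (at 0)"
   by (rule finite_H_cover[OF K(1,2)]) blast
  have "AE y in lborel. \<forall>x\<in>F. y : ball x (r x) --> ((%t. D (y + t *R axis j 1) $ i) has_real_derivative H i j y) (at 0)"
   using F(1,3) by (intro AE_finite_allI) auto
  then show ?thesis by eventually_elim (use F(2) in blast)
 qed
 then have "AE x in lborel. \<forall>n i j. x : K n --> ((%t. D (x + t *R axis j 1) $ i) has_real_derivative H i j x) (at 0)"
  unfolding AE_all_countable by blast
 then show ?thesis by eventually_elim (use K(3) in blast)
qed

lemma H_square_integrable:
 assumes C: "compact C" "C <= V"
 shows "integrable lborel (%x. indicator C x * (H i j x)^2)"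
proof -
 obtain F r where F: "finite F" "C <= (\<Union>x\<in>F. ball x (r x))"
  "!!x i j. x : F ==> integrable lborel (%y. indicator (ball x (r x)) y * (H i j y)^2)" by (rule finite_H_cover[OF C]) blast
 have [measurable]: "C : sets borel" using C by (simp add: borel_compact)
 have i: "integrable lborel (%y. \<Sum>x\<in>F. indicator (ball x (r x)) y * (H i j y)^2)" by (intro Bochner_Integration.integrable_sum F(3))
 show ?thesis
 proof (rule Bochner_Integration.integrable_bound[OF i])
  show "AE y in lborel. norm (indicator C y * (H i j y)^2) <= norm (\<Sum>x\<in>F. indicator (ball x (r x)) y * (H i j y)^2)"
  proof (rule AE_I2)
   fix y
   have "indicator C y * (H i j y)^2 <= (\<Sum>x\<in>F. indicator (ball x (r x)) y * (H i j y)^2)"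
   proof (cases "y : C")
    case True
    then obtain x where x: "x : F" "y : ball x (r x)" using F(2) by blast
    have "indicator (ball x (r x)) y * (H i j y)^2 <= (\<Sum>x\<in>F. indicator (ball x (r x)) y * (H i j y)^2)"
     by (rule member_le_sum[OF x(1) _ F(1)]) auto
    then show ?thesis using True x by simp
   qed (auto intro!: sum_nonneg)
   then show "norm (indicator C y * (H i j y)^2) <= norm (\<Sum>x\<in>F. indicator (ball x (r x)) y * (H i j y)^2)" by (simp add: abs_mult)
  qed
 qed measurable
qed

text \<open>A difference quotient of \<open>D\<close> is the mean of \<open>H\<close> over a segment
  of length \<open>hs n\<close>. Jensen's inequality, Tonelli's theorem and translation invariance
  give the bound with constant exactly 1, at the price of thickening \<open>C\<close>; that constant
  is what makes the limit superior of the norms sharp.\<close>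

lemma Hq_square_bound:
 assumes C: "compact C" "C <= V"
 obtains N where "!!n i j. n >= N ==> (\<integral>\<^sup>+x. ennreal (indicator C x * (Hq n i j x)^2) \<partial>lborel) <= (\<integral>\<^sup>+x. ennreal (indicator (thicken (hs n) C) x * (H i j x)^2) \<partial>lborel)"
proof -
 obtain F r where F: "finite F" "C <= (\<Union>x\<in>F. ball x (r x))" "!!x i j. x : F ==> wderiv (ball x (r x)) j (%x. D x $ i) (H i j)"
  by (rule finite_H_cover[OF C]) blast
 \<comment> \<open>A Lebesgue number of the finite cover: short segments starting in
   \<open>C\<close> stay inside one ball, where the weak derivative is available.\<close>
 obtain de where de: "de > 0" "!!x. x : C ==> \<exists>G\<in>(%x. ball x (r x)) ` F. ball x de <= G"
  by (rule Heine_Borel_lemma[OF C(1), of "(%x. ball x (r x)) ` F"]) (use F(2) in auto)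
 obtain N where N: "!!n. n >= N ==> hs n < de" using hs_eventually_less[OF de(1)] unfolding eventually_sequentially by blast
 have [measurable]: "C : sets borel" using C by (simp add: borel_compact)
 show ?thesis
 proof (rule that[of N])
  fix n i j assume n: "n >= N"
  let ?h = "hs n" let ?e = "axis j 1 :: real^'n"
  have h: "?h > 0" "?h < de" using hs_pos N[OF n] by auto
  let ?T = "thicken ?h C"
  let ?k = "%x t. indicator {0..?h} t * ennreal ((H i j (x + t *R ?e))^2)" and ?w = "%x. ennreal (indicator ?T x * (H i j x)^2)"
  let ?I = "%x. LINT t:{0..?h}|lborel. H i j (x + t *R ?e)"
  have [measurable]: "?T : sets borel" using compact_thicken[OF C(1)] by (simp add: borel_compact)
  have "AE x in lborel. \<forall>y\<in>F. (\<forall>t\<in>{0..?h}. x + t *R ?e : ball y (r y)) -->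
   set_integrable lborel {0..?h} (%t. H i j (x + t *R ?e)) \<and>
   D (x + ?h *R ?e) $ i - D x $ i = ?I x" by (intro AE_finite_allI F(1) wderiv_shift[OF open_ball F(3) h(1) refl])
  then have "AE x in lborel. ennreal (indicator C x * (Hq n i j x)^2) \<le>
    ennreal (1 / ?h) * (\<integral>\<^sup>+t. indicator C x * ?k x t \<partial>lborel)"
  proof eventually_elim
   case (elim x)
   show ?case
   proof (cases "x : C")
    case True
    then obtain y where y: "y : F" "ball x de <= ball y (r y)" using de(2) by blast
    have "x + t *R ?e : ball y (r y)" if "t : {0..?h}" for t using that h y(2) by (auto simp: subset_eq dist_norm)
    then have *: "set_integrable lborel {0..?h} (%t. H i j (x + t *R ?e))"
     "D (x + ?h *R ?e) $ i - D x $ i = ?I x" using elim y(1) by blast+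
    have m: "(%t. H i j (x + t *R ?e)) : borel_measurable borel" by (rule measurable_compose[OF _ H_meas]) measurable
    have "(Hq n i j x)^2 = (1 / ?h)^2 * (?I x)^2"
     unfolding Hq_def *(2) by (simp add: power_divide)
    then have "ennreal ((Hq n i j x)^2) = ennreal ((1 / ?h)^2) * ennreal ((?I x)^2)" by (simp add: ennreal_mult)
    also have "... <= ennreal ((1 / ?h)^2) * (ennreal ?h * (\<integral>\<^sup>+t. ?k x t \<partial>lborel))"
     by (intro mult_left_mono jensen_segment[OF h(1) m *(1)]) auto
    also have "... = ennreal (1 / ?h) * (\<integral>\<^sup>+t. ?k x t \<partial>lborel)"
     using h(1) by (simp add: mult.assoc[symmetric] ennreal_mult[symmetric] power2_eq_square)
    finally show ?thesis using True by simp
   qed simp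
  qed
  then have "(\<integral>\<^sup>+x. ennreal (indicator C x * (Hq n i j x)^2) \<partial>lborel) \<le>
   (\<integral>\<^sup>+x. ennreal (1 / ?h) * (\<integral>\<^sup>+t. indicator C x * ?k x t \<partial>lborel) \<partial>lborel)" by (rule nn_integral_mono_AE)
  also have "... = ennreal (1 / ?h) * (\<integral>\<^sup>+x. \<integral>\<^sup>+t. indicator C x * ?k x t \<partial>lborel \<partial>lborel)"
   by (rule nn_integral_cmult) measurable
  also have "(\<integral>\<^sup>+x. \<integral>\<^sup>+t. indicator C x * ?k x t \<partial>lborel \<partial>lborel) =
    (\<integral>\<^sup>+t. \<integral>\<^sup>+x. indicator C x * ?k x t \<partial>lborel \<partial>lborel)" by (rule lborel_pair.Fubini') measurable
  also have "... <= (\<integral>\<^sup>+t. indicator {0..?h} t * (\<integral>\<^sup>+x. ?w x \<partial>lborel) \<partial>lborel)"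
  proof (rule nn_integral_mono)
   fix t :: real
   have "(\<integral>\<^sup>+x. indicator C x * ?k x t \<partial>lborel) \<le>
     (\<integral>\<^sup>+x. indicator {0..?h} t * ?w (x + t *R ?e) \<partial>lborel)"
   proof (rule nn_integral_mono)
    fix x :: "real^'n"
    have "x + t *R ?e : ?T" if "x : C" "t : {0..?h}" using that by (intro thickenI[of x]) auto
    then show "indicator C x * ?k x t \<le>
      indicator {0..?h} t * ?w (x + t *R ?e)" by (auto simp: indicator_def)
   qed
   also have "... = indicator {0..?h} t * (\<integral>\<^sup>+x. ?w (x + t *R ?e) \<partial>lborel)" by (rule nn_integral_cmult) measurable
   also have "(\<integral>\<^sup>+x. ?w (x + t *R ?e) \<partial>lborel) = (\<integral>\<^sup>+x. ?w x \<partial>lborel)"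
    by (rule nn_integral_lborel_shift[of ?w]) measurable
   finally show "(\<integral>\<^sup>+x. indicator C x * ?k x t \<partial>lborel) \<le>
     indicator {0..?h} t * (\<integral>\<^sup>+x. ?w x \<partial>lborel)" .
  qed
  also have "... = ennreal ?h * (\<integral>\<^sup>+x. ?w x \<partial>lborel)"
   using h(1) by (subst nn_integral_multc) auto
  finally show "(\<integral>\<^sup>+x. ennreal (indicator C x * (Hq n i j x)^2) \<partial>lborel) <= (\<integral>\<^sup>+x. ?w x \<partial>lborel)"
   using h(1) by (simp add: mult.assoc[symmetric] ennreal_mult[symmetric] mult_left_mono)
 qed
qed

lemma Hq_tendsto: "AE x in lborel. x : V --> (\<forall>i j. (%n. Hq n i j x) ~~> H i j x)"
 using AE_H
proof eventually_elim
 case (elim x)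
 then show ?case unfolding Hq_def using DERIV_hs[of "%x. D x $ _"] by blast
qed

text \<open>The squares converge almost everywhere and the limit superior of their integrals does
  not exceed the integral of the limit, since the thickened sets shrink to \<open>C\<close>.
  Scheffe's lemma turns this into L1 convergence.\<close>

lemma Hq_square_L1:
 assumes C: "compact C" "C <= V"
 obtains N where "!!n i j. n >= N ==> integrable lborel (%x. indicator C x * (Hq n i j x)^2)"
  "!!i j. (%n. LBINT x. \<bar>indicator C x * (Hq (n + N) i j x)^2 - indicator C x * (H i j x)^2\<bar>) ~~> 0"
proof -
 have [measurable]: "C : sets borel" using C by (simp add: borel_compact)
 obtain de where de: "de > 0" "thicken de C <= V" using thicken_subset_open[OF C(1) V_open C(2)] .
 obtain N0 where N0: "!!n i j. n >= N0 ==> (\<integral>\<^sup>+x. ennreal (indicator C x * (Hq n i j x)^2) \<partial>lborel) <= (\<integral>\<^sup>+x. ennreal (indicator (thicken (hs n) C) x * (H i j x)^2) \<partial>lborel)"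
  using Hq_square_bound[OF C] by blast
 obtain N1 where N1: "!!n. n >= N1 ==> hs n < de" using hs_eventually_less[OF de(1)] unfolding eventually_sequentially by blast
 define N where "N = max N0 N1"
 let ?T = "%n. thicken (hs n) C"
 let ?q = "%n i j x. indicator C x * (Hq n i j x)^2" and ?H = "%S i j x. indicator S x * (H i j x)^2"
 have Tm[measurable]: "?T n : sets borel" for n using compact_thicken[OF C(1)] by (simp add: borel_compact)
 have TV: "?T n <= V" "?T n <= thicken de C" if "n >= N" for n
  using thicken_mono[of "hs n" de C] N1[of n] that de(2) by (auto simp: N_def)
 have iT: "integrable lborel (%x. ?H (?T n) i j x)" if "n >= N" for n i j by (rule H_square_integrable[OF compact_thicken[OF C(1)] TV(1)[OF that]])
 have iq: "integrable lborel (?q n i j)" if "n >= N" for n i j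
 proof (rule integrableI_nonneg)
  have "(\<integral>\<^sup>+x. ennreal (?H (?T n) i j x) \<partial>lborel) < \<infinity>"
   using nn_integral_eq_integral[OF iT[OF that]] by simp
  then show "(\<integral>\<^sup>+x. ennreal (?q n i j x) \<partial>lborel) < \<infinity>" using N0[of n i j] that by (auto simp: N_def)
 qed auto
 have "(%n. LBINT x. \<bar>?q (n + N) i j x - ?H C i j x\<bar>) ~~> 0" for i j
 proof -
  note iC = H_square_integrable[OF C, of i j]
  have "(%n. LBINT x. ?H (?T (n + N)) i j x) ~~> (LBINT x. ?H C i j x)"
  proof (rule integral_dominated_convergence[where w = "?H (thicken de C) i j"])
   show "integrable lborel (?H (thicken de C) i j)" by (rule H_square_integrable[OF compact_thicken[OF C(1)] de(2)])
   show "AE x in lborel. (%n. ?H (?T (n + N)) i j x) ~~> ?H C i j x"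
   proof (rule AE_I2)
    fix x
    have "\<forall>\<^sub>F n in sequentially. indicator (?T n) x = (indicator C x :: real)"
    proof (cases "x : C")
     case True
     then have "x : ?T n" for n using thicken_superset[of "hs n" C] hs_pos[of n] by auto
     then show ?thesis using True by simp
    next
     case False
     then obtain d where d: "d > 0" "!!y. y : C ==> dist y x >= d"
      using closed_not_in_ball[OF compact_imp_closed[OF C(1)]] by blast
     show ?thesis using hs_eventually_less[OF d(1)]
     proof eventually_elim
      case (elim n)
      then have "x ~: ?T n" using d(2) by (auto elim!: thickenE simp: dist_norm norm_minus_commute dest!: d(2))
      then show ?case using False by simp
     qed
    qed
    then have "\<forall>\<^sub>F n in sequentially. ?H (?T n) i j x = ?H C i j x" by eventually_elim simp
    then have "(%n. ?H (?T n) i j x) ~~> ?H C i j x" by (rule tendsto_eventually)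
    then show "(%n. ?H (?T (n + N)) i j x) ~~> ?H C i j x" by (rule LIMSEQ_ignore_initial_segment)
   qed
   show "AE x in lborel. norm (?H (?T (n + N)) i j x) <= ?H (thicken de C) i j x" for n
    using TV(2)[of "n + N"] by (intro AE_I2) (auto simp: indicator_def)
  qed measurable
  then have lim: "(%n. ennreal (LBINT x. ?H (?T (n + N)) i j x)) ~~> ennreal (LBINT x. ?H C i j x)"
   by (rule tendsto_ennrealI)
  have "(%n. \<integral>\<^sup>+x. norm (?q (n + N) i j x - ?H C i j x) \<partial>lborel) ~~> 0"
  proof (rule Scheffe_lemma1)
   show "integrable lborel (%x. ?q (n + N) i j x)" for n by (rule iq) simp
   show "integrable lborel (?H C i j)" by (rule iC)
   show "AE x in lborel. (%n. ?q (n + N) i j x) ~~> ?H C i j x"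
    using Hq_tendsto
   proof eventually_elim
    case (elim x)
    show ?case
    proof (cases "x : C")
     case True
     then have "(%n. Hq n i j x) ~~> H i j x" using elim C(2) by blast
     from LIMSEQ_ignore_initial_segment[OF this] show ?thesis by (intro tendsto_intros)
    qed simp
   qed
   have "limsup (%n. \<integral>\<^sup>+x. norm (?q (n + N) i j x) \<partial>lborel) <= limsup (%n. ennreal (LBINT x. ?H (?T (n + N)) i j x))"
   proof (rule Limsup_mono, rule always_eventually, rule allI)
    fix n
    show "(\<integral>\<^sup>+x. norm (?q (n + N) i j x) \<partial>lborel) <= ennreal (LBINT x. ?H (?T (n + N)) i j x)"
     using N0[of "n + N" i j] nn_integral_eq_integral[OF iT[of "n + N" i j]] by (simp add: N_def abs_mult)
   qed
   also have "... = ennreal (LBINT x. ?H C i j x)" using lim_imp_Limsup[OF sequentially_bot lim] .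
   also have "... = (\<integral>\<^sup>+x. norm (?H C i j x) \<partial>lborel)" using nn_integral_eq_integral[OF iC] by (simp add: abs_mult)
   finally show "limsup (%n. \<integral>\<^sup>+x. norm (?q (n + N) i j x) \<partial>lborel) <= (\<integral>\<^sup>+x. norm (?H C i j x) \<partial>lborel)" .
  qed
  moreover have "(\<integral>\<^sup>+x. norm (?q (n + N) i j x - ?H C i j x) \<partial>lborel) =
   ennreal (LBINT x. \<bar>?q (n + N) i j x - ?H C i j x\<bar>)" for n
   using nn_integral_eq_integral[OF integrable_abs[OF Bochner_Integration.integrable_diff[OF iq[of "n + N" i j] iC]]] by simp
  ultimately show ?thesis by (simp add: ennreal_0[symmetric] del: ennreal_0)
 qed
 then show ?thesis using iq that by blast
qed

text \<open>A common majorant for expressions at most quadratic in the difference quotients of the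
  gradient and carried by \<open>C\<close>; the summand 1 takes care of terms of lower
  degree.\<close>

definition E :: "(real^'n) set => nat => real^'n => real" where
 "E C n x = indicator C x * (1 + (\<Sum>i\<in>UNIV. \<Sum>j\<in>UNIV. (Hq n i j x)^2))"

definition E' :: "(real^'n) set => real^'n => real" where
 "E' C x = indicator C x * (1 + (\<Sum>i\<in>UNIV. \<Sum>j\<in>UNIV. (H i j x)^2))"

text \<open>Dominated convergence with majorants that vary with n but converge in L1. It is the only
  passage to the limit used for terms containing second derivatives.\<close>

lemma convergence:
 assumes C: "compact C" "C <= V" and fm[measurable]: "!!n. f n : borel_measurable borel" "f' : borel_measurable borel"
  and lim: "AE x in lborel. (%n. f n x) ~~> f' x"
  and bd: "\<forall>\<^sub>F n in sequentially. \<forall>x. \<bar>f n x\<bar> <= c * E C n x"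
 shows "integrable lborel f'" "(%n. LBINT x. f n x) ~~> (LBINT x. f' x)"
proof -
 have Cm[measurable]: "C : sets borel" using C by (simp add: borel_compact)
 obtain N0 where N0: "!!n i j. n >= N0 ==> integrable lborel (%x. indicator C x * (Hq n i j x)^2)"
  "!!i j. (%n. LBINT x. \<bar>indicator C x * (Hq (n + N0) i j x)^2 - indicator C x * (H i j x)^2\<bar>) ~~> 0"
  using Hq_square_L1[OF C] by blast
 obtain N1 where N1: "!!n x. n >= N1 ==> \<bar>f n x\<bar> <= c * E C n x" using bd unfolding eventually_sequentially by blast
 define N where "N = N0 + N1"
 let ?e = "%n x. \<bar>E C n x - E' C x\<bar>" and ?I = "%f. LBINT x. f x"
 have [measurable]: "E C n : borel_measurable borel" "E' C : borel_measurable borel" for n unfolding E_def E'_def by measurable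
 have i1: "integrable lborel (indicator C :: _ => real)" using emeasure_compact_finite[OF C(1)] by (simp add: integrable_indicator_iff)
 have Ei: "integrable lborel (E C n)" if "n >= N0" for n
  unfolding E_def distrib_left sum_distrib_left by (intro Bochner_Integration.integrable_add Bochner_Integration.integrable_sum N0(1)[OF that]) (use i1 in simp)
 have E'i: "integrable lborel (E' C)"
  unfolding E'_def distrib_left sum_distrib_left by (intro Bochner_Integration.integrable_add Bochner_Integration.integrable_sum H_square_integrable[OF C]) (use i1 in simp)
 have E0: "E C n x >= 0" "E' C x >= 0" for n x unfolding E_def E'_def by (auto intro!: mult_nonneg_nonneg add_nonneg_nonneg sum_nonneg)
 define \<kappa> where "\<kappa> = \<bar>c\<bar>"
 have bd': "\<bar>f n x\<bar> <= \<kappa> * E C n x" if "n >= N" for n x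
  using N1[of n x] that E0(1)[of n x] mult_right_mono[OF abs_ge_self[of c] E0(1)[of n x]] by (simp add: \<kappa>_def N_def)
 have Elim: "AE x in lborel. (%n. E C n x) ~~> E' C x"
  using Hq_tendsto
 proof eventually_elim
  case (elim x)
  show ?case
  proof (cases "x : C")
   case True
   then have "(%n. Hq n i j x) ~~> H i j x" for i j using elim C(2) by blast
   then show ?thesis unfolding E_def E'_def by (intro tendsto_intros)
  qed (simp add: E_def E'_def)
 qed
 have f'b: "AE x in lborel. \<bar>f' x\<bar> <= \<kappa> * E' C x"
  using lim Elim
 proof eventually_elim
  case (elim x)
  show ?case
  proof (rule LIMSEQ_le)
   show "(%n. \<bar>f n x\<bar>) ~~> \<bar>f' x\<bar>" by (intro tendsto_intros elim)
   show "(%n. \<kappa> * E C n x) ~~> \<kappa> * E' C x" by (intro tendsto_intros elim)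
   show "\<exists>N. \<forall>n\<ge>N. \<bar>f n x\<bar> <= \<kappa> * E C n x" using bd' by blast
  qed
 qed
 have kE: "integrable lborel (%x. \<kappa> * E' C x)" using E'i by simp
 show f'i: "integrable lborel f'" by (rule Bochner_Integration.integrable_bound[OF kE]) (use f'b in \<open>auto simp: \<kappa>_def abs_mult E0\<close>)
 have fi: "integrable lborel (f n)" if "n >= N" for n by (rule Bochner_Integration.integrable_bound[of _ "%x. \<kappa> * E C n x"])
   (use Ei[of n] bd'[OF that] that in \<open>auto simp: N_def \<kappa>_def abs_mult E0\<close>)
 have lE: "(%n. ?I (?e (n + N0))) ~~> 0"
 proof (rule tendsto_sandwich[where f = "%_. 0"])
  let ?d = "%n i j x. \<bar>indicator C x * (Hq (n + N0) i j x)^2 - indicator C x * (H i j x)^2\<bar>"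
  have id: "integrable lborel (?d n i j)" for n i j using N0(1)[of "n + N0" i j] H_square_integrable[OF C, of i j] by simp
  have "?I (?e (n + N0)) <= (\<Sum>i\<in>UNIV. \<Sum>j\<in>UNIV. LBINT x. ?d n i j x)" for n
  proof -
   have "?I (?e (n + N0)) <= (LBINT x. (\<Sum>i\<in>UNIV. \<Sum>j\<in>UNIV. ?d n i j x))"
   proof (rule integral_mono)
    show "integrable lborel (%x. ?e (n + N0) x)" using Ei[of "n + N0"] E'i by simp
    show "integrable lborel (%x. \<Sum>i\<in>UNIV. \<Sum>j\<in>UNIV. ?d n i j x)" using id by simp
    fix x
    have "E C (n + N0) x - E' C x = (\<Sum>i\<in>UNIV. \<Sum>j\<in>UNIV. indicator C x * (Hq (n + N0) i j x)^2 - indicator C x * (H i j x)^2)"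
     by (simp add: E_def E'_def distrib_left sum_distrib_left sum_subtractf)
    also have "\<bar>...\<bar> <= (\<Sum>i\<in>UNIV. \<Sum>j\<in>UNIV. ?d n i j x)" by (intro order_trans[OF sum_abs] sum_mono order_refl)
    finally show "?e (n + N0) x <= (\<Sum>i\<in>UNIV. \<Sum>j\<in>UNIV. ?d n i j x)" .
   qed
   also have "... = (\<Sum>i\<in>UNIV. \<Sum>j\<in>UNIV. LBINT x. ?d n i j x)" using id by simp
   finally show ?thesis .
  qed
  then show "\<forall>\<^sub>F n in sequentially. ?I (?e (n + N0)) <= (\<Sum>i\<in>UNIV. \<Sum>j\<in>UNIV. LBINT x. ?d n i j x)" by simp
  have "(%n. \<Sum>i\<in>UNIV. \<Sum>j\<in>UNIV. LBINT x. ?d n i j x) ~~> (\<Sum>i\<in>(UNIV::'n set). \<Sum>j\<in>(UNIV::'n set). 0)"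
   by (intro tendsto_sum N0(2))
  then show "(%n. \<Sum>i\<in>UNIV. \<Sum>j\<in>UNIV. LBINT x. ?d n i j x) ~~> 0" by simp
 qed auto
 have lE': "(%n. ?I (?e (n + N))) ~~> 0"
  using LIMSEQ_ignore_initial_segment[OF lE, of N1] by (simp add: N_def add.assoc add.commute[of N0 N1])
 \<comment> \<open>The error truncated at twice the limiting majorant tends to zero by ordinary
   dominated convergence; what the truncation removes is at most \<open>\<kappa>\<close> times the
   distance of the two majorants.\<close>
 define g where "g n x = min \<bar>f (n + N) x - f' x\<bar> (2 * (\<kappa> * E' C x))" for n x
 have gm: "g n : borel_measurable borel" for n unfolding g_def by measurable
 have lg: "(%n. LBINT x. g n x) ~~> (integral\<^sup>L (lborel :: (real^'n) measure) (%x. 0::real))"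
 proof (rule integral_dominated_convergence[where w = "%x. 2 * (\<kappa> * E' C x)"])
  show "AE x in lborel. (%n. g n x) ~~> 0"
   using lim
  proof eventually_elim
   case (elim x)
   have "(%n. \<bar>f (n + N) x - f' x\<bar>) ~~> \<bar>f' x - f' x\<bar>" by (intro tendsto_intros LIMSEQ_ignore_initial_segment elim)
   then have "(%n. min \<bar>f (n + N) x - f' x\<bar> (2 * (\<kappa> * E' C x))) ~~> min \<bar>f' x - f' x\<bar> (2 * (\<kappa> * E' C x))"
    by (intro tendsto_min tendsto_const)
   then show ?case using E0(2)[of x] by (simp add: g_def \<kappa>_def min_def)
  qed
  show "AE x in lborel. norm (g n x) <= 2 * (\<kappa> * E' C x)" for n
   using E0(2) by (intro AE_I2) (auto simp: g_def \<kappa>_def min_def)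
  show "g n : borel_measurable lborel" for n using gm by simp
 qed (use kE in auto)
 have gi: "integrable lborel (g n)" for n by (rule Bochner_Integration.integrable_bound[of _ "%x. 2 * (\<kappa> * E' C x)"])
   (use kE E0 gm in \<open>auto simp: \<kappa>_def intro!: AE_I2\<close>, auto simp: g_def \<kappa>_def min_def)
 have key: "\<bar>?I (f (n + N)) - ?I f'\<bar> <= ?I (g n) + \<kappa> * ?I (?e (n + N))" for n
 proof -
  have fn: "integrable lborel (f (n + N))" by (rule fi) simp
  have ed: "integrable lborel (%x. ?e (n + N) x)" using Ei[of "n + N"] E'i by (simp add: N_def)
  have "?I (f (n + N)) - ?I f' = (LBINT x. f (n + N) x - f' x)" using fn f'i by simp
  also have "\<bar>...\<bar> <= (LBINT x. \<bar>f (n + N) x - f' x\<bar>)" by (rule integral_abs_bound)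
  also have "... <= (LBINT x. g n x + \<kappa> * ?e (n + N) x)"
  proof (rule integral_mono_AE)
   show "integrable lborel (%x. \<bar>f (n + N) x - f' x\<bar>)" using fn f'i by simp
   show "integrable lborel (%x. g n x + \<kappa> * ?e (n + N) x)" using gi ed by simp
   show "AE x in lborel. \<bar>f (n + N) x - f' x\<bar> <= g n x + \<kappa> * ?e (n + N) x"
    using f'b
   proof eventually_elim
    case (elim x)
    have "\<bar>f (n + N) x - f' x\<bar> <= \<kappa> * E C (n + N) x + \<kappa> * E' C x" using bd'[of "n + N" x] elim by simp
    also have "... = 2 * (\<kappa> * E' C x) + \<kappa> * (E C (n + N) x - E' C x)" by (simp add: algebra_simps)
    also have "... <= 2 * (\<kappa> * E' C x) + \<kappa> * ?e (n + N) x" by (intro add_left_mono mult_left_mono) (auto simp: \<kappa>_def)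
    finally have 1: "\<bar>f (n + N) x - f' x\<bar> <= 2 * (\<kappa> * E' C x) + \<kappa> * ?e (n + N) x" .
    have 2: "0 <= \<kappa> * ?e (n + N) x" by (simp add: \<kappa>_def)
    show ?case using 1 2 by (auto simp: g_def min_def)
   qed
  qed
  also have "... = ?I (g n) + \<kappa> * ?I (?e (n + N))" using gi ed by simp
  finally show ?thesis .
 qed
 have "(%n. ?I (g n) + \<kappa> * ?I (?e (n + N))) ~~> 0"
  using tendsto_add[OF lg tendsto_mult_right_zero[OF lE', of \<kappa>]] by simp
 then have "(%n. ?I (f (n + N)) - ?I f') ~~> 0" by (rule Lim_null_comparison[rotated]) (use key in auto)
 then have "(%n. ?I (f (n + N))) ~~> ?I f'" by (simp add: LIM_zero_iff)
 then show "(%n. LBINT x. f n x) ~~> ?I f'" by (rule LIMSEQ_offset)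
qed

end

section \<open>The linearised equation\<close>

lemma GDERIV_compose_vec:
 fixes F :: "real^'n => real" and w :: "'n => real^'n => real"
 assumes w: "!!l. GDERIV (w l) x :> W l" and F: "GDERIV F (\<chi> l. w l x) :> f"
 shows "GDERIV (%x. F (\<chi> l. w l x)) x :> (\<Sum>l\<in>UNIV. f $ l *R W l)"
proof -
 have eq: "(\<chi> l. w l x) = (\<Sum>l\<in>UNIV. w l x *R axis l 1)" for x by (simp add: vec_eq_iff axis_def if_distrib cong: if_cong)
 have "((%x. \<Sum>l\<in>UNIV. w l x *R axis l (1::real)) has_derivative (%v. \<Sum>l\<in>UNIV. (v \<bullet> W l) *R axis l 1)) (at x)"
  using w unfolding gderiv_def by (auto intro!: derivative_eq_intros)
 then have "((%x. \<chi> l. w l x) has_derivative (%v. \<Sum>l\<in>UNIV. (v \<bullet> W l) *R axis l 1)) (at x)" by (simp add: eq)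
 from has_derivative_compose[OF this F[unfolded gderiv_def]]
 have "((%x. F (\<chi> l. w l x)) has_derivative (%v. (\<Sum>l\<in>UNIV. (v \<bullet> W l) *R axis l 1) \<bullet> f)) (at x)" .
 moreover have "(%v. (\<Sum>l\<in>UNIV. (v \<bullet> W l) *R axis l 1) \<bullet> f) = (%v. v \<bullet> (\<Sum>l\<in>UNIV. f $ l *R W l))"
  by (intro ext) (simp add: inner_sum_left inner_sum_right inner_axis' mult.commute)
 ultimately show ?thesis by (simp add: gderiv_def)
qed

lemma GDERIV_isCont: "GDERIV (g :: real^'n => real) x :> w ==> isCont g x"
 unfolding gderiv_def by (rule has_derivative_continuous)

lemma GDERIV_lipschitz_ball:
 fixes g :: "real^'n => real"
 assumes g: "!!et. GDERIV g et :> gg et" and c: "continuous_on UNIV gg"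
 obtains L where "L > 0" "!!et et'. norm et <= R ==> norm et' <= R ==> \<bar>g et - g et'\<bar> <= L * norm (et - et')"
  "!!et. norm et <= R ==> norm (gg et) <= L" "!!et. norm et <= R ==> \<bar>g et\<bar> <= L"
proof -
 have cg: "continuous_on UNIV g" using GDERIV_isCont[OF g] by (simp add: continuous_at_imp_continuous_on)
 have "bounded (gg ` cball 0 R)" "bounded (g ` cball 0 R)"
  by (intro compact_imp_bounded compact_continuous_image continuous_on_subset[OF c] continuous_on_subset[OF cg]; simp)+
 then obtain L1 L2 where L: "L1 > 0" "!!et. norm et <= R ==> norm (gg et) <= L1" "L2 > 0" "!!et. norm et <= R ==> norm (g et) <= L2"
  unfolding bounded_pos by auto
 have lip: "\<bar>g et - g et'\<bar> <= (L1 + L2) * norm (et - et')" if "norm et <= R" "norm et' <= R" for et et'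
 proof -
  have "norm (g et - g et') <= (L1 + L2) * norm (et - et')"
  proof (rule differentiable_bound[of "cball 0 R" g "%et h. h \<bullet> gg et"])
   show "(g has_derivative (%h. h \<bullet> gg et)) (at et within cball 0 R)" for et
    using g[of et] by (auto simp: gderiv_def intro: has_derivative_at_withinI)
   show "onorm (%h. h \<bullet> gg et) <= L1 + L2" if "et : cball 0 R" for et
   proof (rule onorm_le)
    fix h
    have "norm (h \<bullet> gg et) <= norm h * norm (gg et)" using Cauchy_Schwarz_ineq2 by auto
    also have "... <= norm h * (L1 + L2)" using L(2)[of et] L(3) that by (intro mult_left_mono) auto
    finally show "norm (h \<bullet> gg et) <= (L1 + L2) * norm h" by (simp add: mult.commute)
   qed
  qed (use that in auto)
  then show ?thesis by simp
 qed
 show ?thesis by (rule that[of "L1 + L2"]) (use L lip in \<open>force+\<close>)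
qed

text \<open>A chain rule along the sequence \<open>hs\<close> only. The inner sequence is merely
  required to have convergent quotients at one point, which is what is known of \<open>D\<close> at
  almost every point of \<open>V\<close>.\<close>

lemma tendsto_chain_difference_quotient:
 fixes g :: "real^'n => 'b::real_normed_vector"
 assumes g: "(g has_derivative g') (at y)" and d: "(%n. (1 / hs n) *R (z n - y)) ~~> v"
 shows "(%n. (1 / hs n) *R (g (z n) - g y)) ~~> g' v"
proof -
 have bl: "bounded_linear g'" using g by (rule has_derivative_bounded_linear)
 have z: "z ~~> y"
 proof -
  have "(%n. hs n *R ((1 / hs n) *R (z n - y)) + y) ~~> 0 *R v + y" by (intro tendsto_intros hs_lim d)
  moreover have "hs n *R ((1 / hs n) *R (z n - y)) + y = z n" for n using hs_pos[of n] by simp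
  ultimately show ?thesis by simp
 qed
 obtain r where r: "!!y'. g y' = g y + g' (y' - y) + norm (y' - y) *R r y'" "r y = 0" "(r \<longlongrightarrow> 0) (at y)"
 proof
  let ?r = "%y'. (1 / norm (y' - y)) *R (g y' - g y - g' (y' - y))"
  show "g y' = g y + g' (y' - y) + norm (y' - y) *R ?r y'" for y'
   using linear_0[OF bounded_linear.linear[OF bl]] by (cases "y' = y") auto
  show "?r y = 0" by simp
  show "(?r \<longlongrightarrow> 0) (at y)" using g unfolding has_derivative_def by (simp add: divide_inverse Lim_ident_at netlimit_at)
 qed
 have rz: "(%n. r (z n)) ~~> 0"
 proof -
  have "isCont r y" using r(2,3) by (simp add: isCont_def)
  from isCont_tendsto_compose[OF this z] show ?thesis by (simp add: r(2))
 qed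
 have "(%n. g' ((1 / hs n) *R (z n - y)) + norm ((1 / hs n) *R (z n - y)) *R r (z n)) ~~> g' v + norm v *R 0"
  by (intro tendsto_intros bounded_linear.tendsto[OF bl] d rz)
 moreover have "g' ((1 / hs n) *R (z n - y)) + norm ((1 / hs n) *R (z n - y)) *R r (z n) = (1 / hs n) *R (g (z n) - g y)" for n
 proof -
  have e1: "g' ((1 / hs n) *R (z n - y)) = (1 / hs n) *R g' (z n - y)" by (rule linear_cmul[OF bounded_linear.linear[OF bl]])
  have e2: "norm ((1 / hs n) *R (z n - y)) = norm (z n - y) / hs n" unfolding norm_scaleR using hs_pos[of n] by simp
  have e3: "g (z n) - g y = g' (z n - y) + norm (z n - y) *R r (z n)" using r(1)[of "z n"] by simp
  show ?thesis unfolding e1 e2 e3 scaleR_add_right by simp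
 qed
 ultimately show ?thesis by simp
qed

section \<open>Linearisation and test functions of the gradient\<close>

context local_solution
begin

text \<open>The derivative of the whole gradient in direction i; in \<open>H j i\<close> the
  direction of differentiation is the second index.\<close>

definition Hv :: "'n => real^'n => real^'n" where "Hv i x = (\<chi> j. H j i x)"
definition Hqv :: "nat => 'n => real^'n => real^'n" where "Hqv n i x = (1 / hs n) *R (D (x + hs n *R axis i 1) - D x)"
text \<open>A C1 approximation of \<open>D\<close>: functions of \<open>wv n x\<close> are
  admissible in test functions, functions of \<open>D x\<close> are not yet.\<close>

definition wv :: "nat => real^'n => real^'n" where "wv n x = (\<chi> l. w (hs n) l x)"

lemma Hv_meas[measurable]: "Hv i : borel_measurable borel"
proof -
 have "Hv i = (%x. \<Sum>j\<in>UNIV. H j i x *R axis j 1)" by (auto simp: Hv_def vec_eq_iff axis_def if_distrib cong: if_cong)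
 then show ?thesis by simp
qed

lemma Hqv_meas[measurable]: "Hqv n i : borel_measurable borel" unfolding Hqv_def by measurable

lemma Hqv_nth: "Hqv n i x $ j = Hq n j i x" by (simp add: Hqv_def Hq_def)

lemma Hqv_tendsto: "AE x in lborel. x : V --> (\<forall>i. (%n. Hqv n i x) ~~> Hv i x)"
 using Hq_tendsto
proof eventually_elim
 case (elim x)
 then show ?case by (auto simp: Hqv_nth Hv_def intro!: vec_tendstoI)
qed

lemma Hqv_E:
 assumes "x : C"
 shows "norm (Hqv n i x) <= E C n x" "norm (Hqv n i x) * norm (Hqv n l x) <= E C n x" "1 <= E C n x"
proof -
 define T where "T i = (\<Sum>j\<in>UNIV. (Hq n j i x)^2)" for i
 have T0: "T i >= 0" for i by (simp add: T_def sum_nonneg)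
 have nT: "(norm (Hqv n i x))^2 = T i" for i
  unfolding power2_norm_eq_inner inner_vec_def Hqv_nth by (simp add: T_def power2_eq_square)
 have "(\<Sum>i\<in>UNIV. \<Sum>j\<in>UNIV. (Hq n i j x)^2) = (\<Sum>i\<in>UNIV. T i)" unfolding T_def by (rule sum.swap)
 then have EE: "E C n x = 1 + (\<Sum>i\<in>UNIV. T i)" using assms by (simp add: E_def)
 have Tle: "T i <= (\<Sum>i\<in>UNIV. T i)" for i using T0 by (intro member_le_sum) auto
 have "2 * (norm (Hqv n i x) * norm (Hqv n l x)) <= T i + T l"
  using sum_squares_bound[of "norm (Hqv n i x)" "norm (Hqv n l x)"] by (simp add: nT mult.assoc)
 then show "norm (Hqv n i x) * norm (Hqv n l x) <= E C n x" using Tle[of i] Tle[of l] EE by linarith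
 have "2 * norm (Hqv n i x) * 1 <= T i + 1" using sum_squares_bound[of "norm (Hqv n i x)" 1] by (simp add: nT)
 then show "norm (Hqv n i x) <= E C n x" using Tle[of i] T0[of i] EE by linarith
 show "1 <= E C n x" using EE T0 by (simp add: sum_nonneg)
qed

text \<open>The derivative of \<open>a\<close> at \<open>et\<close> applied to \<open>\<xi>\<close>,
  that is, the coefficient matrix of the linearised equation. It is meaningful only for nonzero
  \<open>et\<close>.\<close>

definition qa :: "real^'n => real^'n => real^'n" where
 "qa et \<xi> = A (norm et) *R \<xi> + (deriv A (norm et) / norm et * (et \<bullet> \<xi>)) *R et"

lemma a_has_derivative:
 assumes "et ~= 0" shows "(a has_derivative qa et) (at et)"
proof -
 have n: "norm et > 0" using assms by simp
 have "(A has_derivative (%t. t * deriv A (norm et))) (at (norm et))"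
  using A_DERIV[OF n] by (simp add: has_field_derivative_def mult_commute_abs)
 from has_derivative_compose[OF has_derivative_norm[OF assms] this]
 have "((%et. A (norm et)) has_derivative (%h. (h \<bullet> sgn et) * deriv A (norm et))) (at et)" .
 from has_derivative_scaleR[OF this has_derivative_ident]
 have "((%et. A (norm et) *R et) has_derivative (%h. A (norm et) *R h + ((h \<bullet> sgn et) * deriv A (norm et)) *R et)) (at et)" .
 moreover have "(%h. A (norm et) *R h + ((h \<bullet> sgn et) * deriv A (norm et)) *R et) = qa et"
  by (intro ext) (simp add: qa_def sgn_div_norm inner_commute divide_inverse mult_ac)
 ultimately show ?thesis by (simp add: a_def[abs_def])
qed

lemma B_DERIV: "t > 0 ==> (B has_real_derivative B' t) (at t)"
proof -
 assume t: "t > 0"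
 then have "at t within {0..} = at t" by (intro at_within_interior) simp
 then show ?thesis using B_der[of t] t by simp
qed

lemma bb_GDERIV:
 assumes "et ~= 0" shows "GDERIV bb et :> B' (norm et) *R sgn et"
 using GDERIV_DERIV_compose[OF GDERIV_norm[OF assms] B_DERIV] assms by (simp add: bb_def[abs_def])

lemma A_meas[measurable]: "(%et::real^'n. indicator (- {0}) et *R A (norm et)) : borel_measurable borel"
proof (rule borel_measurable_continuous_on_indicator)
 show "continuous_on (- {0}) (%et::real^'n. A (norm et))" by (rule continuous_on_compose2[OF A_contOn]) (auto intro!: continuous_intros)
qed simp

lemma A'_meas[measurable]: "(%et::real^'n. indicator (- {0}) et *R deriv A (norm et)) : borel_measurable borel"
proof (rule borel_measurable_continuous_on_indicator)
 show "continuous_on (- {0}) (%et::real^'n. deriv A (norm et))" by (rule continuous_on_compose2[OF A_cont]) (auto intro!: continuous_intros)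
qed simp

lemma qa_meas[measurable]:
 assumes [measurable]: "f : borel_measurable borel"
 shows "(%x. indicator V x *R qa (D x) (f x)) : borel_measurable borel"
proof -
 have [measurable]: "V : sets borel" using V_open by simp
 have m1: "(%x. indicator (- {0}) (D x) *R A (norm (D x))) : borel_measurable borel" by (rule measurable_compose[OF D_meas A_meas])
 have m2: "(%x. indicator (- {0}) (D x) *R deriv A (norm (D x))) : borel_measurable borel" by (rule measurable_compose[OF D_meas A'_meas])
 note [measurable] = m1 m2
 have eq: "(%x. indicator V x *R qa (D x) (f x)) = (%x. indicator V x *R
   ((indicator (- {0}) (D x) *R A (norm (D x))) *R f x + ((indicator (- {0}) (D x) *R deriv A (norm (D x))) / norm (D x) * (D x \<bullet> f x)) *R D x))"
  by (intro ext) (auto simp: indicator_def V_def qa_def)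
 show ?thesis unfolding eq by measurable
qed

lemma B'_meas[measurable]: "(%x. B' (norm (D x))) : borel_measurable borel"
proof -
 have "continuous_on UNIV (%t. B' (max 0 t))" by (rule continuous_on_compose2[OF B_cont]) (auto intro!: continuous_intros)
 then have [measurable]: "(%t. B' (max 0 t)) : borel_measurable borel" by (rule borel_measurable_continuous_onI)
 have "(%x. B' (max 0 (norm (D x)))) : borel_measurable borel" by measurable
 then show ?thesis by (simp add: max_absorb2)
qed

lemma compact_nondegenerate:
 assumes "compact S" "S <= U" "ep > 0"
 shows "compact {x : S. ep <= norm (D x)}" "{x : S. ep <= norm (D x)} <= V"
proof -
 have "closedin (top_of_set S) (S \<inter> (%x. norm (D x)) -` {ep..})"
  by (intro continuous_closedin_preimage continuous_intros continuous_on_subset[OF D_cont assms(2)])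
 then have "closed (S \<inter> (%x. norm (D x)) -` {ep..})" using assms(1) closedin_closed_trans compact_imp_closed by blast
 then have "compact (S \<inter> (S \<inter> (%x. norm (D x)) -` {ep..}))" using assms(1) by (rule compact_Int_closed[rotated])
 moreover have "S \<inter> (S \<inter> (%x. norm (D x)) -` {ep..}) = {x : S. ep <= norm (D x)}" by auto
 ultimately show "compact {x : S. ep <= norm (D x)}" by simp
 show "{x : S. ep <= norm (D x)} <= V" using assms by (auto simp: V_def)
qed

lemma D_uniform:
 assumes S: "compact S" "thicken de S <= U" "de > 0" and "ep > 0"
 obtains d where "0 < d" "d <= de" "!!x y. x : S ==> norm (y - x) <= d ==> norm (D y - D x) < ep"
proof -
 have "uniformly_continuous_on (thicken de S) D" by (intro compact_uniformly_continuous continuous_on_subset[OF D_cont] S compact_thicken)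
 then obtain d where d: "d > 0" "!!x y. x : thicken de S ==> y : thicken de S ==> dist y x < d ==> dist (D y) (D x) < ep"
  using \<open>ep > 0\<close> unfolding uniformly_continuous_on_def by metis
 show ?thesis
 proof (rule that[of "min (d / 2) de"])
  fix x y assume xy: "x : S" "norm (y - x) <= min (d / 2) de"
  then have "x : thicken de S" "y : thicken de S" using S(3) thickenI[of x S x de] thickenI[of x S y de] by auto
  then have "dist (D y) (D x) < ep" using xy d(1) by (intro d(2)) (auto simp: dist_norm)
  then show "norm (D y - D x) < ep" by (simp add: dist_norm)
 qed (use d S in auto)
qed

text \<open>The integral of the i-th derivative of \<open>ps x * g (D x)\<close> is zero. Its
  difference quotients integrate to zero by translation invariance, and since \<open>g\<close>
  vanishes near zero they live on a compact part of \<open>V\<close>, where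
  \<open>convergence\<close> applies. Nothing is assumed about weak differentiability of
  \<open>D\<close> across the critical set.\<close>

lemma integral_by_parts:
 fixes ps g :: "real^'n => real"
 assumes ps: "C1c S ps" "S <= U" and g: "!!et. GDERIV g et :> gg et" "continuous_on UNIV gg"
  and ep: "ep > 0" "!!et. norm et < ep ==> g et = 0" "!!et. norm et < ep ==> gg et = 0"
 shows "integrable lborel (%x. ps x * (gg (D x) \<bullet> Hv i x) + pderiv_at i ps x * g (D x))"
  "(LBINT x. ps x * (gg (D x) \<bullet> Hv i x) + pderiv_at i ps x * g (D x)) = 0"
proof -
 define e :: "real^'n" where "e = axis i 1"
 have S: "compact S" and ps0: "!!x. x ~: S ==> ps x = 0" using ps by (auto simp: C1c_def)
 note [measurable] = C1c_measurable[OF ps(1)] C1c_measurable_pderiv[OF ps(1)]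
 have cg: "continuous_on UNIV g" using GDERIV_isCont[OF g(1)] by (simp add: continuous_at_imp_continuous_on)
 note [measurable] = borel_measurable_continuous_onI[OF cg] borel_measurable_continuous_onI[OF g(2)]
 obtain de0 where de0: "de0 > 0" "thicken de0 S <= U" using thicken_subset_open[OF S U ps(2)] .
 \<comment> \<open>The support is thickened twice by this amount: once to contain its translates,
   and once more so that shifts of the thickened set remain in \<open>U\<close>.\<close>
 define de where "de = de0 / 2"
 have de: "de > 0" "de + de <= de0" using de0 by (auto simp: de_def)
 let ?S = "thicken de S"
 have cS: "compact ?S" by (rule compact_thicken[OF S])
 have SS: "thicken de ?S <= U"
 proof
  fix y assume "y : thicken de ?S"
  then obtain x z where "x : S" "norm (z - x) <= de" "norm (y - z) <= de" by (auto elim!: thickenE)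
  then have "norm (y - x) <= de0" using norm_triangle_ineq[of "y - z" "z - x"] de by simp
  then show "y : U" using de0(2) thickenI[OF \<open>x : S\<close>] by blast
 qed
 have SU: "?S <= U" using SS thicken_superset[of de ?S] de by auto
 obtain R where R: "R > 0" "!!x. x : thicken de ?S ==> norm (D x) <= R" by (rule D_bound[OF compact_thicken[OF cS] SS]) blast
 obtain d where d: "0 < d" "d <= de" "!!x y. x : ?S ==> norm (y - x) <= d ==> norm (D y - D x) < ep / 2"
  by (rule D_uniform[OF cS SS de(1), of "ep / 2"]) (use ep in auto)
 \<comment> \<open>Outside \<open>C\<close> the gradient is below \<open>ep / 2\<close>, and it
   varies by less than \<open>ep / 2\<close> over the shift; hence \<open>g\<close> vanishes at both
   points and so does the difference quotient.\<close>
 define C where "C = {x : ?S. ep / 2 <= norm (D x)}"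
 have C: "compact C" "C <= V" unfolding C_def using compact_nondegenerate[OF cS SU, of "ep / 2"] ep by auto
 obtain L where L: "L > 0" "!!et et'. norm et <= R ==> norm et' <= R ==> \<bar>g et - g et'\<bar> <= L * norm (et - et')"
  "!!et. norm et <= R ==> norm (gg et) <= L" "!!et. norm et <= R ==> \<bar>g et\<bar> <= L" by (rule GDERIV_lipschitz_ball[OF g, of R]) blast
 obtain P where P: "P > 0" "!!x v. \<bar>ps (x + v) - ps x\<bar> <= P * norm v" "!!x. norm (grad ps x) <= P" using C1c_bound_diff_quotient[OF ps(1)] by metis
 obtain P0 where P0: "P0 > 0" "!!x. norm (ps x) <= P0" using bounded_compact_support[OF S C1c_continuous[OF ps(1)] ps0] by blast
 define Y where "Y x = ps x * g (D x)" for x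
 have Ym[measurable]: "Y : borel_measurable borel" unfolding Y_def by measurable
 have Yi: "integrable lborel Y"
 proof (rule integrable_bounded_compact[OF cS Ym, of "P0 * L"])
  fix x assume "x : ?S"
  then have "norm (D x) <= R" using R(2) thicken_superset[of de ?S] de by auto
  then show "\<bar>Y x\<bar> <= P0 * L" unfolding Y_def abs_mult using P0 L(4) by (intro mult_mono) auto
 next
  fix x assume "x ~: ?S" then show "Y x = 0" using ps0[of x] thicken_superset[of de S] de by (auto simp: Y_def)
 qed
 define f where "f n x = (Y (x + hs n *R e) - Y x) / hs n" for n x
 let ?f = "%x. ps x * (gg (D x) \<bullet> Hv i x) + pderiv_at i ps x * g (D x)"
 have fm: "f n : borel_measurable borel" for n unfolding f_def by measurable
 have fm': "?f : borel_measurable borel" by measurable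
 obtain N where N: "!!n. n >= N ==> hs n < d" using hs_eventually_less[OF d(1)] unfolding eventually_sequentially by blast
 have f_out: "f n x = 0" if x: "x ~: C" and n: "n >= N" for n x
 proof -
  let ?y = "x + hs n *R e"
  have hd: "norm (?y - x) < d" "norm (x - ?y) < d" using N[OF n] hs_pos[of n] by (auto simp: e_def)
  have "Y x = 0 & Y ?y = 0"
  proof (cases "x : ?S")
   case False
   then have "x ~: S" "?y ~: S" using thicken_superset[of de S] de thickenI[of ?y S x de] hd d(2) by auto
   then show ?thesis using ps0 by (simp add: Y_def)
  next
   case True
   then have "norm (D x) < ep / 2" using x by (auto simp: C_def)
   moreover have "norm (D ?y - D x) < ep / 2" using True hd by (intro d(3)) auto
   ultimately have "norm (D x) < ep" "norm (D ?y) < ep" using norm_triangle_ineq[of "D ?y - D x" "D x"] ep(1) by auto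
   then show ?thesis using ep(2) by (simp add: Y_def)
  qed
  then show ?thesis by (simp add: f_def)
 qed
 have f'_out: "?f x = 0" if "x ~: C" for x
 proof (cases "x : S")
  case True
  then have "x : ?S" using thicken_superset[of de S] de by auto
  then have "norm (D x) < ep" using that ep(1) by (auto simp: C_def)
  then show ?thesis using ep by simp
 next
  case False then show ?thesis using ps0 C1c_pderiv_0[OF ps(1)] by simp
 qed
 have lim: "AE x in lborel. (%n. f n x) ~~> ?f x"
  using Hqv_tendsto
 proof eventually_elim
  case (elim x)
  show ?case
  proof (cases "x : C")
   case False
   then have "\<forall>\<^sub>F n in sequentially. f n x = ?f x" using f_out f'_out by (intro eventually_sequentiallyI[of N]) auto
   then show ?thesis by (rule tendsto_eventually)
  next
   case True
   then have q: "(%n. (1 / hs n) *R (D (x + hs n *R e) - D x)) ~~> Hv i x" using elim C(2) by (auto simp: Hqv_def e_def)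
   have 1: "(%n. (1 / hs n) *R (g (D (x + hs n *R e)) - g (D x))) ~~> Hv i x \<bullet> gg (D x)"
    by (rule tendsto_chain_difference_quotient[OF g(1)[unfolded gderiv_def] q])
   have "GDERIV ps (x + 0 *R e) :> grad ps x" using ps(1) by (auto simp: C1c_def intro: GDERIV_grad)
   from DERIV_hs[OF GDERIV_line[OF this]] have 2: "(%n. (ps (x + hs n *R e) - ps x) / hs n) ~~> pderiv_at i ps x"
    by (simp add: e_def inner_axis')
   have xU: "x : U" using True C(2) V_subset by blast
   have xl: "(%n. x + hs n *R e) ~~> x" using tendsto_add[OF tendsto_const[of x] tendsto_scaleR[OF hs_lim tendsto_const[of e]]] by simp
   have "isCont D x" using D_cont U xU by (simp add: continuous_on_eq_continuous_at)
   from isCont_tendsto_compose[OF this xl] have 3: "(%n. D (x + hs n *R e)) ~~> D x" .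
   have 4: "(%n. g (D (x + hs n *R e))) ~~> g (D x)" by (rule isCont_tendsto_compose[OF GDERIV_isCont[OF g(1)] 3])
   have "(%n. ps x * ((1 / hs n) *R (g (D (x + hs n *R e)) - g (D x))) + (ps (x + hs n *R e) - ps x) / hs n * g (D (x + hs n *R e)))
     ~~> ps x * (Hv i x \<bullet> gg (D x)) + pderiv_at i ps x * g (D x)" by (intro tendsto_intros 1 2 4)
   moreover have "ps x * ((1 / hs n) *R (g (D (x + hs n *R e)) - g (D x))) + (ps (x + hs n *R e) - ps x) / hs n * g (D (x + hs n *R e)) = f n x" for n
    using hs_pos[of n] by (simp add: f_def Y_def field_simps)
   ultimately show ?thesis by (simp add: inner_commute)
  qed
 qed
 have bd: "\<forall>\<^sub>F n in sequentially. \<forall>x. \<bar>f n x\<bar> <= (P0 * L + P * L) * E C n x"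
 proof (rule eventually_sequentiallyI[of N], rule allI)
  fix n x assume n: "n >= N"
  show "\<bar>f n x\<bar> <= (P0 * L + P * L) * E C n x"
  proof (cases "x : C")
   case False then show ?thesis using f_out[OF False n] by (simp add: E_def)
  next
   case True
   let ?y = "x + hs n *R e"
   have hd: "norm (?y - x) < d" using N[OF n] hs_pos[of n] by (auto simp: e_def)
   have xS: "x : ?S" using True by (simp add: C_def)
   have nx: "norm (D x) <= R" "norm (D ?y) <= R"
    using R(2)[of x] R(2)[of ?y] thickenI[OF xS, of x de] thickenI[OF xS, of ?y de] hd d(2) de by auto
   have eq: "f n x = ps x * ((g (D ?y) - g (D x)) / hs n) + (ps ?y - ps x) / hs n * g (D ?y)"
    using hs_pos[of n] by (simp add: f_def Y_def field_simps)
   have "\<bar>g (D ?y) - g (D x)\<bar> / hs n <= L * norm (D ?y - D x) / hs n" using L(2)[OF nx(2,1)] hs_pos[of n] by (intro divide_right_mono) auto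
   also have "... = L * norm (Hqv n i x)" using hs_pos[of n] by (simp add: Hqv_def e_def)
   finally have b1: "\<bar>ps x * ((g (D ?y) - g (D x)) / hs n)\<bar> <= P0 * (L * norm (Hqv n i x))"
    unfolding abs_mult using P0 hs_pos[of n] by (intro mult_mono) auto
   have "\<bar>ps ?y - ps x\<bar> / hs n <= P" using P(2)[of x "hs n *R e"] hs_pos[of n] by (simp add: e_def divide_le_eq)
   then have b2: "\<bar>(ps ?y - ps x) / hs n * g (D ?y)\<bar> <= P * L"
    unfolding abs_mult using L(4)[OF nx(2)] P hs_pos[of n] by (intro mult_mono) auto
   have "\<bar>f n x\<bar> <= P0 * (L * norm (Hqv n i x)) + P * L" unfolding eq using b1 b2 by linarith
   also have "... <= P0 * (L * E C n x) + P * L * E C n x"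
    using Hqv_E(1)[OF True, of n i] Hqv_E(3)[OF True, of n] P0(1) L(1) mult_pos_pos[OF P(1) L(1)] by (intro add_mono mult_left_mono) (auto simp: mult_le_cancel_left1)
   finally show ?thesis by (simp add: algebra_simps)
  qed
 qed
 note conv = convergence[OF C fm fm' lim bd]
 show "integrable lborel ?f" by (rule conv(1))
 have "(LBINT x. f n x) = 0" for n
  unfolding f_def using Yi lborel_integrable_shift[OF Yi] lborel_integral_shift[OF Ym] by (simp add: diff_divide_distrib)
 then show "(LBINT x. ?f x) = 0" using conv(2) by (simp add: LIMSEQ_const_iff)
qed


lemma wv_close:
 assumes S: "compact S" "thicken de S <= U" "de > 0" and ep: "ep > 0"
 obtains N where "!!n. n >= N ==> hs n < de / 2"
  "!!n x i. n >= N ==> x : S ==> norm (D (x + hs n *R axis i 1) - D x) < ep"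
  "!!n x. n >= N ==> x : S ==> norm (wv n x - D x) <= ep"
proof -
 \<comment> \<open>Each component of \<open>wv n x\<close> is the corresponding derivative at an
   intermediate point of its own, so the components are estimated separately and added in the l1
   norm.\<close>
 define ep' where "ep' = ep / real CARD('n)"
 have c: "real CARD('n) >= 1" using zero_less_card_finite[where 'a = 'n] by linarith
 have ep': "ep' > 0" "ep' <= ep" using ep c by (auto simp: ep'_def divide_le_eq mult_le_cancel_left1)
 obtain d where d: "0 < d" "d <= de" "!!x y. x : S ==> norm (y - x) <= d ==> norm (D y - D x) < ep'"
  by (rule D_uniform[OF S ep'(1)]) blast
 have "min d (de / 2) > 0" using d S(3) by simp
 then obtain N where N: "!!n. n >= N ==> hs n < min d (de / 2)" using hs_eventually_less unfolding eventually_sequentially by blast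
 show ?thesis
 proof (rule that[of N])
  fix n assume n: "n >= N"
  show "hs n < de / 2" using N[OF n] by simp
  fix x assume x: "x : S"
  show "norm (D (x + hs n *R axis i 1) - D x) < ep" for i
   using d(3)[OF x, of "x + hs n *R axis i 1"] N[OF n] hs_pos[of n] ep'(2) by simp
  have comp: "\<bar>(wv n x - D x) $ l\<bar> <= ep'" for l
  proof -
   have inU: "x + t *R axis l 1 : U" if "t : {0..hs n}" for t
    using subsetD[OF S(2) thickenI[OF x, of "x + t *R axis l 1" de]] that N[OF n] d(2) by simp
   obtain z where z: "0 < z" "z < hs n" "u (x + hs n *R axis l 1) - u x = hs n * (axis l 1 \<bullet> grad u (x + z *R axis l 1))"
    by (rule mvt_direction[OF hs_pos[of n], of u x "axis l 1"]) (use u_diff inU in auto)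
   have "wv n x $ l = D (x + z *R axis l 1) $ l"
    using z hs_pos[of n] D_U[OF inU[of z]] by (simp add: wv_def w_def inner_axis')
   then have "\<bar>(wv n x - D x) $ l\<bar> = \<bar>(D (x + z *R axis l 1) - D x) $ l\<bar>" by simp
   also have "... <= norm (D (x + z *R axis l 1) - D x)" by (rule component_le_norm_cart)
   also have "... <= ep'" using d(3)[OF x, of "x + z *R axis l 1"] z N[OF n] by simp
   finally show ?thesis .
  qed
  have "norm (wv n x - D x) <= (\<Sum>l\<in>UNIV. \<bar>(wv n x - D x) $ l\<bar>)" by (rule norm_le_l1_cart)
  also have "... <= (\<Sum>l\<in>(UNIV::'n set). ep')" by (intro sum_mono comp)
  also have "... = ep" using c by (simp add: ep'_def)
  finally show "norm (wv n x - D x) <= ep" .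
 qed
qed

lemma wv_tendsto:
 assumes "x : U" shows "(%n. wv n x) ~~> D x"
proof (rule vec_tendstoI)
 fix l
 have "GDERIV u (x + 0 *R axis l 1) :> D x" using GDERIV_grad[OF u_diff[OF assms]] by (simp add: D_U[OF assms])
 from DERIV_hs[OF GDERIV_line[OF this]] show "(%n. wv n x $ l) ~~> D x $ l" by (simp add: wv_def w_def inner_axis')
qed

lemma wv_GDERIV:
 assumes "x : U" "!!i. x + hs n *R axis i 1 : U" "GDERIV F (wv n x) :> f"
 shows "GDERIV (%x. F (wv n x)) x :> (\<Sum>l\<in>UNIV. f $ l *R Hqv n l x)"
proof -
 have "GDERIV (w (hs n) l) x :> Hqv n l x" for l unfolding Hqv_def by (rule w_GDERIV[OF assms(1,2)])
 from GDERIV_compose_vec[where F = F and f = f, OF this] show ?thesis using assms(3) by (simp add: wv_def)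
qed

lemma wv_test:
 fixes ps F :: "real^'n => real"
 assumes ps: "C1c S ps" and S: "thicken de S <= U" "de > 0" and n: "hs n < de / 2"
  and F: "!!et. GDERIV F et :> FF et" "continuous_on UNIV FF"
 shows "C1c S (%x. (ps x)^2 * F (wv n x))"
  and "x : S ==> grad (%x. (ps x)^2 * F (wv n x)) x = (2 * ps x * F (wv n x)) *R grad ps x + (ps x)^2 *R (\<Sum>l\<in>UNIV. FF (wv n x) $ l *R Hqv n l x)"
  and "continuous_on S (wv n)"
proof -
 define W where "W = (\<Union>y\<in>S. ball y (de / 2))"
 have cS: "compact S" and ps0: "!!x. x ~: S ==> ps x = 0" using ps by (auto simp: C1c_def)
 have W: "open W" "S <= W" using S(2) by (auto simp: W_def)
 have WU: "x : U & (\<forall>i. x + hs n *R axis i 1 : U)" if xW: "x : W" for x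
 proof -
  obtain y where y: "y : S" "norm (x - y) < de / 2" using xW by (auto simp: W_def dist_norm norm_minus_commute)
  have "norm (x - y) <= de" "norm (x + hs n *R axis i 1 - y) <= de" for i
   using y n hs_pos[of n] norm_triangle_ineq[of "x - y" "hs n *R axis i 1"] by (auto simp: algebra_simps)
  then show ?thesis using subsetD[OF S(1) thickenI[OF y(1)]] by blast
 qed
 have cH: "continuous_on W (Hqv n l)" for l
  unfolding Hqv_def using WU by (intro continuous_intros continuous_on_compose2[OF D_cont] continuous_on_subset[OF D_cont]) auto
 have cw: "continuous_on W (wv n)"
  unfolding wv_def
 proof (rule continuous_on_vec_lambda)
  fix l
  show "continuous_on W (w (hs n) l)" by (intro continuous_at_imp_continuous_on ballI) (use w_GDERIV WU in \<open>blast intro: GDERIV_isCont\<close>)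
 qed
 show "continuous_on S (wv n)" using cw W(2) by (rule continuous_on_subset)
 have cF: "continuous_on W (%x. F (wv n x))"
  by (rule continuous_on_compose2[OF _ cw, of UNIV]) (auto intro!: continuous_at_imp_continuous_on GDERIV_isCont[OF F(1)])
 have cFF: "continuous_on W (%x. FF (wv n x))" by (rule continuous_on_compose2[OF F(2) cw]) auto
 let ?G = "%x. (ps x)^2 *R (\<Sum>l\<in>UNIV. FF (wv n x) $ l *R Hqv n l x) + (2 * ps x * F (wv n x)) *R grad ps x"
 have G: "GDERIV (%x. (ps x)^2 * F (wv n x)) x :> ?G x" if "x : W" for x
  by (rule grad_square_mult[OF GDERIV_grad wv_GDERIV[OF _ _ F(1)]]) (use ps WU[OF that] in \<open>auto simp: C1c_def\<close>)
 have cG: "continuous_on W ?G" by (intro continuous_intros cF cFF cH C1c_continuous[OF ps] C1c_continuous_grad[OF ps])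
 note X = C1cI[OF cS W G cG]
 show "C1c S (%x. (ps x)^2 * F (wv n x))" by (rule X(1)) (use ps0 in auto)
 show "x : S ==> grad (%x. (ps x)^2 * F (wv n x)) x = (2 * ps x * F (wv n x)) *R grad ps x + (ps x)^2 *R (\<Sum>l\<in>UNIV. FF (wv n x) $ l *R Hqv n l x)"
  using X(2)[of x] W(2) ps0 by (auto simp: add.commute)
qed

lemma sum_Hqv_bound:
 assumes "x : C" "norm f <= L" "L > 0"
 shows "norm (\<Sum>l\<in>UNIV. f $ l *R Hqv n l x) * norm (Hqv n i x) <= L * real CARD('n) * E C n x"
  "norm (\<Sum>l\<in>UNIV. f $ l *R Hqv n l x) <= L * real CARD('n) * E C n x"
proof -
 have f: "\<bar>f $ l\<bar> <= L" for l using component_le_norm_cart[of f l] assms(2) by linarith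
 have *: "norm (\<Sum>l\<in>UNIV. f $ l *R Hqv n l x) <= (\<Sum>l\<in>UNIV. L * norm (Hqv n l x))"
 proof (rule order_trans[OF norm_sum sum_mono])
  fix l show "norm (f $ l *R Hqv n l x) <= L * norm (Hqv n l x)" unfolding norm_scaleR by (intro mult_right_mono f) simp
 qed
 have "norm (\<Sum>l\<in>UNIV. f $ l *R Hqv n l x) * norm (Hqv n i x) <= (\<Sum>l\<in>UNIV. L * norm (Hqv n l x)) * norm (Hqv n i x)"
  by (intro mult_right_mono *) simp
 also have "... = (\<Sum>l\<in>UNIV. L * (norm (Hqv n l x) * norm (Hqv n i x)))" by (simp add: sum_distrib_right mult.assoc)
 also have "... <= (\<Sum>l\<in>(UNIV::'n set). L * E C n x)" using Hqv_E(2)[OF assms(1)] assms(3) by (intro sum_mono mult_left_mono) auto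
 finally show "norm (\<Sum>l\<in>UNIV. f $ l *R Hqv n l x) * norm (Hqv n i x) <= L * real CARD('n) * E C n x" by (simp add: mult_ac)
 have "(\<Sum>l\<in>UNIV. L * norm (Hqv n l x)) <= (\<Sum>l\<in>(UNIV::'n set). L * E C n x)" using Hqv_E(1)[OF assms(1)] assms(3) by (intro sum_mono mult_left_mono) auto
 then show "norm (\<Sum>l\<in>UNIV. f $ l *R Hqv n l x) <= L * real CARD('n) * E C n x" using * by (simp add: mult_ac)
qed

text \<open>The integrand of the equation differentiated in direction i and tested with
  \<open>(ps x)^2 * F (D x)\<close>; \<open>FF\<close> stands for the gradient of \<open>F\<close>.
  The right hand side is left out, since it is only ever estimated.\<close>

definition lin_integrand :: "(real^'n => real) => (real^'n => real) => (real^'n => real^'n) => 'n => real^'n => real" where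
 "lin_integrand ps F FF i x = indicator V x *
   (qa (D x) (Hv i x) \<bullet> ((2 * ps x * F (D x)) *R grad ps x + (ps x)^2 *R (\<Sum>l\<in>UNIV. FF (D x) $ l *R Hv l x))
   + B' (norm (D x)) * (sgn (D x) \<bullet> Hv i x) * ((ps x)^2 * F (D x)))"

text \<open>The difference equation is tested with \<open>(ps x)^2 * F (wv n x)\<close>, divided by
  \<open>hs n\<close>, and passed to the limit. \<open>K0\<close> and \<open>R\<close> are fixed
  before \<open>F\<close>, and the bound depends on \<open>F\<close> only through its supremum on a
  ball: this uniformity allows the truncation in \<open>F\<close> to be removed later.\<close>

lemma linearized_equation:
 fixes ps :: "real^'n => real"
 assumes ps: "C1c S ps" "S <= U" "!!x. 0 <= ps x" "!!x. ps x <= 1"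
 obtains K0 R where "K0 > 0" "R > 0" "!!x. x : S ==> norm (D x) <= R"
  "!!F FF ep Fm i. (!!et. GDERIV F et :> FF et) ==> continuous_on UNIV FF ==> ep > 0 ==>
   (!!et. norm et < ep ==> F et = 0) ==> (!!et. norm et < ep ==> FF et = 0) ==> (!!et. norm et <= R ==> \<bar>F et\<bar> <= Fm) ==>
   integrable lborel (lin_integrand ps F FF i) & \<bar>\<integral>x. lin_integrand ps F FF i x \<partial>lborel\<bar> <= K0 * Fm"
proof -
 have S: "compact S" and ps0: "!!x. x ~: S ==> ps x = 0" using ps by (auto simp: C1c_def)
 note G_meas[measurable]
 have [measurable]: "V : sets borel" using V_open by simp
 note [measurable] = C1c_measurable[OF ps(1)] borel_measurable_continuous_onI[OF C1c_continuous_grad[OF ps(1)]]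
 obtain de where de: "de > 0" "thicken de S <= U" using thicken_subset_open[OF S U ps(2)] .
 obtain R0 where R0: "R0 > 0" "!!x. x : thicken de S ==> norm (D x) <= R0" by (rule D_bound[OF compact_thicken[OF S] de(2)]) blast
 \<comment> \<open>Room for \<open>wv n x\<close>, which is close to \<open>D x\<close> but need not
   obey its bound.\<close>
 define R where "R = R0 + 1"
 have R: "R > 0" "R >= R0" using R0 by (auto simp: R_def)
 have SR: "norm (D x) <= R0" if "x : S" for x using R0(2) that thicken_superset[of de S] de by auto
 obtain LG deG where LG: "LG > 0" "deG > 0" "!!i h. 0 < h ==> h < deG ==> AE x in lborel. x : S --> \<bar>G (x + h *R axis i 1) - G x\<bar> <= LG * h"
  using G_lip[OF S ps(2)] by blast
 obtain LB where LB: "LB > 0" "!!et et'. norm et <= R0 ==> norm et' <= R0 ==> \<bar>bb et - bb et'\<bar> <= LB * norm (et - et')" by (rule bb_lipschitz[of R0]) blast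
 obtain P where P: "P > 0" "!!x. norm (grad ps x) <= P" using bounded_compact_support[OF S C1c_continuous_grad[OF ps(1)] C1c_grad_0[OF ps(1)]] by blast
 define mS :: real where "mS = (LBINT x. indicator S x)"
 have mS: "mS >= 0" unfolding mS_def by (intro Bochner_Integration.integral_nonneg) auto
 have iS: "integrable lborel (indicator S :: _ => real)"
  using emeasure_compact_finite[OF S] S by (simp add: integrable_indicator_iff borel_compact)
 show ?thesis
 \<comment> \<open>Lipschitz constant of \<open>G\<close> times the measure of the support; 1 is
   added to make the constant positive.\<close>
 proof (rule that[of "LG * mS + 1" R])
  show "LG * mS + 1 > 0" using LG mS by (simp add: add_nonneg_pos)
  show "R > 0" by (rule R(1))
  show "norm (D x) <= R" if "x : S" for x using SR[OF that] R(2) by linarith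
  fix F :: "real^'n => real" and FF ep0 Fm i
  assume F: "!!et. GDERIV F et :> FF et" "continuous_on UNIV FF" and ep0: "ep0 > 0"
   and F0: "!!et. norm et < ep0 ==> F et = 0" and FF0: "!!et. norm et < ep0 ==> FF et = 0" and Fm: "!!et. norm et <= R ==> \<bar>F et\<bar> <= Fm"
  have Fm0: "Fm >= 0" using Fm[of 0] R(1) by simp
  define ep where "ep = min ep0 1"
  have ep: "ep > 0" "ep <= ep0" "ep <= 1" using ep0 by (auto simp: ep_def)
  have cF: "continuous_on UNIV F" using GDERIV_isCont[OF F(1)] by (simp add: continuous_at_imp_continuous_on)
  note [measurable] = borel_measurable_continuous_onI[OF cF] borel_measurable_continuous_onI[OF F(2)]
  define e :: "real^'n" where "e = axis i 1"
  let ?a = "%n x. (1 / hs n) *R (a (D (x + hs n *R e)) - a (D x))" and ?b = "%n x. (1 / hs n) *R (bb (D (x + hs n *R e)) - bb (D x))"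
  let ?g = "%x y h. (2 * ps x * F y) *R grad ps x + (ps x)^2 *R (\<Sum>l\<in>UNIV. FF y $ l *R h l)"
  obtain N0 where N0: "!!n. n >= N0 ==> hs n < de / 2"
   "!!n x i. n >= N0 ==> x : S ==> norm (D (x + hs n *R axis i 1) - D x) < ep / 4"
   "!!n x. n >= N0 ==> x : S ==> norm (wv n x - D x) <= ep / 4"
   by (rule wv_close[OF S de(2,1), of "ep / 4"]) (use ep in auto)
  obtain N1 where N1: "!!n. n >= N1 ==> hs n < deG" using hs_eventually_less[OF LG(2)] unfolding eventually_sequentially by blast
  define N where "N = max N0 N1"
  \<comment> \<open>With all deviations at most \<open>ep / 4\<close>, off \<open>C\<close> the
    vector \<open>wv n x\<close> has norm below \<open>ep0\<close>, so \<open>F\<close> and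
    \<open>FF\<close> vanish there, while on \<open>C\<close> the shifted gradient keeps norm at
    least \<open>ep / 4\<close>, where \<open>a\<close> is Lipschitz.\<close>
  define C where "C = {x : S. ep / 2 <= norm (D x)}"
  have C: "compact C" "C <= V" unfolding C_def using compact_nondegenerate[OF S ps(2), of "ep / 2"] ep by auto
  have wR: "norm (wv n x) <= R" if "n >= N" "x : S" for n x
   using N0(3)[of n x] SR[of x] that ep norm_triangle_ineq[of "wv n x - D x" "D x"] by (auto simp: N_def R_def)
  obtain LF where LF: "LF > 0" "!!et. norm et <= R ==> norm (FF et) <= LF" using GDERIV_lipschitz_ball[OF F, of R] by metis
  define ph where "ph n x = (ps x)^2 * F (wv n x)" for n x
  have ph: "C1c S (ph n)" "!!x. x : S ==> grad (ph n) x = ?g x (wv n x) (%l. Hqv n l x)"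
   if "n >= N" for n
   unfolding ph_def using wv_test[OF ps(1) de(2,1) N0(1) F] that by (auto simp: N_def)
  \<comment> \<open>For small n the test function need not be C1; the value zero keeps every member
    of the sequence measurable, as \<open>convergence\<close> demands.\<close>
  define f where "f n x = (if n >= N then ?a n x \<bullet> grad (ph n) x + ?b n x * ph n x else 0)" for n x
  have fm: "f n : borel_measurable borel" for n
  proof (cases "n >= N")
   case True
   note [measurable] = C1c_measurable[OF ph(1)[OF True]] borel_measurable_continuous_onI[OF C1c_continuous_grad[OF ph(1)[OF True]]]
   have "f n = (%x. ?a n x \<bullet> grad (ph n) x + ?b n x * ph n x)"
    using True by (intro ext) (simp add: f_def)
   then show ?thesis by simp
  next
   case False
   then have "f n = (%x. 0)" by (intro ext) (simp add: f_def)
   then show ?thesis by simp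
  qed
  have lm: "lin_integrand ps F FF i : borel_measurable borel"
  proof -
   have [measurable]: "(%x. indicator V x *R qa (D x) (Hv i x)) : borel_measurable borel" by (rule qa_meas) auto
   have FFn[measurable]: "(%x. FF (D x) $ l) : borel_measurable borel" for l
   proof -
    have "(%x. FF (D x) $ l) = (%x. FF (D x) \<bullet> axis l 1)" by (simp add: inner_axis)
    then show ?thesis by simp
   qed
   have eq: "lin_integrand ps F FF i = (%x. (indicator V x *R qa (D x) (Hv i x)) \<bullet> ?g x (D x) (%l. Hv l x)
    + indicator V x * (B' (norm (D x)) * (sgn (D x) \<bullet> Hv i x) * ((ps x)^2 * F (D x))))" by (intro ext) (simp add: lin_integrand_def distrib_left)
   show ?thesis unfolding eq sgn_div_norm by measurable
  qed
  have out: "ph n x = 0 & grad (ph n) x = 0" if x: "x ~: C" and n: "n >= N" for n x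
  proof (cases "x : S")
   case False then show ?thesis using ph(1)[OF n] C1c_grad_0[OF ph(1)[OF n]] by (simp add: C1c_def)
  next
   case True
   then have "norm (wv n x) < ep0" using x N0(3)[of n x] n ep norm_triangle_ineq[of "wv n x - D x" "D x"] by (auto simp: C_def N_def)
   then have "F (wv n x) = 0" "FF (wv n x) = 0" using F0 FF0 by auto
   then show ?thesis using ph(2)[OF n True] by (simp add: ph_def)
  qed
  have out': "lin_integrand ps F FF i x = 0" if "x ~: C" for x
  proof (cases "x : S")
   case False then show ?thesis using ps0 by (simp add: lin_integrand_def)
  next
   case True
   then have "norm (D x) < ep0" using that ep by (auto simp: C_def)
   then show ?thesis using F0 FF0 by (simp add: lin_integrand_def)
  qed
  have lim: "AE x in lborel. (%n. f n x) ~~> lin_integrand ps F FF i x"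
   using Hqv_tendsto
  proof eventually_elim
   case (elim x)
   show ?case
   proof (cases "x : C")
    case False
    then have "\<forall>\<^sub>F n in sequentially. f n x = lin_integrand ps F FF i x" using out out' by (intro eventually_sequentiallyI[of N]) (auto simp: f_def)
    then show ?thesis by (rule tendsto_eventually)
   next
    case True
    then have xV: "x : V" "x : U" "D x ~= 0" "x : S" using C(2) by (auto simp: V_def C_def)
    have Hl: "(%n. Hqv n l x) ~~> Hv l x" for l using elim xV by blast
    have q: "(%n. (1 / hs n) *R (D (x + hs n *R e) - D x)) ~~> Hv i x" using Hl[of i] by (simp add: Hqv_def e_def)
    have l1: "(%n. ?a n x) ~~> qa (D x) (Hv i x)" by (rule tendsto_chain_difference_quotient[OF a_has_derivative[OF xV(3)] q])
    have l2: "(%n. ?b n x) ~~> Hv i x \<bullet> (B' (norm (D x)) *R sgn (D x))"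
     by (rule tendsto_chain_difference_quotient[OF bb_GDERIV[OF xV(3), unfolded gderiv_def] q])
    note wl = wv_tendsto[OF xV(2)]
    have l3: "(%n. F (wv n x)) ~~> F (D x)" by (rule isCont_tendsto_compose[OF GDERIV_isCont[OF F(1)] wl])
    have "isCont FF (D x)" using F(2) by (simp add: continuous_on_eq_continuous_at)
    from isCont_tendsto_compose[OF this wl] have l4: "(%n. FF (wv n x)) ~~> FF (D x)" .
    have lm1: "(%n. ?a n x \<bullet> ?g x (wv n x) (%l. Hqv n l x)
      + ?b n x * ((ps x)^2 * F (wv n x)))
     ~~> qa (D x) (Hv i x) \<bullet> ?g x (D x) (%l. Hv l x)
      + Hv i x \<bullet> (B' (norm (D x)) *R sgn (D x)) * ((ps x)^2 * F (D x))" by (intro tendsto_intros l1 l2 l3 l4 Hl)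
    have lm2: "qa (D x) (Hv i x) \<bullet> ?g x (D x) (%l. Hv l x)
      + Hv i x \<bullet> (B' (norm (D x)) *R sgn (D x)) * ((ps x)^2 * F (D x)) = lin_integrand ps F FF i x"
     using xV(1) by (simp add: lin_integrand_def inner_commute)
    show ?thesis
    proof (rule Lim_transform_eventually[OF lm1[unfolded lm2]])
     show "\<forall>\<^sub>F n in sequentially. ?a n x \<bullet> ?g x (wv n x) (%l. Hqv n l x)
      + ?b n x * ((ps x)^2 * F (wv n x)) = f n x"
     proof (rule eventually_sequentiallyI[of N])
      fix n assume n: "N <= n"
      show "?a n x \<bullet> ?g x (wv n x) (%l. Hqv n l x)
       + ?b n x * ((ps x)^2 * F (wv n x)) = f n x"
       unfolding f_def ph(2)[OF n xV(4)] using n by (simp only: if_True ph_def)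
     qed
    qed
   qed
  qed
  obtain L where L: "L > 0" "!!et et'. ep / 4 <= norm et ==> norm et <= R ==> ep / 4 <= norm et' ==> norm et' <= R ==> norm (a et - a et') <= L * norm (et - et')"
   by (rule a_lipschitz[of "ep / 4" R]) (use ep R0 in \<open>auto simp: R_def\<close>)
  define c where "c = L * (2 * Fm * P) + L * (LF * real CARD('n)) + LB * Fm"
  have bd: "\<forall>\<^sub>F n in sequentially. \<forall>x. \<bar>f n x\<bar> <= c * E C n x"
  proof (rule eventually_sequentiallyI[of N], rule allI)
   fix n x assume n: "n >= N"
   show "\<bar>f n x\<bar> <= c * E C n x"
   proof (cases "x : C")
    case False then show ?thesis using out[OF False n] by (simp add: f_def E_def)
   next
    case True
    let ?y = "x + hs n *R e"
    have xS: "x : S" "ep / 2 <= norm (D x)" using True by (auto simp: C_def)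
    have dy: "norm (D ?y - D x) < ep / 4" using N0(2)[OF _ xS(1), of n i] n by (simp add: e_def N_def)
    have nx: "norm (D x) <= R0" "norm (D ?y) <= R0"
    proof -
     show "norm (D x) <= R0" by (rule SR[OF xS(1)])
     have "?y : thicken de S" using N0(1)[of n] n hs_pos[of n] by (intro thickenI[OF xS(1)]) (auto simp: e_def N_def)
     then show "norm (D ?y) <= R0" by (rule R0(2))
    qed
    have ny: "ep / 4 <= norm (D ?y)" using dy xS(2) norm_triangle_ineq2[of "D x" "D ?y"] by (simp add: norm_minus_commute)
    have hq: "norm (D ?y - D x) / hs n = norm (Hqv n i x)" using hs_pos[of n] by (simp add: Hqv_def e_def)
    have "norm (a (D ?y) - a (D x)) / hs n <= L * norm (D ?y - D x) / hs n"
     using L(2)[of "D ?y" "D x"] nx ny xS(2) R(2) ep hs_pos[of n] by (intro divide_right_mono) auto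
    then have b1: "norm (?a n x) <= L * norm (Hqv n i x)" using hs_pos[of n] unfolding times_divide_eq_right[symmetric] hq by simp
    have "\<bar>bb (D ?y) - bb (D x)\<bar> / hs n <= LB * norm (D ?y - D x) / hs n"
     using LB(2)[of "D ?y" "D x"] nx hs_pos[of n] by (intro divide_right_mono) auto
    then have b2: "\<bar>?b n x\<bar> <= LB * norm (Hqv n i x)" using hs_pos[of n] unfolding times_divide_eq_right[symmetric] hq by (simp add: abs_mult)
    have w1: "norm (wv n x) <= R" by (rule wR[OF n xS(1)])
    have ps1: "\<bar>ps x\<bar> <= 1" "(ps x)^2 <= 1" using ps(3,4)[of x] by (auto intro: power_le_one)
    let ?s = "\<Sum>l\<in>UNIV. FF (wv n x) $ l *R Hqv n l x"
    have "norm (grad (ph n) x) <= \<bar>2 * ps x * F (wv n x)\<bar> * norm (grad ps x) + (ps x)^2 * norm ?s"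
     unfolding ph(2)[OF n xS(1)] using norm_triangle_ineq[of "(2 * ps x * F (wv n x)) *R grad ps x" "(ps x)^2 *R ?s"] by simp
    also have "\<bar>2 * ps x * F (wv n x)\<bar> * norm (grad ps x) <= (2 * Fm) * P"
    proof (intro mult_mono P)
     have "\<bar>ps x\<bar> * \<bar>F (wv n x)\<bar> <= 1 * Fm" using ps1 Fm[OF w1] by (intro mult_mono) auto
     then show "\<bar>2 * ps x * F (wv n x)\<bar> <= 2 * Fm" by (simp add: abs_mult)
    qed (use Fm0 in auto)
    also have "(ps x)^2 * norm ?s <= norm ?s" using ps1 by (simp add: mult_left_le_one_le)
    finally have b3: "norm (grad (ph n) x) <= 2 * Fm * P + norm ?s" by simp
    have b4: "\<bar>ph n x\<bar> <= Fm" unfolding ph_def abs_mult using ps1 Fm[OF w1] mult_mono[of "(ps x)^2" 1 "\<bar>F (wv n x)\<bar>" Fm] by simp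
    have "\<bar>(?a n x) \<bullet> grad (ph n) x\<bar> <= (L * norm (Hqv n i x)) * (2 * Fm * P + norm ?s)"
     by (rule order_trans[OF Cauchy_Schwarz_ineq2 mult_mono[OF b1 b3]]) (use L in auto)
    also have "... = L * (2 * Fm * P) * norm (Hqv n i x) + L * (norm ?s * norm (Hqv n i x))" by (simp add: algebra_simps)
    also have "... <= L * (2 * Fm * P) * E C n x + L * (LF * real CARD('n) * E C n x)"
     using L(1) Fm0 P(1) Hqv_E(1)[OF True, of n i] sum_Hqv_bound(1)[OF True LF(2)[OF w1] LF(1), of n i] by (intro add_mono mult_left_mono) auto
    finally have c1: "\<bar>(?a n x) \<bullet> grad (ph n) x\<bar> <= L * (2 * Fm * P) * E C n x + L * (LF * real CARD('n) * E C n x)" .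
    have "\<bar>?b n x * ph n x\<bar> <= (LB * norm (Hqv n i x)) * Fm"
     using mult_mono[OF b2 b4] LB(1) by (simp add: abs_mult)
    also have "... <= (LB * E C n x) * Fm" using Hqv_E(1)[OF True, of n i] LB(1) Fm0 by (intro mult_right_mono mult_left_mono) auto
    finally have c2: "\<bar>?b n x * ph n x\<bar> <= LB * Fm * E C n x" by (simp add: mult_ac)
    have c0: "\<bar>f n x\<bar> <= \<bar>(?a n x) \<bullet> grad (ph n) x\<bar> + \<bar>?b n x * ph n x\<bar>"
     unfolding f_def using n by (simp only: if_True abs_triangle_ineq)
    show ?thesis using order_trans[OF c0 add_mono[OF c1 c2]] by (simp add: c_def algebra_simps)
   qed
  qed
  note conv = convergence[OF C fm lm lim bd]
  \<comment> \<open>By the difference equation \<open>hs n\<close> times this integral is the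
    integral of the increment of \<open>G\<close> against the test function, and \<open>hs n\<close>
    cancels against the Lipschitz bound.\<close>
  have small: "\<bar>\<integral>x. f n x \<partial>lborel\<bar> <= LG * mS * Fm" if n: "n >= N" for n
  proof -
   have sub: "(%x. x + hs n *R e) ` S <= U"
   proof (rule image_subsetI)
    fix x assume "x : S"
    then have "x + hs n *R e : thicken de S" using N0(1)[of n] n hs_pos[of n] by (intro thickenI[of x]) (auto simp: e_def N_def)
    then show "x + hs n *R e : U" using de(2) by blast
   qed
   note DE = difference_equation[OF ph(1)[OF n] ps(2) sub]
   note [measurable] = C1c_measurable[OF ph(1)[OF n]]
   have phb: "\<bar>ph n x\<bar> <= Fm * indicator S x" for x
   proof (cases "x : S")
    case True
    have "(ps x)^2 <= 1" using ps(3,4)[of x] by (auto intro: power_le_one)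
    then show ?thesis unfolding ph_def abs_mult using True Fm[OF wR[OF n True]] mult_mono[of "(ps x)^2" 1 "\<bar>F (wv n x)\<bar>" Fm] by simp
   qed (simp add: ph_def ps0)
   have gb: "AE x in lborel. \<bar>(G (x + hs n *R e) - G x) * ph n x\<bar> <= (LG * hs n * Fm) * indicator S x"
    using LG(3)[OF hs_pos[of n] N1, of i] n
   proof -
    have "AE x in lborel. x : S --> \<bar>G (x + hs n *R e) - G x\<bar> <= LG * hs n" unfolding e_def by (rule LG(3)[OF hs_pos N1]) (use n in \<open>simp add: N_def\<close>)
    then show ?thesis
    proof eventually_elim
     case (elim x)
     show ?case
     proof (cases "x : S")
      case True
      have "\<bar>G (x + hs n *R e) - G x\<bar> * \<bar>ph n x\<bar> <= (LG * hs n) * Fm" using elim True phb[of x] LG(1) hs_pos[of n] by (intro mult_mono) auto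
      then show ?thesis using True by (simp add: abs_mult)
     qed (simp add: ph_def ps0)
    qed
   qed
   have gi: "integrable lborel (%x. (G (x + hs n *R e) - G x) * ph n x)"
   proof (rule Bochner_Integration.integrable_bound[of _ "%x. (LG * hs n * Fm) * indicator S x"])
    show "AE x in lborel. norm ((G (x + hs n *R e) - G x) * ph n x) <= norm ((LG * hs n * Fm) * indicator S x)"
     using gb by eventually_elim (simp add: order_trans[OF _ abs_ge_self])
   qed (use iS in \<open>simp, measurable\<close>)
   have fI: "(%x. hs n * f n x) = (%x. ((a (D (x + hs n *R e)) - a (D x)) \<bullet> grad (ph n) x + (bb (D (x + hs n *R e)) - bb (D x)) * ph n x - (G (x + hs n *R e) - G x) * ph n x)
     + (G (x + hs n *R e) - G x) * ph n x)"
    using n hs_pos[of n] by (intro ext) (simp add: f_def distrib_left)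
   have "(LBINT x. hs n * f n x) = 0 + (LBINT x. (G (x + hs n *R e) - G x) * ph n x)"
    unfolding fI by (subst Bochner_Integration.integral_add[OF DE(1) gi]) (simp only: DE(2))
   then have hf: "hs n * (LBINT x. f n x) = (LBINT x. (G (x + hs n *R e) - G x) * ph n x)" by simp
   have "hs n * \<bar>\<integral>x. f n x \<partial>lborel\<bar> = \<bar>\<integral>x. (G (x + hs n *R e) - G x) * ph n x \<partial>lborel\<bar>"
    unfolding hf[symmetric] using hs_pos[of n] by (simp only: abs_mult abs_of_pos)
   also have "... <= (LBINT x. (LG * hs n * Fm) * indicator S x)"
    by (rule order_trans[OF integral_abs_bound integral_mono_AE[OF integrable_abs[OF gi] _ gb]]) (use iS in simp)
   also have "... = hs n * (LG * mS * Fm)" using iS by (simp add: mS_def)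
   finally show ?thesis using hs_pos[of n] by simp
  qed
  have "\<bar>\<integral>x. lin_integrand ps F FF i x \<partial>lborel\<bar> <= LG * mS * Fm"
  proof (rule LIMSEQ_le_const2)
   show "(%n. \<bar>\<integral>x. f n x \<partial>lborel\<bar>) ~~> \<bar>\<integral>x. lin_integrand ps F FF i x \<partial>lborel\<bar>" by (intro tendsto_intros conv(2))
  qed (use small in blast)
  also have "... <= (LG * mS + 1) * Fm" using Fm0 by (simp add: distrib_right)
  finally show "integrable lborel (lin_integrand ps F FF i) & \<bar>\<integral>x. lin_integrand ps F FF i x \<partial>lborel\<bar> <= (LG * mS + 1) * Fm"
   using conv(1) by simp
 qed
qed

text \<open>The original, undifferentiated equation tested with \<open>(ps x)^2 * k (D x)\<close>.
  Here \<open>k\<close> may be nonzero at gradient zero; only its gradient has to vanish there,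
  because second derivatives enter through \<open>kk\<close> alone.\<close>

lemma weighted_equation:
 fixes ps k :: "real^'n => real"
 assumes ps: "C1c S ps" "S <= U" "!!x. 0 <= ps x" "!!x. ps x <= 1"
  and k: "!!et. GDERIV k et :> kk et" "continuous_on UNIV kk" and ep0: "ep0 > 0" and kk0: "!!et. norm et < ep0 ==> kk et = 0"
 shows "integrable lborel (%x. (ps x)^2 * (a (D x) \<bullet> (\<Sum>l\<in>UNIV. kk (D x) $ l *R Hv l x)))"
  "integrable lborel (%x. 2 * ps x * k (D x) * (a (D x) \<bullet> grad ps x))"
  "integrable lborel (%x. bb (D x) * ((ps x)^2 * k (D x)))" "integrable lborel (%x. G x * ((ps x)^2 * k (D x)))"
  "(LBINT x. (ps x)^2 * (a (D x) \<bullet> (\<Sum>l\<in>UNIV. kk (D x) $ l *R Hv l x))) + (LBINT x. 2 * ps x * k (D x) * (a (D x) \<bullet> grad ps x))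
   + (LBINT x. bb (D x) * ((ps x)^2 * k (D x))) = (LBINT x. G x * ((ps x)^2 * k (D x)))"
proof -
 have S: "compact S" and ps0: "!!x. x ~: S ==> ps x = 0" using ps by (auto simp: C1c_def)
 note G_meas[measurable]
 have [measurable]: "S : sets borel" using S by (simp add: borel_compact)
 note [measurable] = C1c_measurable[OF ps(1)] borel_measurable_continuous_onI[OF C1c_continuous_grad[OF ps(1)]]
 have ck: "continuous_on UNIV k" using GDERIV_isCont[OF k(1)] by (simp add: continuous_at_imp_continuous_on)
 note [measurable] = borel_measurable_continuous_onI[OF ck] borel_measurable_continuous_onI[OF k(2)]
 obtain de where de: "de > 0" "thicken de S <= U" using thicken_subset_open[OF S U ps(2)] .
 obtain R0 where R0: "R0 > 0" "!!x. x : thicken de S ==> norm (D x) <= R0" by (rule D_bound[OF compact_thicken[OF S] de(2)]) blast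
 define R where "R = R0 + 1"
 have SR: "norm (D x) <= R0" if "x : S" for x using R0(2) that thicken_superset[of de S] de by auto
 obtain P where P: "P > 0" "!!x. norm (grad ps x) <= P" using bounded_compact_support[OF S C1c_continuous_grad[OF ps(1)] C1c_grad_0[OF ps(1)]] by blast
 define ep where "ep = min ep0 1"
 have ep: "ep > 0" "ep <= ep0" "ep <= 1" using ep0 by (auto simp: ep_def)
 obtain N where N: "!!n. n >= N ==> hs n < de / 2"
   "!!n x. n >= N ==> x : S ==> norm (wv n x - D x) <= ep / 4"
  by (rule wv_close[OF S de(2,1), of "ep / 4"]) (use ep in auto)
 have wR: "norm (wv n x) <= R" if "n >= N" "x : S" for n x
  using N(2)[of n x] SR[of x] that ep norm_triangle_ineq[of "wv n x - D x" "D x"] by (auto simp: R_def)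
 have DR: "norm (D x) <= R" if "x : S" for x using SR[OF that] by (simp add: R_def)
 obtain L where L: "L > 0" "!!et. norm et <= R ==> norm (kk et) <= L" "!!et. norm et <= R ==> \<bar>k et\<bar> <= L" using GDERIV_lipschitz_ball[OF k, of R] by metis
 define C where "C = {x : S. ep / 2 <= norm (D x)}"
 have C: "compact C" "C <= V" unfolding C_def using compact_nondegenerate[OF S ps(2), of "ep / 2"] ep by auto
 have ps1: "\<bar>ps x\<bar> <= 1" "(ps x)^2 <= 1" for x using ps(3,4)[of x] by (auto intro: power_le_one)
 \<comment> \<open>Cut off to \<open>S\<close> because \<open>wv n\<close> is controlled only there,
   and zero for small n so that all members are measurable.\<close>
 define W where "W n x = (if n >= N then indicator S x * k (wv n x) else 0)" for n x
 define WW where "WW n x = (if n >= N then indicator S x *R kk (wv n x) else 0)" for n x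
 have Wm[measurable]: "W n : borel_measurable borel" "WW n : borel_measurable borel" for n
 proof -
  have c: "continuous_on S (wv n)" if "n >= N" using wv_test(3)[OF ps(1) de(2,1) N(1)[OF that] k] .
  have "(%x. indicator S x *R k (wv n x)) : borel_measurable borel" "(%x. indicator S x *R kk (wv n x)) : borel_measurable borel" if "n >= N"
   by (rule borel_measurable_continuous_on_indicator[OF _ continuous_on_compose2[OF ck c[OF that]]] borel_measurable_continuous_on_indicator[OF _ continuous_on_compose2[OF k(2) c[OF that]]]; auto)+
  then show "W n : borel_measurable borel" "WW n : borel_measurable borel" unfolding W_def[abs_def] WW_def[abs_def] by (cases "n >= N"; simp)+
 qed
 have Wl: "(%n. W n x) ~~> indicator S x * k (D x)" "(%n. WW n x) ~~> indicator S x *R kk (D x)" for x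
 proof -
  have "(%n. indicator S x * k (wv n x)) ~~> indicator S x * k (D x) & (%n. indicator S x *R kk (wv n x)) ~~> indicator S x *R kk (D x)"
  proof (cases "x : S")
   case True
   then have "x : U" using ps(2) by blast
   note wl = wv_tendsto[OF this]
   have "isCont kk (D x)" using k(2) by (simp add: continuous_on_eq_continuous_at)
   from isCont_tendsto_compose[OF this wl] isCont_tendsto_compose[OF GDERIV_isCont[OF k(1)] wl] show ?thesis by (auto intro!: tendsto_intros)
  qed simp
  moreover have "\<forall>\<^sub>F n in sequentially. indicator S x * k (wv n x) = W n x" "\<forall>\<^sub>F n in sequentially. indicator S x *R kk (wv n x) = WW n x"
   by (rule eventually_sequentiallyI[of N], simp add: W_def WW_def)+
  ultimately show "(%n. W n x) ~~> indicator S x * k (D x)" "(%n. WW n x) ~~> indicator S x *R kk (D x)"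
   by (blast intro: Lim_transform_eventually)+
 qed
 have Wb: "\<bar>W n x\<bar> <= L" "norm (WW n x) <= L" for n x
  using L wR[of n x] by (auto simp: W_def WW_def indicator_def)
 \<comment> \<open>Terms without second derivatives have a fixed integrable factor and a bounded
   convergent one, so ordinary dominated convergence suffices; only \<open>f\<close> below goes
   through \<open>convergence\<close>.\<close>
 have bdd: "(%n. LBINT x. W n x * q x) ~~> (LBINT x. k (D x) * q x)" "integrable lborel (%x. k (D x) * q x)"
  "integrable lborel (%x. W n x * q x)"
  if q: "integrable lborel q" "!!x. x ~: S ==> q x = 0" for q n
 proof -
  note [measurable] = borel_measurable_integrable[OF q(1)]
  have iq: "integrable lborel (%x. L * \<bar>q x\<bar>)" using q(1) by simp
  have eq: "indicator S x * k (D x) * q x = k (D x) * q x" for x using q(2)[of x] by (cases "x : S") auto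
  show "(%n. LBINT x. W n x * q x) ~~> (LBINT x. k (D x) * q x)"
  proof (rule integral_dominated_convergence[OF _ _ iq])
   show "AE x in lborel. (%n. W n x * q x) ~~> k (D x) * q x"
   proof (rule AE_I2)
    fix x
    have "(%n. W n x * q x) ~~> indicator S x * k (D x) * q x" by (intro tendsto_mult Wl tendsto_const)
    then show "(%n. W n x * q x) ~~> k (D x) * q x" unfolding eq .
   qed
   show "AE x in lborel. norm (W n x * q x) <= L * \<bar>q x\<bar>" for n using Wb by (intro AE_I2) (auto simp: abs_mult intro!: mult_right_mono)
  qed measurable
  show "integrable lborel (%x. k (D x) * q x)"
  proof (rule Bochner_Integration.integrable_bound[OF iq])
   show "AE x in lborel. norm (k (D x) * q x) <= norm (L * \<bar>q x\<bar>)"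
   proof (rule AE_I2)
    fix x show "norm (k (D x) * q x) <= norm (L * \<bar>q x\<bar>)"
     using q(2)[of x] L(1) L(3)[OF DR, of x] by (cases "x : S") (auto simp: abs_mult intro!: mult_right_mono)
   qed
  qed measurable
  show "integrable lborel (%x. W n x * q x)"
   by (rule Bochner_Integration.integrable_bound[OF iq]) (use Wb L(1) in \<open>auto simp: abs_mult intro!: AE_I2 mult_right_mono\<close>)
 qed
 define q1 where "q1 x = 2 * ps x * (a (D x) \<bullet> grad ps x)" for x
 define q2 where "q2 x = bb (D x) * (ps x)^2" for x
 define q3 where "q3 x = G x * (ps x)^2" for x
 have q1: "integrable lborel q1" "!!x. x ~: S ==> q1 x = 0"
 proof -
  have "integrable lborel (%x. a (D x) \<bullet> ((2 * ps x) *R grad ps x))"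
  proof (rule aD_integrable[OF S ps(2)])
   show "norm ((2 * ps x) *R grad ps x) <= 2 * P" for x
    unfolding norm_scaleR using ps1(1)[of x] P by (intro mult_mono) (auto simp: abs_mult)
  qed (use ps0 in auto)
  then show "integrable lborel q1" by (simp add: q1_def[abs_def])
 qed (simp add: q1_def ps0)
 have q2: "integrable lborel q2" "!!x. x ~: S ==> q2 x = 0"
  unfolding q2_def using bD_integrable[OF S ps(2), of "%x. (ps x)^2" 1] ps1 ps0 by auto
 have q3: "integrable lborel q3" "!!x. x ~: S ==> q3 x = 0"
  unfolding q3_def using G_integrable[OF S ps(2), of "%x. (ps x)^2" 1] ps1 ps0 by auto
 define f where "f n x = (ps x)^2 * (a (D x) \<bullet> (\<Sum>l\<in>UNIV. WW n x $ l *R Hqv n l x))" for n x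
 let ?f = "%x. (ps x)^2 * (a (D x) \<bullet> (\<Sum>l\<in>UNIV. kk (D x) $ l *R Hv l x))"
 have nthm: "(%x. F x $ l) : borel_measurable borel" if "F : borel_measurable borel" for F :: "real^'n => real^'n" and l
 proof -
  have "(%x. F x $ l) = (%x. F x \<bullet> axis l 1)" by (simp add: inner_axis)
  then show ?thesis using that by simp
 qed
 note [measurable] = nthm[OF Wm(2)]
 have [measurable]: "(%x. kk (D x) $ l) : borel_measurable borel" for l by (rule nthm) measurable
 have fm: "f n : borel_measurable borel" for n unfolding f_def by measurable
 have fm': "?f : borel_measurable borel" by measurable
 have WW0: "(ps x)^2 * y $ l = 0" if "x ~: C" "n >= N" "y = WW n x \<or> y = kk (D x)" for x n l y
 proof (cases "x : S")
  case True
  then have "norm (wv n x) < ep0" "norm (D x) < ep0" using that(1) N(2)[OF that(2)] ep norm_triangle_ineq[of "wv n x - D x" "D x"] by (fastforce simp: C_def)+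
  from kk0[OF this(1)] kk0[OF this(2)] have "y = 0" using that(3) by (auto simp: WW_def)
  then show ?thesis by simp
 qed (simp add: ps0)
 have f0: "f n x = 0" if "x ~: C" "n >= N" for n x
 proof -
  have "f n x = (\<Sum>l\<in>UNIV. ((ps x)^2 * WW n x $ l) * (a (D x) \<bullet> Hqv n l x))" by (simp add: f_def inner_sum_right sum_distrib_left mult.assoc)
  then show ?thesis using WW0[OF that] by simp
 qed
 have f0': "?f x = 0" if "x ~: C" for x
 proof -
  have "?f x = (\<Sum>l\<in>UNIV. ((ps x)^2 * kk (D x) $ l) * (a (D x) \<bullet> Hv l x))" by (simp add: inner_sum_right sum_distrib_left mult.assoc)
  then show ?thesis using WW0[OF that order_refl, of "kk (D x)"] by simp
 qed
 have lim: "AE x in lborel. (%n. f n x) ~~> ?f x"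
  using Hqv_tendsto
 proof eventually_elim
  case (elim x)
  show ?case
  proof (cases "x : C")
   case False
   then have "\<forall>\<^sub>F n in sequentially. f n x = ?f x" using f0 f0' by (intro eventually_sequentiallyI[of N]) auto
   then show ?thesis by (rule tendsto_eventually)
  next
   case True
   then have Hl: "(%n. Hqv n l x) ~~> Hv l x" for l using elim C(2) by blast
   have "(%n. WW n x) ~~> kk (D x)" using Wl(2)[of x] True by (simp add: C_def)
   then show ?thesis unfolding f_def by (intro tendsto_intros Hl)
  qed
 qed
 have bd: "\<forall>\<^sub>F n in sequentially. \<forall>x. \<bar>f n x\<bar> <= (R0 * A R0 * (L * real CARD('n))) * E C n x"
 proof (rule eventually_sequentiallyI[of N], rule allI)
  fix n x assume n: "n >= N"
  show "\<bar>f n x\<bar> <= (R0 * A R0 * (L * real CARD('n))) * E C n x"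
  proof (cases "x : C")
   case False then show ?thesis using f0[OF False n] by (simp add: E_def)
  next
   case True
   then have "norm (D x) <= R0" using SR by (simp add: C_def)
   then have aR: "norm (a (D x)) <= R0 * A R0" using R0(1) by (intro norm_a_le)
   have "\<bar>a (D x) \<bullet> (\<Sum>l\<in>UNIV. WW n x $ l *R Hqv n l x)\<bar> <= (R0 * A R0) * (L * real CARD('n) * E C n x)"
    by (rule order_trans[OF Cauchy_Schwarz_ineq2 mult_mono[OF aR sum_Hqv_bound(2)[OF True Wb(2) L(1)]]]) (use R0(1) A_pos[OF R0(1)] in auto)
   moreover have "\<bar>f n x\<bar> <= \<bar>a (D x) \<bullet> (\<Sum>l\<in>UNIV. WW n x $ l *R Hqv n l x)\<bar>"
    unfolding f_def abs_mult using ps1(2)[of x] by (intro mult_left_le_one_le) auto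
   ultimately show ?thesis by (simp add: mult_ac)
  qed
 qed
 note conv = convergence[OF C fm fm' lim bd]
 show "integrable lborel ?f" by (rule conv(1))
 have e1: "k (D x) * q1 x = 2 * ps x * k (D x) * (a (D x) \<bullet> grad ps x)" "k (D x) * q2 x = bb (D x) * ((ps x)^2 * k (D x))"
  "k (D x) * q3 x = G x * ((ps x)^2 * k (D x))" for x by (auto simp: q1_def q2_def q3_def mult_ac)
 show "integrable lborel (%x. 2 * ps x * k (D x) * (a (D x) \<bullet> grad ps x))" using bdd(2)[OF q1] unfolding e1 .
 show "integrable lborel (%x. bb (D x) * ((ps x)^2 * k (D x)))" using bdd(2)[OF q2] unfolding e1 .
 show "integrable lborel (%x. G x * ((ps x)^2 * k (D x)))" using bdd(2)[OF q3] unfolding e1 .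
 have eqn: "(LBINT x. f n x) + (LBINT x. W n x * q1 x) + (LBINT x. W n x * q2 x) = (LBINT x. W n x * q3 x)" if n: "n >= N" for n
 proof -
  note T = wv_test[OF ps(1) de(2,1) N(1)[OF n] k]
  have g: "(%x. a (D x) \<bullet> grad (%x. (ps x)^2 * k (wv n x)) x) = (%x. f n x + W n x * q1 x)"
  proof
   fix x show "a (D x) \<bullet> grad (%x. (ps x)^2 * k (wv n x)) x = f n x + W n x * q1 x"
   proof (cases "x : S")
    case True then show ?thesis unfolding T(2)[OF True] using n by (simp add: f_def q1_def W_def WW_def inner_add_right mult_ac)
   next
    case False then show ?thesis using C1c_grad_0[OF T(1) False] by (simp add: f_def q1_def ps0)
   qed
  qed
  have "integrable lborel (%x. a (D x) \<bullet> grad (%x. (ps x)^2 * k (wv n x)) x)"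
  proof -
   obtain Q where "!!x. norm (grad (%x. (ps x)^2 * k (wv n x)) x) <= Q"
    using bounded_compact_support[OF S C1c_continuous_grad[OF T(1)] C1c_grad_0[OF T(1)]] by metis
   then show ?thesis by (intro aD_integrable[OF S ps(2)] borel_measurable_continuous_onI C1c_continuous_grad[OF T(1)]) (use C1c_grad_0[OF T(1)] in auto)
  qed
  then have "integrable lborel (%x. (f n x + W n x * q1 x) - W n x * q1 x)" unfolding g by (intro Bochner_Integration.integrable_diff bdd(3)[OF q1])
  then have fi: "integrable lborel (f n)" by simp
  have "(%x. bb (D x) * ((ps x)^2 * k (wv n x))) = (%x. W n x * q2 x)" "(%x. G x * ((ps x)^2 * k (wv n x))) = (%x. W n x * q3 x)"
  proof -
   show "(%x. bb (D x) * ((ps x)^2 * k (wv n x))) = (%x. W n x * q2 x)"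
   proof
    fix x show "bb (D x) * ((ps x)^2 * k (wv n x)) = W n x * q2 x"
     using n ps0[of x] by (cases "x : S") (simp_all add: W_def q2_def)
   qed
   show "(%x. G x * ((ps x)^2 * k (wv n x))) = (%x. W n x * q3 x)"
   proof
    fix x show "G x * ((ps x)^2 * k (wv n x)) = W n x * q3 x"
     using n ps0[of x] by (cases "x : S") (simp_all add: W_def q3_def)
   qed
  qed
  then show ?thesis using equation'[OF T(1) ps(2)] unfolding g using fi bdd(3)[OF q1, of n] by simp
 qed
 have "(%n. (LBINT x. f n x) + (LBINT x. W n x * q1 x) + (LBINT x. W n x * q2 x)) ~~>
   (LBINT x. ?f x) + (LBINT x. k (D x) * q1 x) + (LBINT x. k (D x) * q2 x)"
  by (intro tendsto_add conv(2) bdd(1)[OF q1] bdd(1)[OF q2])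
 moreover have "\<forall>\<^sub>F n in sequentially. (LBINT x. f n x) + (LBINT x. W n x * q1 x) + (LBINT x. W n x * q2 x) = (LBINT x. W n x * q3 x)"
  by (rule eventually_sequentiallyI[of N]) (rule eqn)
 ultimately have "(%n. LBINT x. W n x * q3 x) ~~> (LBINT x. ?f x) + (LBINT x. k (D x) * q1 x) + (LBINT x. k (D x) * q2 x)"
  by (rule Lim_transform_eventually)
 from LIMSEQ_unique[OF this bdd(1)[OF q3]]
 show "(LBINT x. ?f x) + (LBINT x. 2 * ps x * k (D x) * (a (D x) \<bullet> grad ps x))
   + (LBINT x. bb (D x) * ((ps x)^2 * k (D x))) = (LBINT x. G x * ((ps x)^2 * k (D x)))" unfolding e1 .
qed

end

section \<open>Weighted estimates\<close>

lemma integrable_Fatou: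
 fixes f :: "nat => 'a => real"
 assumes f: "!!n. integrable M (f n)" "!!n x. 0 <= f n x" "!!n. (\<integral>x. f n x \<partial>M) <= C"
  and g: "g : borel_measurable M" "AE x in M. (%n. f n x) ~~> g x"
 shows "integrable M g"
proof (rule integrableI_bounded)
 have [measurable]: "f n : borel_measurable M" for n using f(1) by auto
 have "(\<integral>\<^sup>+x. ennreal (norm (g x)) \<partial>M) = (\<integral>\<^sup>+x. liminf (%n. ennreal (f n x)) \<partial>M)"
 proof (rule nn_integral_cong_AE)
  show "AE x in M. ennreal (norm (g x)) = liminf (%n. ennreal (f n x))"
   using g(2)
  proof eventually_elim
   case (elim x)
   have "g x >= 0" by (rule LIMSEQ_le_const[OF elim]) (use f(2) in auto)
   moreover have "(%n. ennreal (f n x)) ~~> ennreal (g x)" by (rule tendsto_ennrealI[OF elim])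
   then have "liminf (%n. ennreal (f n x)) = ennreal (g x)" by (rule lim_imp_Liminf[rotated]) simp
   ultimately show ?case by simp
  qed
 qed
 also have "... <= liminf (%n. \<integral>\<^sup>+x. ennreal (f n x) \<partial>M)" by (rule nn_integral_liminf) simp
 also have "... <= ennreal C"
 proof -
  have "(\<integral>\<^sup>+x. ennreal (f n x) \<partial>M) <= ennreal C" for n
   using f by (subst nn_integral_eq_integral) (auto intro: ennreal_leI)
  then have "liminf (%n. \<integral>\<^sup>+x. ennreal (f n x) \<partial>M) <= limsup (%n. ennreal C)"
   by (intro order_trans[OF Liminf_mono[OF always_eventually] Liminf_le_Limsup]) auto
  then show ?thesis by (simp add: Limsup_const)
 qed
 finally show "(\<integral>\<^sup>+x. ennreal (norm (g x)) \<partial>M) < \<infinity>" by (simp add: le_less_trans)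
qed (use g in simp)

lemma DERIV_pos_part_sq: "((%x::real. (max 0 x)^2) has_real_derivative 2 * max 0 x) (at x)"
proof -
 have "((%x::real. (max 0 x)^2) has_real_derivative 0) (at 0)"
  unfolding DERIV_def
 proof (rule Lim_null_comparison[of _ "%h. \<bar>h\<bar>"])
  show "\<forall>\<^sub>F h in at 0. norm (((max 0 (0 + h))^2 - (max 0 (0::real))^2) / h) <= \<bar>h\<bar>"
   by (intro always_eventually) (auto simp: max_def power2_eq_square)
 qed (auto intro!: tendsto_eq_intros)
 moreover have "((%x::real. (max 0 x)^2) has_real_derivative 2 * x) (at x)" if "x > 0" for x :: real
 proof (rule has_field_derivative_transform_within_open[of "%x. x^2" _ _ "{0<..}"])
 qed (use that in \<open>auto intro!: derivative_eq_intros\<close>)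
 moreover have "((%x::real. (max 0 x)^2) has_real_derivative 0) (at x)" if "x < 0" for x :: real
 proof (rule has_field_derivative_transform_within_open[of "%x. 0" _ _ "{..<0}"])
 qed (use that in auto)
 ultimately show ?thesis by (cases x "0::real" rule: linorder_cases) auto
qed

text \<open>Constancy of \<open>K\<close> near zero removes the only singular point of the norm;
  elsewhere it is the chain rule.\<close>

lemma radial_GDERIV:
 fixes K K' :: "real => real"
 assumes K: "!!t. t > 0 ==> (K has_real_derivative K' t) (at t)" "continuous_on {0<..} K'"
  and ep: "ep > 0" "!!t. 0 <= t ==> t < ep ==> K t = c" "!!t. 0 <= t ==> t < ep ==> K' t = 0"
 shows "GDERIV (%et::real^'n. K (norm et)) et :> K' (norm et) *R sgn et"
  "continuous_on UNIV (%et::real^'n. K' (norm et) *R sgn et)"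
proof -
 show "GDERIV (%et::real^'n. K (norm et)) et :> K' (norm et) *R sgn et"
 proof (cases "et = 0")
  case True
  have "((%et::real^'n. K (norm et)) has_derivative (%h. 0)) (at 0)"
   by (rule has_derivative_transform_within_open[of "%_. c" _ _ _ "ball 0 ep"]) (use ep in auto)
  then show ?thesis using True ep by (simp add: gderiv_def)
 next
  case False
  show ?thesis using GDERIV_DERIV_compose[OF GDERIV_norm[OF False] K(1)] False by simp
 qed
 have "continuous_on ((- {0}) \<union> ball 0 ep) (%et::real^'n. K' (norm et) *R sgn et)"
 proof (rule continuous_on_open_Un)
  show "continuous_on (- {0}) (%et::real^'n. K' (norm et) *R sgn et)"
   by (intro continuous_intros continuous_on_compose2[OF K(2)]) (auto simp: sgn_div_norm intro!: continuous_intros)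
  show "continuous_on (ball 0 ep) (%et::real^'n. K' (norm et) *R sgn et)"
   by (rule continuous_on_eq[of _ "%_. 0"]) (use ep in auto)
 qed auto
 moreover have "(- {0}) \<union> ball (0::real^'n) ep = UNIV" using ep by auto
 ultimately show "continuous_on UNIV (%et::real^'n. K' (norm et) *R sgn et)" by simp
qed

lemma radial_component:
 fixes K K' :: "real => real"
 assumes K: "!!t. t > 0 ==> (K has_real_derivative K' t) (at t)" "continuous_on {0<..} K'"
  and ep: "ep > 0" "!!t. 0 <= t ==> t < ep ==> K t = 0" "!!t. 0 <= t ==> t < ep ==> K' t = 0"
 shows "GDERIV (%et::real^'n. K (norm et) * et $ i) et :> K (norm et) *R axis i 1 + (et $ i * K' (norm et)) *R sgn et"
  "continuous_on UNIV (%et::real^'n. K (norm et) *R axis i 1 + (et $ i * K' (norm et)) *R sgn et)"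
proof -
 note r = radial_GDERIV[of K K' ep 0, OF assms]
 have "GDERIV (%et::real^'n. et $ i) et :> axis i 1" for et
  unfolding gderiv_def inner_axis by (simp add: bounded_linear_imp_has_derivative bounded_linear_vec_nth)
 from GDERIV_mult[OF r(1) this] show "GDERIV (%et::real^'n. K (norm et) * et $ i) et :> K (norm et) *R axis i 1 + (et $ i * K' (norm et)) *R sgn et" by simp
 have "continuous_on UNIV (%et::real^'n. K (norm et))" by (intro continuous_at_imp_continuous_on ballI GDERIV_isCont[OF r(1)])
 then have "continuous_on UNIV (%et::real^'n. K (norm et) *R axis i 1 + et $ i *R (K' (norm et) *R sgn et))" by (intro continuous_intros r(2))
 then show "continuous_on UNIV (%et::real^'n. K (norm et) *R axis i 1 + (et $ i * K' (norm et)) *R sgn et)" by simp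
qed

text \<open>The derivative of \<open>cut_powr b \<epsilon>\<close> at \<open>t\<close> is \<open>(cut_powr_rest b \<epsilon> t - b * cut_powr b \<epsilon> t) / t\<close>.\<close>
definition cut_powr :: "real => real => real => real" where
 "cut_powr b ep t = t powr (- b) * (max 0 (1 - ep / t))^2"
definition cut_powr_rest :: "real => real => real => real" where
 "cut_powr_rest b ep t = 2 * t powr (- b) * max 0 (1 - ep / t) * (ep / t)"

text \<open>The cut-off enters squared, which makes it C1 and leaves one factor of it in its
  derivative. Hence the last bound: the rest term is controlled by the geometric mean of the full
  weight and the truncated one, with no dependence on \<open>ep\<close>.\<close>

lemma cut_powr:
 assumes "ep > 0" "0 <= b"
 shows "t > 0 ==> (cut_powr b ep has_real_derivative (cut_powr_rest b ep t - b * cut_powr b ep t) / t) (at t)"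
  "continuous_on {0<..} (%t. (cut_powr_rest b ep t - b * cut_powr b ep t) / t)"
  "0 <= t ==> t < ep ==> cut_powr b ep t = 0" "0 <= t ==> t < ep ==> cut_powr_rest b ep t = 0"
  "0 <= cut_powr b ep t" "t >= 0 ==> cut_powr b ep t <= t powr (- b)" "t >= 0 ==> 0 <= cut_powr_rest b ep t"
  "t > 0 ==> cut_powr_rest b ep t <= 2 * sqrt (t powr (- b)) * sqrt (cut_powr b ep t)"
proof -
 show "(cut_powr b ep has_real_derivative (cut_powr_rest b ep t - b * cut_powr b ep t) / t) (at t)" if t: "t > 0"
 proof -
  have i: "((%t. 1 - ep / t) has_real_derivative ep / t^2) (at t)"
   using t by (auto intro!: derivative_eq_intros simp: power2_eq_square)
  have d: "((%t. t powr (- b)) has_real_derivative - b * t powr (- b) / t) (at t)"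
   using t by (auto intro!: derivative_eq_intros simp: powr_diff)
  have "(cut_powr b ep has_real_derivative (t powr (- b)) * (2 * max 0 (1 - ep / t) * (ep / t^2)) + (- b * t powr (- b) / t) * (max 0 (1 - ep / t))^2) (at t)"
   unfolding cut_powr_def[abs_def] by (rule DERIV_mult'[OF d DERIV_chain2[OF DERIV_pos_part_sq i]])
  then show ?thesis by (rule DERIV_cong) (use t in \<open>simp add: cut_powr_def cut_powr_rest_def field_simps power2_eq_square\<close>)
 qed
 show "continuous_on {0<..} (%t. (cut_powr_rest b ep t - b * cut_powr b ep t) / t)"
  unfolding cut_powr_def cut_powr_rest_def by (intro continuous_intros) auto
 have z: "t = 0 \<or> max 0 (1 - ep / t) = 0" if "0 <= t" "t < ep" using that by (cases "t = 0") (auto simp: max_def field_simps)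
 show "0 <= t ==> t < ep ==> cut_powr b ep t = 0" "0 <= t ==> t < ep ==> cut_powr_rest b ep t = 0"
  using z by (auto simp: cut_powr_def cut_powr_rest_def)
 show "0 <= cut_powr b ep t" by (simp add: cut_powr_def)
 have l: "max 0 (1 - ep / t) <= 1" if "t >= 0" using that assms by auto
 show "cut_powr b ep t <= t powr (- b)" if "t >= 0"
  unfolding cut_powr_def using l[OF that] by (intro mult_left_le power_le_one) auto
 show "0 <= cut_powr_rest b ep t" if "t >= 0" using that assms by (simp add: cut_powr_rest_def)
 show "cut_powr_rest b ep t <= 2 * sqrt (t powr (- b)) * sqrt (cut_powr b ep t)" if t: "t > 0"
 proof -
  have e: "2 * sqrt (t powr (- b)) * sqrt (cut_powr b ep t) = 2 * t powr (- b) * max 0 (1 - ep / t)" by (simp add: cut_powr_def real_sqrt_mult)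
  have "max 0 (1 - ep / t) * (ep / t) <= max 0 (1 - ep / t) * 1"
  proof (cases "ep <= t")
   case True then show ?thesis using t assms by (intro mult_left_mono) auto
  next
   case False then have "max 0 (1 - ep / t) = 0" using t by (auto simp: max_def field_simps)
   then show ?thesis by simp
  qed
  then have "2 * t powr (- b) * (max 0 (1 - ep / t) * (ep / t)) <= 2 * t powr (- b) * (max 0 (1 - ep / t) * 1)" by (rule mult_left_mono) simp
  then show ?thesis unfolding e cut_powr_rest_def by (simp add: mult.assoc)
 qed
qed

lemma cut_powr_tendsto: "t > 0 ==> (%n. cut_powr b (hs n) t) ~~> t powr (- b)"
 unfolding cut_powr_def by (auto intro!: tendsto_eq_intros hs_lim)

section \<open>Ellipticity of the linearised operator and the weighted Hessian estimate\<close>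

context local_solution begin

lemma qa_inner:
 assumes "et ~= 0"
 shows "qa et \<xi> \<bullet> \<zeta> = A (norm et) * (\<xi> \<bullet> \<zeta> + norm et * deriv A (norm et) / A (norm et) * (sgn et \<bullet> \<xi>) * (sgn et \<bullet> \<zeta>))"
proof -
 have "A (norm et) ~= 0" using A_pos[of "norm et"] assms by simp
 then show ?thesis using assms by (simp add: qa_def sgn_div_norm inner_add_left field_simps)
qed

text \<open>With \<open>\<beta>\<close> the value of t A'(t) / A(t), the quadratic form has
  eigenvalue A(t) orthogonally to the gradient and \<open>A(t) * (1 + \<beta>)\<close> along it.
  \<open>lam\<close> bounds these from below relative to A(t) and is positive because m > -1;
  \<open>Lam\<close> bounds the bilinear form from above.\<close>

definition lam :: real where "lam = min 1 (1 + m)"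
definition Lam :: real where "Lam = 1 + max \<bar>m\<bar> \<bar>M\<bar>"

lemma lam_pos: "lam > 0" and Lam_pos: "Lam > 0" using m by (auto simp: lam_def Lam_def)

lemma sgn_inner_le: "\<bar>sgn et \<bullet> \<xi>\<bar> <= norm (\<xi> :: real^'n)"
 using Cauchy_Schwarz_ineq2[of "sgn et" \<xi>] by (cases "et = 0") (auto simp: norm_sgn)

lemma qa_lower:
 assumes "et ~= 0" shows "lam * A (norm et) * (norm \<xi>)^2 <= qa et \<xi> \<bullet> \<xi>"
proof -
 let ?\<beta> = "norm et * deriv A (norm et) / A (norm et)" and ?s = "(sgn et \<bullet> \<xi>)^2"
 have s: "?s <= (norm \<xi>)^2" using sgn_inner_le[of et \<xi>] by (simp add: abs_le_square_iff[symmetric])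
 have b: "m <= ?\<beta>" using A_m assms by simp
 have "lam * (norm \<xi>)^2 <= (norm \<xi>)^2 + ?\<beta> * ?s"
 proof (cases "?\<beta> >= 0")
  case True
  have "lam * (norm \<xi>)^2 <= 1 * (norm \<xi>)^2" by (intro mult_right_mono) (auto simp: lam_def)
  moreover have "0 <= ?\<beta> * ?s" using True by (intro mult_nonneg_nonneg) auto
  ultimately show ?thesis by linarith
 next
  case False
  have "lam * (norm \<xi>)^2 <= (1 + ?\<beta>) * (norm \<xi>)^2" using b by (intro mult_right_mono) (auto simp: lam_def)
  moreover have "?\<beta> * (norm \<xi>)^2 <= ?\<beta> * ?s" using False s by (intro mult_left_mono_neg) auto
  ultimately show ?thesis by (simp add: distrib_right)
 qed
 then have "A (norm et) * (lam * (norm \<xi>)^2) <= A (norm et) * ((norm \<xi>)^2 + ?\<beta> * ?s)"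
  using A_pos[of "norm et"] assms by (intro mult_left_mono) auto
 then show ?thesis unfolding qa_inner[OF assms] dot_square_norm by (simp add: power2_eq_square mult_ac)
qed

lemma qa_upper:
 assumes "et ~= 0" shows "\<bar>qa et \<xi> \<bullet> \<zeta>\<bar> <= Lam * A (norm et) * (norm \<xi> * norm \<zeta>)"
proof -
 let ?\<beta> = "norm et * deriv A (norm et) / A (norm et)"
 have b: "\<bar>?\<beta>\<bar> <= max \<bar>m\<bar> \<bar>M\<bar>" using A_m[of "norm et"] A_M[of "norm et"] assms by auto
 have "\<bar>?\<beta> * ((sgn et \<bullet> \<xi>) * (sgn et \<bullet> \<zeta>))\<bar> <= max \<bar>m\<bar> \<bar>M\<bar> * (norm \<xi> * norm \<zeta>)"
  unfolding abs_mult[of ?\<beta>] abs_mult[of "sgn et \<bullet> \<xi>"] by (intro mult_mono b sgn_inner_le) auto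
 then have "\<bar>\<xi> \<bullet> \<zeta> + ?\<beta> * (sgn et \<bullet> \<xi>) * (sgn et \<bullet> \<zeta>)\<bar> <= Lam * (norm \<xi> * norm \<zeta>)"
  using Cauchy_Schwarz_ineq2[of \<xi> \<zeta>] unfolding Lam_def distrib_right mult.assoc[of ?\<beta>] by linarith
 then have "A (norm et) * \<bar>\<xi> \<bullet> \<zeta> + ?\<beta> * (sgn et \<bullet> \<xi>) * (sgn et \<bullet> \<zeta>)\<bar> <= A (norm et) * (Lam * (norm \<xi> * norm \<zeta>))"
  using A_pos[of "norm et"] assms by (intro mult_left_mono) auto
 then show ?thesis unfolding qa_inner[OF assms] abs_mult using A_pos[of "norm et"] assms by (simp add: mult_ac)
qed

lemma qa_linear: "qa et (\<xi> + \<zeta>) = qa et \<xi> + qa et \<zeta>" "qa et (c *R \<xi>) = c *R qa et \<xi>" "qa et (\<xi> - \<zeta>) = qa et \<xi> - qa et \<zeta>" "qa et 0 = 0"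
 by (auto simp: qa_def algebra_simps inner_simps add_divide_distrib diff_divide_distrib)

lemma qa_sum: "qa et (\<Sum>l\<in>I. f l) = (\<Sum>l\<in>I. qa et (f l))" by (induction I rule: infinite_finite_induct) (auto simp: qa_linear)

lemma qa_sym: "et ~= 0 ==> qa et \<xi> \<bullet> \<zeta> = qa et \<zeta> \<bullet> \<xi>"
 by (simp add: qa_inner inner_commute[of \<xi> \<zeta>] mult_ac)

lemma sum_sgn_sq: "et ~= 0 ==> (\<Sum>l\<in>UNIV. (sgn et $ l)^2) = (1::real)" for et :: "real^'n"
 using norm_sgn[of et] by (simp add: norm_vec_def L2_set_def)

text \<open>Cauchy--Schwarz for the quadratic form, from \<open>0 \<le> \<Sum>\<^sub>l q(h\<^sub>l - n\<^sub>l Z)\<close>.\<close>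
lemma qa_Cauchy_Schwarz:
 fixes h :: "'n => real^'n"
 assumes "et ~= 0" and Z: "Z = (\<Sum>l\<in>UNIV. sgn et $ l *R h l)"
 shows "qa et Z \<bullet> Z <= (\<Sum>l\<in>UNIV. qa et (h l) \<bullet> h l)"
proof -
 let ?n = "%l. sgn et $ l"
 have nn: "0 <= qa et \<xi> \<bullet> \<xi>" for \<xi>
  using qa_lower[OF assms(1), of \<xi>] lam_pos A_pos[of "norm et"] assms(1) by (auto intro: order_trans[rotated])
 have e: "qa et (h l - ?n l *R Z) \<bullet> (h l - ?n l *R Z) = qa et (h l) \<bullet> h l - 2 * (qa et (?n l *R h l) \<bullet> Z) + (?n l)^2 * (qa et Z \<bullet> Z)" for l
  using qa_sym[OF assms(1), of Z "h l"] by (simp add: qa_linear inner_diff_left inner_diff_right power2_eq_square algebra_simps)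
 have "0 <= (\<Sum>l\<in>UNIV. qa et (h l - ?n l *R Z) \<bullet> (h l - ?n l *R Z))" by (intro sum_nonneg nn)
 also have "... = (\<Sum>l\<in>UNIV. qa et (h l) \<bullet> h l) - 2 * (\<Sum>l\<in>UNIV. qa et (?n l *R h l) \<bullet> Z) + (\<Sum>l\<in>UNIV. (?n l)^2) * (qa et Z \<bullet> Z)"
  unfolding e by (simp add: sum.distrib sum_subtractf sum_distrib_left sum_distrib_right)
 also have "(\<Sum>l\<in>UNIV. qa et (?n l *R h l) \<bullet> Z) = qa et Z \<bullet> Z" by (simp only: Z qa_sum inner_sum_left)
 finally show ?thesis by (simp add: sum_sgn_sq[OF assms(1)])
qed

text \<open>The ellipticity inequality with second vector zero.\<close>

lemma A_lower: "t > 0 ==> c2 * t powr (p - 2) <= A t"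
proof -
 assume t: "t > 0"
 fix i :: 'n
 have "c2 * t powr (p - 2) * t^2 <= A t * t^2"
  using A_ell[of "t *R axis i 1" 0] t by (simp add: power2_eq_square)
 then show ?thesis using t by simp
qed

text \<open>By the mean value theorem B(t) = t B'(z) with z < t, and z A(z) is at most t A(t). A
  one-sided bound on B' is therefore enough for a bound on B.\<close>

lemma B_upper: "t >= 0 ==> B t <= CB * (t^2 * A t)"
proof (cases "t = 0")
 case False
 assume "t >= 0"
 then have t: "t > 0" using False by simp
 have "continuous_on {0..t} B" using B_contOn by (rule continuous_on_subset) auto
 then obtain z where "0 < z" "z < t" "B t - B 0 = (%h. h * B' z) (t - 0)"
  by (rule mvt[OF t, of B "%z h. h * B' z"]) (use B_DERIV in \<open>auto simp: has_field_derivative_def mult_commute_abs\<close>)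
 then have z: "0 < z" "z < t" "B t = t * B' z" using B_0 by auto
 have "B' z <= CB * (t * A t)" using B_le[OF z(1)] tA_mono[OF z(1), of t] z CB by (meson less_imp_le mult_left_mono order_trans)
 then show ?thesis using z t by (simp add: power2_eq_square mult_ac)
qed (simp add: B_0)

text \<open>The algebra of the weighted estimate at one point: \<open>h l\<close> is the derivative
  of the gradient in direction l, \<open>Z\<close> its derivative along its own direction,
  \<open>K\<close> the truncated weight, \<open>P\<close> the rest of its derivative,
  \<open>\<kappa>\<close> the full weight and \<open>g\<close> the gradient of the cut-off.
  Everything except the main term is either free of second derivatives or linear in
  \<open>X\<close>, and is absorbed by Young's inequality; \<open>c'\<close> is the sum of those
  linear coefficients.\<close>

lemma hessian_pointwise:
 fixes h :: "'n => real^'n"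
 assumes et: "et ~= 0" "norm et <= R" and b: "0 <= b" "b < 1" and K: "0 <= K" "K <= \<kappa>" and P: "0 <= P" "P <= 2 * sqrt \<kappa> * sqrt K"
  and ps: "0 <= ps" "ps <= 1" and g: "norm g <= Pg" and Z: "Z = (\<Sum>l\<in>UNIV. sgn et $ l *R h l)"
  and c: "c = (1 - b) * lam" and c': "c' = 2 * Lam * Pg + CB * R * (real CARD('n) + 3)"
 shows "c / 2 * (A (norm et) * (ps^2 * K * (\<Sum>l\<in>UNIV. (norm (h l))^2))) - (c'^2 / (2 * c) + 2 * CB * R * Pg) * (A (norm et) * ((norm et)^2 * \<kappa>))
  <= 2 * ps * K * norm et * (qa et Z \<bullet> g) + ps^2 * (K * (\<Sum>l\<in>UNIV. qa et (h l) \<bullet> h l) + (P - b * K) * (qa et Z \<bullet> Z))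
   - ps^2 * bb et * (K * (\<Sum>l\<in>UNIV. h l $ l) + (P - b * K) * (sgn et \<bullet> Z)) - 2 * ps * bb et * K * (et \<bullet> g)" (is "_ <= ?T")
proof -
 define t where "t = norm et"
 define S where "S = (\<Sum>l\<in>UNIV. (norm (h l))^2)"
 define X where "X = ps * sqrt K * sqrt S"
 define N where "N = real CARD('n)"
 define At where "At = A t"
 have t: "t > 0" "t <= R" using et by (auto simp: t_def)
 have At: "At > 0" using A_pos t by (simp add: At_def)
 have S0: "S >= 0" unfolding S_def by (intro sum_nonneg) auto
 have X0: "X >= 0" using ps K S0 by (simp add: X_def)
 have Pg: "Pg >= 0" using g norm_ge_zero[of g] by linarith
 have \<kappa>: "\<kappa> >= 0" using K by linarith
 have c0: "c > 0" using b lam_pos by (simp add: c)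
 have sK: "K = sqrt K * sqrt K" "sqrt K <= sqrt \<kappa>" using K by auto
 \<comment> \<open>In the linear terms one factor \<open>sqrt K\<close> goes into \<open>X\<close>
   and the other becomes \<open>sqrt \<kappa>\<close>, which remains in the error and does not
   depend on the truncation.\<close>
 have K': "K <= sqrt \<kappa> * sqrt K" by (subst (1) sK(1)) (intro mult_right_mono sK(2) real_sqrt_ge_zero K(1))
 have hl: "norm (h l) <= sqrt S" for l
 proof (rule real_le_rsqrt)
  show "(norm (h l))^2 <= S" unfolding S_def by (rule member_le_sum) auto
 qed
 have sZ: "norm Z <= sqrt S"
 proof -
  have "norm Z <= (\<Sum>l\<in>UNIV. \<bar>sgn et $ l\<bar> * \<bar>norm (h l)\<bar>)" unfolding Z by (rule order_trans[OF norm_sum]) simp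
  also have "... <= L2_set (%l. sgn et $ l) UNIV * L2_set (%l. norm (h l)) UNIV" by (rule L2_set_mult_ineq)
  also have "... = sqrt S" using sum_sgn_sq[OF et(1)] by (simp add: L2_set_def S_def)
  finally show ?thesis .
 qed
 have bbb: "0 <= bb et" "bb et <= CB * (t^2 * At)" using B_nonneg[of t] B_upper[of t] t by (auto simp: bb_def t_def At_def)
 have bbR: "bb et <= CB * (R * t * At)"
 proof (rule order_trans[OF bbb(2)])
  have "t * (t * At) <= R * (t * At)" using t At by (intro mult_right_mono) auto
  then show "CB * (t^2 * At) <= CB * (R * t * At)" using CB by (intro mult_left_mono) (auto simp: power2_eq_square mult_ac)
 qed
 let ?q = "\<Sum>l\<in>UNIV. qa et (h l) \<bullet> h l"
 have lower: "lam * At * S <= ?q" unfolding S_def sum_distrib_left At_def t_def by (intro sum_mono qa_lower et)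
 have z0: "0 <= qa et Z \<bullet> Z" using qa_lower[OF et(1), of Z] lam_pos At by (auto simp: At_def t_def intro: order_trans[rotated])
 have z1: "qa et Z \<bullet> Z <= ?q" by (rule qa_Cauchy_Schwarz[OF et(1) Z])
 \<comment> \<open>The nonnegative \<open>P\<close> term is dropped; the term with
   \<open>- b * K\<close> is bounded by Cauchy-Schwarz for the quadratic form and leaves the factor
   1 - b.\<close>
 have a1: "c * At * X^2 <= ps^2 * (K * ?q + (P - b * K) * (qa et Z \<bullet> Z))"
 proof -
  have "b * K * (qa et Z \<bullet> Z) <= b * K * ?q" using b K z1 by (intro mult_left_mono) auto
  moreover have "0 <= P * (qa et Z \<bullet> Z)" using P z0 by simp
  ultimately have "(1 - b) * K * ?q <= K * ?q + (P - b * K) * (qa et Z \<bullet> Z)" by (simp add: algebra_simps)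
  moreover have "(1 - b) * K * (lam * At * S) <= (1 - b) * K * ?q" using b K lower by (intro mult_left_mono) auto
  ultimately have "ps^2 * ((1 - b) * K * (lam * At * S)) <= ps^2 * (K * ?q + (P - b * K) * (qa et Z \<bullet> Z))" by (intro mult_left_mono) auto
  moreover have "c * At * X^2 = ps^2 * ((1 - b) * K * (lam * At * S))"
   using K(1) S0 by (simp add: X_def c power_mult_distrib mult_ac)
  ultimately show ?thesis by (simp only:)
 qed
 have a2: "\<bar>2 * ps * K * norm et * (qa et Z \<bullet> g)\<bar> <= 2 * Lam * Pg * (At * (t * sqrt \<kappa>) * X)"
 proof -
  have "\<bar>qa et Z \<bullet> g\<bar> <= Lam * At * (norm Z * norm g)" using qa_upper[OF et(1)] by (simp add: At_def t_def)
  also have "... <= Lam * At * (sqrt S * Pg)" using Lam_pos At sZ g S0 by (intro mult_left_mono mult_mono) auto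
  finally have "(2 * ps * t) * (K * \<bar>qa et Z \<bullet> g\<bar>) <= (2 * ps * t) * ((sqrt \<kappa> * sqrt K) * (Lam * At * (sqrt S * Pg)))"
   using ps t K' K \<kappa> by (intro mult_left_mono mult_mono) auto
  then show ?thesis using ps t K by (simp add: abs_mult X_def t_def[symmetric] mult_ac)
 qed
 \<comment> \<open>\<open>N\<close> comes from the trace of the Hessian; 3 is the crude bound 2 + 1
   for the coefficient \<open>P - b * K\<close>.\<close>
 have a3: "\<bar>ps^2 * bb et * (K * (\<Sum>l\<in>UNIV. h l $ l) + (P - b * K) * (sgn et \<bullet> Z))\<bar> <= CB * R * (N + 3) * (At * (t * sqrt \<kappa>) * X)"
 proof -
  have "\<bar>\<Sum>l\<in>UNIV. h l $ l\<bar> <= (\<Sum>l\<in>(UNIV::'n set). sqrt S)" by (rule order_trans[OF sum_abs sum_mono]) (rule order_trans[OF component_le_norm_cart hl])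
  then have "K * \<bar>\<Sum>l\<in>UNIV. h l $ l\<bar> <= (sqrt \<kappa> * sqrt K) * (N * sqrt S)" using K' K S0 \<kappa> by (intro mult_mono) (auto simp: N_def)
  moreover have "\<bar>P - b * K\<bar> * \<bar>sgn et \<bullet> Z\<bar> <= (3 * (sqrt \<kappa> * sqrt K)) * sqrt S"
  proof (intro mult_mono)
   have "b * K <= sqrt \<kappa> * sqrt K" using mult_right_mono[of b 1 K] b K K' by simp
   moreover have "0 <= b * K" using b K by simp
   ultimately show "\<bar>P - b * K\<bar> <= 3 * (sqrt \<kappa> * sqrt K)" using P by (simp add: mult.assoc)
  qed (use sgn_inner_le[of et Z] sZ K \<kappa> in auto)
  ultimately have "\<bar>K * (\<Sum>l\<in>UNIV. h l $ l) + (P - b * K) * (sgn et \<bullet> Z)\<bar> <= (N + 3) * (sqrt \<kappa> * sqrt K * sqrt S)"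
   using abs_triangle_ineq[of "K * (\<Sum>l\<in>UNIV. h l $ l)" "(P - b * K) * (sgn et \<bullet> Z)"] K(1)
   unfolding abs_mult[of "P - b * K"] abs_mult[of K] distrib_right by (simp add: mult_ac distrib_left)
  moreover have "ps^2 * bb et <= ps * (CB * (R * t * At))" using bbR bbb ps by (intro mult_mono) (auto simp: power2_eq_square mult_left_le)
  ultimately have "(ps^2 * bb et) * \<bar>K * (\<Sum>l\<in>UNIV. h l $ l) + (P - b * K) * (sgn et \<bullet> Z)\<bar> <= (ps * (CB * (R * t * At))) * ((N + 3) * (sqrt \<kappa> * sqrt K * sqrt S))"
   using bbb ps CB t At by - (rule mult_mono, auto)
  then show ?thesis using bbb by (simp add: abs_mult X_def mult_ac)
 qed
 have a4: "\<bar>2 * ps * bb et * K * (et \<bullet> g)\<bar> <= 2 * CB * R * Pg * (At * (t^2 * \<kappa>))"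
 proof -
  have "\<bar>et \<bullet> g\<bar> <= R * Pg" using Cauchy_Schwarz_ineq2[of et g] mult_mono[OF et(2) g] t by (auto simp: t_def)
  then have "2 * ps * bb et * K * \<bar>et \<bullet> g\<bar> <= 2 * 1 * (CB * (t^2 * At)) * \<kappa> * (R * Pg)"
   using ps bbb K Pg t CB At \<kappa> by (intro mult_mono) auto
  then show ?thesis using ps bbb K by (simp add: abs_mult mult_ac)
 qed
 define y where "y = t * sqrt \<kappa>"
 \<comment> \<open>Young's inequality with half of the main term as the price; \<open>y^2\<close> is
   the squared gradient times the full weight.\<close>
 have sq: "c' * y * X <= c / 2 * X^2 + c'^2 / (2 * c) * y^2"
 proof -
  have "0 <= (c * X - c' * y)^2 / (2 * c)" using c0 by simp
  also have "... = c / 2 * X^2 - c' * y * X + c'^2 / (2 * c) * y^2" using c0 by (simp add: power2_diff power_mult_distrib field_simps power2_eq_square)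
  finally show ?thesis by linarith
 qed
 have y2: "y^2 = t^2 * \<kappa>" using \<kappa> by (simp add: y_def power_mult_distrib)
 have m: "At * (c' * y * X) <= At * (c / 2 * X^2 + c'^2 / (2 * c) * y^2)" using sq At by (intro mult_left_mono) auto
 have X2: "X^2 = ps^2 * K * S" using K(1) S0 by (simp add: X_def power_mult_distrib)
 have "c * At * X^2 - 2 * Lam * Pg * (At * y * X) - CB * R * (N + 3) * (At * y * X) - 2 * CB * R * Pg * (At * (t^2 * \<kappa>)) <= ?T"
  using a1 a2 a3 a4 unfolding y_def by linarith
 moreover have "2 * Lam * Pg * (At * y * X) + CB * R * (N + 3) * (At * y * X) = At * (c' * y * X)" by (simp add: c' N_def algebra_simps)
 ultimately have "c * At * X^2 - At * (c / 2 * X^2 + c'^2 / (2 * c) * y^2) - 2 * CB * R * Pg * (At * (t^2 * \<kappa>)) <= ?T" using m by linarith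
 moreover have "c * At * X^2 - At * (c / 2 * X^2 + c'^2 / (2 * c) * y^2) - 2 * CB * R * Pg * (At * (t^2 * \<kappa>))
   = c / 2 * (At * (ps^2 * K * S)) - (c'^2 / (2 * c) + 2 * CB * R * Pg) * (At * (t^2 * \<kappa>))"
  unfolding X2[symmetric] y2[symmetric] by (simp add: algebra_simps)
 ultimately show ?thesis by (simp add: At_def t_def S_def)
qed

lemma V_meas[measurable]: "V : sets borel" using V_open by simp

lemma A_V_meas[measurable]: "(%x. indicator V x * A (norm (D x))) : borel_measurable borel"
proof -
 have "(%x. indicator V x * A (norm (D x))) = (%x. indicator V x * (indicator (- {0}) (D x) *R A (norm (D x))))"
  by (auto simp: V_def indicator_def)
 moreover have "(%x. indicator (- {0}) (D x) *R A (norm (D x))) : borel_measurable borel" by (rule measurable_compose[OF D_meas A_meas])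
 ultimately show ?thesis by simp
qed

definition HH :: "real^'n => real" where "HH x = (\<Sum>i\<in>UNIV. (norm (Hv i x))^2)"

lemma HH_meas[measurable]: "HH : borel_measurable borel" unfolding HH_def by measurable

lemma HH_nonneg: "HH x >= 0" unfolding HH_def by (intro sum_nonneg) auto

text \<open>The linearised equations in all directions i are tested with the truncated weight times
  the i-th component of the gradient, and summed. Subtracting the integration by parts for
  \<open>B\<close> removes B', the pointwise inequality bounds the rest from below, and all
  constants are independent of the truncation, so Fatou's lemma finishes.\<close>

lemma weighted_hessian_estimate:
 assumes ps: "C1c S ps" "S <= U" "!!x. 0 <= ps x" "!!x. ps x <= 1" and b: "0 <= b" "b < 1"
 shows "integrable lborel (%x. indicator V x * A (norm (D x)) * ((ps x)^2 * norm (D x) powr (- b) * HH x))"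
proof -
 have S: "compact S" and ps0: "!!x. x ~: S ==> ps x = 0" using ps by (auto simp: C1c_def)
 have [measurable]: "S : sets borel" using S by (simp add: borel_compact)
 note [measurable] = C1c_measurable[OF ps(1)]
 have iS: "integrable lborel (indicator S :: real^'n => real)" using emeasure_compact_finite[OF S] by simp
 obtain Pg where Pg: "Pg > 0" "!!x. norm (grad ps x) <= Pg" using bounded_compact_support[OF S C1c_continuous_grad[OF ps(1)] C1c_grad_0[OF ps(1)]] by blast
 obtain K0 R where K0: "K0 > 0" and R: "R > 0" "!!x. x : S ==> norm (D x) <= R" and
  lin: "!!F FF ep Fm i. (!!et. GDERIV F et :> FF et) ==> continuous_on UNIV FF ==> ep > 0 ==>
   (!!et. norm et < ep ==> F et = 0) ==> (!!et. norm et < ep ==> FF et = 0) ==> (!!et. norm et <= R ==> \<bar>F et\<bar> <= Fm) ==>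
   integrable lborel (lin_integrand ps F FF i) & \<bar>\<integral>x. lin_integrand ps F FF i x \<partial>lborel\<bar> <= K0 * Fm"
  by (rule linearized_equation[OF ps]) blast
 define c where "c = (1 - b) * lam"
 define c' where "c' = 2 * Lam * Pg + CB * R * (real CARD('n) + 3)"
 define C0 where "C0 = c'^2 / (2 * c) + 2 * CB * R * Pg"
 have c0: "c > 0" using b lam_pos by (simp add: c_def)
 have C0: "C0 >= 0" using c0 CB R Pg by (simp add: C0_def)
 \<comment> \<open>The error of the pointwise estimate is (t A(t)) t^(1 - b) up to
   \<open>C0\<close>; both factors increase with t since b < 1, so their values at \<open>R\<close>
   bound them.\<close>
 define C1 where "C1 = C0 * (R * A R * R powr (1 - b))"
 have psps: "C1c S (%x. (ps x)^2)" "pderiv_at i (%x. (ps x)^2) x = 2 * ps x * pderiv_at i ps x" for i x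
  using C1c_mult[OF open_UNIV subset_UNIV, of ps S ps] ps(1) unfolding power2_eq_square by (auto simp: C1c_def)
 define W where "W n x = indicator V x * A (norm (D x)) * ((ps x)^2 * cut_powr b (hs n) (norm (D x)) * HH x)" for n x
 have Wm: "W n : borel_measurable borel" for n unfolding W_def cut_powr_def by measurable
 have W0: "W n x >= 0" for n x
  using cut_powr(5)[OF hs_pos b(1)] HH_nonneg A_pos[of "norm (D x)"] by (auto simp: W_def V_def indicator_def)
 have W: "integrable lborel (W n) & (LBINT x. W n x) <= (real CARD('n) * (K0 * R powr (1 - b)) + C1 * measure lborel S) / (c / 2)" for n
 proof -
  let ?K = "cut_powr b (hs n)" and ?P = "cut_powr_rest b (hs n)"
  define K' where "K' t = (?P t - b * ?K t) / t" for t
  note cp = cut_powr[OF hs_pos[of n] b(1)]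
  define F where "F i et = ?K (norm et) * et $ i" for i and et :: "real^'n"
  define FF where "FF i et = ?K (norm et) *R axis i 1 + (et $ i * K' (norm et)) *R sgn et" for i and et :: "real^'n"
  \<comment> \<open>Chosen so that differentiating \<open>g i (D x)\<close> in direction i
    reproduces the B' term of the linearised equation; what else it produces contains only B
    itself.\<close>
  define g where "g i et = (B (norm et) * ?K (norm et)) * et $ i" for i and et :: "real^'n"
  define gg where "gg i et = (B (norm et) * ?K (norm et)) *R axis i 1 + (et $ i * (B (norm et) * K' (norm et) + B' (norm et) * ?K (norm et))) *R sgn et" for i and et :: "real^'n"
  have K'0: "K' t = 0" if "0 <= t" "t < hs n" for t using cp(3,4)[OF that] by (simp add: K'_def)
  have F: "GDERIV (F i) et :> FF i et" "continuous_on UNIV (FF i)" for i et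
   unfolding F_def[abs_def] FF_def[abs_def] by (rule radial_component[of ?K K' "hs n"]; use cp K'0 hs_pos in \<open>auto simp: K'_def[abs_def]\<close>)+
  have cB: "continuous_on {0<..} B" "continuous_on {0<..} B'" using B_contOn B_cont by (auto intro: continuous_on_subset)
  have cK: "continuous_on {0<..} ?K" using cp(1) by (auto intro: DERIV_continuous_on[OF has_field_derivative_at_within])
  have cK': "continuous_on {0<..} K'" using cp(2) by (simp add: K'_def[abs_def])
  have G: "GDERIV (g i) et :> gg i et" "continuous_on UNIV (gg i)" for i et
   unfolding g_def[abs_def] gg_def[abs_def]
  proof -
   have "((%t. B t * ?K t) has_real_derivative B t * K' t + B' t * ?K t) (at t)" if "t > 0" for t
    unfolding K'_def by (rule DERIV_mult'[OF B_DERIV[OF that] cp(1)[OF that]])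
   moreover have "continuous_on {0<..} (%t. B t * K' t + B' t * ?K t)" by (intro continuous_intros cB cK cK')
   ultimately have r: "(!!t. t > 0 ==> ((%t. B t * ?K t) has_real_derivative B t * K' t + B' t * ?K t) (at t))" "continuous_on {0<..} (%t. B t * K' t + B' t * ?K t)" by auto
   note rc = radial_component[OF r hs_pos[of n]]
   show "GDERIV (%et. B (norm et) * ?K (norm et) * et $ i) et :> (B (norm et) * ?K (norm et)) *R axis i 1 + (et $ i * (B (norm et) * K' (norm et) + B' (norm et) * ?K (norm et))) *R sgn et"
    by (rule rc(1)) (use cp(3) K'0 in auto)
   show "continuous_on UNIV (%et::real^'n. (B (norm et) * ?K (norm et)) *R axis i 1 + (et $ i * (B (norm et) * K' (norm et) + B' (norm et) * ?K (norm et))) *R sgn et)"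
    by (rule rc(2)) (use cp(3) K'0 in auto)
  qed
  have z: "F i et = 0" "FF i et = 0" "g i et = 0" "gg i et = 0" if "norm et < hs n" for i et
   using cp(3)[OF norm_ge_zero that] K'0[OF norm_ge_zero that] by (auto simp: F_def FF_def g_def gg_def)
  \<comment> \<open>A bound independent of n, since the weight is multiplied by one component of the
    gradient and b < 1.\<close>
  have Fb: "\<bar>F i et\<bar> <= R powr (1 - b)" if "norm et <= R" for i et
  proof (cases "et = 0")
   case False
   have "\<bar>F i et\<bar> <= norm et powr (- b) * norm et"
    unfolding F_def abs_mult using cp(5,6)[of "norm et"] component_le_norm_cart[of et i] by (intro mult_mono) auto
   also have "... = norm et powr (1 - b)" using False powr_add[of "norm et" "- b" 1] by simp
   also have "... <= R powr (1 - b)" using that b by (intro powr_mono2) auto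
   finally show ?thesis .
  qed (simp add: F_def)
  have L: "integrable lborel (lin_integrand ps (F i) (FF i) i)" "\<bar>\<integral>x. lin_integrand ps (F i) (FF i) i x \<partial>lborel\<bar> <= K0 * R powr (1 - b)" for i
   using lin[OF F[of i] hs_pos[of n] z(1,2)[of _ i] Fb[of _ i], of i] by auto
  define bp where "bp i x = (ps x)^2 * (gg i (D x) \<bullet> Hv i x) + pderiv_at i (%x. (ps x)^2) x * g i (D x)" for i x
  have bp: "integrable lborel (bp i)" "(LBINT x. bp i x) = 0" for i
   unfolding bp_def[abs_def] using integral_by_parts[OF psps(1) ps(2) G[of i] hs_pos[of n] z(3,4)[of _ i], of i] by auto
  \<comment> \<open>Subtracting \<open>bp\<close> does not change the integral and cancels the terms
    with B', for which no lower bound is assumed.\<close>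
  define T where "T x = (\<Sum>i\<in>UNIV. lin_integrand ps (F i) (FF i) i x - bp i x)" for x
  have Ti: "integrable lborel T" unfolding T_def[abs_def] by (intro Bochner_Integration.integrable_sum Bochner_Integration.integrable_diff L(1) bp(1))
  have "(LBINT x. T x) = (\<Sum>i\<in>UNIV. (LBINT x. lin_integrand ps (F i) (FF i) i x))"
   unfolding T_def using L(1) bp by (subst Bochner_Integration.integral_sum) auto
  also have "... <= (\<Sum>i\<in>(UNIV::'n set). K0 * R powr (1 - b))" using L(2) by (intro sum_mono) (auto intro: order_trans[OF abs_ge_self])
  finally have IT: "(LBINT x. T x) <= real CARD('n) * (K0 * R powr (1 - b))" by simp
  have key: "c / 2 * W n x <= T x + C1 * indicator S x" for x
  proof (cases "x : V & x : S")
   case False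
   have "T x = 0"
   proof (cases "x : S")
    case True
    then have "D x = 0" "x ~: V" using False ps(2) by (auto simp: V_def)
    then show ?thesis using z[of 0] hs_pos[of n] by (simp add: T_def lin_integrand_def bp_def)
   next
    case False
    then show ?thesis using ps0[OF False] by (simp add: T_def lin_integrand_def bp_def psps)
   qed
   moreover have "W n x = 0" using False ps0[of x] by (auto simp: W_def)
   ultimately show ?thesis using C0 R A_pos[of R] by (simp add: C1_def)
  next
   case True
   define et where "et = D x"
   have et: "et ~= 0" "norm et <= R" using True R by (auto simp: V_def et_def)
   then have t: "norm et > 0" by simp
   let ?t = "norm et" and ?n = "sgn et" and ?h = "%l. Hv l x"
   define Z where "Z = (\<Sum>l\<in>UNIV. ?n $ l *R ?h l)"
   have ni: "et $ l = ?t * ?n $ l" for l using t by (simp add: sgn_div_norm)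
   \<comment> \<open>The factor \<open>et $ l\<close> compensates the 1/t in the derivative of the
     weight, so that only the unit vector and the two weights remain.\<close>
   have nK: "et $ l * K' ?t = (?P ?t - b * ?K ?t) * ?n $ l" for l unfolding ni[of l] K'_def using t by simp
   have FFs: "(\<Sum>l\<in>UNIV. FF i et $ l *R ?h l) = ?K ?t *R ?h i + ((?P ?t - b * ?K ?t) * ?n $ i) *R Z" for i
   proof -
    have "FF i et $ l *R ?h l = ?K ?t *R (if l = i then ?h l else 0) + ((?P ?t - b * ?K ?t) * ?n $ i) *R (?n $ l *R ?h l)" for l
     unfolding FF_def nK by (auto simp: axis_def algebra_simps)
    then have "(\<Sum>l\<in>UNIV. FF i et $ l *R ?h l) = ?K ?t *R (\<Sum>l\<in>UNIV. if l = i then ?h l else 0) + ((?P ?t - b * ?K ?t) * ?n $ i) *R Z"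
     by (simp only: sum.distrib Z_def scaleR_sum_right)
    then show ?thesis by simp
   qed
   define psx where "psx = ps x"
   define gr where "gr = grad ps x"
   define k where "k = ?K ?t"
   define q where "q = ?P ?t - b * k"
   \<comment> \<open>The form required by \<open>hessian_pointwise\<close> before summation over i;
     \<open>B'\<close> no longer occurs.\<close>
   have lini: "lin_integrand ps (F i) (FF i) i x - bp i x = 2 * psx * k * ?t * (qa et (?n $ i *R ?h i) \<bullet> gr) + psx^2 * (k * (qa et (?h i) \<bullet> ?h i) + q * (qa et (?n $ i *R ?h i) \<bullet> Z))
     - psx^2 * bb et * (k * (?h i $ i) + q * (?n \<bullet> (?n $ i *R ?h i))) - 2 * psx * bb et * k * (et $ i * gr $ i)" for i
   proof -
    have ggi: "gg i et \<bullet> ?h i = bb et * k * (?h i $ i) + (bb et * q * ?n $ i + B' ?t * k * et $ i) * (?n \<bullet> ?h i)"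
    proof -
     have "et $ i * (B ?t * K' ?t + B' ?t * k) = B ?t * (et $ i * K' ?t) + B' ?t * k * et $ i" by (simp add: algebra_simps)
     also have "et $ i * K' ?t = q * ?n $ i" unfolding q_def k_def by (rule nK)
     finally show ?thesis unfolding gg_def bb_def k_def[symmetric] by (simp add: inner_add_left inner_axis' mult.assoc)
    qed
    have Fi: "F i et = k * (?t * ?n $ i)" "g i et = bb et * k * et $ i" by (simp_all add: F_def g_def bb_def k_def flip: ni)
    show ?thesis
     unfolding lin_integrand_def bp_def psps(2) et_def[symmetric] FFs ggi Fi k_def[symmetric] q_def[symmetric] gr_def grad_nth[symmetric] psx_def[symmetric]
     using True by (simp add: inner_add_right qa_linear ni algebra_simps power2_eq_square)
   qed
   have sums: "(\<Sum>i\<in>UNIV. qa et (?n $ i *R ?h i) \<bullet> v) = qa et Z \<bullet> v" "(\<Sum>i\<in>UNIV. ?n \<bullet> (?n $ i *R ?h i)) = ?n \<bullet> Z"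
    "(\<Sum>i\<in>UNIV. et $ i * gr $ i) = et \<bullet> gr" for v
    by (simp only: Z_def qa_sum inner_sum_left, simp only: Z_def inner_sum_right, simp add: inner_vec_def)
   have Teq: "T x = 2 * psx * k * ?t * (qa et Z \<bullet> gr) + psx^2 * (k * (\<Sum>l\<in>UNIV. qa et (?h l) \<bullet> ?h l) + q * (qa et Z \<bullet> Z))
     - psx^2 * bb et * (k * (\<Sum>l\<in>UNIV. ?h l $ l) + q * (?n \<bullet> Z)) - 2 * psx * bb et * k * (et \<bullet> gr)"
    unfolding T_def lini sum.distrib sum_subtractf sum_distrib_left[symmetric] sums ..
   have "c / 2 * (A ?t * (psx^2 * k * (\<Sum>l\<in>UNIV. (norm (?h l))^2))) - C0 * (A ?t * (?t^2 * ?t powr (- b))) <= T x"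
    unfolding Teq q_def k_def C0_def
    by (rule hessian_pointwise[OF et b cp(5) cp(6) cp(7) cp(8) _ _ _ Z_def c_def c'_def]) (use ps Pg t in \<open>auto simp: psx_def gr_def\<close>)
   moreover have "C0 * (A ?t * (?t^2 * ?t powr (- b))) <= C1"
   proof -
    have "A ?t * (?t^2 * ?t powr (- b)) = (?t * A ?t) * (?t powr (- b) * ?t)" by (simp add: power2_eq_square mult_ac)
    also have "?t powr (- b) * ?t = ?t powr (1 - b)" using t powr_add[of ?t "- b" 1] by simp
    also have "(?t * A ?t) * ?t powr (1 - b) <= (R * A R) * R powr (1 - b)"
     by (rule mult_mono[OF tA_mono[OF t et(2)] powr_mono2]) (use A_pos[OF R(1)] R(1) et(2) b in \<open>auto intro: mult_nonneg_nonneg\<close>)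
    finally show ?thesis unfolding C1_def using C0 by (intro mult_left_mono)
   qed
   ultimately show ?thesis using True by (simp add: W_def HH_def psx_def k_def et_def mult.assoc)
  qed
  have iB: "integrable lborel (%x. T x + C1 * indicator S x)" using Ti iS by simp
  have Wi: "integrable lborel (%x. c / 2 * W n x)"
  proof (rule Bochner_Integration.integrable_bound[OF iB])
   show "AE x in lborel. norm (c / 2 * W n x) <= norm (T x + C1 * indicator S x)"
   proof (rule AE_I2)
    fix x have "0 <= c / 2 * W n x" using W0[of n x] c0 by simp
    then show "norm (c / 2 * W n x) <= norm (T x + C1 * indicator S x)" using key[of x] by simp
   qed
  qed (use Wm in measurable)
  have "c / 2 * (LBINT x. W n x) = (LBINT x. c / 2 * W n x)" by simp
  also have "... <= (LBINT x. T x + C1 * indicator S x)" by (rule integral_mono[OF Wi iB key])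
  also have "... <= real CARD('n) * (K0 * R powr (1 - b)) + C1 * measure lborel S" using IT Ti iS by simp
  finally have "c / 2 * (LBINT x. W n x) <= real CARD('n) * (K0 * R powr (1 - b)) + C1 * measure lborel S" .
  moreover have "integrable lborel (%x. 2 / c * (c / 2 * W n x))" using Wi by (rule Bochner_Integration.integrable_mult_right)
  then have "integrable lborel (W n)" using c0 by simp
  ultimately show ?thesis using c0 by (simp add: pos_le_divide_eq mult.commute)
 qed
 show ?thesis
 proof (rule integrable_Fatou[of lborel W])
  show "AE x in lborel. (%n. W n x) ~~> indicator V x * A (norm (D x)) * ((ps x)^2 * norm (D x) powr (- b) * HH x)"
  proof (rule AE_I2)
   fix x show "(%n. W n x) ~~> indicator V x * A (norm (D x)) * ((ps x)^2 * norm (D x) powr (- b) * HH x)"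
    unfolding W_def by (cases "x : V") (auto intro!: tendsto_intros cut_powr_tendsto simp: V_def)
  qed
 qed (use W W0 in auto)
qed

end

text \<open>A \<open>C\<^sup>1\<close> version of \<open>max t \<epsilon>\<close>.\<close>
definition smax :: "real => real => real" where
 "smax ep t = 3 * ep / 2 + (max 0 (t - ep))^2 / (2 * ep) - (max 0 (t - 2 * ep))^2 / (2 * ep)"
definition smax' :: "real => real => real" where
 "smax' ep t = (max 0 (t - ep) - max 0 (t - 2 * ep)) / ep"

lemma smax:
 assumes ep: "ep > 0"
 shows "(smax ep has_real_derivative smax' ep t) (at t)" "continuous_on UNIV (smax' ep)"
  "t <= ep ==> smax ep t = 3 * ep / 2" "t <= ep ==> smax' ep t = 0" "2 * ep <= t ==> smax ep t = t"
  "t <= smax ep t" "smax ep t > 0" "ep <= t ==> smax ep t <= 2 * t" "\<bar>smax' ep t\<bar> <= 1" "t >= 0 ==> smax ep t <= t + 2 * ep"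
proof -
 have d: "((%t. (max 0 (t - c))^2 / (2 * ep)) has_real_derivative max 0 (t - c) / ep) (at t)" for c
 proof -
  have "((%t. (max 0 (t - c))^2) has_real_derivative 2 * max 0 (t - c) * 1) (at t)"
   by (rule DERIV_chain2[OF DERIV_pos_part_sq]) (auto intro!: derivative_eq_intros)
  from DERIV_cdivide[OF this, of "2 * ep"] show ?thesis by simp
 qed
 have "(smax ep has_real_derivative 0 + max 0 (t - ep) / ep - max 0 (t - 2 * ep) / ep) (at t)"
  unfolding smax_def[abs_def] by (intro DERIV_diff DERIV_add d DERIV_const)
 then show "(smax ep has_real_derivative smax' ep t) (at t)" by (simp add: smax'_def diff_divide_distrib)
 show "continuous_on UNIV (smax' ep)" unfolding smax'_def[abs_def] using ep by (intro continuous_intros) auto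
 show s1: "smax ep t = 3 * ep / 2" if "t <= ep" using that ep by (simp add: smax_def max_def)
 show "t <= ep ==> smax' ep t = 0" using ep by (simp add: smax'_def max_def)
 show s2: "smax ep t = t" if "2 * ep <= t"
 proof -
  have "smax ep t = 3 * ep / 2 + (t - ep)^2 / (2 * ep) - (t - 2 * ep)^2 / (2 * ep)" using that ep by (simp add: smax_def max_def)
  also have "... = t" using ep by (simp add: field_simps power2_eq_square)
  finally show ?thesis .
 qed
 have mid: "t <= smax ep t & 3 * ep / 2 <= smax ep t & smax ep t <= 2 * ep" if "ep <= t" "t <= 2 * ep"
 proof -
  have e: "smax ep t = 3 * ep / 2 + (t - ep)^2 / (2 * ep)" using that ep by (simp add: smax_def max_def)
  have "smax ep t - t = (2 * ep - t)^2 / (2 * ep)" unfolding e using ep by (simp add: field_simps power2_eq_square)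
  moreover have "0 <= (2 * ep - t)^2 / (2 * ep)" using ep by simp
  ultimately have "t <= smax ep t" by linarith
  moreover have "(t - ep)^2 <= ep^2" using that by (intro power_mono) auto
  then have "(t - ep)^2 / (2 * ep) <= ep / 2" using ep by (simp add: field_simps power2_eq_square)
  then have "smax ep t <= 2 * ep" unfolding e by simp
  moreover have "3 * ep / 2 <= smax ep t" unfolding e using ep by simp
  ultimately show ?thesis by simp
 qed
 consider "t <= ep" | "ep <= t" "t <= 2 * ep" | "2 * ep <= t" by linarith
 then show "t <= smax ep t" "smax ep t > 0" "ep <= t ==> smax ep t <= 2 * t" "t >= 0 ==> smax ep t <= t + 2 * ep"
  using s1 s2 mid ep by (cases; fastforce)+
 show "\<bar>smax' ep t\<bar> <= 1" using ep by (auto simp: smax'_def abs_le_iff divide_le_eq max_def)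
qed

section \<open>Integrability of the inverse weight\<close>

context local_solution begin

definition \<kappa> :: "real => real => real" where "\<kappa> b t = t powr (- b) / A t"
definition \<kappa>' :: "real => real => real" where "\<kappa>' b t = - (b + t * deriv A t / A t) * \<kappa> b t / t"

text \<open>The bounds on t A'(t) / A(t) control the logarithmic derivative of the weight by a
  multiple of 1/t; this scale-invariant bound is the last claim.\<close>

lemma \<kappa>:
 assumes "0 <= b"
 shows "t > 0 ==> (\<kappa> b has_real_derivative \<kappa>' b t) (at t)" "continuous_on {0<..} (\<kappa>' b)" "continuous_on {0<..} (\<kappa> b)"
  "t > 0 ==> \<kappa> b t > 0" "t > 0 ==> \<bar>\<kappa>' b t\<bar> <= (b + Lam) * \<kappa> b t / t"
proof -
 show d: "(\<kappa> b has_real_derivative \<kappa>' b t) (at t)" if t: "t > 0" for t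
 proof -
  have "((%t. t powr (- b)) has_real_derivative - b * t powr (- b) / t) (at t)"
   using t by (auto intro!: derivative_eq_intros simp: powr_diff)
  from DERIV_divide[OF this A_DERIV[OF t]] A_pos[OF t]
  have "(\<kappa> b has_real_derivative (- b * t powr (- b) / t * A t - t powr (- b) * deriv A t) / (A t * A t)) (at t)" by (simp add: \<kappa>_def[abs_def])
  then show ?thesis by (rule DERIV_cong) (use t A_pos[OF t] in \<open>simp add: \<kappa>'_def \<kappa>_def field_simps\<close>)
 qed
 show c: "continuous_on {0<..} (\<kappa> b)" using d by (auto intro: DERIV_continuous_on[OF has_field_derivative_at_within])
 show "continuous_on {0<..} (\<kappa>' b)" unfolding \<kappa>'_def[abs_def] using A_pos by (intro continuous_intros c A_cont A_contOn) (auto simp: less_imp_neq[symmetric] dest: A_pos)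
 show k: "t > 0 ==> \<kappa> b t > 0" for t using A_pos by (simp add: \<kappa>_def)
 show "\<bar>\<kappa>' b t\<bar> <= (b + Lam) * \<kappa> b t / t" if t: "t > 0"
 proof -
  have "\<bar>b + t * deriv A t / A t\<bar> <= b + Lam" using A_m[OF t] A_M[OF t] assms by (auto simp: Lam_def)
  then have "\<bar>b + t * deriv A t / A t\<bar> * \<kappa> b t / t <= (b + Lam) * \<kappa> b t / t" using t k[OF t] by (intro divide_right_mono mult_right_mono) auto
  then show ?thesis using t k[OF t] by (simp only: \<kappa>'_def abs_divide abs_mult abs_minus_cancel abs_of_pos)
 qed
qed

text \<open>Tested with the weight \<open>k\<close>, the right hand side of the equation dominates c
  times its integral. On the left, the diffusion term is at most a multiple of A times the weight
  times the norm of the Hessian; Young's inequality splits it into half of c times the weight, which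
  is absorbed, and the integrand of \<open>weighted_hessian_estimate\<close>. Evaluating the weight
  at \<open>smax\<close> keeps it finite at gradient zero.\<close>

lemma inverse_weight_estimate:
 assumes ps: "C1c S ps" "S <= U" "!!x. 0 <= ps x" "!!x. ps x <= 1" and b: "0 <= b" "b < 1"
 shows "integrable lborel (%x. indicator V x * ((ps x)^2 * (norm (D x) powr (- b) / A (norm (D x)))))"
proof -
 let ?w = "%x. indicator V x * ((ps x)^2 * (norm (D x) powr (- b) / A (norm (D x))))"
 have S: "compact S" and ps0: "!!x. x ~: S ==> ps x = 0" using ps by (auto simp: C1c_def)
 have [measurable]: "S : sets borel" using S by (simp add: borel_compact)
 note [measurable] = C1c_measurable[OF ps(1)] G_meas
 have iS: "integrable lborel (indicator S :: real^'n => real)" using emeasure_compact_finite[OF S] by simp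
 obtain Pg where Pg: "Pg > 0" "!!x. norm (grad ps x) <= Pg" using bounded_compact_support[OF S C1c_continuous_grad[OF ps(1)] C1c_grad_0[OF ps(1)]] by blast
 obtain R where R: "R > 0" "!!x. x : S ==> norm (D x) <= R" by (rule D_bound[OF S ps(2)]) blast
 obtain c where c: "c > 0" "AE x in lborel. x : S --> c <= G x" using G_pos[OF S ps(2)] by blast
 define Y where "Y x = indicator V x * A (norm (D x)) * ((ps x)^2 * norm (D x) powr (- b) * HH x)" for x
 have Yi: "integrable lborel Y" unfolding Y_def[abs_def] by (rule weighted_hessian_estimate[OF ps b])
 \<comment> \<open>The leading 2 comes from A(t) <= 2 A(s) for t <= s <= 2t, the rest from Young's
   inequality.\<close>
 define C1 where "C1 = 2 * (b + Lam)^2 / (2 * (c / 2))"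
 define C2 where "C2 = (2 * Pg + CB * R) * (R + 2) powr (1 - b)"
 have nb: "0 < b + Lam" using b Lam_pos by simp
 have C12: "C1 >= 0" "C2 >= 0" using c Pg CB R by (auto simp: C1_def C2_def)
 define k where "k n et = \<kappa> b (smax (hs n) (norm et))" for n and et :: "real^'n"
 have est: "integrable lborel (%x. (ps x)^2 * k n (D x))
   & (LBINT x. (ps x)^2 * k n (D x)) <= (C1 * (LBINT x. Y x) + C2 * measure lborel S) / (c / 2)" for n
 proof -
  note sm = smax[OF hs_pos[of n]]
  let ?K = "%t. \<kappa> b (smax (hs n) t)" and ?K' = "%t. \<kappa>' b (smax (hs n) t) * smax' (hs n) t"
  have k1: "(?K has_real_derivative ?K' t) (at t)" for t by (rule DERIV_chain2[OF \<kappa>(1)[OF b(1) sm(7)] sm(1)])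
  have cs: "continuous_on A' (smax (hs n))" for A' using sm(1) by (auto intro: DERIV_continuous_on[OF has_field_derivative_at_within])
  have k2: "continuous_on {0<..} ?K'" by (intro continuous_intros continuous_on_compose2[OF \<kappa>(2)[OF b(1)] cs] continuous_on_subset[OF sm(2)]) (use sm(7) in auto)
  define kk where "kk et = ?K' (norm et) *R sgn et" for et :: "real^'n"
  have kG: "GDERIV (k n) et :> kk et" "continuous_on UNIV kk" for et
  proof -
   have z: "?K t = \<kappa> b (3 * hs n / 2)" "?K' t = 0" if "t < hs n" for t by (simp only: sm(3)[OF less_imp_le[OF that]]) (simp only: sm(4)[OF less_imp_le[OF that]] mult_zero_right)
   note rg = radial_GDERIV[OF k1 k2 hs_pos[of n] z, where 'n = 'n]
   show "GDERIV (k n) et :> kk et" "continuous_on UNIV kk" unfolding k_def[abs_def] kk_def[abs_def] using rg by auto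
  qed
  have "continuous_on UNIV (k n)" by (intro continuous_at_imp_continuous_on ballI GDERIV_isCont[OF kG(1)])
  then have km: "(%x. k n (D x)) : borel_measurable borel" by (intro measurable_compose[OF D_meas] borel_measurable_continuous_onI)
  have kk0: "kk et = 0" if "norm et < hs n" for et using sm(4)[of "norm et"] that by (simp add: kk_def)
  note we = weighted_equation[OF ps kG hs_pos kk0]
  have k0: "k n et > 0" for et unfolding k_def by (rule \<kappa>(4)[OF b(1) sm(7)])
  let ?f1 = "%x. (ps x)^2 * (a (D x) \<bullet> (\<Sum>l\<in>UNIV. kk (D x) $ l *R Hv l x))"
  let ?f2 = "%x. 2 * ps x * k n (D x) * (a (D x) \<bullet> grad ps x)" and ?f3 = "%x. bb (D x) * ((ps x)^2 * k n (D x))"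
  let ?g = "%x. (ps x)^2 * k n (D x)"
  \<comment> \<open>Monotonicity of t A(t) moves everything to the larger argument
    \<open>?s\<close>, where A cancels and only the power 1 - b is left; \<open>?s\<close> is at
    most \<open>R + 2\<close> because \<open>hs n\<close> is at most 1.\<close>
  have tk: "norm (D x) * A (norm (D x)) * k n (D x) <= (R + 2) powr (1 - b)" if "x : S" "D x ~= 0" for x
  proof -
   let ?t = "norm (D x)" let ?s = "smax (hs n) ?t"
   have s: "?t <= ?s" "?s > 0" "?s <= R + 2" using sm(6,7,10)[of ?t] R(2)[OF that(1)] hs_le[of n] by auto
   have "?t * A ?t * k n (D x) <= (?s * A ?s) * \<kappa> b ?s" unfolding k_def
    using that s \<kappa>(4)[OF b(1) s(2)] by (intro mult_right_mono tA_mono) auto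
   also have "... = ?s powr (1 - b)" using s(2) A_pos[OF s(2)] powr_add[of ?s "- b" 1] by (simp add: \<kappa>_def)
   also have "... <= (R + 2) powr (1 - b)" using s b by (intro powr_mono2) auto
   finally show ?thesis .
  qed
  \<comment> \<open>The coefficient is half of the lower bound c for \<open>G\<close>, so after
    integration half of the right hand side survives.\<close>
  have key: "?f1 x + ?f2 x + ?f3 x <= c / 2 * ?g x + (C1 * Y x + C2 * indicator S x)" for x
  proof (cases "x : V & x : S")
   case False
   have Y0: "Y x >= 0" using A_pos[of "norm (D x)"] HH_nonneg[of x] by (auto simp: Y_def V_def indicator_def)
   have f0: "?f1 x = 0 & ?f2 x = 0 & ?f3 x = 0"
   proof (cases "x : S")
    case True
    then have "D x = 0" using False ps(2) by (auto simp: V_def)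
    then show ?thesis by (simp add: a_def bb_def B_0)
   qed (simp add: ps0)
   have "0 <= c / 2 * ?g x" using c k0[of "D x"] by (intro mult_nonneg_nonneg) auto
   moreover have "0 <= C1 * Y x + C2 * indicator S x" using C12 Y0 by simp
   ultimately show ?thesis using f0 by linarith
  next
   case True
   define t where "t = norm (D x)"
   define s where "s = smax (hs n) t"
   define r where "r = norm (\<Sum>l\<in>UNIV. sgn (D x) $ l *R Hv l x)"
   have D0: "D x ~= 0" "x : S" using True by (auto simp: V_def)
   have t: "t > 0" "t <= R" using D0 R by (auto simp: t_def)
   have s: "t <= s" "s > 0" using sm(6,7)[of t] by (auto simp: s_def)
   have At: "A t > 0" using A_pos t by simp
   have kn: "k n (D x) = \<kappa> b s" "\<kappa> b s > 0" using k0[of "D x"] by (auto simp: k_def s_def t_def)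
   have na: "norm (a (D x)) = t * A t" using norm_a[OF D0(1)] by (simp add: t_def)
   have r2: "r^2 <= HH x"
   proof -
    have "r <= (\<Sum>l\<in>UNIV. \<bar>sgn (D x) $ l\<bar> * \<bar>norm (Hv l x)\<bar>)" unfolding r_def by (rule order_trans[OF norm_sum]) simp
    also have "... <= L2_set (%l. sgn (D x) $ l) UNIV * L2_set (%l. norm (Hv l x)) UNIV" by (rule L2_set_mult_ineq)
    also have "... = sqrt (HH x)" using sum_sgn_sq[OF D0(1)] by (simp add: L2_set_def HH_def)
    finally show ?thesis using HH_nonneg[of x] by (metis real_sqrt_pow2 power_mono r_def norm_ge_zero)
   qed
   have g1: "(\<Sum>l\<in>UNIV. kk (D x) $ l *R Hv l x) = (\<kappa>' b s * smax' (hs n) t) *R (\<Sum>l\<in>UNIV. sgn (D x) $ l *R Hv l x)"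
    by (simp add: kk_def s_def t_def scaleR_sum_right mult.assoc)
   have f1: "a (D x) \<bullet> (\<Sum>l\<in>UNIV. kk (D x) $ l *R Hv l x) <= c / 2 * \<kappa> b s + C1 * (A t * (t powr (- b) * HH x))"
   \<comment> \<open>Below the truncation level \<open>smax\<close> is constant and the diffusion
     term vanishes; above it s and t are comparable within a factor 2.\<close>
   proof (cases "t <= hs n")
    case True
    then show ?thesis unfolding g1 using sm(4)[OF True] c kn(2) C12 At HH_nonneg[of x] by simp
   next
    case False
    then have s2: "s <= 2 * t" using sm(8)[of t] by (simp add: s_def)
    have A2: "A t <= 2 * A s"
    proof -
     have "t * A t <= s * A s" by (rule tA_mono[OF t(1) s(1)])
     also have "... <= 2 * t * A s" using s2 A_pos[OF s(2)] by (intro mult_right_mono) auto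
     finally show ?thesis using t by simp
    qed
    have "\<bar>\<kappa>' b s * smax' (hs n) t\<bar> <= (b + Lam) * \<kappa> b s / s * 1" unfolding abs_mult using nb kn s
     by (intro mult_mono \<kappa>(5) sm(9)) (auto simp: b)
    also have "... <= (b + Lam) * \<kappa> b s / t" using nb kn s t by (simp add: frac_le)
    finally have q: "\<bar>\<kappa>' b s * smax' (hs n) t\<bar> <= (b + Lam) * \<kappa> b s / t" .
    have "a (D x) \<bullet> (\<Sum>l\<in>UNIV. kk (D x) $ l *R Hv l x) <= norm (a (D x)) * (\<bar>\<kappa>' b s * smax' (hs n) t\<bar> * r)"
     unfolding g1 r_def by (rule order_trans[OF norm_cauchy_schwarz]) simp
    also have "... <= (t * A t) * ((b + Lam) * \<kappa> b s / t * r)" unfolding na using q t At by (intro mult_left_mono mult_right_mono) (auto simp: r_def)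
    also have "... = \<kappa> b s * (((b + Lam) * A t * r) * 1)" using t by simp
    \<comment> \<open>One factor of the weight stays outside: times the second A(t) it returns to
      the power of t, so the quadratic part carries a single A(t), as in the Hessian
      estimate.\<close>
    also have "... <= \<kappa> b s * (c / 2 + ((b + Lam) * A t * r)^2 / (2 * (c / 2)))"
    proof (intro mult_left_mono)
     let ?v = "(b + Lam) * A t * r"
     have "0 <= (?v - c)^2 / (2 * c)" using c by simp
     also have "... = ?v^2 / (2 * c) - ?v + c / 2" using c by (simp add: power2_diff field_simps power2_eq_square)
     finally have "?v <= c / 2 + ?v^2 / (2 * c)" by linarith
     moreover have "?v^2 / (2 * c) <= ?v^2 / c" using c by (intro divide_left_mono) auto
     ultimately show "?v * 1 <= c / 2 + ?v^2 / (2 * (c / 2))" by simp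
    qed (use kn in auto)
    also have "... = c / 2 * \<kappa> b s + (b + Lam)^2 / (2 * (c / 2)) * ((\<kappa> b s * A t) * A t * r^2)" by (simp add: power_mult_distrib power2_eq_square algebra_simps)
    also have "... <= c / 2 * \<kappa> b s + (b + Lam)^2 / (2 * (c / 2)) * ((2 * t powr (- b)) * A t * HH x)"
    proof -
     have "\<kappa> b s * A t <= \<kappa> b s * (2 * A s)" using A2 kn by (intro mult_left_mono) auto
     also have "... = 2 * s powr (- b)" using A_pos[OF s(2)] by (simp add: \<kappa>_def)
     also have "... <= 2 * t powr (- b)" using s t b by (intro mult_left_mono powr_mono2') auto
     finally have "(\<kappa> b s * A t) * A t * r^2 <= (2 * t powr (- b)) * A t * HH x"
      using r2 At kn by (intro mult_mono[OF mult_right_mono]) auto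
     then show ?thesis using c by (intro add_left_mono mult_left_mono) auto
    qed
    also have "... = c / 2 * \<kappa> b s + C1 * (A t * (t powr (- b) * HH x))" by (simp add: C1_def mult_ac)
    finally show ?thesis .
   qed
   have F1: "?f1 x <= c / 2 * ?g x + C1 * Y x"
   proof -
    have "?f1 x <= (ps x)^2 * (c / 2 * \<kappa> b s + C1 * (A t * (t powr (- b) * HH x)))" by (intro mult_left_mono f1) simp
    also have "... = c / 2 * ?g x + C1 * Y x" using True by (simp add: kn Y_def t_def algebra_simps)
    finally show ?thesis .
   qed
   have tk': "t * A t * \<kappa> b s <= (R + 2) powr (1 - b)" using tk[OF D0(2,1)] by (simp add: kn t_def)
   have F2: "?f2 x <= 2 * Pg * (R + 2) powr (1 - b)"
   proof -
    have "?f2 x = 2 * ps x * (\<kappa> b s * (a (D x) \<bullet> grad ps x))" by (simp add: kn)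
    also have "... <= 2 * ps x * (\<kappa> b s * (t * A t * Pg))"
    proof (intro mult_left_mono)
     show "a (D x) \<bullet> grad ps x <= t * A t * Pg" by (rule order_trans[OF norm_cauchy_schwarz]) (use na Pg(2) t At in \<open>auto intro: mult_left_mono\<close>)
    qed (use kn ps(3) in auto)
    also have "... <= 2 * 1 * (\<kappa> b s * (t * A t * Pg))" using ps(4)[of x] kn t At Pg by (intro mult_right_mono) auto
    also have "... = 2 * Pg * (t * A t * \<kappa> b s)" by simp
    also have "... <= 2 * Pg * (R + 2) powr (1 - b)" using tk' Pg by (intro mult_left_mono) auto
    finally show ?thesis .
   qed
   have F3: "?f3 x <= CB * R * (R + 2) powr (1 - b)"
   proof -
    have "bb (D x) <= CB * (R * (t * A t))"
    proof -
     have "bb (D x) <= CB * (t^2 * A t)" using B_upper[of t] t by (simp add: bb_def t_def)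
     also have "... <= CB * (R * (t * A t))" using CB t At by (simp add: power2_eq_square mult_right_mono mult.assoc)
     finally show ?thesis .
    qed
    moreover have "(ps x)^2 * k n (D x) <= \<kappa> b s" using ps(3,4)[of x] kn by (auto intro!: mult_left_le_one_le power_le_one)
    ultimately have "?f3 x <= CB * (R * (t * A t)) * \<kappa> b s" using kn CB R At t by (intro mult_mono) auto
    also have "... = CB * R * (t * A t * \<kappa> b s)" by simp
    also have "... <= CB * R * (R + 2) powr (1 - b)" using tk' CB R by (intro mult_left_mono) auto
    finally show ?thesis .
   qed
   show ?thesis using F1 F2 F3 D0 by (simp add: C2_def distrib_right)
  qed
  have Gg: "AE x in lborel. c * ?g x <= G x * ?g x"
   using c(2)
  proof eventually_elim
   case (elim x)
   then show ?case using k0[of "D x"] ps0[of x] by (cases "x : S") (auto intro!: mult_right_mono mult_nonneg_nonneg)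
  qed
  have g0: "0 <= ?g x" for x using k0[of "D x"] by simp
  have gi: "integrable lborel (%x. c * ?g x)"
  proof (rule Bochner_Integration.integrable_bound[OF we(4)])
   show "AE x in lborel. norm (c * ?g x) <= norm (G x * ?g x)" using Gg
   proof eventually_elim
    case (elim x)
    then show ?case using g0[of x] c by (simp add: mult_nonneg_nonneg)
   qed
  qed (use km in measurable)
  then have gi': "integrable lborel ?g" using c by simp
  have iR: "integrable lborel (%x. c / 2 * ?g x + (C1 * Y x + C2 * indicator S x))" using gi' Yi iS by (intro Bochner_Integration.integrable_add) auto
  have "c * (LBINT x. ?g x) = (LBINT x. c * ?g x)" by simp
  also have "... <= (LBINT x. G x * ?g x)" by (rule integral_mono_AE[OF gi we(4) Gg])
  also have "... = (LBINT x. ?f1 x + ?f2 x + ?f3 x)" using we by simp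
  also have "... <= (LBINT x. c / 2 * ?g x + (C1 * Y x + C2 * indicator S x))"
   by (rule integral_mono[OF _ iR key]) (intro Bochner_Integration.integrable_add we(1-3))
  also have "... = c / 2 * (LBINT x. ?g x) + (C1 * (LBINT x. Y x) + C2 * measure lborel S)" using gi' Yi iS by simp
  finally have "c / 2 * (LBINT x. ?g x) <= C1 * (LBINT x. Y x) + C2 * measure lborel S" by simp
  then show ?thesis
   using gi' c by (simp add: field_simps)
 qed
 define W where "W n x = indicator V x * ((ps x)^2 * k n (D x))" for n x
 have kpos: "k n et > 0" for n et unfolding k_def by (rule \<kappa>(4)[OF b(1) smax(7)[OF hs_pos]])
 have Wi: "integrable lborel (W n)" for n
  unfolding W_def[abs_def] using est[of n] integrable_mult_indicator[of V lborel "%x. (ps x)^2 * k n (D x)"] by simp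
 show ?thesis
 proof (rule integrable_Fatou[of lborel W, OF Wi])
  show "0 <= W n x" for n x using kpos[of n "D x"] by (simp add: W_def)
  show "(LBINT x. W n x) <= (C1 * (LBINT x. Y x) + C2 * measure lborel S) / (c / 2)" for n
  proof (rule order_trans[OF integral_mono conjunct2[OF est]])
   show "W n x <= (ps x)^2 * k n (D x)" for x using kpos[of n "D x"] by (auto simp: W_def indicator_def)
  qed (use Wi est in auto)
  have eq: "?w = (%x. indicator V x * ((ps x)^2 * (norm (D x) powr (- b) / (indicator V x * A (norm (D x))))))" by (auto simp: indicator_def)
  show "?w : borel_measurable lborel"
   unfolding eq by measurable
  show "AE x in lborel. (%n. W n x) ~~> ?w x"
  proof (rule AE_I2)
   fix x show "(%n. W n x) ~~> ?w x"
   proof (cases "x : V")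
    case True
    then have "norm (D x) / 2 > 0" by (simp add: V_def)
    from hs_eventually_less[OF this] have "\<forall>\<^sub>F n in sequentially. W n x = ?w x"
     by eventually_elim (simp add: W_def k_def smax(5)[OF hs_pos] \<kappa>_def)
    then show ?thesis by (rule tendsto_eventually)
   qed (simp add: W_def)
  qed
 qed
qed

end

section \<open>Integrability of the second derivatives\<close>

text \<open>Young's inequality without its sharp constants, by cases: if
  \<open>W * X powr (2 - s)\<close> is at least 1 the square dominates, otherwise X is bounded by a
  power of W.\<close>

lemma powr_le_weighted_square:
 fixes X W s :: real
 assumes "X >= 0" "W > 0" "0 < s" "s < 2"
 shows "X powr s <= W * X^2 + W powr (- (s / (2 - s)))"
proof (cases "X = 0")
 case False
 then have X: "X > 0" using assms by simp
 show ?thesis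
 proof (cases "1 <= W * X powr (2 - s)")
  case True
  have "X powr s <= (W * X powr (2 - s)) * X powr s" using mult_right_mono[OF True, of "X powr s"] by simp
  also have "... = W * X^2" using X by (simp add: powr_add[symmetric] mult.assoc)
  finally show ?thesis by (simp add: add_increasing2)
 next
  case False
  then have "X powr (2 - s) <= W powr (-1)" using assms by (simp add: powr_minus field_simps)
  then have "(X powr (2 - s)) powr (s / (2 - s)) <= (W powr (-1)) powr (s / (2 - s))" using assms by (intro powr_mono2) auto
  moreover have "(X powr (2 - s)) powr (s / (2 - s)) = X powr s" using assms by (simp add: powr_powr)
  moreover have "(W powr (-1)) powr (s / (2 - s)) = W powr (- (s / (2 - s)))" unfolding powr_powr by simp
  ultimately have "X powr s <= W powr (- (s / (2 - s)))" by simp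
  then show ?thesis using assms by (simp add: add_increasing)
 qed
qed (use assms in simp)

context local_solution begin

lemma H_le_HH: "(H i j x)^2 <= HH x"
proof -
 have "\<bar>H i j x\<bar> <= norm (Hv j x)" using component_le_norm_cart[of "Hv j x" i] by (simp add: Hv_def)
 then have "(H i j x)^2 <= (norm (Hv j x))^2" using abs_le_square_iff[of "H i j x" "norm (Hv j x)"] by simp
 also have "... <= HH x" unfolding HH_def by (rule member_le_sum) auto
 finally show ?thesis .
qed

definition admissible :: "real => bool" where
 "admissible s \<longleftrightarrow> (p < 3 & s = 2) \<or> (3 <= p & 1 <= s & s < (p - 1) / (p - 2))"

text \<open>The integrand is bounded pointwise by the two quantities already known to be integrable:
  the weighted square of the Hessian and the inverse weight, with the same exponent b. The work is
  in choosing b.\<close>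

lemma H_powr_integrable:
 assumes K: "compact K" "K <= U" and s: "admissible s"
 shows "integrable lborel (%x. indicator K x * \<bar>indicator V x * H i j x\<bar> powr s)"
proof -
 obtain ps where ps': "ps : test_fun U" "!!x. 0 <= ps x" "!!x. ps x <= 1" "!!x. x : K ==> ps x = 1" by (rule smooth_cutoff[OF K(1) U K(2)]) blast
 obtain S where S: "C1c S ps" "S <= U" by (rule test_funE[OF ps'(1)]) blast
 note ps = S ps'(2,3)
 have [measurable]: "K : sets borel" using K by (simp add: borel_compact)
 obtain R where R: "R > 0" "!!x. x : K ==> norm (D x) <= R" by (rule D_bound[OF K]) blast
 define Y where "Y b x = indicator V x * A (norm (D x)) * ((ps x)^2 * norm (D x) powr (- b) * HH x)" for b x
 define Q where "Q b x = indicator V x * ((ps x)^2 * (norm (D x) powr (- b) / A (norm (D x))))" for b x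
 have Y: "integrable lborel (Y b)" and Q: "integrable lborel (Q b)" if "0 <= b" "b < 1" for b
  unfolding Y_def[abs_def] Q_def[abs_def] using weighted_hessian_estimate[OF ps that] inverse_weight_estimate[OF ps that] by auto
 have YQ0: "Y b x >= 0" "Q b x >= 0" for b x using A_pos[of "norm (D x)"] HH_nonneg[of x] by (auto simp: Y_def Q_def V_def indicator_def)
 have bound: "integrable lborel (%x. indicator K x * \<bar>indicator V x * H i j x\<bar> powr s)"
  if b: "0 <= b" "b < 1" and C: "C >= 0" "!!x. x : K ==> x : V ==> \<bar>H i j x\<bar> powr s <= C * (A (norm (D x)) * norm (D x) powr (- b) * (H i j x)^2 + norm (D x) powr (- b) / A (norm (D x)))"
  and s0: "s > 0" for b C
 proof (rule Bochner_Integration.integrable_bound[of _ "%x. C * (Y b x + Q b x)"])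
  show "integrable lborel (%x. C * (Y b x + Q b x))" using Y[OF b] Q[OF b] by simp
  show "AE x in lborel. norm (indicator K x * \<bar>indicator V x * H i j x\<bar> powr s) <= norm (C * (Y b x + Q b x))"
  proof (rule AE_I2)
   fix x
   have "indicator K x * \<bar>indicator V x * H i j x\<bar> powr s <= C * (Y b x + Q b x)"
   proof (cases "x : K & x : V")
    case True
    then have t: "A (norm (D x)) > 0" using A_pos by (simp add: V_def)
    have "A (norm (D x)) * norm (D x) powr (- b) * (H i j x)^2 <= A (norm (D x)) * norm (D x) powr (- b) * HH x"
     using t by (intro mult_left_mono H_le_HH) auto
    then have "\<bar>H i j x\<bar> powr s <= C * (A (norm (D x)) * norm (D x) powr (- b) * HH x + norm (D x) powr (- b) / A (norm (D x)))"
     using C True by (meson order_trans mult_left_mono add_right_mono)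
    then show ?thesis using True ps'(4) by (simp add: Y_def Q_def mult_ac)
   qed (use C YQ0[of b x] s0 in auto)
   then show "norm (indicator K x * \<bar>indicator V x * H i j x\<bar> powr s) <= norm (C * (Y b x + Q b x))" by simp
  qed
 qed simp
 from s consider "p < 3" "s = 2" | "3 <= p" "1 <= s" "s < (p - 1) / (p - 2)" by (auto simp: admissible_def)
 then show ?thesis
 proof cases
  case 1
  \<comment> \<open>For p >= 2 the weight with b = p - 2 exactly compensates the lower bound of A;
    for p < 2 that bound is itself at least its value at \<open>R\<close>, and b = 0. In both cases
    b < 1.\<close>
  define c where "c = c2 * min 1 (R powr (p - 2))"
  have c: "c > 0" using c2 R by (simp add: c_def)
  show ?thesis
  proof (rule bound[of "max 0 (p - 2)" "1 / c"])
   fix x assume x: "x : K" "x : V"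
   let ?t = "norm (D x)" and ?b = "max 0 (p - 2)"
   have t: "?t > 0" "?t <= R" using x R by (auto simp: V_def)
   have "min 1 (R powr (p - 2)) <= ?t powr (p - 2) * ?t powr (- ?b)"
   proof (cases "p >= 2")
    case True then have "?t powr (p - 2) * ?t powr (- ?b) = 1" using t by (simp add: powr_add[symmetric])
    then show ?thesis by simp
   next
    case False
    then have "R powr (p - 2) <= ?t powr (p - 2)" using t by (intro powr_mono2') auto
    then show ?thesis using False t by simp
   qed
   then have "c <= (c2 * ?t powr (p - 2)) * ?t powr (- ?b)" unfolding c_def using c2 by (simp add: mult.assoc)
   also have "... <= A ?t * ?t powr (- ?b)" by (intro mult_right_mono A_lower t) simp
   finally have "c * (H i j x)^2 <= A ?t * ?t powr (- ?b) * (H i j x)^2" by (intro mult_right_mono) auto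
   moreover have "0 <= ?t powr (- ?b) / A ?t" using A_pos[OF t(1)] by simp
   ultimately have "c * (H i j x)^2 <= A ?t * ?t powr (- ?b) * (H i j x)^2 + ?t powr (- ?b) / A ?t" by linarith
   then show "\<bar>H i j x\<bar> powr s <= 1 / c * (A ?t * ?t powr (- ?b) * (H i j x)^2 + ?t powr (- ?b) / A ?t)"
   proof -
    assume "c * (H i j x)^2 <= A ?t * ?t powr (- ?b) * (H i j x)^2 + ?t powr (- ?b) / A ?t"
    moreover have "\<bar>H i j x\<bar> powr s = (H i j x)^2" using 1 by simp
    ultimately show ?thesis using c unfolding times_divide_eq_left mult_1 by (simp only: pos_le_divide_eq mult.commute)
   qed
  qed (use 1 c in auto)
 next
  case 2
  \<comment> \<open>The exponent for which the remainder of Young's inequality with weight W = A(t)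
    t^(-b) is again an inverse weight t^(-b) / A(t).\<close>
  define b where "b = (p - 2) * (s - 1)"
  \<comment> \<open>The excess over 1 of the exponent s / (2 - s). The lower bound c2 t^(p - 2 - b)
    of W raised to -e gives t^(-2b) by \<open>eb\<close>, and division by the remaining W leaves
    t^(-b) / A(t).\<close>
  define e where "e = 2 * (s - 1) / (2 - s)"
  have s2: "s < 2"
  proof -
   have "(p - 1) / (p - 2) <= 2" using 2 by (simp add: field_simps)
   then show ?thesis using 2 by linarith
  qed
  have "s * (p - 2) < p - 1" using 2 by (simp add: pos_less_divide_eq)
  then have "b < 1" by (simp add: b_def algebra_simps)
  moreover have "0 <= b" unfolding b_def using 2 by (intro mult_nonneg_nonneg) auto
  ultimately have b: "0 <= b" "b < 1" by auto
  have e: "e >= 0" using 2 s2 by (simp add: e_def)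
  have eb: "(p - 2 - b) * e = 2 * b"
  proof -
   have "p - 2 - b = (p - 2) * (2 - s)" by (simp add: b_def algebra_simps)
   then show ?thesis using s2 by (simp add: e_def b_def)
  qed
  have se: "s / (2 - s) = 1 + e" using s2 by (simp add: e_def field_simps)
  show ?thesis
  proof (rule bound[OF b, of "max 1 (c2 powr (- e))"])
   fix x assume x: "x : K" "x : V"
   let ?t = "norm (D x)"
   define W where "W = A ?t * ?t powr (- b)"
   have t: "?t > 0" using x by (auto simp: V_def)
   have At: "A ?t > 0" using A_pos t by simp
   have W: "W > 0" using At t by (simp add: W_def)
   have "c2 * ?t powr (p - 2 - b) = (c2 * ?t powr (p - 2)) * ?t powr (- b)" using t by (simp add: mult.assoc powr_add[symmetric])
   also have "... <= W" unfolding W_def by (intro mult_right_mono A_lower t) simp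
   finally have "W powr (- e) <= (c2 * ?t powr (p - 2 - b)) powr (- e)" using e c2 t by (intro powr_mono2') auto
   also have "... = c2 powr (- e) * ?t powr (- (2 * b))" using c2 t eb by (simp add: powr_mult powr_powr)
   finally have We: "W powr (- e) <= c2 powr (- e) * ?t powr (- (2 * b))" .
   have "- (s / (2 - s)) = - e - 1" using se by simp
   then have "W powr (- (s / (2 - s))) = W powr (- e) / W" using W powr_diff[of W "- e" 1] by simp
   also have "... <= c2 powr (- e) * ?t powr (- (2 * b)) / W" using We W by (intro divide_right_mono) auto
   also have "... = c2 powr (- e) * (?t powr (- b) / A ?t)"
   proof -
    have "?t powr (- (2 * b)) = ?t powr (- b) * ?t powr (- b)" by (simp add: powr_add[symmetric])
    then show ?thesis using t by (simp add: W_def)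
   qed
   also have "... <= max 1 (c2 powr (- e)) * (?t powr (- b) / A ?t)" using At by (intro mult_right_mono) auto
   finally have q: "W powr (- (s / (2 - s))) <= max 1 (c2 powr (- e)) * (?t powr (- b) / A ?t)" .
   have "W * (H i j x)^2 <= max 1 (c2 powr (- e)) * (W * (H i j x)^2)" using W mult_right_mono[of 1 "max 1 (c2 powr (- e))" "W * (H i j x)^2"] by simp
   moreover have "\<bar>H i j x\<bar> powr s <= W * (H i j x)^2 + W powr (- (s / (2 - s)))"
    using powr_le_weighted_square[of "\<bar>H i j x\<bar>" W s] W s2 2 by simp
   ultimately have "\<bar>H i j x\<bar> powr s <= max 1 (c2 powr (- e)) * (W * (H i j x)^2) + max 1 (c2 powr (- e)) * (?t powr (- b) / A ?t)" using q by linarith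
   then show "\<bar>H i j x\<bar> powr s <= max 1 (c2 powr (- e)) * (A ?t * ?t powr (- b) * (H i j x)^2 + ?t powr (- b) / A ?t)" by (simp only: distrib_left W_def)
  qed (use 2 in auto)
 qed
qed

lemma admissible_ge_1: "admissible s ==> 1 <= s" by (auto simp: admissible_def)

lemma ex_admissible: obtains s where "admissible s"
proof (cases "p < 3")
 case True then show ?thesis by (intro that[of 2]) (simp add: admissible_def)
next
 case False then show ?thesis by (intro that[of 1]) (simp add: admissible_def field_simps)
qed

lemma H_set_integrable:
 assumes K: "compact K" "K <= U"
 shows "set_integrable lborel K (%x. indicator V x * H i j x)"
proof -
 obtain s where s: "admissible s" by (rule ex_admissible)
 have [measurable]: "K : sets borel" using K by (simp add: borel_compact)
 have iK: "integrable lborel (indicator K :: real^'n => real)" using emeasure_compact_finite[OF K(1)] by simp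
 show ?thesis unfolding set_integrable_def
 proof (rule Bochner_Integration.integrable_bound[OF Bochner_Integration.integrable_add[OF iK H_powr_integrable[OF K s, of i j]]])
  show "AE x in lborel. norm (indicator K x *R (indicator V x * H i j x)) <= norm (indicator K x + indicator K x * \<bar>indicator V x * H i j x\<bar> powr s)"
  proof (rule AE_I2)
   fix x
   have "\<bar>y\<bar> <= 1 + \<bar>y\<bar> powr s" for y :: real
   proof (cases "\<bar>y\<bar> <= 1")
    case False then have "\<bar>y\<bar> powr 1 <= \<bar>y\<bar> powr s" using admissible_ge_1[OF s] by (intro powr_mono) auto
    then show ?thesis by simp
   qed (simp add: add_increasing2)
   then show "norm (indicator K x *R (indicator V x * H i j x)) <= norm (indicator K x + indicator K x * \<bar>indicator V x * H i j x\<bar> powr s)"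
    by (cases "x : K") (auto simp: abs_mult[symmetric] add_increasing)
  qed
 qed simp
qed

text \<open>The components of the gradient are multiplied by a cut-off in its norm, with exponent
  zero, so that \<open>integral_by_parts\<close> applies. Differentiating the cut-off costs a factor
  that is bounded by 2 and tends to zero at each point of \<open>V\<close>; local integrability of
  the Hessian then allows dominated convergence. Off \<open>V\<close> the gradient is zero or the
  test function vanishes.\<close>

lemma D_wderiv: "wderiv U j (%x. D x $ i) (%x. indicator V x * H i j x)"
 unfolding wderiv_def
proof (intro conjI allI impI ballI)
 show "set_integrable lborel K (%x. D x $ i)" if K: "compact K & K <= U" for K
  unfolding set_integrable_def using borel_integrable_compact[of K "%x. D x $ i"] continuous_on_subset[OF D_nth_cont] K by (auto simp: indicator_def if_distrib[of "%c. c *R _"] cong: if_cong)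
 show "set_integrable lborel K (%x. indicator V x * H i j x)" if "compact K & K <= U" for K using H_set_integrable that by blast
 fix ph assume "ph : test_fun U"
 then obtain S where S: "C1c S ph" "S <= U" "compact S" "!!x. x ~: S ==> ph x = 0" by (rule test_funE) blast
 note [measurable] = C1c_measurable[OF S(1)] C1c_measurable_pderiv[OF S(1)]
 define K where "K n = cut_powr 0 (hs n)" for n
 define K' where "K' n t = (cut_powr_rest 0 (hs n) t - 0 * K n t) / t" for n t
 define g where "g n et = K n (norm et) * et $ i" for n and et :: "real^'n"
 define gg where "gg n et = K n (norm et) *R axis i 1 + (et $ i * K' n (norm et)) *R sgn et" for n and et :: "real^'n"
 note cp = cut_powr[OF hs_pos order_refl]
 have K0: "K n t = 0" "K' n t = 0" if "0 <= t" "t < hs n" for n t using cp(3,4)[OF that] by (auto simp: K_def K'_def)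
 have G: "GDERIV (g n) et :> gg n et" "continuous_on UNIV (gg n)" for n et
  unfolding g_def[abs_def] gg_def[abs_def] by (rule radial_component[of "K n" "K' n" "hs n"]; use cp(1,2) K0 hs_pos in \<open>auto simp: K_def K'_def[abs_def]\<close>)+
 have z: "g n et = 0" "gg n et = 0" if "norm et < hs n" for n et using K0[OF norm_ge_zero that] by (auto simp: g_def gg_def)
 define f where "f n x = ph x * (gg n (D x) \<bullet> Hv j x) + pderiv_at j ph x * g n (D x)" for n x
 have f: "integrable lborel (f n)" "(LBINT x. f n x) = 0" for n
  unfolding f_def[abs_def] using integral_by_parts[OF S(1,2) G[of n] hs_pos[of n] z[of _ n], of j] by auto
 define l where "l x = ph x * (indicator V x * H i j x) + pderiv_at j ph x * D x $ i" for x
 \<comment> \<open>The 3 is 1 for the cut-off and 2 for its rest term, which also involves entries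
   of the Hessian other than the i-th; hence the sum.\<close>
 define d where "d x = 3 * (\<Sum>k\<in>UNIV. \<bar>(indicator V x * H k j x) * ph x\<bar>) + \<bar>D x $ i * pderiv_at j ph x\<bar>" for x
 have i1: "integrable lborel (%x. (indicator V x * H k j x) * ph x)" for k
  by (rule integrable_mult_compact_support[OF H_set_integrable[OF S(3,2)] C1c_continuous[OF S(1)] S(3,4)])
 have i2: "integrable lborel (%x. D x $ i * pderiv_at j ph x)"
 proof (rule integrable_mult_compact_support[OF _ _ S(3) C1c_pderiv_0[OF S(1)]])
  show "continuous_on UNIV (pderiv_at j ph)" using C1c_continuous_grad[OF S(1)] continuous_on_grad_iff by blast
  show "set_integrable lborel S (%x. D x $ i)"
   unfolding set_integrable_def using borel_integrable_compact[OF S(3) continuous_on_subset[OF D_nth_cont S(2)], of i] by (auto simp: indicator_def if_distrib[of "%c. c *R _"] cong: if_cong)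
 qed
 have di: "integrable lborel d" unfolding d_def by (intro Bochner_Integration.integrable_add integrable_mult_right Bochner_Integration.integrable_sum integrable_abs i1 i2)
 have "(%n. LBINT x. f n x) ~~> (LBINT x. l x)"
 proof (rule integral_dominated_convergence[OF _ _ di])
  have out: "D x = 0 \<or> ph x = 0 & pderiv_at j ph x = 0" if "x ~: V" for x
   using that S(2,4) C1c_pderiv_0[OF S(1)] by (auto simp: V_def)
  have nt: "et $ i * K' n (norm et) = cut_powr_rest 0 (hs n) (norm et) * sgn et $ i" for n and et :: "real^'n"
   by (simp add: K'_def sgn_div_norm divide_inverse mult_ac)
  have ggH: "gg n (D x) \<bullet> Hv j x = K n (norm (D x)) * H i j x + cut_powr_rest 0 (hs n) (norm (D x)) * (sgn (D x) $ i * (sgn (D x) \<bullet> Hv j x))" for n x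
   unfolding gg_def nt by (simp add: inner_add_left inner_axis' Hv_def)
  show "AE x in lborel. (%n. f n x) ~~> l x"
  proof (rule AE_I2)
   fix x show "(%n. f n x) ~~> l x"
   proof (cases "x : V")
    case True
    then have t: "norm (D x) > 0" by (simp add: V_def)
    have k: "(%n. K n (norm (D x))) ~~> 1" using cut_powr_tendsto[OF t, of 0] t by (simp add: K_def)
    have r: "(%n. cut_powr_rest 0 (hs n) (norm (D x))) ~~> 0" unfolding cut_powr_rest_def using t by (auto intro!: tendsto_eq_intros hs_lim)
    show ?thesis unfolding f_def ggH g_def l_def by (rule tendsto_eq_intros k r refl)+ (use True in simp)
   next
    case False
    have "gg n 0 = 0" "g n 0 = 0" for n using z[of 0 n] hs_pos[of n] by auto
    then have "f n x = l x" for n using out[OF False] False by (auto simp: f_def l_def)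
    then show ?thesis by simp
   qed
  qed
  fix n show "AE x in lborel. norm (f n x) <= d x"
  proof (rule AE_I2)
   fix x
   have k: "0 <= K n (norm (D x))" "K n (norm (D x)) <= 1"
    using cut_powr(5,6)[OF hs_pos[of n] order_refl, of "norm (D x)"] by (auto simp: K_def split: if_splits)
   have gb: "\<bar>g n (D x)\<bar> <= \<bar>D x $ i\<bar>" unfolding g_def abs_mult using k by (intro mult_left_le_one_le) auto
   have hb: "\<bar>gg n (D x) \<bullet> Hv j x\<bar> <= 3 * (\<Sum>k\<in>UNIV. \<bar>H k j x\<bar>)"
   proof (cases "D x = 0")
    case True then show ?thesis using z(2)[of 0 n] hs_pos[of n] by (simp add: sum_nonneg)
   next
    case False
    then have t: "norm (D x) > 0" by simp
    have "\<bar>H i j x\<bar> <= (\<Sum>k\<in>UNIV. \<bar>H k j x\<bar>)" by (rule member_le_sum) auto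
    then have 1: "\<bar>K n (norm (D x)) * H i j x\<bar> <= (\<Sum>k\<in>UNIV. \<bar>H k j x\<bar>)"
     unfolding abs_mult using k by (intro order_trans[OF mult_left_le_one_le]) auto
    have "cut_powr_rest 0 (hs n) (norm (D x)) <= 2 * sqrt (K n (norm (D x)))" "sqrt (K n (norm (D x))) <= 1"
     using cut_powr(8)[OF hs_pos[of n] order_refl t] t k by (auto simp: K_def)
    then have r: "0 <= cut_powr_rest 0 (hs n) (norm (D x))" "cut_powr_rest 0 (hs n) (norm (D x)) <= 2"
     using cut_powr(7)[OF hs_pos[of n] order_refl norm_ge_zero[of "D x"]] by linarith+
    have "\<bar>sgn (D x) $ i\<bar> <= 1" using component_le_norm_cart[of "sgn (D x)" i] False by (simp add: norm_sgn)
    moreover have "\<bar>sgn (D x) \<bullet> Hv j x\<bar> <= (\<Sum>k\<in>UNIV. \<bar>H k j x\<bar>)"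
     by (rule order_trans[OF sgn_inner_le order_trans[OF norm_le_l1_cart]]) (simp add: Hv_def)
    ultimately have "\<bar>sgn (D x) $ i * (sgn (D x) \<bullet> Hv j x)\<bar> <= 1 * (\<Sum>k\<in>UNIV. \<bar>H k j x\<bar>)" unfolding abs_mult by (intro mult_mono) auto
    then have "\<bar>cut_powr_rest 0 (hs n) (norm (D x)) * (sgn (D x) $ i * (sgn (D x) \<bullet> Hv j x))\<bar> <= 2 * (1 * (\<Sum>k\<in>UNIV. \<bar>H k j x\<bar>))"
     unfolding abs_mult[of "cut_powr_rest 0 (hs n) (norm (D x))"] using r by (intro mult_mono) auto
    then show ?thesis unfolding ggH using 1 by linarith
   qed
   show "norm (f n x) <= d x"
   proof (cases "x : V")
    case True
    have "\<bar>f n x\<bar> <= \<bar>ph x\<bar> * \<bar>gg n (D x) \<bullet> Hv j x\<bar> + \<bar>pderiv_at j ph x\<bar> * \<bar>g n (D x)\<bar>" unfolding f_def abs_mult[symmetric] by (rule abs_triangle_ineq)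
    also have "... <= \<bar>ph x\<bar> * (3 * (\<Sum>k\<in>UNIV. \<bar>H k j x\<bar>)) + \<bar>pderiv_at j ph x\<bar> * \<bar>D x $ i\<bar>" by (intro add_mono mult_left_mono hb gb) auto
    also have "... = d x" using True by (simp add: d_def abs_mult sum_distrib_left mult_ac)
    finally show ?thesis by simp
   next
    case False
    have "gg n 0 = 0" "g n 0 = 0" using z[of 0 n] hs_pos[of n] by auto
    then have "f n x = 0" using out[OF False] by (auto simp: f_def)
    then show ?thesis by (simp add: d_def sum_nonneg)
   qed
  qed
 qed (use f(1) in \<open>auto simp: l_def[abs_def]\<close>)
 then have "(LBINT x. l x) = 0" unfolding f(2) using LIMSEQ_unique tendsto_const by metis
 moreover have "(LBINT x. l x) = (LBINT x. (indicator V x * H i j x) * ph x) + (LBINT x. D x $ i * pderiv_at j ph x)"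
  unfolding Bochner_Integration.integral_add[OF i1[of i] i2, symmetric] by (simp only: l_def mult.commute)
 ultimately show "(LBINT x. D x $ i * pderiv_at j ph x) = - (LBINT x. (indicator V x * H i j x) * ph x)" by linarith
qed auto

end

section \<open>Back to the Sobolev spaces of the statement\<close>

lemma Lp_loc_1I:
 assumes "g' : borel_measurable borel" "!!x. x : U ==> g x = g' x" "!!K. compact K ==> K <= U ==> set_integrable lborel K g'"
 shows "g : Lp_loc 1 (U :: (real^'n) set)"
 unfolding Lp_loc_def
proof (intro CollectI allI impI)
 fix K assume K: "compact K & K <= U"
 show "g : Lp_on 1 K"
 proof (rule Lp_on_borelI[OF _ assms(1)])
  show "integrable lborel (%x. indicator K x * \<bar>g' x\<bar> powr 1)"
   using integrable_abs[OF assms(3)[of K, unfolded set_integrable_def]] K by (simp add: abs_mult)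
 qed (use K assms(2) in \<open>auto simp: borel_compact\<close>)
qed

lemma wderiv_imp_weak_pderiv:
 assumes w: "wderiv U i g' h'" and U: "open U" and eq: "!!x. x : U ==> g x = g' x" "!!x. x : U ==> h x = h' x"
 shows "weak_pderiv U i g h"
 unfolding weak_pderiv_def
proof (intro conjI ballI)
 have m[measurable]: "g' : borel_measurable borel" "h' : borel_measurable borel" "U : sets borel" using w U by (auto simp: wderiv_def)
 show "g : Lp_loc 1 U" by (rule Lp_loc_1I[OF m(1) eq(1)]) (use w in \<open>auto simp: wderiv_def\<close>)
 show "h : Lp_loc 1 U" by (rule Lp_loc_1I[OF m(2) eq(2)]) (use w in \<open>auto simp: wderiv_def\<close>)
 fix ph assume ph: "ph : test_fun U"
 obtain S where S: "C1c S ph" "S <= U" using ph by (rule test_funE)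
 have "(%x. indicator U x * g x) = (%x. indicator U x * g' x)" "(%x. indicator U x * h x) = (%x. indicator U x * h' x)"
  using eq by (auto simp: indicator_def)
 then have im: "(%x. indicator U x * g x) : borel_measurable lebesgue" "(%x. indicator U x * h x) : borel_measurable lebesgue"
  by (auto intro!: measurable_completion)
 have "(LINT x:U|lebesgue. g x * pderiv_at i ph x) = (LBINT x. g' x * pderiv_at i ph x)"
  by (rule LINT_lebesgue_to_lborel[OF im(1) m(1) C1c_measurable_pderiv[OF S(1)]])
   (use S C1c_pderiv_0[OF S(1)] eq in auto)
 moreover have "(LINT x:U|lebesgue. h x * ph x) = (LBINT x. h' x * ph x)"
  by (rule LINT_lebesgue_to_lborel[OF im(2) m(2) C1c_measurable[OF S(1)]])
   (use S eq in \<open>auto simp: C1c_def\<close>)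
 ultimately show "(LINT x:U|lebesgue. g x * pderiv_at i ph x) = - (LINT x:U|lebesgue. h x * ph x)"
  using w ph by (simp add: wderiv_def)
qed

lemma (in local_solution) pderiv_W1p_loc:
 assumes s: "admissible s"
 shows "pderiv_at i u : W1p_loc s U"
 unfolding W1p_loc_def
proof (intro CollectI conjI allI)
 have eq: "pderiv_at i u x = D x $ i" if "x : U" for x using that by (simp add: D_U)
 show "pderiv_at i u : Lp_loc s U"
  unfolding Lp_loc_def
 proof (intro CollectI allI impI)
  fix K assume K: "compact K & K <= U"
  have [measurable]: "K : sets borel" using K by (simp add: borel_compact)
  obtain R where R: "R > 0" "!!x. x : K ==> norm (D x) <= R" by (rule D_bound[of K]) (use K in blast)+
  show "pderiv_at i u : Lp_on s K"
  proof (rule Lp_on_borelI[OF _ D_nth_meas[of i]])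
   show "integrable lborel (%x. indicator K x * \<bar>D x $ i\<bar> powr s)"
   proof (rule integrable_bounded_compact[of K _ "R powr s"])
    show "\<bar>indicator K x * \<bar>D x $ i\<bar> powr s\<bar> <= R powr s" if "x : K" for x
     using that R component_le_norm_cart[of "D x" i] admissible_ge_1[OF s] by (auto intro!: powr_mono2 intro: order_trans)
   qed (use K in auto)
  qed (use K eq in auto)
 qed
 fix j
 show "\<exists>h\<in>Lp_loc s U. weak_pderiv U j (pderiv_at i u) h"
 proof (rule bexI)
  show "weak_pderiv U j (pderiv_at i u) (%x. indicator V x * H i j x)" by (rule wderiv_imp_weak_pderiv[OF D_wderiv U eq]) auto
  show "(%x. indicator V x * H i j x) : Lp_loc s U"
   unfolding Lp_loc_def by (intro CollectI allI impI Lp_on_borelI[OF _ _ refl H_powr_integrable[OF _ _ s]]) (auto simp: borel_compact)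
 qed
qed

section \<open>Reduction to the local problem\<close>

text \<open>Integrates the bound along the segment; by Fubini it holds at almost every point of
  almost every segment.\<close>

lemma wderiv_bounded_lipschitz:
 fixes v h :: "real^'n => real"
 assumes U: "open U" and w: "wderiv U i v h" and C: "AE x in lborel. x : U --> \<bar>h x\<bar> <= C" and b: "b > 0"
 shows "AE x in lborel. (\<forall>t\<in>{0..b}. x + t *R axis i 1 : U) --> \<bar>v (x + b *R axis i 1) - v x\<bar> <= C * b"
 using wderiv_shift[OF U w b refl] AE_lines[OF C, of "axis i 1"]
proof eventually_elim
 case (elim x)
 show ?case
 proof
  assume seg: "\<forall>t\<in>{0..b}. x + t *R axis i 1 : U"
  let ?h = "%t. h (x + t *R axis i 1)"
  have i: "integrable lborel (%t. indicator {0..b} t *R ?h t)"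
   and eq: "v (x + b *R axis i 1) - v x = (LBINT t. indicator {0..b} t *R ?h t)"
   using elim(1) seg by (auto simp: set_integrable_def set_lebesgue_integral_def)
  have "\<bar>v (x + b *R axis i 1) - v x\<bar> <= (LBINT t. C * indicator {0..b} t)"
   unfolding eq
  proof (rule order_trans[OF integral_abs_bound integral_mono_AE[OF integrable_abs[OF i]]])
   show "AE t in lborel. \<bar>indicator {0..b} t *R ?h t\<bar> <= C * indicator {0..b} t"
    using elim(2) by eventually_elim (use seg in \<open>auto simp: indicator_def\<close>)
  qed (use b in simp)
  also have "... = C * b" using b by simp
  finally show "\<bar>v (x + b *R axis i 1) - v x\<bar> <= C * b" .
 qed
qed

lemma C1_locally_lipschitz:
 fixes k :: "real^'n => real"
 assumes U: "open U" and k: "!!x. x : U ==> k differentiable (at x)" "continuous_on U (grad k)" and K: "compact K" "K <= U"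
 obtains L de where "L > 0" "de > 0" "thicken de K <= U"
  "!!i h x. 0 < h ==> h < de ==> x : K ==> \<bar>k (x + h *R axis i 1) - k x\<bar> <= L * h"
proof -
 obtain de where de: "de > 0" "thicken de K <= U" using thicken_subset_open[OF K(1) U K(2)] .
 have "bounded (grad k ` thicken de K)" by (intro compact_imp_bounded compact_continuous_image continuous_on_subset[OF k(2)] compact_thicken K de)
 then obtain L where L: "L > 0" "!!x. x : thicken de K ==> norm (grad k x) <= L" by (auto simp: bounded_pos)
 show ?thesis
 proof (rule that[OF L(1) de])
  fix i :: 'n and h x assume h: "0 < h" "h < de" "x : K"
  have in_t: "x + t *R axis i 1 : thicken de K" if "0 <= t" "t <= h" for t using h that by (intro thickenI[of x]) auto
  obtain z where z: "0 < z" "z < h" "k (x + h *R axis i 1) - k x = h * (axis i 1 \<bullet> grad k (x + z *R axis i 1))"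
   by (rule mvt_direction[OF h(1), of k x "axis i 1"]) (use in_t de(2) k(1) in auto)
  have "\<bar>axis i 1 \<bullet> grad k (x + z *R axis i 1)\<bar> <= L"
   using L(2)[OF in_t[of z]] z component_le_norm_cart[of "grad k (x + z *R axis i 1)" i] by (simp add: inner_axis')
  then show "\<bar>k (x + h *R axis i 1) - k x\<bar> <= L * h" unfolding z(3) abs_mult using h by (simp add: mult.commute)
 qed
qed

text \<open>A linear functional involving only the function and its first derivatives, with locally
  integrable coefficients, is continuous under uniform convergence of both with supports in a fixed
  compact set.\<close>

lemma C1c_extension:
 fixes q0 :: "real^'n => real" and q :: "'n => real^'n => real"
 assumes U: "open U" and q: "!!i K. compact K ==> K <= U ==> set_integrable lborel K (q i)" "!!K. compact K ==> K <= U ==> set_integrable lborel K q0"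
  and eq: "!!ph. ph : test_fun U ==> (\<Sum>i\<in>UNIV. LBINT x. q i x * pderiv_at i ph x) + (LBINT x. q0 x * ph x) = 0"
  and ph: "C1c S ph" "S <= U"
 shows "(\<Sum>i\<in>UNIV. LBINT x. q i x * pderiv_at i ph x) + (LBINT x. q0 x * ph x) = 0"
proof -
 let ?I = "%f g. LBINT x. f x * g x"
 have S: "compact S" using ph by (simp add: C1c_def)
 obtain r where r: "r > 0" "thicken r S <= U" using thicken_subset_open[OF S U ph(2)] .
 let ?S = "thicken r S"
 let ?n = "%f. LBINT x. \<bar>indicator ?S x *R f x\<bar>"
 have cS: "compact ?S" by (rule compact_thicken[OF S])
 have SS: "S <= ?S" using r by (simp add: thicken_superset)
 define C where "C = (\<Sum>i\<in>UNIV. ?n (q i)) + ?n q0"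
 have close: "\<bar>?I g k' - ?I g k\<bar> <= e * ?n g"
  if g: "set_integrable lborel ?S g" and k: "continuous_on UNIV k" "continuous_on UNIV k'" "!!x. x ~: ?S ==> k x = 0" "!!x. x ~: ?S ==> k' x = 0" "!!x. \<bar>k' x - k x\<bar> <= e" for g k k' :: "real^'n => real" and e
 proof -
  have i: "integrable lborel (%x. g x * k x)" "integrable lborel (%x. g x * k' x)"
   using integrable_mult_compact_support[OF g k(1) cS k(3)] integrable_mult_compact_support[OF g k(2) cS k(4)] by auto
  have "?I g k' - ?I g k = (LBINT x. g x * k' x - g x * k x)" using i by simp
  also have "\<bar>...\<bar> <= (LBINT x. e * \<bar>indicator ?S x *R g x\<bar>)"
  proof (rule order_trans[OF integral_abs_bound integral_mono])
   fix x show "\<bar>g x * k' x - g x * k x\<bar> <= e * \<bar>indicator ?S x *R g x\<bar>"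
    using k(3,4)[of x] mult_left_mono[OF k(5)[of x], of "\<bar>g x\<bar>"] by (cases "x : ?S") (auto simp: abs_mult[symmetric] algebra_simps)
  qed (use i g in \<open>auto simp: set_integrable_def intro!: integrable_abs Bochner_Integration.integrable_diff integrable_mult_right\<close>)
  also have "... = e * ?n g" by simp
  finally show ?thesis .
 qed
 let ?\<Lambda> = "%ph. (\<Sum>i\<in>UNIV. ?I (q i) (pderiv_at i ph)) + ?I q0 ph"
 have bound: "\<bar>?\<Lambda> ph\<bar> <= e * C" if e: "e > 0" for e
 proof -
  obtain ph' where ph': "ph' : test_fun U" "!!x. x ~: ?S ==> ph' x = 0" "!!x. \<bar>ph' x - ph x\<bar> <= e" "!!i x. \<bar>pderiv_at i ph' x - pderiv_at i ph x\<bar> <= e"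
   using C1c_approx_step[OF ph(1) r(2,1) e] by blast
  have sm: "!!m. Ck_on m UNIV ph'" using ph'(1) by (simp add: test_fun_def)
  have c': "C1c ?S ph'" by (rule smooth_imp_C1c[OF sm cS ph'(2)])
  have c: "C1c ?S ph" using ph(1) SS cS by (auto simp: C1c_def)
  have cp: "continuous_on UNIV (pderiv_at i ph)" "continuous_on UNIV (pderiv_at i ph')" for i
   using C1c_continuous_grad[OF c] C1c_continuous_grad[OF c'] continuous_on_grad_iff by blast+
  have b0: "\<bar>?I q0 ph' - ?I q0 ph\<bar> <= e * ?n q0"
   by (rule close[OF q(2)[OF cS r(2)] C1c_continuous[OF c] C1c_continuous[OF c']]) (use c c' ph' in \<open>auto simp: C1c_def\<close>)
  have b1: "\<bar>?I (q i) (pderiv_at i ph') - ?I (q i) (pderiv_at i ph)\<bar> <= e * ?n (q i)" for i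
   by (rule close[OF q(1)[OF cS r(2)] cp]) (use C1c_pderiv_0[OF c] C1c_pderiv_0[OF c'] ph' in auto)
  have "\<bar>\<Sum>i\<in>UNIV. (?I (q i) (pderiv_at i ph') - ?I (q i) (pderiv_at i ph))\<bar> <= (\<Sum>i\<in>UNIV. e * ?n (q i))"
   by (rule order_trans[OF sum_abs sum_mono[OF b1]])
  then have "\<bar>(\<Sum>i\<in>UNIV. ?I (q i) (pderiv_at i ph')) - (\<Sum>i\<in>UNIV. ?I (q i) (pderiv_at i ph))\<bar> <= e * (\<Sum>i\<in>UNIV. ?n (q i))"
   by (simp only: sum_subtractf sum_distrib_left)
  then have "\<bar>?\<Lambda> ph' - ?\<Lambda> ph\<bar> <= e * C" using b0 unfolding C_def distrib_left by linarith
  then show ?thesis using eq[OF ph'(1)] by simp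
 qed
 have C0: "C >= 0" unfolding C_def by (intro add_nonneg_nonneg sum_nonneg Bochner_Integration.integral_nonneg) auto
 have "\<bar>?\<Lambda> ph\<bar> <= 0"
 proof (rule field_le_epsilon)
  fix e :: real assume e: "e > 0"
  have "\<bar>?\<Lambda> ph\<bar> <= e / (C + 1) * C" using C0 e by (intro bound) auto
  also have "... <= 0 + e" using C0 e by (simp add: field_simps)
  finally show "\<bar>?\<Lambda> ph\<bar> <= 0 + e" .
 qed
 then show ?thesis by simp
qed

section \<open>Smooth functions as admissible test functions of the equation\<close>

lemma test_fun_weak_pderiv:
 assumes U: "open U" and ph: "ph : test_fun U"
 shows "weak_pderiv U i ph (pderiv_at i ph)"
proof -
 obtain S where S: "C1c S ph" "S <= U" by (rule test_funE[OF ph]) blast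
 note [measurable] = C1c_measurable[OF S(1)] C1c_measurable_pderiv[OF S(1)]
 have cp: "continuous_on UNIV (pderiv_at i ph)" using C1c_continuous_grad[OF S(1)] continuous_on_grad_iff by blast
 have si: "set_integrable lborel K g" if "compact K" "continuous_on UNIV g" for K and g :: "real^'n => real"
  unfolding set_integrable_def using borel_integrable_compact[OF that(1) continuous_on_subset[OF that(2)]] by (auto simp: indicator_def if_distrib[of "%c. c *R _"] cong: if_cong)
 have "wderiv U i ph (pderiv_at i ph)"
  unfolding wderiv_def
 proof (intro conjI allI impI ballI)
  fix ps assume "ps : test_fun U"
  then obtain S' where S': "C1c S' ps" "compact S'" by (rule test_funE) blast
  have d: "ph differentiable (at x)" for x using S(1) by (simp add: C1c_def)
  note m = C1c_mult[OF open_UNIV subset_UNIV d C1c_continuous_grad[OF S(1)] S'(1)]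
  have c': "continuous_on UNIV (pderiv_at i ps)" using C1c_continuous_grad[OF S'(1)] continuous_on_grad_iff by blast
  have i: "integrable lborel (%x. ph x * pderiv_at i ps x)" "integrable lborel (%x. pderiv_at i ph x * ps x)"
   using integrable_mult_compact_support[OF si[OF S'(2) C1c_continuous[OF S(1)]] c' S'(2) C1c_pderiv_0[OF S'(1)]]
    integrable_mult_compact_support[OF si[OF S'(2) cp] C1c_continuous[OF S'(1)] S'(2)] S'(1) by (auto simp: C1c_def)
  have "0 = (LBINT x. ph x * pderiv_at i ps x + pderiv_at i ph x * ps x)"
   using C1c_integral_pderiv[OF m(1), of i] unfolding m(3) by (simp add: mult.commute)
  then show "(LBINT x. ph x * pderiv_at i ps x) = - (LBINT x. pderiv_at i ph x * ps x)" using i by simp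
 qed (use si cp C1c_continuous[OF S(1)] in auto)
 then show ?thesis by (rule wderiv_imp_weak_pderiv[OF _ U]) auto
qed

text \<open>\<open>weak_grad\<close> is an arbitrary choice of weak gradient on all of
  \<open>U\<close>. Wherever the function is C1, every such choice is the classical gradient almost
  everywhere.\<close>

lemma weak_grad_eq_grad:
 fixes g :: "real^'n => real"
 assumes U: "open U" and V: "open V" "V <= U" and g: "!!x. x : V ==> g differentiable (at x)" "continuous_on V (grad g)"
  and ex: "!!i. \<exists>h. weak_pderiv U i g h"
 shows "AE x in lborel. x : V --> weak_grad U g x = grad g x"
proof -
 obtain h where h: "!!i. weak_pderiv U i g (h i)" using ex by metis
 have "\<exists>G. \<forall>i. weak_pderiv U i g (%x. G x $ i)" using h by (intro exI[of _ "%x. \<chi> i. h i x"]) simp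
 from someI_ex[OF this] have w: "weak_pderiv U i g (%x. weak_grad U g x $ i)" for i unfolding weak_grad_def by blast
 have "AE x in lborel. x : V --> weak_grad U g x $ i = grad g x $ i" for i
 proof -
  obtain g' h' where gh: "wderiv U i g' h'" "AE x in lborel. x : U --> g x = g' x & weak_grad U g x $ i = h' x"
   by (rule weak_pderiv_imp_wderiv[OF U w])
  have "AE x in lborel. x : V --> g x = g' x" using gh(2) by eventually_elim (use V in auto)
  then have "AE x in lborel. x : V --> h' x = pderiv_at i g x" by (rule wderiv_C1_unique[OF U V gh(1)]) (use g in auto)
  with gh(2) show ?thesis by eventually_elim (use V in auto)
 qed
 then have "AE x in lborel. \<forall>i. x : V --> weak_grad U g x $ i = grad g x $ i" unfolding AE_all_countable by blast
 then show ?thesis by eventually_elim (simp add: vec_eq_iff)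
qed

lemma test_fun_W1p_0:
 assumes U: "open U" and ph: "ph : test_fun U" and p: "p > 0"
 shows "ph : W1p_0 p U \<inter> Linf_on U" "AE x in lborel. x : U --> weak_grad U ph x = grad ph x"
proof -
 obtain S where S: "C1c S ph" "S <= U" by (rule test_funE[OF ph]) blast
 have cS: "compact S" using S by (simp add: C1c_def)
 have [measurable]: "U : sets borel" using U by simp
 note [measurable] = C1c_measurable[OF S(1)] C1c_measurable_pderiv[OF S(1)]
 show ae: "AE x in lborel. x : U --> weak_grad U ph x = grad ph x"
  by (rule weak_grad_eq_grad[OF U U subset_refl]) (use S(1) test_fun_weak_pderiv[OF U ph] in \<open>auto simp: C1c_def intro: continuous_on_subset\<close>)
 have Lp: "g : Lp_on p U" if [measurable]: "g : borel_measurable borel" and g: "continuous_on UNIV g" "!!x. x ~: S ==> g x = 0" for g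
 proof (rule Lp_on_borelI[OF _ that(1)])
  obtain C where C: "!!x. norm (g x) <= C" by (rule bounded_compact_support[OF cS g]) auto
  show "integrable lborel (%x. indicator U x * \<bar>g x\<bar> powr p)"
  proof (rule integrable_bounded_compact[OF cS, of _ "C powr p"])
   show "\<bar>indicator U x * \<bar>g x\<bar> powr p\<bar> <= C powr p" for x using C[of x] p by (auto simp: indicator_def intro!: powr_mono2)
  qed (use g p in auto)
 qed auto
 have 1: "ph : Lp_on p U" by (rule Lp) (use S C1c_continuous in \<open>auto simp: C1c_def\<close>)
 have 2: "pderiv_at i ph : Lp_on p U" for i by (rule Lp) (use C1c_continuous_grad[OF S(1)] continuous_on_grad_iff C1c_pderiv_0[OF S(1)] in auto)
 have "ph : W1p_0 p U"
  unfolding W1p_0_def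
 \<comment> \<open>The constant sequence approximates; its gradient agrees with the chosen weak
   gradient only almost everywhere, which suffices for the integrals.\<close>
 proof (intro CollectI conjI exI[of _ "%n. ph"] allI)
  show "ph : W1p p U" using 1 2 test_fun_weak_pderiv[OF U ph] by (auto simp: W1p_def)
  fix i
  have "(LINT x:U|lebesgue. \<bar>pderiv_at i ph x - weak_grad U ph x $ i\<bar> powr p) = 0"
   unfolding set_lebesgue_integral_def
  proof (rule integral_eq_zero_AE)
   show "AE x in lebesgue. indicator U x *R \<bar>pderiv_at i ph x - weak_grad U ph x $ i\<bar> powr p = 0"
    unfolding AE_completion_iff using ae by eventually_elim (use p in \<open>auto simp: indicator_def\<close>)
  qed
  then show "(%n. LINT x:U|lebesgue. \<bar>pderiv_at i ph x - weak_grad U ph x $ i\<bar> powr p) ~~> 0" by simp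
 qed (use ph p in auto)
 moreover obtain C where "!!x. norm (ph x) <= C" by (rule bounded_compact_support[OF cS C1c_continuous[OF S(1)]]) (use S in \<open>auto simp: C1c_def\<close>)
 then have "ph : Linf_on U" by (auto simp: Linf_on_def set_borel_measurable_def intro!: exI[of _ C] AE_I2 measurable_completion)
 ultimately show "ph : W1p_0 p U \<inter> Linf_on U" by simp
qed

lemma LINT_absolutely_integrable_transfer:
 fixes f g :: "real^'n => real"
 assumes f: "f absolutely_integrable_on U" and g: "g : borel_measurable borel" and ae: "AE x in lborel. x : U --> f x = g x" and g0: "!!x. x ~: U ==> g x = 0"
 shows "integrable lborel g" "(LINT x:U|lebesgue. f x) = (LBINT x. g x)"
proof -
 have i: "integrable lebesgue (%x. indicator U x *R f x)" using f by (simp add: set_integrable_def)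
 have e: "AE x in lebesgue. indicator U x *R f x = g x"
  unfolding AE_completion_iff using ae by eventually_elim (use g0 in \<open>auto simp: indicator_def\<close>)
 have gm: "g : borel_measurable lebesgue" using g by (auto intro: measurable_completion)
 have "integrable lebesgue g" by (rule integrable_cong_AE_imp[OF i gm e])
 then show "integrable lborel g" using g by (simp add: integrable_completion)
 have "(LINT x:U|lebesgue. f x) = (\<integral>x. g x \<partial>lebesgue)"
  unfolding set_lebesgue_integral_def by (rule integral_cong_AE[OF borel_measurable_integrable[OF i] gm e])
 also have "... = (LBINT x. g x)" using g by (simp add: integral_completion)
 finally show "(LINT x:U|lebesgue. f x) = (LBINT x. g x)" .
qed

text \<open>The extended-real infimum and supremum are traded for real bounds; since -1 lies
  strictly below the infimum, a real m strictly between them exists.\<close>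

lemma structural_A_bounds:
 assumes "structural_A TYPE('n::finite) p A"
 obtains c2 m M where "c2 > 0" "- 1 < m"
  "!!et et' :: real^'n. et ~= 0 \<or> et' ~= 0 ==> (A (norm et) *R et - A (norm et') *R et') \<bullet> (et - et') >= c2 * (norm et + norm et') powr (p - 2) * (norm (et - et'))^2"
  "!!t. t > 0 ==> m <= t * deriv A t / A t" "!!t. t > 0 ==> t * deriv A t / A t <= M"
proof -
 obtain c2 where c2: "c2 > 0" "!!et et' :: real^'n. et ~= 0 \<or> et' ~= 0 ==> (A (norm et) *R et - A (norm et') *R et') \<bullet> (et - et') >= c2 * (norm et + norm et') powr (p - 2) * (norm (et - et'))^2"
  using assms unfolding structural_A_def by blast
 have "- 1 < m_low A" "M_upp A < \<infinity>" using assms by (auto simp: structural_A_def)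
 then obtain m M where m: "- 1 < ereal m" "ereal m < m_low A" and M: "M_upp A < ereal M" using ereal_dense2 by blast
 have "ereal m < ereal (t * deriv A t / A t)" "ereal (t * deriv A t / A t) < ereal M" if "t > 0" for t
 proof -
  have "m_low A <= ereal (t * deriv A t / A t)" unfolding m_low_def using that by (intro INF_lower) auto
  then show "ereal m < ereal (t * deriv A t / A t)" using m(2) by (rule less_le_trans[rotated])
  have "ereal (t * deriv A t / A t) <= M_upp A" unfolding M_upp_def using that by (intro SUP_upper) auto
  then show "ereal (t * deriv A t / A t) < ereal M" using M by (rule le_less_trans)
 qed
 moreover have "- 1 < m" using m(1) by (simp add: one_ereal_def)
 ultimately show ?thesis using c2 by (intro that[of c2 m M]) (auto intro: less_imp_le)
qed

text \<open>Each direction comes with its own Borel representative from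
  \<open>weak_pderiv_imp_wderiv\<close>; \<open>wderiv_cong\<close> exchanges them for the single
  \<open>f'\<close>, so one function and one constant serve all directions.\<close>

lemma W1inf_lipschitz:
 fixes f :: "real^'n => real"
 assumes U: "open U" and f: "f : W1inf U"
 obtains f' L where "f' : borel_measurable borel" "AE x in lborel. x : U --> f x = f' x" "L > 0" "AE x in lborel. x : U --> \<bar>f' x\<bar> <= L"
  "!!i b. b > 0 ==> AE x in lborel. (\<forall>t\<in>{0..b}. x + t *R axis i 1 : U) --> \<bar>f' (x + b *R axis i 1) - f' x\<bar> <= L * b"
proof -
 obtain h where h: "!!i. h i : Linf_on U" "!!i. weak_pderiv U i f (h i)" using f unfolding W1inf_def by (auto simp: Bex_def) metis
 have "f : Lp_loc 1 U" using h(2) by (auto simp: weak_pderiv_def)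
 then obtain f' where f': "f' : borel_measurable borel" "AE x in lborel. x : U --> f x = f' x" by (rule Lp_loc_1_borel[OF U])
 have "\<exists>C. AE x in lborel. x : U --> \<bar>h i x\<bar> <= C" for i using h(1)[of i] by (simp add: Linf_on_def AE_completion_iff)
 then obtain C where C: "!!i. AE x in lborel. x : U --> \<bar>h i x\<bar> <= C i" by metis
 obtain C0 where C0: "AE x in lborel. x : U --> \<bar>f x\<bar> <= C0" using f by (auto simp: W1inf_def Linf_on_def AE_completion_iff)
 define L where "L = \<bar>C0\<bar> + (\<Sum>i\<in>UNIV. \<bar>C i\<bar>) + 1"
 have CL: "C i <= L" for i
 proof -
  have "\<bar>C i\<bar> <= (\<Sum>i\<in>UNIV. \<bar>C i\<bar>)" by (rule member_le_sum) auto
  then show ?thesis by (simp add: L_def)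
 qed
 have "0 <= (\<Sum>i\<in>UNIV. \<bar>C i\<bar>)" by (intro sum_nonneg) auto
 then have L0: "C0 <= L" "L > 0" unfolding L_def by linarith+
 show ?thesis
 proof (rule that[OF f' L0(2)])
  show "AE x in lborel. x : U --> \<bar>f' x\<bar> <= L" using f'(2) C0 by eventually_elim (use L0 in auto)
  fix i :: 'n and b :: real assume b: "b > 0"
  obtain g h' where gh: "wderiv U i g h'" "AE x in lborel. x : U --> f x = g x & h i x = h' x" by (rule weak_pderiv_imp_wderiv[OF U h(2)])
  have gf: "AE x in lborel. x : U --> g x = f' x" using gh(2) f'(2) by eventually_elim auto
  have "AE x in lborel. x : U --> \<bar>h' x\<bar> <= L" using gh(2) C[of i] by eventually_elim (use CL[of i] in auto)
  moreover have "wderiv U i f' h'" by (rule wderiv_cong[OF gh(1) f'(1) _ gf]) (use gh(1) in \<open>auto simp: wderiv_def\<close>)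
  ultimately show "AE x in lborel. (\<forall>t\<in>{0..b}. x + t *R axis i 1 : U) --> \<bar>f' (x + b *R axis i 1) - f' x\<bar> <= L * b" using wderiv_bounded_lipschitz[OF U _ _ b] by blast
 qed
qed

section \<open>The singular potential and the equation away from the origin\<close>

lemma singular_potential_C1:
 fixes u :: "real^'n => real"
 assumes u: "!!x. x : U ==> u differentiable (at x)" "continuous_on U (grad u)" "!!x. x : U ==> u x > 0" and U: "open U" "0 ~: U"
 shows "x : U ==> (%x. u x powr q / norm x powr p) differentiable (at x)" "continuous_on U (grad (%x. u x powr q / norm x powr p))"
proof -
 let ?k = "%x. u x powr q / norm x powr p"
 define g where "g x = (u x powr q) *R ((- p * norm x powr (- p - 1)) *R sgn x) + (norm x powr (- p)) *R ((q * u x powr (q - 1)) *R grad u x)" for x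
 have k: "?k = (%x. u x powr q * norm x powr (- p))" by (simp add: powr_minus divide_inverse)
 have G: "GDERIV ?k x :> g x" if x: "x : U" for x
 proof -
  have x0: "x ~= 0" using x U by auto
  have "GDERIV (%x. u x powr q) x :> (q * u x powr (q - 1)) *R grad u x"
   by (rule GDERIV_DERIV_compose[OF GDERIV_grad[OF u(1)[OF x]] has_real_derivative_powr[OF u(3)[OF x]]])
  moreover have "GDERIV (%x. norm x powr (- p)) x :> (- p * norm x powr (- p - 1)) *R sgn x"
   by (rule GDERIV_DERIV_compose[OF GDERIV_norm[OF x0] has_real_derivative_powr]) (use x0 in simp)
  ultimately show ?thesis unfolding k g_def by (rule GDERIV_mult)
 qed
 then show "x : U ==> ?k differentiable (at x)" for x by (simp add: GDERIV_iff_grad)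
 have cu: "continuous_on U u" using u(1) by (auto intro!: continuous_at_imp_continuous_on differentiable_imp_continuous_within)
 have n0: "x : U ==> norm x ~= 0" "x : U ==> u x ~= 0" for x using U u(3)[of x] by auto
 have "continuous_on U g" unfolding g_def sgn_div_norm by (intro continuous_intros cu u(2)) (use n0 in auto)
 then show "continuous_on U (grad ?k)" by (rule continuous_on_cong[THEN iffD1, rotated 2]) (use G in \<open>auto simp: GDERIV_iff_grad\<close>)
qed

lemma radial_borel:
 fixes A B :: "real => real"
 shows "continuous_on {0<..} A ==> (%et::real^'n. A (norm et) *R et) : borel_measurable borel"
  "continuous_on {0..} B ==> (%et::real^'n. B (norm et)) : borel_measurable borel"
proof -
 assume A: "continuous_on {0<..} A"
 have [measurable]: "(%t. indicator {0<..} t *R A t) : borel_measurable borel" by (rule borel_measurable_continuous_on_indicator[OF _ A]) simp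
 have eq: "(%et::real^'n. A (norm et) *R et) = (%et. (indicator {0<..} (norm et) *R A (norm et)) *R et)"
  by (auto simp: indicator_def)
 show "(%et::real^'n. A (norm et) *R et) : borel_measurable borel" unfolding eq by measurable
next
 assume B: "continuous_on {0..} B"
 show "(%et::real^'n. B (norm et)) : borel_measurable borel"
  by (intro borel_measurable_continuous_onI continuous_on_compose2[OF B]) (auto intro!: continuous_intros)
qed

text \<open>Smooth functions supported off the origin are admissible in the weak formulation, and
  there the weak gradients may be replaced by classical ones. The resulting identity is linear in
  the test function and its derivatives, with locally bounded flux, so \<open>C1c_extension\<close>
  carries it to C1 functions.\<close>

lemma weak_solution_local_equation:
 fixes u f f' :: "real^'n => real" and \<Omega>
 defines "U \<equiv> \<Omega> - {0}"
 assumes \<Omega>: "open \<Omega>" and ws: "weak_solution \<Omega> p q \<theta> A B f u" and p: "p > 0"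
  and u: "!!x. x : U ==> u differentiable (at x)" "continuous_on U (grad u)"
  and A: "continuous_on {0<..} A" "mono_on {0<..} (%t. t * A t)" "!!t. t > 0 ==> A t > 0" and B: "continuous_on {0..} B"
  and f': "f' : borel_measurable borel" "AE x in lborel. x : \<Omega> --> f x = f' x"
  and G: "G = (%x. indicator U x * (\<theta> * (u x powr q / norm x powr p) + f' x))"
  and Gi: "!!K. compact K ==> K <= U ==> set_integrable lborel K G" and ph: "C1c S ph" "S <= U"
 shows "(LBINT x. A (norm (grad u x)) * (grad u x \<bullet> grad ph x)) + (LBINT x. B (norm (grad u x)) * ph x) = (LBINT x. G x * ph x)"
proof -
 have U: "open U" using \<Omega> by (simp add: U_def open_delete)
 have [measurable]: "U : sets borel" using U by simp
 define D where "D x = indicator U x *R grad u x" for x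
 have Dm[measurable]: "D : borel_measurable borel" unfolding D_def[abs_def] using borel_measurable_continuous_on_indicator[OF _ u(2)] U by simp
 have Dc: "continuous_on U D" by (rule continuous_on_eq[OF u(2)]) (simp add: D_def)
 have DU: "D x = grad u x" if "x : U" for x using that by (simp add: D_def)
 define a where "a et = A (norm et) *R et" for et :: "real^'n"
 have [measurable]: "a : borel_measurable borel" unfolding a_def[abs_def] by (rule radial_borel(1)[OF A(1)])
 have [measurable]: "(%x. B (norm (D x))) : borel_measurable borel" by (rule measurable_compose[OF Dm radial_borel(2)[OF B]])
 define q' where "q' i x = a (D x) $ i" for i x
 have q'm[measurable]: "q' i : borel_measurable borel" for i
 proof -
  have "q' i = (%x. a (D x) \<bullet> axis i 1)" by (simp add: q'_def[abs_def] inner_axis)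
  then show ?thesis by simp
 qed
 define q0 where "q0 x = B (norm (D x)) - G x" for x
 let ?L = "%f. LINT x:\<Omega>|lebesgue. f x"
 let ?Ia = "%ph. LBINT x. a (D x) \<bullet> grad ph x" and ?IB = "%ph. LBINT x. B (norm (D x)) * ph x"
 let ?IG = "%ph. LBINT x. G x * ph x" and ?Iq = "%ph. \<Sum>i\<in>UNIV. LBINT x. q' i x * pderiv_at i ph x"
 have qi: "set_integrable lborel K (q' i)" and Bi: "set_integrable lborel K (%x. B (norm (D x)))" and q0i: "set_integrable lborel K q0" if K: "compact K" "K <= U" for K i
 proof -
  have [measurable]: "K : sets borel" using K by (simp add: borel_compact)
  have "bounded (D ` K)" by (intro compact_imp_bounded compact_continuous_image continuous_on_subset[OF Dc] K)
  then obtain R where R: "R > 0" "!!x. x : K ==> norm (D x) <= R" by (auto simp: bounded_pos)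
  have aR: "\<bar>q' i x\<bar> <= R * A R" if "x : K" for x
  proof (cases "D x = 0")
   case False
   have "\<bar>q' i x\<bar> <= norm (a (D x))" unfolding q'_def by (rule component_le_norm_cart)
   also have "... = norm (D x) * A (norm (D x))" using A(3)[of "norm (D x)"] False by (simp add: a_def)
   also have "... <= R * A R" using A(2) False R that by (auto simp: mono_on_def)
   finally show ?thesis .
  qed (use R A(3)[of R] in \<open>simp add: q'_def a_def\<close>)
  show "set_integrable lborel K (q' i)" unfolding set_integrable_def by (rule integrable_bounded_compact[OF K(1), of _ "R * A R"]) (use aR in auto)
  have "continuous_on K (%x. B (norm (D x)))" by (rule continuous_on_compose2[OF B]) (auto intro!: continuous_intros continuous_on_subset[OF Dc K(2)])
  from borel_integrable_compact[OF K(1) this] show Bi: "set_integrable lborel K (%x. B (norm (D x)))"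
   unfolding set_integrable_def by (auto simp: indicator_def if_distrib[of "%c. c *R _"] cong: if_cong)
  show "set_integrable lborel K q0" unfolding q0_def[abs_def] by (rule set_integral_diff(1)[OF Bi Gi[OF K]])
 qed
 have ints: "integrable lborel (%x. q' i x * pderiv_at i ph x)" "integrable lborel (%x. B (norm (D x)) * ph x)" "integrable lborel (%x. G x * ph x)"
  if ph: "C1c S ph" "S <= U" for i S ph
 proof -
  have S: "compact S" "!!x. x ~: S ==> ph x = 0" using ph by (auto simp: C1c_def)
  have "continuous_on UNIV (pderiv_at i ph)" using C1c_continuous_grad[OF ph(1)] continuous_on_grad_iff by blast
  from integrable_mult_compact_support[OF qi[OF S(1) ph(2)] this S(1) C1c_pderiv_0[OF ph(1)]]
  show "integrable lborel (%x. q' i x * pderiv_at i ph x)" .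
  show "integrable lborel (%x. B (norm (D x)) * ph x)" "integrable lborel (%x. G x * ph x)"
   using integrable_mult_compact_support[OF Bi[OF S(1) ph(2)] C1c_continuous[OF ph(1)] S]
    integrable_mult_compact_support[OF Gi[OF S(1) ph(2)] C1c_continuous[OF ph(1)] S] by auto
 qed
 have split: "?Iq ph + (LBINT x. q0 x * ph x)
   = ?Ia ph + ?IB ph - ?IG ph"
  if ph: "C1c S ph" "S <= U" for S ph
 proof -
  have "?Ia ph = (LBINT x. (\<Sum>i\<in>UNIV. q' i x * pderiv_at i ph x))" by (simp add: inner_vec_def q'_def)
  also have "... = ?Iq ph" by (rule Bochner_Integration.integral_sum) (rule ints[OF ph])
  finally have 1: "?Ia ph = ?Iq ph" .
  have "(LBINT x. q0 x * ph x) = ?IB ph - ?IG ph"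
   unfolding q0_def left_diff_distrib by (rule Bochner_Integration.integral_diff[OF ints(2,3)[OF ph]])
  then show ?thesis unfolding 1 by simp
 qed
 have cu: "continuous_on U u" using u(1) by (auto intro!: continuous_at_imp_continuous_on differentiable_imp_continuous_within)
 have upos: "!!x. x : U ==> u x > 0" and uW: "u : W1p p \<Omega>" using ws by (auto simp: weak_solution_def W1p_0_def U_def)
 have Du: "AE x in lborel. x : U --> weak_grad \<Omega> u x = grad u x"
  by (rule weak_grad_eq_grad[OF \<Omega> U _ u]) (use uW in \<open>auto simp: U_def W1p_def\<close>)
 have n0: "AE x in lborel. x ~= (0::real^'n)" by (rule AE_lborel_singleton)
 define kU where "kU x = indicator U x *R (u x powr q / norm x powr p)" for x
 have [measurable]: "kU : borel_measurable borel" unfolding kU_def[abs_def]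
 proof (rule borel_measurable_continuous_on_indicator)
  show "continuous_on U (%x. u x powr q / norm x powr p)" by (intro continuous_intros cu) (use upos in \<open>force simp: U_def\<close>)+
 qed simp
 have test: "?Iq ph + (LBINT x. q0 x * ph x) = 0" if ph: "ph : test_fun U" for ph
 proof -
  obtain S where S: "C1c S ph" "S <= U" by (rule test_funE[OF ph]) blast
  have S0: "ph x = 0" "grad ph x = 0" if "x ~: U" for x using that S C1c_grad_0[OF S(1), of x] by (auto simp: C1c_def)
  note [measurable] = C1c_measurable[OF S(1)] borel_measurable_continuous_onI[OF C1c_continuous_grad[OF S(1)]] f'(1)
  have ph\<Omega>: "ph : test_fun \<Omega>" using ph by (auto simp: test_fun_def U_def)
  note W = test_fun_W1p_0[OF \<Omega> ph\<Omega> p]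
  define k1 where "k1 x = A (norm (weak_grad \<Omega> u x)) * (weak_grad \<Omega> u x \<bullet> weak_grad \<Omega> ph x)" for x
  define k2 where "k2 x = B (norm (weak_grad \<Omega> u x)) * ph x" for x
  define k3 where "k3 x = u x powr q / norm x powr p * ph x" for x
  define k4 where "k4 x = f x * ph x" for x
  have eq: "k1 absolutely_integrable_on \<Omega>" "k2 absolutely_integrable_on \<Omega>" "k3 absolutely_integrable_on \<Omega>" "k4 absolutely_integrable_on \<Omega>"
   "?L k1 + ?L k2 = \<theta> * ?L k3 + ?L k4"
   using ws W(1) unfolding weak_solution_def k1_def[abs_def] k2_def[abs_def] k3_def[abs_def] k4_def[abs_def] Let_def by blast+
  note t1 = LINT_absolutely_integrable_transfer[OF eq(1), of "%x. a (D x) \<bullet> grad ph x"]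
  note t2 = LINT_absolutely_integrable_transfer[OF eq(2), of "%x. B (norm (D x)) * ph x"]
  note t3 = LINT_absolutely_integrable_transfer[OF eq(3), of "%x. kU x * ph x"]
  note t4 = LINT_absolutely_integrable_transfer[OF eq(4), of "%x. f' x * ph x"]
  have out: "x ~: U" if "x ~: \<Omega>" for x using that by (auto simp: U_def)
  have a1: "AE x in lborel. x : \<Omega> --> k1 x = a (D x) \<bullet> grad ph x" using Du W(2) n0
   by eventually_elim (auto simp: k1_def a_def DU U_def)
  have a2: "AE x in lborel. x : \<Omega> --> k2 x = B (norm (D x)) * ph x" using Du n0 by eventually_elim (auto simp: k2_def DU U_def)
  have a3: "AE x in lborel. x : \<Omega> --> k3 x = kU x * ph x" using n0 by eventually_elim (auto simp: k3_def kU_def U_def)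
  have a4: "AE x in lborel. x : \<Omega> --> k4 x = f' x * ph x" using f'(2) by eventually_elim (auto simp: k4_def)
  have e1: "?L k1 = ?Ia ph" by (rule t1(2)[OF _ a1]) (use S0 out in auto)
  have e2: "?L k2 = ?IB ph" by (rule t2(2)[OF _ a2]) (use S0 out in auto)
  have e3: "?L k3 = (LBINT x. kU x * ph x)"
   "integrable lborel (%x. kU x * ph x)" by (rule t3[OF _ a3]; use S0 out in auto)+
  have e4: "?L k4 = (LBINT x. f' x * ph x)" "integrable lborel (%x. f' x * ph x)" by (rule t4[OF _ a4]; use S0 out in auto)+
  have "?IG ph = (LBINT x. \<theta> * (kU x * ph x) + f' x * ph x)"
  proof (rule Bochner_Integration.integral_cong[OF refl])
   fix x show "G x * ph x = \<theta> * (kU x * ph x) + f' x * ph x"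
    using S0(1)[of x] by (cases "x : U") (auto simp: G kU_def distrib_right)
  qed
  also have "... = \<theta> * ?L k3 + ?L k4" unfolding e3(1) e4(1) using e3(2) e4(2) by simp
  finally have "?IG ph = \<theta> * ?L k3 + ?L k4" .
  then show ?thesis unfolding split[OF S] using eq(5) e1 e2 by simp
 qed
 have "?Ia ph + ?IB ph - ?IG ph = 0"
  unfolding split[OF ph, symmetric] by (rule C1c_extension[OF U qi q0i test ph])
 moreover have "(%x. A (norm (grad u x)) * (grad u x \<bullet> grad ph x)) = (%x. a (D x) \<bullet> grad ph x)"
 proof
  fix x
  have "x ~: U ==> grad ph x = 0" using ph(2) C1c_grad_0[OF ph(1), of x] by blast
  then show "A (norm (grad u x)) * (grad u x \<bullet> grad ph x) = a (D x) \<bullet> grad ph x"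
   using DU[of x] by (cases "x : U") (simp_all add: a_def)
 qed
 moreover have "(%x. B (norm (grad u x)) * ph x) = (%x. B (norm (D x)) * ph x)"
 proof
  fix x show "B (norm (grad u x)) * ph x = B (norm (D x)) * ph x"
   using DU[of x] ph by (cases "x : U") (auto simp: C1c_def)
 qed
 ultimately show ?thesis by simp
qed

text \<open>Off the critical set this is differentiability along almost every line. On it u_i
  vanishes, so its weak derivative is zero almost everywhere there, in accordance with the
  convention for the classical one. The origin is a null set.\<close>

lemma weak_pderiv_has_classical_pderiv2:
 assumes \<Omega>: "open \<Omega>" and cont: "continuous_on (\<Omega> - {0}) (grad u)" and h: "weak_pderiv (\<Omega> - {0}) j (pderiv_at i u) h"
 shows "AE x in lebesgue. x : \<Omega> --> has_classical_pderiv2 \<Omega> u i j x (h x)"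
proof -
 let ?U = "\<Omega> - {0}"
 define v where "v x = indicator ?U x *R pderiv_at i u x" for x
 have U: "open ?U" using \<Omega> by (simp add: open_delete)
 have c: "continuous_on ?U (pderiv_at i u)" using cont continuous_on_grad_iff by blast
 have vm: "v : borel_measurable borel" unfolding v_def[abs_def] by (rule borel_measurable_continuous_on_indicator[OF _ c]) (use U in simp)
 have vc: "continuous_on ?U v" by (rule continuous_on_eq[OF c]) (simp add: v_def)
 obtain g' h' where gh: "wderiv ?U j g' h'" "AE x in lborel. x : ?U --> pderiv_at i u x = g' x & h x = h' x"
  by (rule weak_pderiv_imp_wderiv[OF U h])
 have "AE x in lborel. x : ?U --> g' x = v x" using gh(2) by eventually_elim (auto simp: v_def)
 then have w: "wderiv ?U j v h'" by (rule wderiv_cong[OF gh(1) vm, rotated]) (use gh(1) in \<open>auto simp: wderiv_def\<close>)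
 have n0: "AE x in lborel. x ~= (0::real^'n)" by (rule AE_lborel_singleton)
 show ?thesis
  unfolding AE_completion_iff
  using wderiv_imp_DERIV[OF U w vc refl] wderiv_zero_on_zeros[OF U w vc] gh(2) n0
 proof eventually_elim
  case (elim x)
  show ?case
  proof
   assume "x : \<Omega>"
   then have x: "x : ?U" using elim by auto
   have hx: "h x = h' x" using elim x by auto
   show "has_classical_pderiv2 \<Omega> u i j x (h x)"
   proof (cases "x : crit_set \<Omega> u")
    case True
    then have "grad u x $ i = 0" by (simp add: crit_set_def)
    then have "v x = 0" by (simp add: v_def)
    then show ?thesis using True elim x hx by (auto simp: has_classical_pderiv2_def)
   next
    case False
    have "((%t. v (x + t *R axis j 1)) has_real_derivative h x) (at 0)" using elim x hx by simp
    moreover have "open ((%t. x + t *R axis j 1) -` ?U)" by (rule open_vimage[OF U]) (intro continuous_intros)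
    ultimately have "((%t. pderiv_at i u (x + t *R axis j 1)) has_real_derivative h x) (at 0)"
     by (rule has_field_derivative_transform_within_open) (use x in \<open>auto simp: v_def\<close>)
    then show ?thesis using False by (simp add: has_classical_pderiv2_def)
   qed
  qed
 qed
qed

theorem theorem1p5:
  fixes \<Omega> :: "(real^'n) set" and p q \<theta> :: real and A B :: "real \<Rightarrow> real"
    and f u :: "real^'n \<Rightarrow> real"
  assumes "smooth_bounded_domain \<Omega>" and "0 \<in> \<Omega>"
    and "1 < p" and "p < real CARD('n)"
    and "p - 1 < q" and "q < p" and "\<theta> > 0"
    and "structural_A TYPE('n) p A" and "structural_B p A B"
    and "f \<in> W1inf \<Omega>" and "AE x in lebesgue. x \<in> \<Omega> \<longrightarrow> f x \<ge> 0"
    and "C1_upto (\<Omega> - {0}) (closure \<Omega> - {0}) u"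
    and "weak_solution \<Omega> p q \<theta> A B f u"
    and "\<forall>x\<in>frontier \<Omega>. u x = 0"
  shows "(p < 3 \<longrightarrow> (\<forall>i. pderiv_at i u \<in> W1p_loc 2 (\<Omega> - {0}))) \<and>
         (p \<ge> 3 \<longrightarrow> (\<forall>i. \<forall>s. 1 \<le> s \<and> s < (p - 1) / (p - 2) \<longrightarrow>
                        pderiv_at i u \<in> W1p_loc s (\<Omega> - {0}))) \<and>
         (\<forall>i j. \<forall>h. weak_pderiv (\<Omega> - {0}) j (pderiv_at i u) h \<longrightarrow>
            (AE x in lebesgue. x \<in> \<Omega> \<longrightarrow> has_classical_pderiv2 \<Omega> u i j x (h x)))"
proof -
 define U where "U = \<Omega> - {0}"
 have \<Omega>: "open \<Omega>" using assms(1) by (simp add: smooth_bounded_domain_def)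
 have U: "open U" using \<Omega> by (simp add: U_def open_delete)
 have [measurable]: "U : sets borel" using U by simp
 have Ck: "Ck_on 1 U u" using assms(12) by (simp add: C1_upto_def U_def)
 have u: "!!x. x : U ==> u differentiable (at x)" "continuous_on U (grad u)"
  using Ck by (auto simp: continuous_on_grad_iff)
 have upos: "!!x. x : U ==> u x > 0" using assms(13) by (auto simp: weak_solution_def U_def)
 obtain c2 m M where Ac: "c2 > 0" "- 1 < m"
  "!!et et' :: real^'n. et ~= 0 \<or> et' ~= 0 ==> (A (norm et) *R et - A (norm et') *R et') \<bullet> (et - et') >= c2 * (norm et + norm et') powr (p - 2) * (norm (et - et'))^2"
  "!!t. t > 0 ==> m <= t * deriv A t / A t" "!!t. t > 0 ==> t * deriv A t / A t <= M"
  by (rule structural_A_bounds[OF assms(8)]) blast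
 have A: "!!t. t > 0 ==> A t > 0" "!!t. t > 0 ==> A differentiable (at t)" "continuous_on {0<..} (deriv A)" "mono_on {0<..} (%t. t * A t)"
  using assms(8) by (auto simp: structural_A_def)
 have Acont: "continuous_on {0<..} A" using A(2) by (auto intro!: continuous_at_imp_continuous_on differentiable_imp_continuous_within)
 obtain B' CB where B: "!!t. t >= 0 ==> B t >= 0" "B 0 = 0" "!!t. t >= 0 ==> (B has_real_derivative B' t) (at t within {0..})"
   "continuous_on {0..} B'" "CB > 0" "!!t. t > 0 ==> B' t <= CB * (t * A t)"
  using assms(9) unfolding structural_B_def by blast
 have Bcont: "continuous_on {0..} B" using B(3) by (meson DERIV_continuous_on atLeast_iff)
 obtain f' L where f': "f' : borel_measurable borel" "AE x in lborel. x : \<Omega> --> f x = f' x" "L > 0" "AE x in lborel. x : \<Omega> --> \<bar>f' x\<bar> <= L"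
  "!!i b. b > 0 ==> AE x in lborel. (\<forall>t\<in>{0..b}. x + t *R axis i 1 : \<Omega>) --> \<bar>f' (x + b *R axis i 1) - f' x\<bar> <= L * b"
  by (rule W1inf_lipschitz[OF \<Omega> assms(10)]) blast
 have f0: "AE x in lborel. x : \<Omega> --> 0 <= f' x"
  using f'(2) assms(11)[unfolded AE_completion_iff] by eventually_elim auto
 define k where "k x = u x powr q / norm x powr p" for x
 have k: "!!x. x : U ==> k differentiable (at x)" "continuous_on U (grad k)"
  unfolding k_def[abs_def] using singular_potential_C1[of U u, OF u upos U] by (auto simp: U_def)
 have kc: "continuous_on U k" using k(1) by (auto intro!: continuous_at_imp_continuous_on differentiable_imp_continuous_within)
 have kpos: "k x > 0" if "x : U" for x using upos[OF that] that by (auto simp: k_def U_def)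
 \<comment> \<open>Built from the Borel representative of f and cut off to \<open>U\<close>, so that
   it is a Borel function on the whole space.\<close>
 define G where "G x = indicator U x * (\<theta> * k x + f' x)" for x
 have Gm: "G : borel_measurable borel"
 proof -
  have [measurable]: "(%x. indicator U x *R k x) : borel_measurable borel" by (rule borel_measurable_continuous_on_indicator[OF _ kc]) simp
  note [measurable] = f'(1)
  have "G = (%x. \<theta> * (indicator U x *R k x) + indicator U x * f' x)" by (auto simp: G_def algebra_simps)
  then show ?thesis by (simp only:) measurable
 qed
 have Gbd: "\<exists>L>0. AE x in lborel. x : K --> \<bar>G x\<bar> <= L" if K: "compact K" "K <= U" for K
 proof -
  have "bounded (k ` K)" by (intro compact_imp_bounded compact_continuous_image continuous_on_subset[OF kc] K)
  then obtain R where R: "R > 0" "!!x. x : K ==> \<bar>k x\<bar> <= R" by (auto simp: bounded_pos)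
  have "AE x in lborel. x : K --> \<bar>G x\<bar> <= \<theta> * R + L"
   using f'(4)
  proof eventually_elim
   case (elim x)
   show ?case
   proof
    assume x: "x : K"
    have "\<theta> * \<bar>k x\<bar> <= \<theta> * R" using R(2)[OF x] assms(7) by (intro mult_left_mono) auto
    moreover have "\<bar>f' x\<bar> <= L" using elim x K by (auto simp: U_def)
    moreover have "G x = \<theta> * k x + f' x" using x K by (auto simp: G_def)
    moreover have "\<bar>\<theta> * k x\<bar> = \<theta> * \<bar>k x\<bar>" using assms(7) by (simp add: abs_mult)
    ultimately show "\<bar>G x\<bar> <= \<theta> * R + L" using abs_triangle_ineq[of "\<theta> * k x" "f' x"] by linarith
   qed
  qed
  moreover have "\<theta> * R + L > 0" using R f'(3) assms(7) by (simp add: add_pos_pos)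
  ultimately show ?thesis by blast
 qed
 interpret local_solution U u A B B' G p c2 m M CB
 proof
  show "\<exists>L>0. \<exists>de>0. \<forall>i. \<forall>h. 0 < h & h < de --> (AE x in lborel. x : K --> \<bar>G (x + h *R axis i 1) - G x\<bar> <= L * h)"
   if K: "compact K" "K <= U" for K
  proof -
   obtain Lk de where Lk: "Lk > 0" "de > 0" "thicken de K <= U"
    "!!i h x. 0 < h ==> h < de ==> x : K ==> \<bar>k (x + h *R axis i 1) - k x\<bar> <= Lk * h"
    using C1_locally_lipschitz[OF U k K] by metis
   have "AE x in lborel. x : K --> \<bar>G (x + h *R axis i 1) - G x\<bar> <= (\<theta> * Lk + L) * h" if h: "0 < h" "h < de" for i h
    using f'(5)[OF h(1), of i]
   proof eventually_elim
    case (elim x)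
    show ?case
    proof
     assume x: "x : K"
     have seg: "x + t *R axis i 1 : U" if "t : {0..h}" for t
     proof -
      have "x + t *R axis i 1 : thicken de K" using that h x by (intro thickenI[of x]) auto
      then show ?thesis using Lk(3) by blast
     qed
     have "\<bar>f' (x + h *R axis i 1) - f' x\<bar> <= L * h" using elim seg by (auto simp: U_def)
     moreover have "\<theta> * \<bar>k (x + h *R axis i 1) - k x\<bar> <= \<theta> * (Lk * h)" using Lk(4)[OF h x] assms(7) by (intro mult_left_mono) auto
     moreover have "G (x + h *R axis i 1) - G x = \<theta> * (k (x + h *R axis i 1) - k x) + (f' (x + h *R axis i 1) - f' x)"
      using seg[of h] h x K by (auto simp: G_def algebra_simps)
     moreover have "\<bar>\<theta> * (k (x + h *R axis i 1) - k x)\<bar> = \<theta> * \<bar>k (x + h *R axis i 1) - k x\<bar>" using assms(7) by (simp add: abs_mult)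
     ultimately show "\<bar>G (x + h *R axis i 1) - G x\<bar> <= (\<theta> * Lk + L) * h"
      using abs_triangle_ineq[of "\<theta> * (k (x + h *R axis i 1) - k x)" "f' (x + h *R axis i 1) - f' x"] unfolding distrib_right mult.assoc by linarith
    qed
   qed
   moreover have "\<theta> * Lk + L > 0" using Lk f'(3) assms(7) by (simp add: add_pos_pos)
   ultimately show ?thesis using Lk(2) by blast
  qed
  \<comment> \<open>The positive lower bound comes from the potential, which is continuous and
    positive and so attains a positive minimum on a nonempty compact set; f contributes a
    nonnegative amount.\<close>
  show "\<exists>c>0. AE x in lborel. x : K --> c <= G x" if K: "compact K" "K <= U" for K
  proof -
   obtain c where c: "c > 0" "!!x. x : K ==> c <= k x"
   proof (cases "K = {}")
    case False
    then obtain y where "y : K" "\<forall>x\<in>K. k y <= k x" using continuous_attains_inf[OF K(1) False continuous_on_subset[OF kc K(2)]] by blast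
    then show ?thesis using that[of "k y"] kpos K by blast
   qed (use that[of 1] in auto)
   have "AE x in lborel. x : K --> \<theta> * c <= G x" using f0
   proof eventually_elim
    case (elim x)
    show ?case
    proof
     assume x: "x : K"
     have "\<theta> * c <= \<theta> * k x" using c(2)[OF x] assms(7) by (intro mult_left_mono) auto
     moreover have xU: "x : U" using x K by blast
     then have "G x = \<theta> * k x + f' x" by (simp add: G_def)
     moreover have "0 <= f' x" using elim xU by (auto simp: U_def)
     ultimately show "\<theta> * c <= G x" by linarith
    qed
   qed
   then show ?thesis using c assms(7) by (intro exI[of _ "\<theta> * c"]) auto
  qed
  show "(LBINT x. A (norm (grad u x)) * (grad u x \<bullet> grad ph x)) + (LBINT x. B (norm (grad u x)) * ph x) = (LBINT x. G x * ph x)"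
   if ph: "C1c S ph" "S <= U" for S ph
  proof (rule weak_solution_local_equation[OF \<Omega> assms(13) _ u[unfolded U_def] Acont A(4,1) Bcont f'(1,2) _ _ ph[unfolded U_def]])
   show "G = (%x. indicator (\<Omega> - {0}) x * (\<theta> * (u x powr q / norm x powr p) + f' x))" by (simp add: G_def[abs_def] k_def U_def)
   show "set_integrable lborel K G" if K: "compact K" "K <= \<Omega> - {0}" for K
   proof -
    have [measurable]: "K : sets borel" using K by (simp add: borel_compact)
    obtain C where C: "AE x in lborel. x : K --> \<bar>G x\<bar> <= C" using Gbd[of K] K by (auto simp: U_def)
    have "integrable lborel (%x. C * indicator K x)" using emeasure_compact_finite[OF K(1)] by simp
    then show ?thesis
     unfolding set_integrable_def
    proof (rule Bochner_Integration.integrable_bound)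
     show "AE x in lborel. norm (indicator K x *R G x) <= norm (C * indicator K x)" using C by eventually_elim (auto simp: indicator_def)
    qed (use Gm in simp)
   qed
  qed (use assms(3) in auto)
 qed (fact U u A Ac B Gm Gbd)+
 have "pderiv_at i u : W1p_loc s (\<Omega> - {0})" if "admissible s" for i s using pderiv_W1p_loc[OF that] by (simp add: U_def)
 moreover have "AE x in lebesgue. x : \<Omega> --> has_classical_pderiv2 \<Omega> u i j x (h x)" if "weak_pderiv (\<Omega> - {0}) j (pderiv_at i u) h" for i j h
  by (rule weak_pderiv_has_classical_pderiv2[OF \<Omega> _ that]) (use u(2) in \<open>simp add: U_def\<close>)
 ultimately show ?thesis by (auto simp: admissible_def)
qed

end
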